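(* Let $(\mathcal{X},d)$ be a metric space on $n$ points accessed in the weak-strong oracle model. There exists an algorithm in the weak-strong oracle model that, with high probability, computes a $(k,\varepsilon)$-coreset for $k$-median clustering of size $\tilde O(k^2/\varepsilon^3)$, using $\tilde O(k^2/\varepsilon^3)$ strong oracle point queries (or, alternatively, strong oracle distance queries), $\tilde O(nk)$ weak oracle queries, and $\tilde O(nk)$ time.
   Context: Weak-strong oracle model: the metric $d$ on the $n$-point set $\mathcal{X}$ is not directly accessible. A weak oracle query $\mathrm{WO}(x,y)$ returns $d(x,y)$ exactly with probability $2/3$ and an arbitrary (possibly adversarial) value with probability $1/3$; this randomness is drawn exactly once per pair, so repeated queries give the same answer. A strong point query $\mathrm{SO}(x)$: once both $\mathrm{SO}(x)$ and $\mathrm{SO}(y)$ have been queried, $d(x,y)$ is revealed exactly. A strong distance query $\mathrm{SO}(x,y)$ reveals $d(x,y)$ exactly. Distances are integers and the aspect ratio is $\mathrm{poly}(n)$. $\tilde O(\cdot)$ hides $\mathrm{polylog}(n)$ factors; "with high probability" means with probability $1-1/\mathrm{poly}(n)$. For a weighted set $S$ with weights $w$ and centers $\mathcal{C}$, $\mathrm{cost}(\mathcal{C},S)=\sum_{x\in S}w(x)\min_{c\in\mathcal{C}}d(x,c)$ (unweighted means unit weights). A weighted subset $S\subseteq\mathcal{X}$ is a $(k,\varepsilon)$-coreset for $k$-median if $|\mathrm{cost}(\mathcal{C},S)-\mathrm{cost}(\mathcal{C},\mathcal{X})|\le\varepsilon\,\mathrm{cost}(\mathcal{C},\mathcal{X})$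 for all $\mathcal{C}\subseteq\mathcal{X}$ with $|\mathcal{C}|\le k$. *)

theory Defs
  imports "HOL-Analysis.Analysis" "HOL-Probability.Probability"
begin

section \<open>Coresets for k-median\<close>

definition cost :: "('a \<Rightarrow> 'a \<Rightarrow> real) \<Rightarrow> 'a set \<Rightarrow> 'a set \<Rightarrow> ('a \<Rightarrow> real) \<Rightarrow> real" where
  "cost d C S w = (\<Sum>x\<in>S. w x * Min ((\<lambda>c. d x c) ` C))"

text \<open>Centre sets are nonempty, since \<open>Min {}\<close> is unspecified.\<close>

definition is_coreset ::
    "'a set \<Rightarrow> ('a \<Rightarrow> 'a \<Rightarrow> real) \<Rightarrow> nat \<Rightarrow> real \<Rightarrow> 'a set \<Rightarrow> ('a \<Rightarrow> real) \<Rightarrow> bool" where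
  "is_coreset X d k \<epsilon> S w \<longleftrightarrow>
     S \<subseteq> X \<and> (\<forall>x\<in>S. 0 \<le> w x) \<and>
     (\<forall>C. C \<subseteq> X \<and> C \<noteq> {} \<and> card C \<le> k \<longrightarrow>
        \<bar>cost d C S w - cost d C X (\<lambda>_. 1)\<bar> \<le> \<epsilon> * cost d C X (\<lambda>_. 1))"

definition aspect_ratio :: "'a set \<Rightarrow> ('a \<Rightarrow> 'a \<Rightarrow> real) \<Rightarrow> real" where
  "aspect_ratio X d =
     (let D = {d x y | x y. x \<in> X \<and> y \<in> X \<and> x \<noteq> y}
      in if D = {} then 1 else Max D / Min D)"

section \<open>The weak oracle\<close>

definition pairs :: "nat \<Rightarrow> nat set set" where
  "pairs n = {{x, y} | x y. x < n \<and> y < n \<and> x \<noteq> y}"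

text \<open>A corruption pattern says which unordered pairs are corrupted. It is drawn once and for all,
  independently over the pairs.\<close>

definition corruption :: "nat \<Rightarrow> (nat set \<Rightarrow> bool) pmf" where
  "corruption n = Pi_pmf (pairs n) False (\<lambda>_. bernoulli_pmf (1 / 3))"

text \<open>The adversary \<open>adv\<close> chooses the answers on the corrupted pairs with knowledge of the whole
  corruption pattern \<open>K\<close>.\<close>

definition weak_oracle ::
    "(nat \<Rightarrow> nat \<Rightarrow> nat) \<Rightarrow> ((nat set \<Rightarrow> bool) \<Rightarrow> nat set \<Rightarrow> nat) \<Rightarrow> (nat set \<Rightarrow> bool)
      \<Rightarrow> nat \<Rightarrow> nat \<Rightarrow> nat" where
  "weak_oracle d adv K x y = (if K {x, y} then adv K {x, y} else d x y)"

section \<open>A randomized word RAM with weak and strong oracles\<close>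

text \<open>Programs are structured, and run on registers and an addressable memory whose cells hold
  words, i.e. numbers below \<open>2 ^ W\<close>. Expressions have constant size in a fixed program, so
  executing one command counts as one time step.\<close>

datatype exp =
    Const nat
  | Reg string
  | Mem exp
  | Add exp exp
  | Sub exp exp
  | Mul exp exp
  | Div exp exp
  | Mod exp exp
  | Less exp exp
  | Eql exp exp

datatype com =
    Skip
  | Assign string exp
  | Store exp exp
  | Seq com com
  | If exp com com
  | While exp com
  | Rand string exp
  | WeakQ string exp exp
  | StrongPoint exp
  | Reveal string exp exp
  | StrongDist string exp exp

record state =
  regs :: "string \<Rightarrow> nat"
  mem :: "nat \<Rightarrow> nat"
  known :: "nat set"
  weak_count :: nat
  point_count :: nat
  dist_count :: nat

record env =
  word_size :: nat
  num_points :: nat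
  true_dist :: "nat \<Rightarrow> nat \<Rightarrow> nat"
  weak_dist :: "nat \<Rightarrow> nat \<Rightarrow> nat"

definition to_word :: "env \<Rightarrow> nat \<Rightarrow> nat" where
  "to_word E v = v mod 2 ^ word_size E"

text \<open>Subtraction is truncated at zero.\<close>

fun eval :: "env \<Rightarrow> state \<Rightarrow> exp \<Rightarrow> nat" where
  "eval E s (Const v) = to_word E v"
| "eval E s (Reg x) = regs s x"
| "eval E s (Mem e) = mem s (eval E s e)"
| "eval E s (Add e f) = to_word E (eval E s e + eval E s f)"
| "eval E s (Sub e f) = eval E s e - eval E s f"
| "eval E s (Mul e f) = to_word E (eval E s e * eval E s f)"
| "eval E s (Div e f) = eval E s e div eval E s f"
| "eval E s (Mod e f) = eval E s e mod eval E s f"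
| "eval E s (Less e f) = to_word E (of_bool (eval E s e < eval E s f))"
| "eval E s (Eql e f) = to_word E (of_bool (eval E s e = eval E s f))"

definition set_reg :: "env \<Rightarrow> string \<Rightarrow> nat \<Rightarrow> state \<Rightarrow> state" where
  "set_reg E x v s = s\<lparr>regs := (regs s)(x := to_word E v)\<rparr>"

definition answer :: "env \<Rightarrow> (nat \<Rightarrow> nat \<Rightarrow> nat) \<Rightarrow> nat \<Rightarrow> nat \<Rightarrow> nat" where
  "answer E f x y = (if x < num_points E \<and> y < num_points E then f x y else 0)"

text \<open>A configuration consists of the stack of commands still to be executed and the state; it is
  final when the stack is empty. \<open>Rand x e\<close> draws uniformly from the numbers below the value of
  \<open>e\<close>. \<open>Reveal\<close> costs time but no query: it reads a distance between two points on both of which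
  \<open>StrongPoint\<close> has been called.\<close>

type_synonym config = "com list \<times> state"

fun step :: "env \<Rightarrow> config \<Rightarrow> config pmf" where
  "step E ([], s) = return_pmf ([], s)"
| "step E (Skip # cs, s) = return_pmf (cs, s)"
| "step E (Assign x e # cs, s) = return_pmf (cs, set_reg E x (eval E s e) s)"
| "step E (Store e f # cs, s) =
     return_pmf (cs, s\<lparr>mem := (mem s)(eval E s e := eval E s f)\<rparr>)"
| "step E (Seq c c' # cs, s) = return_pmf (c # c' # cs, s)"
| "step E (If e c c' # cs, s) = return_pmf ((if eval E s e \<noteq> 0 then c else c') # cs, s)"
| "step E (While e c # cs, s) =
     return_pmf (if eval E s e \<noteq> 0 then c # While e c # cs else cs, s)"
| "step E (Rand x e # cs, s) =
     (if eval E s e = 0 then return_pmf (cs, set_reg E x 0 s)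
      else map_pmf (\<lambda>v. (cs, set_reg E x v s)) (pmf_of_set {..<eval E s e}))"
| "step E (WeakQ x e f # cs, s) =
     return_pmf (cs, set_reg E x (answer E (weak_dist E) (eval E s e) (eval E s f))
       (s\<lparr>weak_count := weak_count s + 1\<rparr>))"
| "step E (StrongPoint e # cs, s) =
     return_pmf (cs, s\<lparr>known := insert (eval E s e) (known s),
                        point_count := point_count s + 1\<rparr>)"
| "step E (Reveal x e f # cs, s) =
     return_pmf (cs, set_reg E x
       (if eval E s e \<in> known s \<and> eval E s f \<in> known s
        then answer E (true_dist E) (eval E s e) (eval E s f) else 0) s)"
| "step E (StrongDist x e f # cs, s) =
     return_pmf (cs, set_reg E x (answer E (true_dist E) (eval E s e) (eval E s f))
       (s\<lparr>dist_count := dist_count s + 1\<rparr>))"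

primrec run :: "env \<Rightarrow> nat \<Rightarrow> config \<Rightarrow> config pmf" where
  "run E 0 cf = return_pmf cf"
| "run E (Suc t) cf = bind_pmf (run E t cf) (step E)"

text \<open>The machine receives the real parameter \<open>\<epsilon>\<close> rounded to the reciprocal of an integer.\<close>

definition init_state :: "nat \<Rightarrow> nat \<Rightarrow> real \<Rightarrow> state" where
  "init_state n k \<epsilon> =
     \<lparr>regs = (\<lambda>_. 0)(''n'' := n, ''k'' := k, ''inv_eps'' := nat \<lceil>1 / \<epsilon>\<rceil>),
      mem = (\<lambda>_. 0), known = {}, weak_count = 0, point_count = 0, dist_count = 0\<rparr>"

text \<open>The output is a list of \<open>regs s ''out''\<close> triples stored from address 0 on: a point, and the
  numerator and denominator of its weight. Weights of repeated points add up.\<close>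

definition out_set :: "state \<Rightarrow> nat set" where
  "out_set s = (\<lambda>i. mem s (3 * i)) ` {..<regs s ''out''}"

definition out_weight :: "state \<Rightarrow> nat \<Rightarrow> real" where
  "out_weight s x =
     (\<Sum>i | i < regs s ''out'' \<and> mem s (3 * i) = x.
        real (mem s (3 * i + 1)) / real (mem s (3 * i + 2)))"

text \<open>The joint distribution, over the weak oracle and the coins of the program, of the
  configuration after \<open>t\<close> steps.\<close>

definition execution ::
    "com \<Rightarrow> nat \<Rightarrow> nat \<Rightarrow> nat \<Rightarrow> real \<Rightarrow> (nat \<Rightarrow> nat \<Rightarrow> nat) \<Rightarrow>
     ((nat set \<Rightarrow> bool) \<Rightarrow> nat set \<Rightarrow> nat) \<Rightarrow> nat \<Rightarrow> config pmf" where
  "execution P W n k \<epsilon> d adv t =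
     bind_pmf (corruption n) (\<lambda>K.
       run \<lparr>word_size = W, num_points = n, true_dist = d, weak_dist = weak_oracle d adv K\<rparr>
         t ([P], init_state n k \<epsilon>))"

datatype strong_mode = Point_Queries | Distance_Queries

fun strong_queries_le :: "strong_mode \<Rightarrow> state \<Rightarrow> real \<Rightarrow> bool" where
  "strong_queries_le Point_Queries s B \<longleftrightarrow> real (point_count s) \<le> B \<and> dist_count s = 0"
| "strong_queries_le Distance_Queries s B \<longleftrightarrow> real (dist_count s) \<le> B \<and> point_count s = 0"

text \<open>The shift by one keeps the logarithmic factor at least 1 for every \<open>n \<ge> 1\<close>.\<close>

definition soft_bound :: "real \<Rightarrow> nat \<Rightarrow> nat \<Rightarrow> real \<Rightarrow> real" where
  "soft_bound A e n B = A * B * log 2 (real n + 1) ^ e"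

end

theory Submission
  imports Defs
begin

text \<open>
  Up to logarithmic factors, the space is clustered greedily. While many points are unclustered,
  sample \<open>N\<close> of them, use strong queries among the samples to find a ball \<open>B(t, r)\<close> of small radius
  that contains \<open>h\<close> samples, and let these \<open>h\<close> samples vote, by their weak answers, on which points lie
  within growing multiples of \<open>r\<close> of \<open>t\<close>. With high probability over the corruption pattern, any \<open>h\<close>
  voters misjudge only few points, simultaneously for all choices of the voters, so an adversary who
  knows the pattern cannot exploit adaptivity. At some scale the accepted set stops growing by a
  constant factor; most of it then lies in a true ball, and a second vote by a uniform sample of the
  accepted set is correct for every point. The accepted points form a cluster.

  A typical unclustered point is within \<open>2 OPT / u\<close> of its optimal centre when \<open>u\<close> points are left, so
  the cluster radius is \<open>O(h OPT / u)\<close>, and summing over the clusters gives a harmonic sum: the total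
  distance of the points to their clusters is \<open>O(h log n) OPT\<close>. Since a step removes a
  \<open>1 / (2 N)\<close> fraction of the unclustered points, \<open>2 N L\<close> steps suffice. Finally, each cluster is
  replaced by a uniform sample; Hoeffding's inequality and a union bound over all centre sets bound
  the error by \<open>\<epsilon> OPT\<close>.
\<close>

section \<open>A program logic with time, query and failure budgets\<close>

text \<open>The adversary knows the whole corruption pattern, so a voter set that depends on weak
  answers cannot be assumed honest. What holds is a uniform statement: the \<open>m * h\<close>
  pairs between \<open>m\<close> points and \<open>h\<close> voters are corrupted independently, so
  a union bound over all voter sets is affordable once \<open>m\<close> is a large multiple of
  \<open>log n\<close>. It leaves fewer than \<open>m\<close> misjudged points, but not none. The
  second vote removes these errors: its voters are drawn with fresh coins after the accepted set is
  fixed. This needs, for every single point, a clear majority of honest and well-placed members of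
  that set. At most 7/20 of a ball is corrupted towards a point (the rate is 1/3), and a stalled
  scale adds about 1/11 of misplaced members; both together stay below 1/2, which is why growth is
  measured by the factor 11/10.

  Time and query bounds must hold in every outcome, also for bad patterns and unlucky samples. Hence
  triples separate a sure postcondition from a likely one, and goodness of the pattern is a
  hypothesis inside the likely one. The optimal centres serve only as a comparison in the analysis;
  the program never computes them.\<close>

text \<open>\<open>HT E c s \<tau> \<sigma> \<delta> S Q\<close>: started in \<open>s\<close>, the command \<open>c\<close> takes at most \<open>\<tau>\<close> steps and \<open>\<sigma>\<close> strong
  queries, surely reaches a state satisfying \<open>S\<close>, and satisfies \<open>Q\<close> except with probability \<open>\<delta>\<close>.\<close>

fun mods :: "com \<Rightarrow> string set" where
  "mods Skip = {}"
| "mods (Assign x e) = {x}"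
| "mods (Store e f) = {}"
| "mods (Seq c c') = mods c \<union> mods c'"
| "mods (If e c c') = mods c \<union> mods c'"
| "mods (While e c) = mods c"
| "mods (Rand x e) = {x}"
| "mods (WeakQ x e f) = {x}"
| "mods (StrongPoint e) = {}"
| "mods (Reveal x e f) = {x}"
| "mods (StrongDist x e f) = {x}"

fun stores :: "com \<Rightarrow> bool" where
  "stores (Store e f) \<longleftrightarrow> True"
| "stores (Seq c c') \<longleftrightarrow> stores c \<or> stores c'"
| "stores (If e c c') \<longleftrightarrow> stores c \<or> stores c'"
| "stores (While e c) \<longleftrightarrow> stores c"
| "stores _ \<longleftrightarrow> False"

definition strong_count :: "state \<Rightarrow> nat" where
  "strong_count s = point_count s + dist_count s"

section \<open>Runs as a Markov chain, and what a command cannot change\<close>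

lemma prob_bind_pmf:
  "measure_pmf.prob (bind_pmf M f) A = measure_pmf.expectation M (\<lambda>x. measure_pmf.prob (f x) A)"
  unfolding measure_pmf_bind
  by (subst measure_pmf.measure_bind[where N = "count_space UNIV"]) (auto simp: measure_subprob)

lemma run_add: "run E (t + u) cf = bind_pmf (run E t cf) (run E u)"
  by (induction u) (simp_all add: bind_return_pmf' bind_assoc_pmf)

text \<open>\<open>run\<close> appends steps at the end, whereas the logic consumes a program from
  its first command; this turns one recursion into the other.\<close>

lemma run_Suc_left: "run E (Suc t) cf = bind_pmf (step E cf) (run E t)"
  using run_add[of E 1 t cf] by (simp add: bind_return_pmf)

text \<open>Finished configurations are absorbing, so a run of prescribed length remains meaningful
  for computations that stop earlier.\<close>

lemma run_final: "run E t ([], s) = return_pmf ([], s)"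
  by (induction t) (simp_all add: bind_return_pmf)

lemma run_invariant:
  assumes "I cf" and "\<And>cf cf'. I cf \<Longrightarrow> cf' \<in> set_pmf (step E cf) \<Longrightarrow> I cf'"
  shows "cf' \<in> set_pmf (run E t cf) \<Longrightarrow> I cf'"
proof (induction t arbitrary: cf')
  case 0
  then show ?case using assms(1) by simp
next
  case (Suc t)
  from Suc.prems obtain cf'' where "cf'' \<in> set_pmf (run E t cf)" "cf' \<in> set_pmf (step E cf'')"
    by (auto simp del: split_paired_Ex)
  with Suc.IH assms(2) show ?case by blast
qed

lemma set_reg_simps [simp]:
  "regs (set_reg E x v s) = (regs s)(x := to_word E v)"
  "mem (set_reg E x v s) = mem s"
  "known (set_reg E x v s) = known s"
  "weak_count (set_reg E x v s) = weak_count s"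
  "point_count (set_reg E x v s) = point_count s"
  "dist_count (set_reg E x v s) = dist_count s"
  by (simp_all add: set_reg_def)

lemma strong_count_simps [simp]:
  "strong_count (set_reg E x v s) = strong_count s"
  "strong_count (s\<lparr>mem := m\<rparr>) = strong_count s"
  "strong_count (s\<lparr>regs := r\<rparr>) = strong_count s"
  "strong_count (s\<lparr>known := K\<rparr>) = strong_count s"
  "strong_count (s\<lparr>weak_count := w\<rparr>) = strong_count s"
  by (simp_all add: strong_count_def)

text \<open>The first and third claims make the other two inductive: a step only unfolds commands
  already on the stack, so no further assigned register and no further store can turn up
  later.\<close>

lemma step_frame:
  assumes "(cs', s') \<in> set_pmf (step E (cs, s))"
  shows "\<Union>(mods ` set cs') \<subseteq> \<Union>(mods ` set cs)"
    and "x \<notin> \<Union>(mods ` set cs) \<Longrightarrow> regs s' x = regs s x"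
    and "(\<exists>c\<in>set cs'. stores c) \<Longrightarrow> (\<exists>c\<in>set cs. stores c)"
    and "\<not> (\<exists>c\<in>set cs. stores c) \<Longrightarrow> mem s' = mem s"
  using assms by (induction E "(cs, s)" rule: step.induct) (auto split: if_splits)

lemma run_frame:
  assumes "(cs', s') \<in> set_pmf (run E t (cs, s))"
  shows "x \<notin> \<Union>(mods ` set cs) \<Longrightarrow> regs s' x = regs s x"
    and "\<not> (\<exists>c\<in>set cs. stores c) \<Longrightarrow> mem s' = mem s"
proof -
  let ?I = "\<lambda>(cs', s'). \<Union>(mods ` set cs') \<subseteq> \<Union>(mods ` set cs) \<and>
     (\<forall>x. x \<notin> \<Union>(mods ` set cs) \<longrightarrow> regs s' x = regs s x)"
  let ?J = "\<lambda>(cs', s'). \<not> (\<exists>c\<in>set cs'. stores c) \<and> mem s' = mem s"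
  have "?I (cs', s')"
  proof (rule run_invariant[where I = ?I, OF _ _ assms])
    fix cf cf' assume *: "?I cf" "cf' \<in> set_pmf (step E cf)"
    obtain c1 s1 c2 s2 where [simp]: "cf = (c1, s1)" "cf' = (c2, s2)" by fastforce
    show "?I cf'"
      using * step_frame(1)[of c2 s2 E c1 s1] step_frame(2)[of c2 s2 E c1 s1] by (simp add: subset_iff) metis
  qed auto
  then show "x \<notin> \<Union>(mods ` set cs) \<Longrightarrow> regs s' x = regs s x" by auto
  assume ns: "\<not> (\<exists>c\<in>set cs. stores c)"
  have "?J (cs', s')"
  proof (rule run_invariant[where I = ?J, OF _ _ assms])
    fix cf cf' assume *: "?J cf" "cf' \<in> set_pmf (step E cf)"
    obtain c1 s1 c2 s2 where [simp]: "cf = (c1, s1)" "cf' = (c2, s2)" by fastforce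
    show "?J cf'"
      using * step_frame(3)[of c2 s2 E c1 s1] step_frame(4)[of c2 s2 E c1 s1] by auto
  qed (use ns in auto)
  then show "mem s' = mem s" by auto
qed

definition HT :: "env \<Rightarrow> com \<Rightarrow> state \<Rightarrow> nat \<Rightarrow> nat \<Rightarrow> real \<Rightarrow> (state \<Rightarrow> bool) \<Rightarrow> (state \<Rightarrow> bool) \<Rightarrow> bool"
  where "HT E c s \<tau> \<sigma> \<delta> S Q \<longleftrightarrow> (\<exists>\<mu> :: (state \<times> nat) pmf.
    (\<forall>(s', u) \<in> set_pmf \<mu>. u \<le> \<tau> \<and> strong_count s' \<le> strong_count s + \<sigma> \<and> S s') \<and>
    measure_pmf.prob \<mu> {(s', u). \<not> Q s'} \<le> \<delta> \<and>
    (\<forall>cs t. \<tau> \<le> t \<longrightarrow> run E t (c # cs, s) = bind_pmf \<mu> (\<lambda>(s', u). run E (t - u) (cs, s'))))"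

abbreviation ST :: "env \<Rightarrow> com \<Rightarrow> state \<Rightarrow> nat \<Rightarrow> nat \<Rightarrow> (state \<Rightarrow> bool) \<Rightarrow> bool"
  where "ST E c s \<tau> \<sigma> S \<equiv> HT E c s \<tau> \<sigma> 0 S (\<lambda>_. True)"

text \<open>The frame condition is free: with empty continuation and exactly \<open>\<tau>\<close>
  steps the witness distribution can be read off an actual run, to which \<open>run_frame\<close>
  applies. Specifications below therefore mention only what changes.\<close>

lemma HT_framed:
  assumes "HT E c s \<tau> \<sigma> \<delta> S Q"
  shows "HT E c s \<tau> \<sigma> \<delta> (\<lambda>s'. S s' \<and> (\<forall>x. x \<notin> mods c \<longrightarrow> regs s' x = regs s x) \<and>
           (\<not> stores c \<longrightarrow> mem s' = mem s)) Q"
proof -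
  from assms obtain \<mu> where \<mu>: "\<forall>(s', u) \<in> set_pmf \<mu>. u \<le> \<tau> \<and> strong_count s' \<le> strong_count s + \<sigma> \<and> S s'"
    "measure_pmf.prob \<mu> {(s', u). \<not> Q s'} \<le> \<delta>"
    "\<forall>cs t. \<tau> \<le> t \<longrightarrow> run E t (c # cs, s) = bind_pmf \<mu> (\<lambda>(s', u). run E (t - u) (cs, s'))"
    unfolding HT_def by blast
  have "(\<forall>x. x \<notin> mods c \<longrightarrow> regs s' x = regs s x) \<and> (\<not> stores c \<longrightarrow> mem s' = mem s)"
    if "(s', u) \<in> set_pmf \<mu>" for s' u
  proof -
    have "run E \<tau> ([c], s) = bind_pmf \<mu> (\<lambda>(s', u). return_pmf ([], s'))"
      using \<mu>(3) by (simp add: run_final)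
    then have "([], s') \<in> set_pmf (run E \<tau> ([c], s))"
      using that by force
    from run_frame[OF this] show ?thesis by auto
  qed
  then show ?thesis
    unfolding HT_def by (intro exI[of _ \<mu>]) (use \<mu> in auto)
qed

lemma HT_conseq:
  assumes "HT E c s \<tau> \<sigma> \<delta> S Q" "\<tau> \<le> \<tau>'" "\<sigma> \<le> \<sigma>'" "\<delta> \<le> \<delta>'"
    and "\<And>s'. S s' \<Longrightarrow> (\<forall>x. x \<notin> mods c \<longrightarrow> regs s' x = regs s x) \<Longrightarrow>
           (\<not> stores c \<longrightarrow> mem s' = mem s) \<Longrightarrow> S' s' \<and> (Q s' \<longrightarrow> Q' s')"
  shows "HT E c s \<tau>' \<sigma>' \<delta>' S' Q'"
proof -
  let ?S = "\<lambda>s'. S s' \<and> (\<forall>x. x \<notin> mods c \<longrightarrow> regs s' x = regs s x) \<and> (\<not> stores c \<longrightarrow> mem s' = mem s)"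
  from HT_framed[OF assms(1)] obtain \<mu> where \<mu>:
    "\<forall>(s', u) \<in> set_pmf \<mu>. u \<le> \<tau> \<and> strong_count s' \<le> strong_count s + \<sigma> \<and> ?S s'"
    "measure_pmf.prob \<mu> {(s', u). \<not> Q s'} \<le> \<delta>"
    "\<forall>cs t. \<tau> \<le> t \<longrightarrow> run E t (c # cs, s) = bind_pmf \<mu> (\<lambda>(s', u). run E (t - u) (cs, s'))"
    unfolding HT_def by blast
  have "measure_pmf.prob \<mu> {(s', u). \<not> Q' s'} \<le> measure_pmf.prob \<mu> {(s', u). \<not> Q s'}"
    using \<mu>(1) assms(5) by (intro measure_pmf.finite_measure_mono_AE) (auto simp: AE_measure_pmf_iff)
  then have 1: "measure_pmf.prob \<mu> {(s', u). \<not> Q' s'} \<le> \<delta>'" using \<mu>(2) assms(4) by linarith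
  have 2: "\<forall>(s', u) \<in> set_pmf \<mu>. u \<le> \<tau>' \<and> strong_count s' \<le> strong_count s + \<sigma>' \<and> S' s'"
    using \<mu>(1) assms(2,3,5) by (auto intro: order_trans)
  show ?thesis
    unfolding HT_def using 1 2 \<mu>(3) assms(2) by (intro exI[of _ \<mu>] conjI allI impI) simp_all
qed

text \<open>The rule behind every primitive command except \<open>Rand\<close>. A witness of
  \<open>HT\<close> pairs each final state with the time spent, here one step; the condition
  \<open>\<tau> \<le> t\<close> ensures that no run is cut off inside the command, whatever follows
  on the stack.\<close>

lemma HT_det:
  assumes "\<And>cs. step E (c # cs, s) = return_pmf (cs, s')"
    and "1 \<le> \<tau>" "strong_count s' \<le> strong_count s + \<sigma>" "S s'" "0 \<le> \<delta>" "Q s'"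
  shows "HT E c s \<tau> \<sigma> \<delta> S Q"
  unfolding HT_def
proof (intro exI[of _ "return_pmf (s', 1)"] conjI allI impI)
  fix cs t assume "\<tau> \<le> t"
  then obtain u where "t = Suc u" using assms(2) by (cases t) auto
  then show "run E t (c # cs, s) = bind_pmf (return_pmf (s', 1)) (\<lambda>(s', u). run E (t - u) (cs, s'))"
    using assms(1) by (simp only: run_Suc_left) (simp add: bind_return_pmf)
qed (use assms in \<open>auto simp: measure_return_pmf\<close>)

text \<open>The continuation \<open>c'\<close> may be the rest of a loop: all that matters is that one step leads
  from \<open>c\<close> to the pair.\<close>

lemma HT_unfold_seq:
  assumes st: "\<And>cs. step E (c0 # cs, s) = return_pmf (c # c' # cs, s)"
    and 1: "HT E c s \<tau>a \<sigma>a \<delta>a Sm Qm"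
    and 2: "\<And>s'. Sm s' \<Longrightarrow> (\<forall>x. x \<notin> mods c \<longrightarrow> regs s' x = regs s x) \<Longrightarrow>
           (\<not> stores c \<longrightarrow> mem s' = mem s) \<Longrightarrow> HT E c' s' \<tau>b \<sigma>b \<delta>b S (\<lambda>s''. Qm s' \<longrightarrow> Q s'')"
    and "0 \<le> \<delta>b" "Suc (\<tau>a + \<tau>b) \<le> \<tau>" "\<sigma>a + \<sigma>b \<le> \<sigma>" "\<delta>a + \<delta>b \<le> \<delta>"
  shows "HT E c0 s \<tau> \<sigma> \<delta> S Q"
proof -
  let ?S = "\<lambda>s'. Sm s' \<and> (\<forall>x. x \<notin> mods c \<longrightarrow> regs s' x = regs s x) \<and> (\<not> stores c \<longrightarrow> mem s' = mem s)"
  from HT_framed[OF 1] obtain \<mu> where \<mu>: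
    "\<forall>(s', u) \<in> set_pmf \<mu>. u \<le> \<tau>a \<and> strong_count s' \<le> strong_count s + \<sigma>a \<and> ?S s'"
    "measure_pmf.prob \<mu> {(s', u). \<not> Qm s'} \<le> \<delta>a"
    "\<And>cs t. \<tau>a \<le> t \<Longrightarrow> run E t (c # cs, s) = bind_pmf \<mu> (\<lambda>(s', u). run E (t - u) (cs, s'))"
    unfolding HT_def by blast
  define OK where "OK = (\<lambda>s' \<nu>. (\<forall>(s'', u) \<in> set_pmf \<nu>. u \<le> \<tau>b \<and> strong_count s'' \<le> strong_count s' + \<sigma>b \<and> S s'') \<and>
      measure_pmf.prob \<nu> {(s'', u). \<not> (Qm s' \<longrightarrow> Q s'')} \<le> \<delta>b \<and>
      (\<forall>cs t. \<tau>b \<le> t \<longrightarrow> run E t (c' # cs, s') = bind_pmf \<nu> (\<lambda>(s', u). run E (t - u) (cs, s'))))"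
  \<comment> \<open>The second command has its own witness for each intermediate state;
    \<open>choice\<close> bundles them into a kernel, and \<open>\<xi>\<close> below is the
    composition of the two distributions.\<close>
  have "\<forall>s'. \<exists>\<nu>. ?S s' \<longrightarrow> OK s' \<nu>"
  proof
    fix s'
    show "\<exists>\<nu>. ?S s' \<longrightarrow> OK s' \<nu>"
    proof (cases "?S s'")
      case True
      then have "HT E c' s' \<tau>b \<sigma>b \<delta>b S (\<lambda>s''. Qm s' \<longrightarrow> Q s'')" by (intro 2) auto
      then show ?thesis unfolding HT_def OK_def by (elim exE) (rule exI, rule impI)
    qed auto
  qed
  from choice[OF this] obtain \<nu> where OK: "\<And>s'. ?S s' \<Longrightarrow> OK s' (\<nu> s')" by blast
  have \<nu>: "\<forall>(s'', u) \<in> set_pmf (\<nu> s'). u \<le> \<tau>b \<and> strong_count s'' \<le> strong_count s' + \<sigma>b \<and> S s''"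
      "measure_pmf.prob (\<nu> s') {(s'', u). \<not> (Qm s' \<longrightarrow> Q s'')} \<le> \<delta>b"
      "\<And>cs t. \<tau>b \<le> t \<Longrightarrow> run E t (c' # cs, s') = bind_pmf (\<nu> s') (\<lambda>(s', u). run E (t - u) (cs, s'))"
    if "?S s'" for s'
    using OK[OF that] unfolding OK_def by auto
  define \<xi> where "\<xi> = bind_pmf \<mu> (\<lambda>(s', u). map_pmf (\<lambda>(s'', u'). (s'', Suc (u + u'))) (\<nu> s'))"
  have sure: "\<forall>(s'', u) \<in> set_pmf \<xi>. u \<le> \<tau> \<and> strong_count s'' \<le> strong_count s + \<sigma> \<and> S s''"
  proof -
    have "w \<le> \<tau> \<and> strong_count s'' \<le> strong_count s + \<sigma> \<and> S s''" if "(s'', w) \<in> set_pmf \<xi>" for s'' w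
    proof -
      from that obtain s' u u' where *: "(s', u) \<in> set_pmf \<mu>" "(s'', u') \<in> set_pmf (\<nu> s')" "w = Suc (u + u')"
        unfolding \<xi>_def by auto
      with \<mu>(1) have **: "u \<le> \<tau>a" "strong_count s' \<le> strong_count s + \<sigma>a" "?S s'" by auto
      with \<nu>(1)[of s'] * have "u' \<le> \<tau>b" "strong_count s'' \<le> strong_count s' + \<sigma>b" "S s''" by auto
      with * ** assms show ?thesis by linarith
    qed
    then show ?thesis by auto
  qed
  have run: "run E t (c0 # cs, s) = bind_pmf \<xi> (\<lambda>(s', u). run E (t - u) (cs, s'))" if t: "\<tau> \<le> t" for cs t
  proof -
    obtain v where v: "t = Suc v" using t assms(5) by (cases t) auto
    have "run E t (c0 # cs, s) = run E v (c # c' # cs, s)"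
      using st by (simp only: v run_Suc_left) (simp add: bind_return_pmf)
    also have "\<dots> = bind_pmf \<mu> (\<lambda>(s', u). run E (v - u) (c' # cs, s'))"
      using \<mu>(3) v t assms(5) by simp
    also have "\<dots> = bind_pmf \<mu> (\<lambda>(s', u). bind_pmf (\<nu> s') (\<lambda>(s'', u'). run E (v - u - u') (cs, s'')))"
    proof (intro bind_pmf_cong refl, clarify)
      fix s' u assume "(s', u) \<in> set_pmf \<mu>"
      then have "u \<le> \<tau>a" "?S s'" using \<mu>(1) by auto
      then show "run E (v - u) (c' # cs, s') = bind_pmf (\<nu> s') (\<lambda>(s'', u'). run E (v - u - u') (cs, s''))"
        using \<nu>(3)[of s' "v - u" cs] v t assms(5) by simp
    qed
    also have "\<dots> = bind_pmf \<xi> (\<lambda>(s', u). run E (t - u) (cs, s'))"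
      unfolding \<xi>_def v by (simp add: bind_assoc_pmf bind_map_pmf case_prod_unfold)
    finally show ?thesis .
  qed
  have "measure_pmf.prob \<xi> {(s'', u). \<not> Q s''} =
      measure_pmf.expectation \<mu> (\<lambda>p. measure_pmf.prob (\<nu> (fst p)) {(s'', u). \<not> Q s''})"
    unfolding \<xi>_def 
    by (subst prob_bind_pmf) (auto simp: case_prod_unfold vimage_def intro!: Bochner_Integration.integral_cong)
  \<comment> \<open>Union bound along the sequence: where \<open>Qm\<close> fails, the budget
    \<open>\<delta>a\<close> has already paid 1; elsewhere the second command fails with probability
    at most \<open>\<delta>b\<close>.\<close>
  also have "\<dots> \<le> measure_pmf.expectation \<mu> (\<lambda>p. indicator {(s', u). \<not> Qm s'} p + \<delta>b)"
  proof (rule integral_mono_AE)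
    show "AE p in measure_pmf \<mu>. measure_pmf.prob (\<nu> (fst p)) {(s'', u). \<not> Q s''} \<le> indicator {(s', u). \<not> Qm s'} p + \<delta>b"
      unfolding AE_measure_pmf_iff
    proof clarify
      fix s' u assume "(s', u) \<in> set_pmf \<mu>"
      then have *: "?S s'" using \<mu>(1) by auto
      show "measure_pmf.prob (\<nu> (fst (s', u))) {(s'', u). \<not> Q s''} \<le> indicator {(s', u). \<not> Qm s'} (s', u) + \<delta>b"
        using \<nu>(2)[OF *] assms(4) by (auto simp: indicator_def add_increasing2)
    qed
  qed (auto intro!: measure_pmf.integrable_const_bound[where B = 1] Bochner_Integration.integrable_add)
  also have "\<dots> = measure_pmf.prob \<mu> {(s', u). \<not> Qm s'} + \<delta>b"
    by (subst Bochner_Integration.integral_add) (auto intro!: measure_pmf.integrable_const_bound[where B = 1])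
  finally have "measure_pmf.prob \<xi> {(s'', u). \<not> Q s''} \<le> \<delta>" using \<mu>(2) assms by linarith
  with sure run show ?thesis unfolding HT_def by blast
qed

lemma HT_unfold:
  assumes "\<And>cs. step E (c0 # cs, s) = return_pmf (c # cs, s)" "HT E c s \<tau>a \<sigma> \<delta> S Q" "Suc \<tau>a \<le> \<tau>"
  shows "HT E c0 s \<tau> \<sigma> \<delta> S Q"
proof -
  from assms(2) obtain \<mu> where \<mu>:
    "\<forall>(s', u) \<in> set_pmf \<mu>. u \<le> \<tau>a \<and> strong_count s' \<le> strong_count s + \<sigma> \<and> S s'"
    "measure_pmf.prob \<mu> {(s', u). \<not> Q s'} \<le> \<delta>"
    "\<And>cs t. \<tau>a \<le> t \<Longrightarrow> run E t (c # cs, s) = bind_pmf \<mu> (\<lambda>(s', u). run E (t - u) (cs, s'))"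
    unfolding HT_def by blast
  let ?\<xi> = "map_pmf (\<lambda>(s', u). (s', Suc u)) \<mu>"
  have "run E t (c0 # cs, s) = bind_pmf ?\<xi> (\<lambda>(s', u). run E (t - u) (cs, s'))" if t: "\<tau> \<le> t" for cs t
  proof -
    obtain v where v: "t = Suc v" using t assms(3) by (cases t) auto
    have "run E t (c0 # cs, s) = run E v (c # cs, s)"
      using assms(1) by (simp only: v run_Suc_left) (simp add: bind_return_pmf)
    also have "\<dots> = bind_pmf ?\<xi> (\<lambda>(s', u). run E (t - u) (cs, s'))"
      using \<mu>(3)[of v cs] v t assms(3) by (simp add: bind_map_pmf case_prod_unfold)
    finally show ?thesis .
  qed
  moreover have "measure_pmf.prob ?\<xi> {(s', u). \<not> Q s'} \<le> \<delta>"
    using \<mu>(2) by (simp add: vimage_def case_prod_unfold)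
  ultimately show ?thesis
    unfolding HT_def by (intro exI[of _ ?\<xi>]) (use \<mu>(1) assms(3) in auto)
qed

lemmas HT_Seq = HT_unfold_seq[OF step.simps(5)]

lemma HT_If:
  assumes "eval E s e \<noteq> 0 \<Longrightarrow> HT E c s \<tau>a \<sigma> \<delta> S Q" "eval E s e = 0 \<Longrightarrow> HT E c' s \<tau>a \<sigma> \<delta> S Q" "Suc \<tau>a \<le> \<tau>"
  shows "HT E (If e c c') s \<tau> \<sigma> \<delta> S Q"
proof (cases "eval E s e = 0")
  case True
  show ?thesis by (rule HT_unfold[OF _ assms(2)[OF True] assms(3)]) (simp add: True)
next
  case False
  show ?thesis by (rule HT_unfold[OF _ assms(1)[OF False] assms(3)]) (simp add: False)
qed

lemma HT_Skip: "1 \<le> \<tau> \<Longrightarrow> 0 \<le> \<delta> \<Longrightarrow> S s \<Longrightarrow> Q s \<Longrightarrow> HT E Skip s \<tau> \<sigma> \<delta> S Q"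
  by (rule HT_det) auto

lemma HT_Assign:
  "1 \<le> \<tau> \<Longrightarrow> 0 \<le> \<delta> \<Longrightarrow> S (set_reg E x (eval E s e) s) \<Longrightarrow> Q (set_reg E x (eval E s e) s) \<Longrightarrow>
   HT E (Assign x e) s \<tau> \<sigma> \<delta> S Q"
  by (rule HT_det) auto

lemma HT_Store:
  "1 \<le> \<tau> \<Longrightarrow> 0 \<le> \<delta> \<Longrightarrow> S (s\<lparr>mem := (mem s)(eval E s e := eval E s f)\<rparr>) \<Longrightarrow>
   Q (s\<lparr>mem := (mem s)(eval E s e := eval E s f)\<rparr>) \<Longrightarrow> HT E (Store e f) s \<tau> \<sigma> \<delta> S Q"
  by (rule HT_det) auto

lemma ST_WeakQ:
  assumes "1 \<le> \<tau>" "S (set_reg E x (answer E (weak_dist E) (eval E s e) (eval E s f)) (s\<lparr>weak_count := weak_count s + 1\<rparr>))"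
  shows "ST E (WeakQ x e f) s \<tau> \<sigma> S"
  by (rule HT_det) (use assms in auto)

definition For :: "string \<Rightarrow> exp \<Rightarrow> com \<Rightarrow> com" where
  "For v e c = Seq (Assign v (Const 0)) (While (Less (Reg v) e) (Seq c (Assign v (Add (Reg v) (Const 1)))))"

lemma mods_For [simp]: "mods (For v e c) = insert v (mods c)"
  by (auto simp: For_def)

lemma stores_For [simp]: "stores (For v e c) = stores c"
  by (auto simp: For_def)

lemma to_word_id: "v < 2 ^ word_size E \<Longrightarrow> to_word E v = v"
  by (simp add: to_word_def)

lemma to_word_0 [simp]: "to_word E 0 = 0"
  by (simp add: to_word_def)

text \<open>Two invariants advance side by side, \<open>Inv\<close> in every outcome and
  \<open>Gd\<close> only with high probability. The body proves the implication from
  \<open>Gd i\<close> to \<open>Gd (Suc i)\<close>, so failure budgets add up over the rounds.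
  Beyond the body a round costs 3 steps: the loop test, the opening of \<open>Seq\<close> and the
  increment.\<close>

lemma HT_For_aux:
  fixes N :: nat and \<delta> \<delta>' :: real
  assumes w: "1 < (2::nat) ^ word_size E" "N < 2 ^ word_size E"
    and ev: "\<And>i s'. Inv i s' \<Longrightarrow> i \<le> N \<Longrightarrow> fr s' \<Longrightarrow> eval E s' e = N"
    and body: "\<And>i s'. i < N \<Longrightarrow> Inv i s' \<Longrightarrow> regs s' v = i \<Longrightarrow> fr s' \<Longrightarrow>
         HT E c s' \<tau> \<sigma> \<delta> (\<lambda>s''. Inv (Suc i) (set_reg E v (Suc i) s''))
            (\<lambda>s''. Gd i s' \<longrightarrow> Gd (Suc i) (set_reg E v (Suc i) s''))"
    and fr: "\<And>s' s'' w. fr s' \<Longrightarrow> (\<forall>x. x \<notin> mods c \<longrightarrow> regs s'' x = regs s' x) \<Longrightarrow>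
           (\<not> stores c \<longrightarrow> mem s'' = mem s') \<Longrightarrow> fr (set_reg E v w s'')"
    and vc: "v \<notin> mods c"
    and d0: "0 \<le> \<delta>"
  shows "i \<le> N \<Longrightarrow> Inv i s \<Longrightarrow> regs s v = i \<Longrightarrow> fr s \<Longrightarrow>
    HT E (While (Less (Reg v) e) (Seq c (Assign v (Add (Reg v) (Const 1))))) s
      (Suc ((N - i) * (\<tau> + 3))) ((N - i) * \<sigma>) ((N - i) * \<delta>) (Inv N) (\<lambda>s'. Gd i s \<longrightarrow> Gd N s')"
proof (induction "N - i" arbitrary: i s)
  case 0
  then have "i = N" by simp
  then show ?case using 0 ev[of N s] by (intro HT_det[of _ _ _ s]) auto
next
  case (Suc m)
  then have i: "i < N" "m = N - Suc i" and Nm: "N - i = Suc m" by auto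
  have le: "eval E s e = N" using ev[of i s] Suc.prems by simp
  have "HT E (Seq c (Assign v (Add (Reg v) (Const 1)))) s (\<tau> + 2) \<sigma> \<delta>
      (\<lambda>s''. Inv (Suc i) s'' \<and> regs s'' v = Suc i \<and> fr s'') (\<lambda>s''. Gd i s \<longrightarrow> Gd (Suc i) s'')"
  proof (rule HT_Seq[OF body[OF i(1) Suc.prems(2,3,4)], where \<tau>b = 1 and \<sigma>b = 0 and \<delta>b = 0])
    fix s' assume s': "Inv (Suc i) (set_reg E v (Suc i) s')" "\<forall>x. x \<notin> mods c \<longrightarrow> regs s' x = regs s x"
      "\<not> stores c \<longrightarrow> mem s' = mem s"
    have *: "eval E s' (Add (Reg v) (Const 1)) = Suc i"
      using s'(2) vc Suc.prems(3) i w by (simp add: to_word_id)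
    show "HT E (Assign v (Add (Reg v) (Const 1))) s' 1 0 0 (\<lambda>s''. Inv (Suc i) s'' \<and> regs s'' v = Suc i \<and> fr s'')
       (\<lambda>s''. (Gd i s \<longrightarrow> Gd (Suc i) (set_reg E v (Suc i) s')) \<longrightarrow> Gd i s \<longrightarrow> Gd (Suc i) s'')"
      using s' i w Suc.prems(4)
      by (intro HT_Assign) (simp_all only: *, auto simp: to_word_id intro: fr)
  qed auto
  then show ?case
  proof (rule HT_unfold_seq[rotated, where \<tau>b = "Suc (m * (\<tau> + 3))" and \<sigma>b = "m * \<sigma>" and \<delta>b = "m * \<delta>"])
    fix s' assume "Inv (Suc i) s' \<and> regs s' v = Suc i \<and> fr s'"
    then show "HT E (While (Less (Reg v) e) (Seq c (Assign v (Add (Reg v) (Const 1))))) s' (Suc (m * (\<tau> + 3)))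
         (m * \<sigma>) (m * \<delta>) (Inv N) (\<lambda>s''. (Gd i s \<longrightarrow> Gd (Suc i) s') \<longrightarrow> Gd i s \<longrightarrow> Gd N s'')"
      using Suc.hyps(1)[OF i(2), of s'] i
      by (auto intro: HT_conseq[where S = "Inv N" and Q = "\<lambda>s''. Gd (Suc i) s' \<longrightarrow> Gd N s''"])
  next
    show "step E (While (Less (Reg v) e) (Seq c (Assign v (Add (Reg v) (Const 1)))) # cs, s) =
          return_pmf (Seq c (Assign v (Add (Reg v) (Const 1))) # While (Less (Reg v) e) (Seq c (Assign v (Add (Reg v) (Const 1)))) # cs, s)" for cs
      using i Suc.prems(3) le w(1) by (simp add: to_word_id)
  qed (use d0 in \<open>simp_all add: Nm algebra_simps\<close>)
qed

lemma HT_For: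
  fixes N :: nat and \<delta> \<delta>' :: real
  assumes w: "1 < (2::nat) ^ word_size E" "N < 2 ^ word_size E"
    and i0: "Inv 0 (set_reg E v 0 s)" 
    and ev: "\<And>i s'. Inv i s' \<Longrightarrow> i \<le> N \<Longrightarrow> (\<forall>x. x \<noteq> v \<longrightarrow> x \<notin> mods c \<longrightarrow> regs s' x = regs s x) \<Longrightarrow> (\<not> stores c \<longrightarrow> mem s' = mem s) \<Longrightarrow> eval E s' e = N"
    and body: "\<And>i s'. i < N \<Longrightarrow> Inv i s' \<Longrightarrow> regs s' v = i \<Longrightarrow> (\<forall>x. x \<noteq> v \<longrightarrow> x \<notin> mods c \<longrightarrow> regs s' x = regs s x) \<Longrightarrow>
         (\<not> stores c \<longrightarrow> mem s' = mem s) \<Longrightarrow>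
         HT E c s' \<tau> \<sigma> \<delta> (\<lambda>s''. Inv (Suc i) (set_reg E v (Suc i) s''))
            (\<lambda>s''. Gd i s' \<longrightarrow> Gd (Suc i) (set_reg E v (Suc i) s''))"
    and vc: "v \<notin> mods c"
    and d0: "0 \<le> \<delta>"
    and b: "N * (\<tau> + 3) + 3 \<le> \<tau>'" "N * \<sigma> \<le> \<sigma>'" "N * \<delta> \<le> \<delta>'"
    and fin: "\<And>s'. Inv N s' \<Longrightarrow> (\<forall>x. x \<noteq> v \<longrightarrow> x \<notin> mods c \<longrightarrow> regs s' x = regs s x) \<Longrightarrow> (\<not> stores c \<longrightarrow> mem s' = mem s) \<Longrightarrow>
        S s' \<and> ((Gd 0 (set_reg E v 0 s) \<longrightarrow> Gd N s') \<longrightarrow> Q s')"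
  shows "HT E (For v e c) s \<tau>' \<sigma>' \<delta>' S Q"
  unfolding For_def
proof (rule HT_Seq[where \<tau>a = 1 and \<sigma>a = 0 and \<delta>a = 0 and Sm = "\<lambda>s'. s' = set_reg E v 0 s" and Qm = "\<lambda>_. True"
      and \<tau>b = "Suc (N * (\<tau> + 3))" and \<sigma>b = "N * \<sigma>" and \<delta>b = "N * \<delta>"])
  show "ST E (Assign v (Const 0)) s 1 0 (\<lambda>s'. s' = set_reg E v 0 s)"
    by (rule HT_Assign) auto
  fix s' assume s': "s' = set_reg E v 0 s"
  let ?fr = "\<lambda>s'. (\<forall>x. x \<noteq> v \<longrightarrow> x \<notin> mods c \<longrightarrow> regs s' x = regs s x) \<and> (\<not> stores c \<longrightarrow> mem s' = mem s)"
  have "HT E (While (Less (Reg v) e) (Seq c (Assign v (Add (Reg v) (Const 1))))) s'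
      (Suc ((N - 0) * (\<tau> + 3))) ((N - 0) * \<sigma>) ((N - 0) * \<delta>) (Inv N) (\<lambda>s''. Gd 0 s' \<longrightarrow> Gd N s'')"
    by (rule HT_For_aux[where fr = ?fr]) (use assms s' in \<open>auto intro!: ev body\<close>)
  then show "HT E (While (Less (Reg v) e) (Seq c (Assign v (Add (Reg v) (Const 1))))) s'
      (Suc (N * (\<tau> + 3))) (N * \<sigma>) (N * \<delta>) S (\<lambda>s''. True \<longrightarrow> Q s'')"
    by (rule HT_conseq) (use s' fin in auto)
qed (use d0 b in auto)

section \<open>Arrays and sampling\<close>

text \<open>The likely postcondition is replaced by the expectation of a nonnegative function. Such
  an expectation can be carried backwards through random choices without loss, which is what
  identifies the joint law of several draws in \<open>HT_Sample\<close>.\<close>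

definition HTe :: "env \<Rightarrow> com \<Rightarrow> state \<Rightarrow> nat \<Rightarrow> nat \<Rightarrow> ennreal \<Rightarrow> (state \<Rightarrow> bool) \<Rightarrow> (state \<Rightarrow> ennreal) \<Rightarrow> bool"
  where "HTe E c s \<tau> \<sigma> \<delta> S F \<longleftrightarrow> (\<exists>\<mu> :: (state \<times> nat) pmf.
    (\<forall>(s', u) \<in> set_pmf \<mu>. u \<le> \<tau> \<and> strong_count s' \<le> strong_count s + \<sigma> \<and> S s') \<and>
    (\<integral>\<^sup>+p. F (fst p) \<partial>\<mu>) \<le> \<delta> \<and>
    (\<forall>cs t. \<tau> \<le> t \<longrightarrow> run E t (c # cs, s) = bind_pmf \<mu> (\<lambda>(s', u). run E (t - u) (cs, s'))))"

lemma HT_of_HTe: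
  assumes "HTe E c s \<tau> \<sigma> (ennreal \<delta>) S (\<lambda>s'. of_bool (\<not> Q s'))" "0 \<le> \<delta>"
  shows "HT E c s \<tau> \<sigma> \<delta> S Q"
proof -
  have "(\<integral>\<^sup>+p. of_bool (\<not> Q (fst p)) \<partial>\<mu>) = emeasure (measure_pmf \<mu>) {(s', u). \<not> Q s'}" for \<mu> :: "(state \<times> nat) pmf"
  proof -
    have "(\<integral>\<^sup>+p. of_bool (\<not> Q (fst p)) \<partial>\<mu>) = (\<integral>\<^sup>+p. indicator {(s', u). \<not> Q s'} p \<partial>\<mu>)"
      by (auto intro!: nn_integral_cong simp: indicator_def)
    then show ?thesis by simp
  qed
  then show ?thesis
    using assms unfolding HT_def HTe_def
    by (elim exE conjE, intro exI conjI) (auto simp: measure_pmf.emeasure_eq_measure)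
qed

lemma HTe_mono: "HTe E c s \<tau> \<sigma> \<delta> S F \<Longrightarrow> \<delta> \<le> \<delta>' \<Longrightarrow> HTe E c s \<tau> \<sigma> \<delta>' S F"
  unfolding HTe_def by (elim exE conjE, intro exI conjI) auto

lemma HTe_det:
  assumes "\<And>cs. step E (c # cs, s) = return_pmf (cs, s')"
    and "1 \<le> \<tau>" "strong_count s' \<le> strong_count s + \<sigma>" "S s'" "F s' \<le> \<delta>"
  shows "HTe E c s \<tau> \<sigma> \<delta> S F"
  unfolding HTe_def
proof (intro exI[of _ "return_pmf (s', 1)"] conjI allI impI)
  fix cs t assume "\<tau> \<le> t"
  then obtain u where "t = Suc u" using assms(2) by (cases t) auto
  then show "run E t (c # cs, s) = bind_pmf (return_pmf (s', 1)) (\<lambda>(s', u). run E (t - u) (cs, s'))"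
    using assms(1) by (simp only: run_Suc_left) (simp add: bind_return_pmf)
qed (use assms in auto)

text \<open>The tower property: \<open>f\<close> bounds the conditional expectation of
  \<open>F\<close> given the intermediate state.\<close>

lemma HTe_unfold_seq:
  assumes st: "\<And>cs. step E (c0 # cs, s) = return_pmf (c # c' # cs, s)"
    and 1: "HTe E c s \<tau>a \<sigma>a \<delta> Sm f"
    and 2: "\<And>s'. Sm s' \<Longrightarrow> HTe E c' s' \<tau>b \<sigma>b (f s') S F"
    and "Suc (\<tau>a + \<tau>b) \<le> \<tau>" "\<sigma>a + \<sigma>b \<le> \<sigma>"
  shows "HTe E c0 s \<tau> \<sigma> \<delta> S F"
proof -
  from 1 obtain \<mu> where \<mu>:
    "\<forall>(s', u) \<in> set_pmf \<mu>. u \<le> \<tau>a \<and> strong_count s' \<le> strong_count s + \<sigma>a \<and> Sm s'"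
    "(\<integral>\<^sup>+p. f (fst p) \<partial>\<mu>) \<le> \<delta>"
    "\<And>cs t. \<tau>a \<le> t \<Longrightarrow> run E t (c # cs, s) = bind_pmf \<mu> (\<lambda>(s', u). run E (t - u) (cs, s'))"
    unfolding HTe_def by blast
  define OK where "OK = (\<lambda>s' \<nu>. (\<forall>(s'', u) \<in> set_pmf \<nu>. u \<le> \<tau>b \<and> strong_count s'' \<le> strong_count s' + \<sigma>b \<and> S s'') \<and>
      (\<integral>\<^sup>+p. F (fst p) \<partial>\<nu>) \<le> f s' \<and>
      (\<forall>cs t. \<tau>b \<le> t \<longrightarrow> run E t (c' # cs, s') = bind_pmf \<nu> (\<lambda>(s', u). run E (t - u) (cs, s'))))"
  have "\<forall>s'. \<exists>\<nu>. Sm s' \<longrightarrow> OK s' \<nu>"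
    using 2 unfolding HTe_def OK_def by blast
  from choice[OF this] obtain \<nu> where OK: "\<And>s'. Sm s' \<Longrightarrow> OK s' (\<nu> s')" by blast
  have \<nu>: "\<forall>(s'', u) \<in> set_pmf (\<nu> s'). u \<le> \<tau>b \<and> strong_count s'' \<le> strong_count s' + \<sigma>b \<and> S s''"
      "(\<integral>\<^sup>+p. F (fst p) \<partial>\<nu> s') \<le> f s'"
      "\<And>cs t. \<tau>b \<le> t \<Longrightarrow> run E t (c' # cs, s') = bind_pmf (\<nu> s') (\<lambda>(s', u). run E (t - u) (cs, s'))"
    if "Sm s'" for s'
    using OK[OF that] unfolding OK_def by auto
  define \<xi> where "\<xi> = bind_pmf \<mu> (\<lambda>(s', u). map_pmf (\<lambda>(s'', u'). (s'', Suc (u + u'))) (\<nu> s'))"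
  have "w \<le> \<tau> \<and> strong_count s'' \<le> strong_count s + \<sigma> \<and> S s''" if "(s'', w) \<in> set_pmf \<xi>" for s'' w
  proof -
    from that obtain s' u u' where *: "(s', u) \<in> set_pmf \<mu>" "(s'', u') \<in> set_pmf (\<nu> s')" "w = Suc (u + u')"
      unfolding \<xi>_def by auto
    with \<mu>(1) have **: "u \<le> \<tau>a" "strong_count s' \<le> strong_count s + \<sigma>a" "Sm s'" by auto
    with \<nu>(1)[of s'] * have "u' \<le> \<tau>b" "strong_count s'' \<le> strong_count s' + \<sigma>b" "S s''" by auto
    with * ** assms(4,5) show ?thesis by linarith
  qed
  moreover have "run E t (c0 # cs, s) = bind_pmf \<xi> (\<lambda>(s', u). run E (t - u) (cs, s'))" if t: "\<tau> \<le> t" for cs t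
  proof -
    obtain v where v: "t = Suc v" using t assms(4) by (cases t) auto
    have "run E t (c0 # cs, s) = run E v (c # c' # cs, s)"
      using st by (simp only: v run_Suc_left) (simp add: bind_return_pmf)
    also have "\<dots> = bind_pmf \<mu> (\<lambda>(s', u). run E (v - u) (c' # cs, s'))"
      using \<mu>(3) v t assms(4) by simp
    also have "\<dots> = bind_pmf \<mu> (\<lambda>(s', u). bind_pmf (\<nu> s') (\<lambda>(s'', u'). run E (v - u - u') (cs, s'')))"
    proof (intro bind_pmf_cong refl, clarify)
      fix s' u assume "(s', u) \<in> set_pmf \<mu>"
      then have "u \<le> \<tau>a" "Sm s'" using \<mu>(1) by auto
      then show "run E (v - u) (c' # cs, s') = bind_pmf (\<nu> s') (\<lambda>(s'', u'). run E (v - u - u') (cs, s''))"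
        using \<nu>(3)[of s' "v - u" cs] v t assms(4) by simp
    qed
    also have "\<dots> = bind_pmf \<xi> (\<lambda>(s', u). run E (t - u) (cs, s'))"
      unfolding \<xi>_def v by (simp add: bind_assoc_pmf bind_map_pmf case_prod_unfold)
    finally show ?thesis .
  qed
  moreover have "(\<integral>\<^sup>+p. F (fst p) \<partial>\<xi>) = (\<integral>\<^sup>+p. (\<integral>\<^sup>+q. F (fst q) \<partial>\<nu> (fst p)) \<partial>\<mu>)"
    unfolding \<xi>_def by (simp add: case_prod_unfold)
  moreover have "\<dots> \<le> (\<integral>\<^sup>+p. f (fst p) \<partial>\<mu>)"
    using \<mu>(1) \<nu>(2) by (intro nn_integral_mono_AE) (auto simp: AE_measure_pmf_iff)
  ultimately show ?thesis unfolding HTe_def using \<mu>(2) by (intro exI[of _ \<xi>]) auto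
qed

lemmas HTe_Seq = HTe_unfold_seq[OF step.simps(5)]

lemma HTe_Rand:
  assumes "0 < eval E s e"
    and "1 \<le> \<tau>" "\<And>v. v < eval E s e \<Longrightarrow> S (set_reg E x v s)"
    and "(\<integral>\<^sup>+v. F (set_reg E x v s) \<partial>pmf_of_set {..<eval E s e}) \<le> \<delta>"
  shows "HTe E (Rand x e) s \<tau> \<sigma> \<delta> S F"
  unfolding HTe_def
proof (intro exI[of _ "map_pmf (\<lambda>v. (set_reg E x v s, 1)) (pmf_of_set {..<eval E s e})"] conjI allI impI)
  fix cs t assume "\<tau> \<le> t"
  then obtain u where "t = Suc u" using assms(2) by (cases t) auto
  then show "run E t (Rand x e # cs, s) = bind_pmf (map_pmf (\<lambda>v. (set_reg E x v s, 1)) (pmf_of_set {..<eval E s e})) (\<lambda>(s', u). run E (t - u) (cs, s'))"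
    using assms(1) by (simp only: run_Suc_left) (simp add: bind_map_pmf)
qed (use assms in \<open>auto simp: set_pmf_of_set lessThan_empty_iff\<close>)

section \<open>Arrays in memory: filtering, voting and uniform sampling\<close>

lemma eval_cong: "regs s = regs s' \<Longrightarrow> mem s = mem s' \<Longrightarrow> eval E s e = eval E s' e"
  by (induction e) auto

text \<open>Memory is cut into blocks of \<open>G\<close> cells, and block \<open>j\<close> holds
  array \<open>j\<close>: 0 the output, 1 the cluster labels (0 for unclustered), 2 the set to
  sample from, 3 a sample, 4 marks, 5 the sample without repetitions, 6 distances to the current
  centre, 7 the first voters, 8 the accepted set, 9 the second voters.\<close>

definition Ar :: "nat \<Rightarrow> exp \<Rightarrow> exp" where
  "Ar j e = Mem (Add (Mul (Const j) (Reg ''G'')) e)"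

definition Put :: "nat \<Rightarrow> exp \<Rightarrow> exp \<Rightarrow> com" where
  "Put j e f = Store (Add (Mul (Const j) (Reg ''G'')) e) f"

definition Incr :: "string \<Rightarrow> com" where
  "Incr x = Assign x (Add (Reg x) (Const 1))"

text \<open>Either mode spends at most two strong queries per distance. A point query for an already
  known point is paid again, so that both modes share one bound.\<close>

definition Dist :: "strong_mode \<Rightarrow> string \<Rightarrow> exp \<Rightarrow> exp \<Rightarrow> com" where
  "Dist mode r e f = (case mode of
      Point_Queries \<Rightarrow> Seq (StrongPoint e) (Seq (StrongPoint f) (Reveal r e f))
    | Distance_Queries \<Rightarrow> StrongDist r e f)"

definition Vote :: "nat \<Rightarrow> string \<Rightarrow> com" where
  "Vote j l = Seq (Assign ''cnt'' (Const 0))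
     (For ''vi'' (Reg l)
       (Seq (WeakQ ''w'' (Reg ''x'') (Ar j (Reg ''vi'')))
         (If (Less (Reg ''thr'') (Reg ''w'')) Skip (Incr ''cnt''))))"

definition Filter :: "nat \<Rightarrow> string \<Rightarrow> com \<Rightarrow> exp \<Rightarrow> com" where
  "Filter j l c e = Seq (Assign l (Const 0))
     (For ''x'' (Reg ''n'') (Seq c (If e (Seq (Put j (Reg l) (Reg ''x'')) (Incr l)) Skip)))"

definition Sample :: "nat \<Rightarrow> nat \<Rightarrow> string \<Rightarrow> string \<Rightarrow> com" where
  "Sample jd js l N = For ''i'' (Reg N) (Seq (Rand ''p'' (Reg l)) (Put jd (Reg ''i'') (Ar js (Reg ''p''))))"

lemma mods_macros [simp]:
  "mods (Put j e f) = {}" "mods (Incr x) = {x}" "mods (Dist mode r e f) = {r}"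
  "mods (Vote j l) = {''cnt'', ''vi'', ''w''}" "mods (Filter j l c e) = {l, ''x''} \<union> mods c"
  "mods (Sample jd js l N) = {''i'', ''p''}"
  by (auto simp: Put_def Incr_def Dist_def Vote_def Filter_def Sample_def split: strong_mode.split)

lemma stores_macros [simp]:
  "stores (Put j e f)" "\<not> stores (Incr x)" "\<not> stores (Dist mode r e f)" "\<not> stores (Vote j l)"
  "stores (Filter j l c e)" "stores (Sample jd js l N)"
  by (auto simp: Put_def Incr_def Dist_def Vote_def Filter_def Sample_def split: strong_mode.split)

definition block :: "nat \<Rightarrow> nat \<Rightarrow> nat set" where
  "block G j = {j * G..<j * G + G}"

definition mem_frame :: "nat \<Rightarrow> nat \<Rightarrow> state \<Rightarrow> state \<Rightarrow> bool" where
  "mem_frame G j s s' \<longleftrightarrow> (\<forall>a. a \<notin> block G j \<longrightarrow> mem s' a = mem s a)"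

lemma in_block_iff: "i < G \<Longrightarrow> j' * G + i \<in> block G j \<longleftrightarrow> j' = j"
proof
  assume *: "i < G" "j' * G + i \<in> block G j"
  have "\<not> j' < j" using * mult_le_mono1[of "Suc j'" j G] by (auto simp: block_def)
  moreover have "\<not> j < j'" using * mult_le_mono1[of "Suc j" j' G] by (auto simp: block_def)
  ultimately show "j' = j" by simp
qed (auto simp: block_def)

lemma mem_frameD: "mem_frame G j s s' \<Longrightarrow> i < G \<Longrightarrow> j' \<noteq> j \<Longrightarrow> mem s' (j' * G + i) = mem s (j' * G + i)"
  by (simp add: mem_frame_def in_block_iff)

lemma mem_frame_refl [simp]: "mem_frame G j s s"
  by (simp add: mem_frame_def)

lemma mem_frame_trans: "mem_frame G j s s' \<Longrightarrow> mem_frame G j s' s'' \<Longrightarrow> mem_frame G j s s''"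
  by (simp add: mem_frame_def)

lemma mem_frame_set_reg [simp]: "mem_frame G j s (set_reg E x v s') = mem_frame G j s s'"
  "mem_frame G j (set_reg E x v s) s' = mem_frame G j s s'"
  by (simp_all add: mem_frame_def)

lemma mem_frame_upd: "i < G \<Longrightarrow> mem_frame G j s s' \<Longrightarrow> mem_frame G j s (s'\<lparr>mem := (mem s')(j * G + i := v)\<rparr>)"
  by (auto simp: mem_frame_def block_def)

text \<open>Sixteen times \<open>G\<close> leaves room for the addresses of the ten arrays and for
  small products such as \<open>11 * prev\<close>, so none of these computations wraps
  around.\<close>

locale machine =
  fixes E :: env and G :: nat
  assumes word: "16 * G + 16 \<le> 2 ^ word_size E" and G_pos: "0 < G"
begin

abbreviation wo :: "nat \<Rightarrow> nat \<Rightarrow> nat" where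
  "wo x y \<equiv> to_word E (answer E (weak_dist E) x y)"

abbreviation td :: "nat \<Rightarrow> nat \<Rightarrow> nat" where
  "td x y \<equiv> to_word E (answer E (true_dist E) x y)"

lemma to_word_of_bool [simp]: "to_word E (of_bool b) = 0 \<longleftrightarrow> \<not> b" "0 < to_word E (of_bool b) \<longleftrightarrow> b"
  using word by (auto simp: to_word_id)

lemma to_word_small: "v \<le> 16 * G \<Longrightarrow> to_word E v = v" "v < 16 \<Longrightarrow> to_word E v = v"
  "to_word E 1 = 1" "to_word E (Suc 0) = Suc 0"
  using word by (auto intro!: to_word_id)

lemma word_gt1: "1 < (2::nat) ^ word_size E" 
  using word by linarith

lemma word_gt: "v \<le> G \<Longrightarrow> v < (2::nat) ^ word_size E" 
  using word by linarith

lemma eval_addr: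
  assumes "regs s ''G'' = G" "j < 10" "eval E s e = i" "i < G"
  shows "eval E s (Add (Mul (Const j) (Reg ''G'')) e) = j * G + i"
proof -
  have "j * G \<le> 9 * G" using assms by simp
  then have "to_word E (j * G) = j * G" "to_word E (j * G + i) = j * G + i"
    using assms(4) by (intro to_word_small; linarith)+
  then show ?thesis using assms by (simp add: to_word_small)
qed

lemma eval_Ar:
  assumes "regs s ''G'' = G" "j < 10" "eval E s e = i" "i < G"
  shows "eval E s (Ar j e) = mem s (j * G + i)"
  using eval_addr[OF assms] unfolding Ar_def by simp

lemma ST_Put:
  assumes "regs s ''G'' = G" "j < 10" "eval E s e = i" "i < G" "1 \<le> \<tau>"
    and "S (s\<lparr>mem := (mem s)(j * G + i := eval E s f)\<rparr>)"
  shows "ST E (Put j e f) s \<tau> \<sigma> S"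
  unfolding Put_def by (rule HT_Store) (use assms eval_addr[OF assms(1-4)] in auto)

lemma ST_Incr:
  assumes "regs s x < 16 * G" "1 \<le> \<tau>" "S (set_reg E x (Suc (regs s x)) s)"
  shows "ST E (Incr x) s \<tau> \<sigma> S"
  unfolding Incr_def by (rule HT_Assign) (use assms in \<open>auto simp: to_word_small set_reg_def\<close>)

lemma ST_Dist:
  assumes "5 \<le> \<tau>" "2 \<le> \<sigma>"
  shows "ST E (Dist mode r e f) s \<tau> \<sigma> (\<lambda>s'. regs s' r = td (eval E s e) (eval E s f))"
proof (cases mode)
  case Distance_Queries
  then show ?thesis
    using assms unfolding Dist_def
    by (auto intro!: HT_det[OF step.simps(12)] simp: strong_count_def)
next
  case Point_Queries
  have ev: "eval E (s\<lparr>known := K, point_count := m\<rparr>) e' = eval E s e'" for K m e'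
    by (rule eval_cong) auto
  let ?s1 = "s\<lparr>known := insert (eval E s e) (known s), point_count := point_count s + 1\<rparr>"
  let ?s2 = "s\<lparr>known := insert (eval E s f) (insert (eval E s e) (known s)), point_count := point_count s + 2\<rparr>"
  have 1: "ST E (StrongPoint e) s 1 1 (\<lambda>s'. s' = ?s1)"
    by (rule HT_det[OF step.simps(10)]) (auto simp: strong_count_def)
  have 2: "ST E (StrongPoint f) ?s1 1 1 (\<lambda>s'. s' = ?s2)"
    by (rule HT_det[OF step.simps(10)]) (auto simp: strong_count_def ev)
  have 3: "ST E (Reveal r e f) ?s2 1 0 (\<lambda>s'. regs s' r = td (eval E s e) (eval E s f))"
    by (rule HT_det[OF step.simps(11)]) (auto simp: strong_count_def ev)
  have 4: "ST E (Seq (StrongPoint f) (Reveal r e f)) ?s1 3 1 (\<lambda>s'. regs s' r = td (eval E s e) (eval E s f))"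
    by (rule HT_Seq[OF 2, where \<tau>b = 1 and \<sigma>b = 0 and \<delta>b = 0]) (use 3 in auto)
  show ?thesis
    unfolding Dist_def Point_Queries strong_mode.case
    by (rule HT_Seq[OF 1, where \<tau>b = 3 and \<sigma>b = 1 and \<delta>b = 0]) (use 4 assms in auto)
qed

lemma ST_Seq:
  assumes "ST E c s \<tau>a \<sigma>a Sm"
    and "\<And>s'. Sm s' \<Longrightarrow> (\<forall>x. x \<notin> mods c \<longrightarrow> regs s' x = regs s x) \<Longrightarrow>
           (\<not> stores c \<longrightarrow> mem s' = mem s) \<Longrightarrow> ST E c' s' \<tau>b \<sigma>b S"
    and "Suc (\<tau>a + \<tau>b) \<le> \<tau>" "\<sigma>a + \<sigma>b \<le> \<sigma>"
  shows "ST E (Seq c c') s \<tau> \<sigma> S"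
  by (rule HT_Seq[OF assms(1), where \<delta>b = 0]) (use assms(2-4) in auto)

lemma ST_For:
  fixes N :: nat
  assumes "N \<le> G" "regs s r = N" "r \<noteq> v" "r \<notin> mods c" "v \<notin> mods c"
    and "Inv 0 (set_reg E v 0 s)" 
    and "\<And>i s'. i < N \<Longrightarrow> Inv i s' \<Longrightarrow> regs s' v = i \<Longrightarrow> (\<forall>x. x \<noteq> v \<longrightarrow> x \<notin> mods c \<longrightarrow> regs s' x = regs s x) \<Longrightarrow>
         (\<not> stores c \<longrightarrow> mem s' = mem s) \<Longrightarrow>
         ST E c s' \<tau> \<sigma> (\<lambda>s''. Inv (Suc i) (set_reg E v (Suc i) s''))"
    and "N * (\<tau> + 3) + 3 \<le> \<tau>'" "N * \<sigma> \<le> \<sigma>'"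
    and "\<And>s'. Inv N s' \<Longrightarrow> (\<forall>x. x \<noteq> v \<longrightarrow> x \<notin> mods c \<longrightarrow> regs s' x = regs s x) \<Longrightarrow> (\<not> stores c \<longrightarrow> mem s' = mem s) \<Longrightarrow> S s'"
  shows "ST E (For v (Reg r) c) s \<tau>' \<sigma>' S"
  by (rule HT_For[where N = N and \<tau> = \<tau> and \<sigma> = \<sigma> and \<delta> = 0 and Gd = "\<lambda>_ _. True" and Inv = Inv])
    (use assms word_gt1 word_gt in auto)

lemma ST_conseq:
  assumes "ST E c s \<tau> \<sigma> S" "\<tau> \<le> \<tau>'" "\<sigma> \<le> \<sigma>'"
    and "\<And>s'. S s' \<Longrightarrow> (\<forall>x. x \<notin> mods c \<longrightarrow> regs s' x = regs s x) \<Longrightarrow>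
           (\<not> stores c \<longrightarrow> mem s' = mem s) \<Longrightarrow> S' s'"
  shows "ST E c s \<tau>' \<sigma>' S'"
  by (rule HT_conseq[OF assms(1-3)]) (use assms(4) in auto)

lemma card_less_Suc:
  "card {i'. i' < Suc i \<and> P i'} = card {i'. i' < i \<and> P i'} + (if P i then 1 else 0)"
proof -
  have "{i'. i' < Suc i \<and> P i'} = (if P i then insert i {i'. i' < i \<and> P i'} else {i'. i' < i \<and> P i'})"
    by (auto simp: less_Suc_eq)
  then show ?thesis by auto
qed

lemma card_less_le: "card {i'. i' < i \<and> P i'} \<le> (i::nat)"
  using card_mono[of "{..<i}" "{i'. i' < i \<and> P i'}"] by auto

lemma ST_Vote:
  assumes G: "regs s ''G'' = G" and j: "j < 10" and l: "regs s l = N" "N \<le> G" "l \<notin> {''cnt'', ''vi'', ''w''}"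
    and \<tau>: "N * 8 + 5 \<le> \<tau>"
  shows "ST E (Vote j l) s \<tau> \<sigma> (\<lambda>s'. regs s' ''cnt'' =
     card {i. i < N \<and> wo (regs s ''x'') (mem s (j * G + i)) \<le> regs s ''thr''})"
  unfolding Vote_def
proof (rule ST_Seq[where \<tau>a = 1 and \<sigma>a = 0 and \<tau>b = "N * 8 + 3" and \<sigma>b = 0 and Sm = "\<lambda>s'. s' = set_reg E ''cnt'' 0 s"])
  fix s0 assume s0: "s0 = set_reg E ''cnt'' 0 s"
  let ?P = "\<lambda>i. wo (regs s ''x'') (mem s (j * G + i)) \<le> regs s ''thr''"
  let ?b = "Seq (WeakQ ''w'' (Reg ''x'') (Ar j (Reg ''vi''))) (If (Less (Reg ''thr'') (Reg ''w'')) Skip (Incr ''cnt''))"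
  show "ST E (For ''vi'' (Reg l) ?b) s0 (N * 8 + 3) 0 (\<lambda>s'. regs s' ''cnt'' = card {i. i < N \<and> ?P i})"
  proof (rule ST_For[where N = N and \<tau> = 5 and \<sigma> = 0 and Inv = "\<lambda>i s'. regs s' ''cnt'' = card {i'. i' < i \<and> ?P i'}"])
    fix i and t :: state assume t: "i < N" "regs t ''cnt'' = card {i'. i' < i \<and> ?P i'}" "regs t ''vi'' = i"
      "\<forall>x. x \<noteq> ''vi'' \<longrightarrow> x \<notin> mods ?b \<longrightarrow> regs t x = regs s0 x" "\<not> stores ?b \<longrightarrow> mem t = mem s0"
    have r: "regs t ''G'' = G" "regs t ''thr'' = regs s ''thr''" "regs t ''x'' = regs s ''x''" "mem t = mem s"
      using t(4,5) s0 G by auto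
    have ar: "eval E t (Ar j (Reg ''vi'')) = mem s (j * G + i)"
      using eval_Ar[OF r(1) j, of "Reg ''vi''" i] t(1,3) l r(4) by simp
    let ?t1 = "set_reg E ''w'' (answer E (weak_dist E) (regs s ''x'') (mem s (j * G + i))) (t\<lparr>weak_count := weak_count t + 1\<rparr>)"
    have cle: "card {i'. i' < i \<and> ?P i'} < 16 * G" using card_less_le[of i ?P] t(1) l by linarith
    have w: "ST E (WeakQ ''w'' (Reg ''x'') (Ar j (Reg ''vi''))) t 1 0 (\<lambda>t'. t' = ?t1)"
      by (rule ST_WeakQ) (use ar r in auto)
    show "ST E ?b t 5 0 (\<lambda>s''. regs (set_reg E ''vi'' (Suc i) s'') ''cnt'' = card {i'. i' < Suc i \<and> ?P i'})"
    proof (rule ST_Seq[OF w, where \<tau>b = 3 and \<sigma>b = 0])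
      fix t1 assume t1: "t1 = ?t1"
      have v: "regs t1 ''w'' = wo (regs s ''x'') (mem s (j * G + i))" "regs t1 ''thr'' = regs s ''thr''"
        "regs t1 ''cnt'' = card {i'. i' < i \<and> ?P i'}" using t1 t(2) r by auto
      show "ST E (If (Less (Reg ''thr'') (Reg ''w'')) Skip (Incr ''cnt'')) t1 3 0
         (\<lambda>s''. regs (set_reg E ''vi'' (Suc i) s'') ''cnt'' = card {i'. i' < Suc i \<and> ?P i'})"
      proof (rule HT_If[where \<tau>a = 1])
        assume "eval E t1 (Less (Reg ''thr'') (Reg ''w'')) \<noteq> 0"
        then have "\<not> ?P i" using v by simp
        then show "ST E Skip t1 1 0 (\<lambda>s''. regs (set_reg E ''vi'' (Suc i) s'') ''cnt'' = card {i'. i' < Suc i \<and> ?P i'})"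
          by (intro HT_Skip) (simp_all add: v(3) card_less_Suc)
      next
        assume "eval E t1 (Less (Reg ''thr'') (Reg ''w'')) = 0"
        then have "?P i" using v by simp
        then show "ST E (Incr ''cnt'') t1 1 0 (\<lambda>s''. regs (set_reg E ''vi'' (Suc i) s'') ''cnt'' = card {i'. i' < Suc i \<and> ?P i'})"
          using cle by (intro ST_Incr) (simp_all add: v(3) card_less_Suc to_word_small)
      qed auto
    qed auto
  qed (use s0 l in auto)
qed (use \<tau> in \<open>auto intro!: HT_Assign\<close>)

text \<open>The array lists the filtered set bijectively; this is what later turns a uniform index
  into a uniform element of the set.\<close>

lemma ST_Filter:
  assumes G: "regs s ''G'' = G" and j: "j < 10" and n: "regs s ''n'' = n" "n \<le> G"
    and l: "l \<notin> {''x'', ''n'', ''G''} \<union> mods c" and c: "\<not> stores c" "mods c \<inter> {''x'', ''n'', ''G''} = {}"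
    and test: "\<And>s' x. x < n \<Longrightarrow> regs s' ''x'' = x \<Longrightarrow> (\<forall>y. y \<notin> {l, ''x''} \<union> mods c \<longrightarrow> regs s' y = regs s y) \<Longrightarrow>
         mem_frame G j s s' \<Longrightarrow> ST E c s' \<tau> 0 (\<lambda>s''. (eval E s'' e \<noteq> 0) = P x)"
    and \<tau>: "n * (\<tau> + 8) + 5 \<le> \<tau>'"
  shows "ST E (Filter j l c e) s \<tau>' \<sigma> (\<lambda>s'. regs s' l = card {x. x < n \<and> P x} \<and>
     bij_betw (\<lambda>i. mem s' (j * G + i)) {..<card {x. x < n \<and> P x}} {x. x < n \<and> P x} \<and> mem_frame G j s s')"
  unfolding Filter_def
proof (rule ST_Seq[where \<tau>a = 1 and \<sigma>a = 0 and \<tau>b = "n * (\<tau> + 8) + 3" and \<sigma>b = 0 and Sm = "\<lambda>s'. s' = set_reg E l 0 s"])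
  fix s0 assume s0: "s0 = set_reg E l 0 s"
  let ?b = "Seq c (If e (Seq (Put j (Reg l) (Reg ''x'')) (Incr l)) Skip)"
  let ?I = "\<lambda>i s'. regs s' l = card {x. x < i \<and> P x} \<and>
     bij_betw (\<lambda>i. mem s' (j * G + i)) {..<card {x. x < i \<and> P x}} {x. x < i \<and> P x} \<and> mem_frame G j s s'"
  show "ST E (For ''x'' (Reg ''n'') ?b) s0 (n * (\<tau> + 8) + 3) 0 (?I n)"
  proof (rule ST_For[where N = n and \<tau> = "\<tau> + 5" and \<sigma> = 0 and Inv = ?I])
    fix i and t :: state assume t: "i < n" "?I i t" "regs t ''x'' = i"
      "\<forall>x. x \<noteq> ''x'' \<longrightarrow> x \<notin> mods ?b \<longrightarrow> regs t x = regs s0 x"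
    have tc: "ST E c t \<tau> 0 (\<lambda>s''. (eval E s'' e \<noteq> 0) = P i)"
      using t s0 by (intro test) auto
    show "ST E ?b t (\<tau> + 5) 0 (\<lambda>s''. ?I (Suc i) (set_reg E ''x'' (Suc i) s''))"
    proof (rule ST_Seq[OF tc, where \<tau>b = 4 and \<sigma>b = 0])
      fix t1 assume t1: "(eval E t1 e \<noteq> 0) = P i" "\<forall>x. x \<notin> mods c \<longrightarrow> regs t1 x = regs t x"
        "\<not> stores c \<longrightarrow> mem t1 = mem t"
      have r: "regs t1 ''G'' = G" "regs t1 l = card {x. x < i \<and> P x}" "regs t1 ''x'' = i" "mem t1 = mem t"
        using t1 t s0 G l c by auto
      have lt: "card {x. x < i \<and> P x} < G" using card_less_le[of i P] t(1) n by linarith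
      let ?k = "card {x. x < i \<and> P x}"
      let ?t2 = "t1\<lparr>mem := (mem t1)(j * G + ?k := i)\<rparr>"
      show "ST E (If e (Seq (Put j (Reg l) (Reg ''x'')) (Incr l)) Skip) t1 4 0
        (\<lambda>s''. ?I (Suc i) (set_reg E ''x'' (Suc i) s''))"
      proof (rule HT_If[where \<tau>a = 3])
        assume "eval E t1 e \<noteq> 0"
        then have Pi: "P i" using t1 by simp
        show "ST E (Seq (Put j (Reg l) (Reg ''x'')) (Incr l)) t1 3 0 (\<lambda>s''. ?I (Suc i) (set_reg E ''x'' (Suc i) s''))"
        proof (rule ST_Seq[OF ST_Put[where S = "\<lambda>s'. s' = ?t2" and i = ?k and \<tau> = 1 and \<sigma> = 0],
                where \<tau>b = 1 and \<sigma>b = 0])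
          fix t2 assume t2: "t2 = ?t2"
          have set_eq: "{x. x < Suc i \<and> P x} = insert i {x. x < i \<and> P x}" using Pi by (auto simp: less_Suc_eq)
          have b: "bij_betw (\<lambda>i. mem t (j * G + i)) {..<?k} {x. x < i \<and> P x}" using t(2) by simp
          have "bij_betw (\<lambda>i. mem t2 (j * G + i)) {..<?k} {x. x < i \<and> P x}"
            by (rule bij_betw_cong[THEN iffD1, OF _ b]) (use t2 r in auto)
          then have b': "bij_betw (\<lambda>i. mem t2 (j * G + i)) (insert ?k {..<?k}) (insert i {x. x < i \<and> P x})"
            using notIn_Un_bij_betw[of ?k "{..<?k}" "\<lambda>i. mem t2 (j * G + i)" "{x. x < i \<and> P x}"] by (simp add: t2)
          have f: "mem_frame G j s t2" 
            unfolding t2 by (rule mem_frame_upd) (use lt t(2) r(4) in \<open>auto simp: mem_frame_def\<close>)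
          show "ST E (Incr l) t2 1 0 (\<lambda>s''. ?I (Suc i) (set_reg E ''x'' (Suc i) s''))"
            by (rule ST_Incr) (use t2 r lt l b' f Pi in \<open>auto simp: card_less_Suc to_word_small set_eq lessThan_Suc\<close>)
        qed (use r lt j in auto)
      next
        assume "eval E t1 e = 0"
        then have "\<not> P i" using t1 by simp
        then have "{x. x < Suc i \<and> P x} = {x. x < i \<and> P x}" by (auto simp: less_Suc_eq)
        then show "ST E Skip t1 3 0 (\<lambda>s''. ?I (Suc i) (set_reg E ''x'' (Suc i) s''))"
          using t r l by (intro HT_Skip) (auto simp: mem_frame_def)
      qed auto
    qed auto
  qed (use s0 n l c G \<tau> in \<open>auto simp: algebra_simps bij_betw_def\<close>)
qed (use \<tau> in \<open>auto intro!: HT_Assign\<close>)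

lemma uniform_map_bij:
  assumes "bij_betw f {..<l::nat} U" "0 < l"
  shows "map_pmf f (pmf_of_set {..<l}) = pmf_of_set U"
  using assms by (intro map_pmf_of_set_bij_betw) auto

text \<open>The draws are made one at a time, with other steps in between, but the event
  \<open>Ev\<close> refers to the product distribution. The link is a martingale: the probability
  that \<open>Ev\<close> fails, conditioned on the cells filled so far, is preserved in expectation
  by each round and is an indicator at the end.\<close>

lemma HT_Sample:
  fixes \<delta> :: real
  assumes G: "regs s ''G'' = G" and j: "jd < 10" "js < 10" "jd \<noteq> js"
    and l: "regs s lr = l" "0 < l" "l \<le> G" "lr \<notin> {''i'', ''p''}"
    and N: "regs s Nr = N" "N \<le> G" "Nr \<notin> {''i'', ''p''}"
    and U: "bij_betw (\<lambda>i. mem s (js * G + i)) {..<l} U"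
    and Ev: "measure_pmf.prob (Pi_pmf {..<N} 0 (\<lambda>_. pmf_of_set U)) {\<omega>. \<not> Ev \<omega>} \<le> \<delta>"
    and \<tau>: "N * 6 + 3 \<le> \<tau>"
  shows "HT E (Sample jd js lr Nr) s \<tau> \<sigma> \<delta> (\<lambda>s'. (\<forall>i<N. mem s' (jd * G + i) \<in> U) \<and> mem_frame G jd s s')
     (\<lambda>s'. Ev (\<lambda>i. if i < N then mem s' (jd * G + i) else 0))"
proof -
  \<comment> \<open>The first \<open>i\<close> values are read from memory and the remaining ones
    from an ideal sample; \<open>?pr i\<close> is the resulting conditional failure
    probability.\<close>
  let ?cont = "\<lambda>i s' \<omega> i'. if i' < i then mem s' (jd * G + i') else \<omega> i'"
  let ?pr = "\<lambda>i s'. emeasure (measure_pmf (Pi_pmf {i..<N} 0 (\<lambda>_. pmf_of_set U))) {\<omega>. \<not> Ev (?cont i s' \<omega>)}"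
  let ?b = "Seq (Rand ''p'' (Reg lr)) (Put jd (Reg ''i'') (Ar js (Reg ''p'')))"
  let ?W = "While (Less (Reg ''i'') (Reg Nr)) (Seq ?b (Assign ''i'' (Add (Reg ''i'') (Const 1))))"
  let ?J = "\<lambda>i s'. (\<forall>i'<i. mem s' (jd * G + i') \<in> U) \<and> mem_frame G jd s s' \<and> regs s' ''i'' = i \<and>
       (\<forall>x. x \<notin> {''i'', ''p''} \<longrightarrow> regs s' x = regs s x)"
  have loop: "HTe E ?W s' (Suc ((N - i) * 6)) 0 (?pr i s') (?J N)
     (\<lambda>s''. of_bool (\<not> Ev (\<lambda>i. if i < N then mem s'' (jd * G + i) else 0)))"
    if "i \<le> N" "?J i s'" for i s'
    using that
  proof (induction "N - i" arbitrary: i s')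
    case 0
    then have "i = N" by simp
    then have "regs s' ''i'' = N" "regs s' Nr = N" "{i..<N} = {}" using 0 N by auto
    then show ?case using 0 \<open>i = N\<close> by (intro HTe_det[of _ _ _ s']) (simp_all add: indicator_def)
  next
    case (Suc m)
    then have i: "i < N" "m = N - Suc i" and Nm: "N - i = Suc m" by auto
    have r: "regs s' ''G'' = G" "regs s' lr = l" "regs s' ''i'' = i" "regs s' Nr = N"
      using Suc.prems G l N by auto
    have src: "mem s' (js * G + p) = mem s (js * G + p)" if "p < l" for p
      using Suc.prems j l that by (auto intro: mem_frameD)
    define nx where "nx = (\<lambda>v. (set_reg E ''i'' (Suc i) (set_reg E ''p'' v s'))\<lparr>mem := (mem s')(jd * G + i := mem s (js * G + v))\<rparr>)"
    have fr: "mem_frame G jd s (nx v)" for v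
      unfolding nx_def using mem_frame_upd[of i G jd s s' "mem s (js * G + v)"] Suc.prems i N by (auto simp: mem_frame_def)
    have J: "?J (Suc i) (nx v)" if v: "v < l" for v
    proof -
      have "mem s (js * G + v) \<in> U" using U v by (auto simp: bij_betw_def)
      moreover have "Suc i \<le> 16 * G" using i N by simp
      ultimately show ?thesis
        using Suc.prems(2) fr[of v] by (simp add: nx_def less_Suc_eq to_word_small)
    qed
    have split: "{i..<N} = insert i {Suc i..<N}" using i by auto
    \<comment> \<open>One round preserves the conditional failure probability:
      \<open>Pi_pmf_insert\<close> splits off coordinate \<open>i\<close> of the ideal sample, and
      \<open>uniform_map_bij\<close> replaces it by a uniform index into the source array.\<close>
    have pr: "(\<integral>\<^sup>+v. ?pr (Suc i) (nx v) \<partial>pmf_of_set {..<l}) = ?pr i s'"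
    proof -
      let ?R = "Pi_pmf {Suc i..<N} 0 (\<lambda>_. pmf_of_set U)"
      have "?pr i s' = (\<integral>\<^sup>+\<omega>. indicator {\<omega>. \<not> Ev (?cont i s' \<omega>)} \<omega> \<partial>Pi_pmf {i..<N} 0 (\<lambda>_. pmf_of_set U))"
        by simp
      also have "\<dots> = (\<integral>\<^sup>+y. (\<integral>\<^sup>+\<omega>. indicator {\<omega>. \<not> Ev (?cont i s' \<omega>)} (fun_upd \<omega> i y) \<partial>?R) \<partial>pmf_of_set U)"
        unfolding split by (subst Pi_pmf_insert) (auto simp: nn_integral_pair_pmf' case_prod_unfold)
      also have "\<dots> = (\<integral>\<^sup>+v. (\<integral>\<^sup>+\<omega>. indicator {\<omega>. \<not> Ev (?cont i s' \<omega>)} (fun_upd \<omega> i (mem s (js * G + v))) \<partial>?R) \<partial>pmf_of_set {..<l})"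
        unfolding uniform_map_bij[OF U l(2), symmetric] by simp
      also have "\<dots> = (\<integral>\<^sup>+v. ?pr (Suc i) (nx v) \<partial>pmf_of_set {..<l})"
      proof (intro nn_integral_cong)
        fix v
        have "?cont i s' (fun_upd \<omega> i (mem s (js * G + v))) = ?cont (Suc i) (nx v) \<omega>" for \<omega>
          by (auto simp: fun_eq_iff nx_def)
        then have "(\<integral>\<^sup>+\<omega>. indicator {\<omega>. \<not> Ev (?cont i s' \<omega>)} (fun_upd \<omega> i (mem s (js * G + v))) \<partial>?R) =
            (\<integral>\<^sup>+\<omega>. indicator {\<omega>. \<not> Ev (?cont (Suc i) (nx v) \<omega>)} \<omega> \<partial>?R)"
          by (intro nn_integral_cong) (simp add: indicator_def)
        then show "(\<integral>\<^sup>+\<omega>. indicator {\<omega>. \<not> Ev (?cont i s' \<omega>)} (fun_upd \<omega> i (mem s (js * G + v))) \<partial>?R) = ?pr (Suc i) (nx v)"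
          by simp
      qed
      finally show ?thesis by simp
    qed
    have 1: "HTe E (Rand ''p'' (Reg lr)) s' 1 0 (?pr i s') (\<lambda>t. \<exists>v<l. t = set_reg E ''p'' v s') (\<lambda>t. ?pr (Suc i) (nx (regs t ''p'')))"
    proof (rule HTe_Rand)
      have "(\<integral>\<^sup>+v. ?pr (Suc i) (nx (regs (set_reg E ''p'' v s') ''p'')) \<partial>pmf_of_set {..<l}) = (\<integral>\<^sup>+v. ?pr (Suc i) (nx v) \<partial>pmf_of_set {..<l})"
      proof (intro nn_integral_cong_AE AE_pmfI)
        fix v assume "v \<in> set_pmf (pmf_of_set {..<l})"
        then have "regs (set_reg E ''p'' v s') ''p'' = v"
          using l by (simp add: set_pmf_of_set lessThan_empty_iff to_word_small)
        then show "?pr (Suc i) (nx (regs (set_reg E ''p'' v s') ''p'')) = ?pr (Suc i) (nx v)"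
          by (rule arg_cong[where f = "\<lambda>z. ?pr (Suc i) (nx z)"])
      qed
      then show "(\<integral>\<^sup>+v. ?pr (Suc i) (nx (regs (set_reg E ''p'' v s') ''p'')) \<partial>pmf_of_set {..<eval E s' (Reg lr)}) \<le> ?pr i s'"
        using pr r by simp
    qed (use r l in auto)
    have 2: "HTe E ?b s' 3 0 (?pr i s') (\<lambda>t. \<exists>v<l. set_reg E ''i'' (Suc i) t = nx v \<and> regs t ''i'' = i) (\<lambda>t. ?pr (Suc i) (set_reg E ''i'' (Suc i) t))"
    proof (rule HTe_Seq[OF 1, where \<tau>b = 1 and \<sigma>b = 0])
      fix t assume "\<exists>v<l. t = set_reg E ''p'' v s'"
      then obtain v where v: "v < l" "t = set_reg E ''p'' v s'" by blast
      have rt: "regs t ''G'' = G" "regs t ''p'' = v" "regs t ''i'' = i" using v r l by (auto simp: to_word_small)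
      let ?t = "t\<lparr>mem := (mem t)(jd * G + i := mem s (js * G + v))\<rparr>"
      have a1: "eval E t (Add (Mul (Const jd) (Reg ''G'')) (Reg ''i'')) = jd * G + i"
        by (rule eval_addr) (use rt j i N in auto)
      have a2: "eval E t (Ar js (Reg ''p'')) = mem s (js * G + v)"
        by (subst eval_Ar[where i = v]) (use rt j v l src in auto)
      have nx: "set_reg E ''i'' (Suc i) ?t = nx v" unfolding nx_def v(2) by (simp add: set_reg_def)
      show "HTe E (Put jd (Reg ''i'') (Ar js (Reg ''p''))) t 1 0 (?pr (Suc i) (nx (regs t ''p'')))
         (\<lambda>t. \<exists>v<l. set_reg E ''i'' (Suc i) t = nx v \<and> regs t ''i'' = i) (\<lambda>t. ?pr (Suc i) (set_reg E ''i'' (Suc i) t))"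
        unfolding Put_def by (rule HTe_det[where s' = ?t]) (use v(1) in \<open>simp_all add: a1 a2 nx rt del: eval.simps cong del: if_weak_cong, blast?\<close>)
    qed auto
    have 3: "HTe E (Seq ?b (Assign ''i'' (Add (Reg ''i'') (Const 1)))) s' 5 0 (?pr i s') (\<lambda>t. \<exists>v<l. t = nx v) (?pr (Suc i))"
    proof (rule HTe_Seq[OF 2, where \<tau>b = 1 and \<sigma>b = 0])
      fix t assume t: "\<exists>v<l. set_reg E ''i'' (Suc i) t = nx v \<and> regs t ''i'' = i"
      have "eval E t (Add (Reg ''i'') (Const 1)) = Suc i" using t i N by (auto simp: to_word_small)
      then show "HTe E (Assign ''i'' (Add (Reg ''i'') (Const 1))) t 1 0 (?pr (Suc i) (set_reg E ''i'' (Suc i) t)) (\<lambda>t. \<exists>v<l. t = nx v) (?pr (Suc i))"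
        using t by (intro HTe_det[where s' = "set_reg E ''i'' (Suc i) t"]) (auto simp del: eval.simps)
    qed auto
    show ?case
    proof (rule HTe_unfold_seq[OF _ 3, where \<tau>b = "Suc (m * 6)" and \<sigma>b = 0])
      show "step E (?W # cs, s') = return_pmf (Seq ?b (Assign ''i'' (Add (Reg ''i'') (Const 1))) # ?W # cs, s')" for cs
        using r i by (simp add: to_word_small)
    next
      fix t assume "\<exists>v<l. t = nx v"
      then obtain v where v: "v < l" "t = nx v" by blast
      show "HTe E ?W t (Suc (m * 6)) 0 (?pr (Suc i) t) (?J N)
        (\<lambda>s''. of_bool (\<not> Ev (\<lambda>i. if i < N then mem s'' (jd * G + i) else 0)))"
        using Suc.hyps(1)[OF i(2) Suc_leI[OF i(1)] J[OF v(1)]] unfolding i(2)[symmetric] v(2) .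
    qed (simp_all add: Nm)
  qed
  have d0: "0 \<le> \<delta>" using Ev measure_nonneg order_trans by blast
  have "{0..<N} = {..<N}" by auto
  then have "?pr 0 (set_reg E ''i'' 0 s) \<le> ennreal \<delta>"
    using Ev d0 by (simp add: measure_pmf.emeasure_eq_measure ennreal_leI)
  moreover have "HTe E (Sample jd js lr Nr) s \<tau> \<sigma> (?pr 0 (set_reg E ''i'' 0 s)) (?J N)
     (\<lambda>s''. of_bool (\<not> Ev (\<lambda>i. if i < N then mem s'' (jd * G + i) else 0)))"
    unfolding Sample_def For_def
  proof (rule HTe_Seq[where \<tau>a = 1 and \<sigma>a = 0 and \<tau>b = "Suc (N * 6)" and \<sigma>b = 0 and Sm = "\<lambda>t. t = set_reg E ''i'' 0 s" and f = "?pr 0"])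
    fix t assume "t = set_reg E ''i'' 0 s"
    then show "HTe E ?W t (Suc (N * 6)) 0 (?pr 0 t) (?J N) (\<lambda>s''. of_bool (\<not> Ev (\<lambda>i. if i < N then mem s'' (jd * G + i) else 0)))"
      using loop[of 0 t] by simp
  next
    show "HTe E (Assign ''i'' (Const 0)) s 1 0 (?pr 0 (set_reg E ''i'' 0 s)) (\<lambda>t. t = set_reg E ''i'' 0 s) (?pr 0)"
      by (rule HTe_det[where s' = "set_reg E ''i'' 0 s"]) simp_all
  qed (use \<tau> in simp_all)
  ultimately have fin: "HTe E (Sample jd js lr Nr) s \<tau> \<sigma> (ennreal \<delta>) (?J N)
     (\<lambda>s''. of_bool (\<not> Ev (\<lambda>i. if i < N then mem s'' (jd * G + i) else 0)))"
    by (rule HTe_mono[rotated])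
  show ?thesis
    by (rule HT_conseq[OF HT_of_HTe[OF fin d0]]) simp_all
qed

end

section \<open>The components of a clustering step\<close>

definition mem_frames :: "nat \<Rightarrow> nat set \<Rightarrow> state \<Rightarrow> state \<Rightarrow> bool" where
  "mem_frames G J s s' \<longleftrightarrow> (\<forall>a. (\<forall>j\<in>J. a \<notin> block G j) \<longrightarrow> mem s' a = mem s a)"

lemma mem_framesI: "mem_frame G j s s' \<Longrightarrow> j \<in> J \<Longrightarrow> mem_frames G J s s'"
  by (auto simp: mem_frames_def mem_frame_def)

lemma mem_framesD: "mem_frames G J s s' \<Longrightarrow> i < G \<Longrightarrow> j \<notin> J \<Longrightarrow> mem s' (j * G + i) = mem s (j * G + i)"
  unfolding mem_frames_def by (drule spec[of _ "j * G + i"]) (auto simp: in_block_iff)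

lemma mem_frames_trans: "mem_frames G J s s' \<Longrightarrow> mem_frames G J' s' s'' \<Longrightarrow> J \<subseteq> K \<Longrightarrow> J' \<subseteq> K \<Longrightarrow> mem_frames G K s s''"
  by (fastforce simp: mem_frames_def)

section \<open>Subprograms of a clustering step and their sure specifications\<close>

definition Dists :: "strong_mode \<Rightarrow> com" where
  "Dists mode = For ''i'' (Reg ''tl'')
     (Seq (Dist mode ''dd'' (Reg ''t'') (Ar 5 (Reg ''i''))) (Put 6 (Reg ''i'') (Reg ''dd'')))"

definition Count :: com where
  "Count = Seq (Assign ''cnt'' (Const 0))
     (For ''vi'' (Reg ''tl'') (If (Less (Ar 6 (Reg ''i'')) (Ar 6 (Reg ''vi''))) Skip (Incr ''cnt'')))"

definition Update :: com where
  "Update = Seq (Assign ''br'' (Ar 6 (Reg ''i''))) (Seq (Assign ''bt'' (Reg ''t'')) (Assign ''bf'' (Const 1)))"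

definition Rank :: com where
  "Rank = For ''i'' (Reg ''tl'')
     (Seq Count (If (Less (Reg ''cnt'') (Reg ''h'')) Skip
       (If (Add (Less (Ar 6 (Reg ''i'')) (Reg ''br'')) (Eql (Reg ''bf'') (Const 0))) Update Skip)))"

text \<open>Only the first \<open>h\<close> samples are tried as centres, although all samples count
  as members of a ball. Some core containing a constant fraction of good centres makes
  \<open>h\<close> trials enough, and a step then costs of order \<open>h * N\<close> strong queries
  rather than \<open>N * N\<close>.\<close>

definition Best :: "strong_mode \<Rightarrow> com" where
  "Best mode = For ''c'' (Reg ''h'') (Seq (Assign ''t'' (Ar 3 (Reg ''c''))) (Seq (Dists mode) Rank))"

text \<open>Collecting stops at \<open>h\<close> entries because the vote is analysed for sets of
  exactly \<open>h\<close> voters.\<close>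

definition Collect_ball :: com where
  "Collect_ball = Seq (Assign ''bl'' (Const 0)) (For ''i'' (Reg ''tl'')
     (If (Less (Reg ''br'') (Ar 6 (Reg ''i''))) Skip
       (If (Less (Reg ''bl'') (Reg ''h'')) (Seq (Put 7 (Reg ''bl'') (Ar 5 (Reg ''i''))) (Incr ''bl'')) Skip)))"

definition Scale :: com where
  "Scale = Seq (Assign ''thr'' (Mul (Mul (Const 2) (Add (Reg ''j'') (Const 1))) (Reg ''br'')))
     (Seq (Filter 8 ''zl'' (Vote 7 ''bl'') (Less (Reg ''bl'') (Add (Reg ''cnt'') (Reg ''cnt''))))
       (If (Less (Mul (Const 11) (Reg ''prev'')) (Mul (Const 10) (Reg ''zl'')))
         (Assign ''prev'' (Reg ''zl'')) (Assign ''done'' (Const 1))))"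

definition Scales :: com where
  "Scales = For ''j'' (Reg ''h'') (If (Reg ''done'') Skip Scale)"

definition Clear :: com where
  "Clear = For ''x'' (Reg ''n'') (Put 4 (Reg ''x'') (Const 0))"

definition Mark :: com where
  "Mark = For ''i'' (Reg ''N'') (Put 4 (Ar 3 (Reg ''i'')) (Const 1))"

definition Absorb :: com where
  "Absorb = For ''x'' (Reg ''n'') (If (Ar 1 (Reg ''x'')) Skip
     (Seq (Vote 9 ''h'') (If (Less (Reg ''h'') (Add (Reg ''cnt'') (Reg ''cnt''))) (Put 1 (Reg ''x'') (Reg ''ncl'')) Skip)))"

lemma mods_parts [simp]:
  "mods (Dists mode) = {''i'', ''dd''}" "mods Count = {''cnt'', ''vi''}" "mods Update = {''br'', ''bt'', ''bf''}"
  "mods Rank = {''i'', ''cnt'', ''vi'', ''br'', ''bt'', ''bf''}"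
  "mods (Best mode) = {''c'', ''t'', ''i'', ''dd'', ''cnt'', ''vi'', ''br'', ''bt'', ''bf''}"
  "mods Collect_ball = {''bl'', ''i''}"
  "mods Scale = {''thr'', ''zl'', ''x'', ''cnt'', ''vi'', ''w'', ''prev'', ''done''}"
  "mods Scales = {''j'', ''thr'', ''zl'', ''x'', ''cnt'', ''vi'', ''w'', ''prev'', ''done''}"
  "mods Clear = {''x''}" "mods Mark = {''i''}" "mods Absorb = {''x'', ''cnt'', ''vi'', ''w''}"
  unfolding Dists_def Count_def Update_def Rank_def Best_def Collect_ball_def Scale_def Scales_def Clear_def Mark_def Absorb_def
  by auto

lemma stores_parts [simp]:
  "stores (Dists mode)" "\<not> stores Count" "\<not> stores Update" "\<not> stores Rank" "stores (Best mode)" "stores Collect_ball"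
  "stores Scale" "stores Scales" "stores Clear" "stores Mark" "stores Absorb"
  unfolding Dists_def Count_def Update_def Rank_def Best_def Collect_ball_def Scale_def Scales_def Clear_def Mark_def Absorb_def
  by auto

text \<open>A running minimum over the pairs examined so far (centre index, sample index). The
  clause for \<open>bf = 0\<close> keeps \<open>bt\<close> a legal point and \<open>br\<close> small
  when no pair qualifies, so the sure bounds survive an unlucky sample.\<close>

definition best_inv :: "(nat \<times> nat \<Rightarrow> bool) \<Rightarrow> (nat \<times> nat \<Rightarrow> nat) \<Rightarrow> (nat \<Rightarrow> nat) \<Rightarrow> (nat \<times> nat) set \<Rightarrow> state \<Rightarrow> bool" where
  "best_inv ok val cand A s \<longleftrightarrow>
     (regs s ''bf'' = 0 \<longrightarrow> regs s ''br'' = 0 \<and> regs s ''bt'' = 0) \<and>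
     (regs s ''bf'' \<noteq> 0 \<longrightarrow> (\<exists>q\<in>A. ok q \<and> regs s ''br'' = val q \<and> regs s ''bt'' = cand (fst q))) \<and>
     (\<forall>q\<in>A. ok q \<longrightarrow> regs s ''bf'' \<noteq> 0 \<and> regs s ''br'' \<le> val q)"

lemma best_inv_cong:
  assumes "best_inv ok val cand A s" "regs s' ''bf'' = regs s ''bf''" "regs s' ''br'' = regs s ''br''" "regs s' ''bt'' = regs s ''bt''"
  shows "best_inv ok val cand A s'"
  using assms(1) unfolding best_inv_def by (simp add: assms(2-4))

lemma best_inv_skip:
  assumes "best_inv ok val cand A s" "ok q \<Longrightarrow> regs s ''bf'' \<noteq> 0 \<and> regs s ''br'' \<le> val q"
  shows "best_inv ok val cand (insert q A) s"
  using assms unfolding best_inv_def by blast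

lemma best_inv_update:
  assumes "best_inv ok val cand A s" "ok q" "val q < regs s ''br'' \<or> regs s ''bf'' = 0"
    "regs s' ''br'' = val q" "regs s' ''bt'' = cand (fst q)" "regs s' ''bf'' = 1"
  shows "best_inv ok val cand (insert q A) s'"
  using assms unfolding best_inv_def by fastforce

lemma to_word_idem [simp]: "to_word E (to_word E v) = to_word E v"
  by (simp add: to_word_def)

context machine
begin

lemma ST_Dists:
  assumes G: "regs s ''G'' = G" and N: "regs s ''tl'' = N" "N \<le> G" and \<tau>: "N * 10 + 3 \<le> \<tau>" and \<sigma>: "N * 2 \<le> \<sigma>"
  shows "ST E (Dists mode) s \<tau> \<sigma> (\<lambda>s'. (\<forall>i<N. mem s' (6 * G + i) = td (regs s ''t'') (mem s (5 * G + i))) \<and> mem_frame G 6 s s')"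
  unfolding Dists_def
proof (rule ST_For[where N = N and \<tau> = 7 and \<sigma> = 2
      and Inv = "\<lambda>k s'. (\<forall>i<k. mem s' (6 * G + i) = td (regs s ''t'') (mem s (5 * G + i))) \<and> mem_frame G 6 s s'"])
  fix i and t :: state
  let ?b = "Seq (Dist mode ''dd'' (Reg ''t'') (Ar 5 (Reg ''i''))) (Put 6 (Reg ''i'') (Reg ''dd''))"
  assume t: "i < N" "(\<forall>i'<i. mem t (6 * G + i') = td (regs s ''t'') (mem s (5 * G + i'))) \<and> mem_frame G 6 s t"
    "regs t ''i'' = i" "\<forall>x. x \<noteq> ''i'' \<longrightarrow> x \<notin> mods ?b \<longrightarrow> regs t x = regs s x"
  have r: "regs t ''G'' = G" "regs t ''t'' = regs s ''t''" using t(4) G by auto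
  have ar: "eval E t (Ar 5 (Reg ''i'')) = mem s (5 * G + i)"
    using eval_Ar[OF r(1), of 5 "Reg ''i''" i] t N mem_frameD[of G 6 s t i 5] by simp
  show "ST E ?b t 7 2 (\<lambda>s''. (\<forall>i'<Suc i. mem (set_reg E ''i'' (Suc i) s'') (6 * G + i') = td (regs s ''t'') (mem s (5 * G + i')))
      \<and> mem_frame G 6 s (set_reg E ''i'' (Suc i) s''))"
  proof (rule ST_Seq[OF ST_Dist[of 5 2], where \<tau>b = 1 and \<sigma>b = 0])
    fix t1 :: state assume t1: "regs t1 ''dd'' = td (eval E t (Reg ''t'')) (eval E t (Ar 5 (Reg ''i'')))"
      "\<forall>x. x \<notin> mods (Dist mode ''dd'' (Reg ''t'') (Ar 5 (Reg ''i''))) \<longrightarrow> regs t1 x = regs t x"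
      "\<not> stores (Dist mode ''dd'' (Reg ''t'') (Ar 5 (Reg ''i''))) \<longrightarrow> mem t1 = mem t"
    have r1: "regs t1 ''G'' = G" "regs t1 ''i'' = i" "regs t1 ''dd'' = td (regs s ''t'') (mem s (5 * G + i))" "mem t1 = mem t"
      using t1 r ar t(3) by auto
    have f: "mem_frame G 6 s (t1\<lparr>mem := (mem t1)(6 * G + i := v)\<rparr>)" for v
      using mem_frame_upd[of i G 6 s t1 v] t N r1(4) by (simp add: mem_frame_def)
    show "ST E (Put 6 (Reg ''i'') (Reg ''dd'')) t1 1 0 (\<lambda>s''. (\<forall>i'<Suc i. mem (set_reg E ''i'' (Suc i) s'') (6 * G + i') = td (regs s ''t'') (mem s (5 * G + i')))
      \<and> mem_frame G 6 s (set_reg E ''i'' (Suc i) s''))"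
      by (rule ST_Put[where i = i]) (use r1 t N f in \<open>simp_all add: less_Suc_eq\<close>)
  qed simp_all
qed (use G N \<tau> \<sigma> in simp_all)

lemma ST_Count:
  assumes G: "regs s ''G'' = G" and N: "regs s ''tl'' = N" "N \<le> G" and i: "regs s ''i'' = i" "i < N" and \<tau>: "N * 5 + 5 \<le> \<tau>"
  shows "ST E Count s \<tau> \<sigma> (\<lambda>s'. regs s' ''cnt'' = card {i'. i' < N \<and> mem s (6 * G + i') \<le> mem s (6 * G + i)})"
  unfolding Count_def
proof (rule ST_Seq[where \<tau>a = 1 and \<sigma>a = 0 and \<tau>b = "N * 5 + 3" and \<sigma>b = 0 and Sm = "\<lambda>s'. s' = set_reg E ''cnt'' 0 s"])
  fix s0 :: state assume s0: "s0 = set_reg E ''cnt'' 0 s"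
  let ?P = "\<lambda>i'. mem s (6 * G + i') \<le> mem s (6 * G + i)"
  let ?b = "If (Less (Ar 6 (Reg ''i'')) (Ar 6 (Reg ''vi''))) Skip (Incr ''cnt'')"
  show "ST E (For ''vi'' (Reg ''tl'') ?b) s0 (N * 5 + 3) 0 (\<lambda>s'. regs s' ''cnt'' = card {i'. i' < N \<and> ?P i'})"
  proof (rule ST_For[where N = N and \<tau> = 2 and \<sigma> = 0 and Inv = "\<lambda>k s'. regs s' ''cnt'' = card {i'. i' < k \<and> ?P i'}"])
    fix k and t :: state assume t: "k < N" "regs t ''cnt'' = card {i'. i' < k \<and> ?P i'}" "regs t ''vi'' = k"
      "\<forall>x. x \<noteq> ''vi'' \<longrightarrow> x \<notin> mods ?b \<longrightarrow> regs t x = regs s0 x" "\<not> stores ?b \<longrightarrow> mem t = mem s0"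
    have r: "regs t ''G'' = G" "regs t ''i'' = i" "mem t = mem s"
      using t(4,5) s0 G i by auto
    have ar: "eval E t (Ar 6 (Reg ''vi'')) = mem s (6 * G + k)" "eval E t (Ar 6 (Reg ''i'')) = mem s (6 * G + i)"
      using eval_Ar[OF r(1), of 6 "Reg ''vi''" k] eval_Ar[OF r(1), of 6 "Reg ''i''" i] t(1,3) N r i by simp_all
    have cle: "card {i'. i' < k \<and> ?P i'} < 16 * G" using card_less_le[of k ?P] t(1) N by linarith
    show "ST E ?b t 2 0 (\<lambda>s''. regs (set_reg E ''vi'' (Suc k) s'') ''cnt'' = card {i'. i' < Suc k \<and> ?P i'})"
    proof (rule HT_If[where \<tau>a = 1])
      assume "eval E t (Less (Ar 6 (Reg ''i'')) (Ar 6 (Reg ''vi''))) \<noteq> 0"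
      then have "\<not> ?P k" using ar by simp
      then show "ST E Skip t 1 0 (\<lambda>s''. regs (set_reg E ''vi'' (Suc k) s'') ''cnt'' = card {i'. i' < Suc k \<and> ?P i'})"
        by (intro HT_Skip) (simp_all add: t(2) card_less_Suc)
    next
      assume "eval E t (Less (Ar 6 (Reg ''i'')) (Ar 6 (Reg ''vi''))) = 0"
      then have "?P k" using ar by simp
      then show "ST E (Incr ''cnt'') t 1 0 (\<lambda>s''. regs (set_reg E ''vi'' (Suc k) s'') ''cnt'' = card {i'. i' < Suc k \<and> ?P i'})"
        using cle by (intro ST_Incr) (simp_all add: t(2) card_less_Suc to_word_small)
    qed simp
  qed (use s0 N in simp_all)
qed (use \<tau> in \<open>simp_all add: HT_Assign\<close>)

lemma ST_Rank:
  assumes G: "regs s ''G'' = G" and N: "regs s ''tl'' = N" "N \<le> G" and t: "regs s ''t'' = cand c" "cand c \<le> G"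
    and val: "\<And>i. i < N \<Longrightarrow> mem s (6 * G + i) = val (c, i)" "\<And>i. i < N \<Longrightarrow> to_word E (val (c, i)) = val (c, i)"
    and ok: "\<And>i. ok (c, i) \<longleftrightarrow> regs s ''h'' \<le> card {i'. i' < N \<and> val (c, i') \<le> val (c, i)}"
    and bi: "best_inv ok val cand A s" and \<tau>: "N * (N * 5 + 16) + 3 \<le> \<tau>"
  shows "ST E Rank s \<tau> \<sigma> (\<lambda>s'. best_inv ok val cand (A \<union> {c} \<times> {..<N}) s')"
  unfolding Rank_def
proof (rule ST_For[where N = N and \<tau> = "N * 5 + 13" and \<sigma> = 0 and Inv = "\<lambda>k s'. best_inv ok val cand (A \<union> {c} \<times> {..<k}) s'"])
  fix i and t :: state
  let ?u = "If (Add (Less (Ar 6 (Reg ''i'')) (Reg ''br'')) (Eql (Reg ''bf'') (Const 0))) Update Skip"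
  let ?b = "Seq Count (If (Less (Reg ''cnt'') (Reg ''h'')) Skip ?u)"
  assume t: "i < N" "best_inv ok val cand (A \<union> {c} \<times> {..<i}) t"
    "regs t ''i'' = i" "\<forall>x. x \<noteq> ''i'' \<longrightarrow> x \<notin> mods ?b \<longrightarrow> regs t x = regs s x" "\<not> stores ?b \<longrightarrow> mem t = mem s"
  have r: "regs t ''G'' = G" "regs t ''tl'' = N" "regs t ''t'' = cand c" "regs t ''h'' = regs s ''h''" "mem t = mem s"
    using t(4,5) assms by auto
  have set_eq: "A \<union> {c} \<times> {..<Suc i} = insert (c, i) (A \<union> {c} \<times> {..<i})" by auto
  have ce: "{i'. i' < N \<and> mem t (6 * G + i') \<le> mem t (6 * G + i)} = {i'. i' < N \<and> val (c, i') \<le> val (c, i)}"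
    using t(1) by (simp add: val(1) r cong: conj_cong)
  show "ST E ?b t (N * 5 + 13) 0 (\<lambda>s''. best_inv ok val cand (A \<union> {c} \<times> {..<Suc i}) (set_reg E ''i'' (Suc i) s''))"
  proof (rule ST_Seq[OF ST_Count[OF r(1) r(2) N(2) t(3,1) order_refl], where \<tau>b = 7 and \<sigma>b = 0])
    fix t1 :: state assume t1: "regs t1 ''cnt'' = card {i'. i' < N \<and> mem t (6 * G + i') \<le> mem t (6 * G + i)}"
      "\<forall>x. x \<notin> mods Count \<longrightarrow> regs t1 x = regs t x" "\<not> stores Count \<longrightarrow> mem t1 = mem t"
    have r1: "regs t1 ''G'' = G" "regs t1 ''t'' = cand c" "regs t1 ''h'' = regs s ''h''" "mem t1 = mem s" "regs t1 ''i'' = i"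
      "regs t1 ''br'' = regs t ''br''" "regs t1 ''bf'' = regs t ''bf''"
      using t1(2,3) r t(3) by auto
    have bi1: "best_inv ok val cand (A \<union> {c} \<times> {..<i}) t1"
      by (rule best_inv_cong[OF t(2)]) (use t1(2) in simp_all)
    have "i < G" using t(1) N(2) by simp
    then have ar: "eval E t1 (Ar 6 (Reg ''i'')) = val (c, i)"
      using eval_Ar[OF r1(1), of 6 "Reg ''i''" i] val(1)[OF t(1)] by (simp add: r1(4,5))
    have cnt: "regs t1 ''cnt'' < regs t1 ''h'' \<longleftrightarrow> \<not> ok (c, i)"
      unfolding t1(1) ce r1(3) ok by (simp add: not_le)
    have keep: "HT E Skip t1 \<tau> 0 0 (\<lambda>s''. best_inv ok val cand (A \<union> {c} \<times> {..<Suc i}) (set_reg E ''i'' (Suc i) s'')) (\<lambda>_. True)"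
      if "ok (c, i) \<Longrightarrow> regs t1 ''bf'' \<noteq> 0 \<and> regs t1 ''br'' \<le> val (c, i)" "1 \<le> \<tau>" for \<tau>
    proof (intro HT_Skip)
      show "best_inv ok val cand (A \<union> {c} \<times> {..<Suc i}) (set_reg E ''i'' (Suc i) t1)"
        unfolding set_eq using best_inv_cong[OF best_inv_skip[OF bi1 that(1)], of "set_reg E ''i'' (Suc i) t1"] by simp
    qed (use that in simp_all)
    show "ST E (If (Less (Reg ''cnt'') (Reg ''h'')) Skip ?u) t1 7 0
        (\<lambda>s''. best_inv ok val cand (A \<union> {c} \<times> {..<Suc i}) (set_reg E ''i'' (Suc i) s''))"
    proof (rule HT_If[where \<tau>a = 6])
      assume "eval E t1 (Less (Reg ''cnt'') (Reg ''h'')) \<noteq> 0"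
      then have "\<not> ok (c, i)" using cnt by simp
      then show "ST E Skip t1 6 0 (\<lambda>s''. best_inv ok val cand (A \<union> {c} \<times> {..<Suc i}) (set_reg E ''i'' (Suc i) s''))"
        by (intro keep) simp_all
    next
      assume "eval E t1 (Less (Reg ''cnt'') (Reg ''h'')) = 0"
      then have ok_i: "ok (c, i)" using cnt by simp
      have cond: "eval E t1 (Add (Less (Ar 6 (Reg ''i'')) (Reg ''br'')) (Eql (Reg ''bf'') (Const 0))) = 0 \<longleftrightarrow>
          \<not> (val (c, i) < regs t1 ''br'' \<or> regs t1 ''bf'' = 0)"
        unfolding eval.simps ar by (cases "val (c, i) < regs t1 ''br''"; cases "regs t1 ''bf'' = 0") (simp_all add: to_word_small)
      show "ST E ?u t1 6 0 (\<lambda>s''. best_inv ok val cand (A \<union> {c} \<times> {..<Suc i}) (set_reg E ''i'' (Suc i) s''))"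
      proof (rule HT_If[where \<tau>a = 5])
        assume "eval E t1 (Add (Less (Ar 6 (Reg ''i'')) (Reg ''br'')) (Eql (Reg ''bf'') (Const 0))) = 0"
        then show "ST E Skip t1 5 0 (\<lambda>s''. best_inv ok val cand (A \<union> {c} \<times> {..<Suc i}) (set_reg E ''i'' (Suc i) s''))"
          using cond by (intro keep) auto
      next
        assume "eval E t1 (Add (Less (Ar 6 (Reg ''i'')) (Reg ''br'')) (Eql (Reg ''bf'') (Const 0))) \<noteq> 0"
        then have c: "val (c, i) < regs t1 ''br'' \<or> regs t1 ''bf'' = 0" using cond by simp
        have fin: "best_inv ok val cand (A \<union> {c} \<times> {..<Suc i}) (set_reg E ''i'' (Suc i) s'')"
          if "regs s'' ''br'' = val (c, i)" "regs s'' ''bt'' = cand c" "regs s'' ''bf'' = 1" for s'' :: state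
          unfolding set_eq by (rule best_inv_update[OF bi1 ok_i c]) (use that in simp_all)
        let ?t2 = "set_reg E ''br'' (val (c, i)) t1"
        let ?t3 = "set_reg E ''bt'' (cand c) ?t2"
        have 1: "ST E (Assign ''br'' (Ar 6 (Reg ''i''))) t1 1 0 (\<lambda>t'. t' = ?t2)"
          by (rule HT_Assign) (simp_all add: ar)
        have 2: "ST E (Assign ''bt'' (Reg ''t'')) ?t2 1 0 (\<lambda>t'. t' = ?t3)"
          by (rule HT_Assign) (simp_all add: r1)
        have 3: "ST E (Assign ''bf'' (Const 1)) ?t3 1 0 (\<lambda>s''. best_inv ok val cand (A \<union> {c} \<times> {..<Suc i}) (set_reg E ''i'' (Suc i) s''))"
          by (rule HT_Assign) (use val(2)[OF t(1)] \<open>cand c \<le> G\<close> in \<open>simp_all add: fin to_word_small\<close>)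
        have 4: "ST E (Seq (Assign ''bt'' (Reg ''t'')) (Assign ''bf'' (Const 1))) ?t2 3 0
            (\<lambda>s''. best_inv ok val cand (A \<union> {c} \<times> {..<Suc i}) (set_reg E ''i'' (Suc i) s''))"
          by (rule ST_Seq[OF 2, where \<tau>b = 1 and \<sigma>b = 0]) (use 3 in simp_all)
        show "ST E Update t1 5 0 (\<lambda>s''. best_inv ok val cand (A \<union> {c} \<times> {..<Suc i}) (set_reg E ''i'' (Suc i) s''))"
          unfolding Update_def by (rule ST_Seq[OF 1, where \<tau>b = 3 and \<sigma>b = 0]) (use 4 in simp_all)
      qed simp
    qed simp
  qed simp_all
next
  show "best_inv ok val cand (A \<union> {c} \<times> {..<0}) (set_reg E ''i'' 0 s)"
    using best_inv_cong[OF bi, of "set_reg E ''i'' 0 s"] by simp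
  show "N * (N * 5 + 13 + 3) + 3 \<le> \<tau>" using \<tau> by (simp add: add.assoc)
qed (use N in simp_all)

lemma ST_Best:
  fixes s :: state and H N :: nat
  defines "cand \<equiv> \<lambda>c. mem s (3 * G + c)"
  defines "val \<equiv> \<lambda>(c, i). td (cand c) (mem s (5 * G + i))"
  defines "ok \<equiv> \<lambda>(c, i). H \<le> card {i'. i' < N \<and> val (c, i') \<le> val (c, i)}"
  assumes G: "regs s ''G'' = G" and N: "regs s ''tl'' = N" "N \<le> G" and H: "regs s ''h'' = H" "H \<le> G"
    and cand: "\<And>c. c < H \<Longrightarrow> cand c \<le> G"
    and z: "regs s ''bf'' = 0" "regs s ''br'' = 0" "regs s ''bt'' = 0"
    and \<tau>: "H * (N * N * 5 + N * 26 + 12) + 3 \<le> \<tau>" and \<sigma>: "H * (N * 2) \<le> \<sigma>"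
  shows "ST E (Best mode) s \<tau> \<sigma> (\<lambda>s'. best_inv ok val cand ({..<H} \<times> {..<N}) s' \<and> mem_frame G 6 s s')"
  unfolding Best_def
proof (rule ST_For[where N = H and \<tau> = "N * N * 5 + N * 26 + 9" and \<sigma> = "N * 2"
      and Inv = "\<lambda>k s'. best_inv ok val cand ({..<k} \<times> {..<N}) s' \<and> mem_frame G 6 s s'"])
  fix c and t :: state
  let ?b = "Seq (Assign ''t'' (Ar 3 (Reg ''c''))) (Seq (Dists mode) Rank)"
  assume t: "c < H" "best_inv ok val cand ({..<c} \<times> {..<N}) t \<and> mem_frame G 6 s t" "regs t ''c'' = c"
    "\<forall>x. x \<noteq> ''c'' \<longrightarrow> x \<notin> mods ?b \<longrightarrow> regs t x = regs s x"
  have r: "regs t ''G'' = G" "regs t ''tl'' = N" "regs t ''h'' = H" using t(4) G N H by auto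
  have ar: "eval E t (Ar 3 (Reg ''c'')) = cand c"
    using eval_Ar[OF r(1), of 3 "Reg ''c''" c] t H mem_frameD[of G 6 s t c 3] by (simp add: cand_def)
  let ?t1 = "set_reg E ''t'' (cand c) t"
  have c16: "to_word E (cand c) = cand c" using cand[OF t(1)] by (simp add: to_word_small)
  have 1: "ST E (Assign ''t'' (Ar 3 (Reg ''c''))) t 1 0 (\<lambda>t'. t' = ?t1)"
    by (rule HT_Assign) (simp_all add: ar)
  have 2: "ST E (Dists mode) ?t1 (N * 10 + 3) (N * 2) (\<lambda>s'. (\<forall>i<N. mem s' (6 * G + i) = td (regs ?t1 ''t'') (mem ?t1 (5 * G + i))) \<and> mem_frame G 6 ?t1 s')"
    by (rule ST_Dists) (use r N in simp_all)
  have 3: "ST E (Seq (Dists mode) Rank) ?t1 (N * N * 5 + N * 26 + 7) (N * 2)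
     (\<lambda>s''. best_inv ok val cand ({..<Suc c} \<times> {..<N}) (set_reg E ''c'' (Suc c) s'') \<and> mem_frame G 6 s (set_reg E ''c'' (Suc c) s''))"
  proof (rule ST_Seq[OF 2, where \<tau>b = "N * (N * 5 + 16) + 3" and \<sigma>b = 0])
    fix t2 :: state assume t2: "(\<forall>i<N. mem t2 (6 * G + i) = td (regs ?t1 ''t'') (mem ?t1 (5 * G + i))) \<and> mem_frame G 6 ?t1 t2"
      "\<forall>x. x \<notin> mods (Dists mode) \<longrightarrow> regs t2 x = regs ?t1 x"
    have r2: "regs t2 ''G'' = G" "regs t2 ''tl'' = N" "regs t2 ''h'' = H" "regs t2 ''t'' = cand c"
      using t2(2) r c16 by auto
    have fr: "mem_frame G 6 s t2" using t2(1) t(2) by (auto intro: mem_frame_trans)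
    have v: "mem t2 (6 * G + i) = val (c, i)" if "i < N" for i
      using t2(1) that c16 t(2) N mem_frameD[of G 6 s t i 5] by (simp add: val_def)
    have bi2: "best_inv ok val cand ({..<c} \<times> {..<N}) t2"
      by (rule best_inv_cong[of _ _ _ _ t]) (use t(2) t2(2) in simp_all)
    have "ST E Rank t2 (N * (N * 5 + 16) + 3) 0 (\<lambda>s'. best_inv ok val cand (({..<c} \<times> {..<N}) \<union> {c} \<times> {..<N}) s')"
    proof (rule ST_Rank[OF r2(1,2) N(2) r2(4) cand[OF t(1)] v _ _ bi2 order_refl])
      show "to_word E (val (c, i)) = val (c, i)" for i by (simp add: val_def)
      show "ok (c, i) = (regs t2 ''h'' \<le> card {i'. i' < N \<and> val (c, i') \<le> val (c, i)})" for i
        using r2 by (simp add: ok_def)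
    qed
    then show "ST E Rank t2 (N * (N * 5 + 16) + 3) 0 (\<lambda>s''. best_inv ok val cand ({..<Suc c} \<times> {..<N}) (set_reg E ''c'' (Suc c) s'')
        \<and> mem_frame G 6 s (set_reg E ''c'' (Suc c) s''))"
    proof (rule ST_conseq)
      fix s' :: state assume s': "best_inv ok val cand (({..<c} \<times> {..<N}) \<union> {c} \<times> {..<N}) s'" "\<not> stores Rank \<longrightarrow> mem s' = mem t2"
      have "({..<c} \<times> {..<N}) \<union> {c} \<times> {..<N} = {..<Suc c} \<times> {..<N}" by auto
      then show "best_inv ok val cand ({..<Suc c} \<times> {..<N}) (set_reg E ''c'' (Suc c) s') \<and> mem_frame G 6 s (set_reg E ''c'' (Suc c) s')"
        using s' fr by (simp add: mem_frame_def best_inv_def)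
    qed simp_all
  qed (simp_all add: algebra_simps)
  show "ST E ?b t (N * N * 5 + N * 26 + 9) (N * 2)
     (\<lambda>s''. best_inv ok val cand ({..<Suc c} \<times> {..<N}) (set_reg E ''c'' (Suc c) s'') \<and> mem_frame G 6 s (set_reg E ''c'' (Suc c) s''))"
    by (rule ST_Seq[OF 1, where \<tau>b = "N * N * 5 + N * 26 + 7" and \<sigma>b = "N * 2"]) (use 3 in simp_all)
next
  show "H * (N * N * 5 + N * 26 + 9 + 3) + 3 \<le> \<tau>" using \<tau> by (simp add: add.assoc)
qed (use G N H \<sigma> z in \<open>simp_all add: best_inv_def\<close>)

lemma ST_Collect_ball:
  fixes s :: state and H N :: nat
  defines "P \<equiv> \<lambda>i. mem s (6 * G + i) \<le> regs s ''br''"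
  defines "T \<equiv> \<lambda>i. mem s (5 * G + i)"
  assumes G: "regs s ''G'' = G" and N: "regs s ''tl'' = N" "N \<le> G" and H: "regs s ''h'' = H" "H \<le> G"
    and T: "inj_on T {..<N}"
    and \<tau>: "N * 8 + 5 \<le> \<tau>"
  shows "ST E Collect_ball s \<tau> \<sigma> (\<lambda>s'. regs s' ''bl'' = min H (card {i. i < N \<and> P i}) \<and>
     inj_on (\<lambda>i. mem s' (7 * G + i)) {..<regs s' ''bl''} \<and>
     (\<lambda>i. mem s' (7 * G + i)) ` {..<regs s' ''bl''} \<subseteq> T ` {i. i < N \<and> P i} \<and> mem_frame G 7 s s')"
  unfolding Collect_ball_def
proof (rule ST_Seq[where \<tau>a = 1 and \<sigma>a = 0 and \<tau>b = "N * 8 + 3" and \<sigma>b = 0 and Sm = "\<lambda>s'. s' = set_reg E ''bl'' 0 s"])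
  fix s0 :: state assume s0: "s0 = set_reg E ''bl'' 0 s"
  let ?b = "If (Less (Reg ''br'') (Ar 6 (Reg ''i''))) Skip
       (If (Less (Reg ''bl'') (Reg ''h'')) (Seq (Put 7 (Reg ''bl'') (Ar 5 (Reg ''i''))) (Incr ''bl'')) Skip)"
  let ?I = "\<lambda>k s'. regs s' ''bl'' = min H (card {i. i < k \<and> P i}) \<and>
     inj_on (\<lambda>i. mem s' (7 * G + i)) {..<regs s' ''bl''} \<and>
     (\<lambda>i. mem s' (7 * G + i)) ` {..<regs s' ''bl''} \<subseteq> T ` {i. i < k \<and> P i} \<and> mem_frame G 7 s s'"
  show "ST E (For ''i'' (Reg ''tl'') ?b) s0 (N * 8 + 3) 0 (?I N)"
  proof (rule ST_For[where N = N and \<tau> = 5 and \<sigma> = 0 and Inv = ?I])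
    fix i and t :: state
    assume t: "i < N" "?I i t" "regs t ''i'' = i" "\<forall>x. x \<noteq> ''i'' \<longrightarrow> x \<notin> mods ?b \<longrightarrow> regs t x = regs s0 x"
    have r: "regs t ''G'' = G" "regs t ''h'' = H" "regs t ''br'' = regs s ''br''" using t(4) s0 G H by simp_all
    have iG: "i < G" using t(1) N by simp
    have ar: "eval E t (Ar 6 (Reg ''i'')) = mem s (6 * G + i)" "eval E t (Ar 5 (Reg ''i'')) = T i"
      using eval_Ar[OF r(1), of 6 "Reg ''i''" i] eval_Ar[OF r(1), of 5 "Reg ''i''" i] t(2,3) iG
        mem_frameD[of G 7 s t i 6] mem_frameD[of G 7 s t i 5] by (simp_all add: T_def)
    have sub: "T ` {k. k < i \<and> P k} \<subseteq> T ` {k. k < Suc i \<and> P k}" by (auto simp: less_Suc_eq)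
    have keep: "ST E Skip t \<tau> 0 (\<lambda>s''. ?I (Suc i) (set_reg E ''i'' (Suc i) s''))"
      if "P i \<Longrightarrow> \<not> regs t ''bl'' < H" "1 \<le> \<tau>" for \<tau>
    proof (intro HT_Skip)
      have "regs t ''bl'' = min H (card {k. k < Suc i \<and> P k})"
        using that(1) t(2) by (cases "P i") (auto simp: card_less_Suc)
      moreover have "(\<lambda>k. mem t (7 * G + k)) ` {..<regs t ''bl''} \<subseteq> T ` {k. k < Suc i \<and> P k}"
        using t(2) sub by (meson order_trans)
      moreover have "inj_on (\<lambda>k. mem t (7 * G + k)) {..<regs t ''bl''}" "mem_frame G 7 s t" using t(2) by blast+
      ultimately show "?I (Suc i) (set_reg E ''i'' (Suc i) t)" by simp
    qed (use that in simp_all)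
    show "ST E ?b t 5 0 (\<lambda>s''. ?I (Suc i) (set_reg E ''i'' (Suc i) s''))"
    proof (rule HT_If[where \<tau>a = 4])
      assume "eval E t (Less (Reg ''br'') (Ar 6 (Reg ''i''))) \<noteq> 0"
      then have "\<not> P i" using ar r by (simp add: P_def)
      then show "ST E Skip t 4 0 (\<lambda>s''. ?I (Suc i) (set_reg E ''i'' (Suc i) s''))" by (intro keep) simp_all
    next
      assume "eval E t (Less (Reg ''br'') (Ar 6 (Reg ''i''))) = 0"
      then have Pi: "P i" using ar r by (simp add: P_def)
      show "ST E (If (Less (Reg ''bl'') (Reg ''h'')) (Seq (Put 7 (Reg ''bl'') (Ar 5 (Reg ''i''))) (Incr ''bl'')) Skip) t 4 0
         (\<lambda>s''. ?I (Suc i) (set_reg E ''i'' (Suc i) s''))"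
      proof (rule HT_If[where \<tau>a = 3])
        assume "eval E t (Less (Reg ''bl'') (Reg ''h'')) = 0"
        then show "ST E Skip t 3 0 (\<lambda>s''. ?I (Suc i) (set_reg E ''i'' (Suc i) s''))"
          using r by (intro keep) simp_all
      next
        assume "eval E t (Less (Reg ''bl'') (Reg ''h'')) \<noteq> 0"
        then have lt: "regs t ''bl'' < H" using r by simp
        define b where "b = regs t ''bl''"
        have bG: "b < G" "b < H" using lt H by (simp_all add: b_def)
        have bc: "b = card {k. k < i \<and> P k}" using t(2) lt by (simp add: b_def)
        let ?t2 = "t\<lparr>mem := (mem t)(7 * G + b := T i)\<rparr>"
        have 1: "ST E (Put 7 (Reg ''bl'') (Ar 5 (Reg ''i''))) t 1 0 (\<lambda>t'. t' = ?t2)"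
          by (rule ST_Put[where i = b]) (use r bG ar in \<open>simp_all add: b_def\<close>)
        have fr: "mem_frame G 7 s ?t2" using mem_frame_upd[of b G 7 s t "T i"] bG t(2) by simp
        have old: "inj_on (\<lambda>k. mem t (7 * G + k)) {..<b}" "(\<lambda>k. mem t (7 * G + k)) ` {..<b} \<subseteq> T ` {k. k < i \<and> P k}"
          unfolding b_def using t(2) by blast+
        have new: "T i \<notin> T ` {k. k < i \<and> P k}"
          using T t(1) by (fastforce dest: inj_onD)
        have imeq: "(\<lambda>k. mem ?t2 (7 * G + k)) ` {..<b} = (\<lambda>k. mem t (7 * G + k)) ` {..<b}" by (intro image_cong) auto
        have inj: "inj_on (\<lambda>k. mem ?t2 (7 * G + k)) {..<Suc b}"
          unfolding lessThan_Suc
        proof (rule inj_on_insert[THEN iffD2], intro conjI)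
          show "inj_on (\<lambda>k. mem ?t2 (7 * G + k)) {..<b}"
            using old(1) by (rule inj_on_cong[THEN iffD1, rotated]) auto
          show "mem ?t2 (7 * G + b) \<notin> (\<lambda>k. mem ?t2 (7 * G + k)) ` ({..<b} - {b})"
            using imeq new old(2) by auto
        qed
        have im: "(\<lambda>k. mem ?t2 (7 * G + k)) ` {..<Suc b} \<subseteq> T ` {k. k < Suc i \<and> P k}"
          unfolding lessThan_Suc image_insert imeq using old(2) sub Pi by auto
        have 2: "ST E (Incr ''bl'') ?t2 1 0 (\<lambda>s''. ?I (Suc i) (set_reg E ''i'' (Suc i) s''))"
          by (rule ST_Incr) (use bG inj im fr bc Pi in \<open>simp_all add: b_def[symmetric] card_less_Suc to_word_small min_def\<close>)
        show "ST E (Seq (Put 7 (Reg ''bl'') (Ar 5 (Reg ''i''))) (Incr ''bl'')) t 3 0 (\<lambda>s''. ?I (Suc i) (set_reg E ''i'' (Suc i) s''))"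
          by (rule ST_Seq[OF 1, where \<tau>b = 1 and \<sigma>b = 0]) (use 2 in simp_all)
      qed simp
    qed simp
  next
    fix s' :: state assume "?I N s'"
    then show "?I N s'" .
  qed (use s0 N in simp_all)
qed (use \<tau> in \<open>simp_all add: HT_Assign\<close>)

definition pass :: "state \<Rightarrow> nat \<Rightarrow> nat \<Rightarrow> nat \<Rightarrow> nat \<Rightarrow> bool" where
  "pass s j l \<rho> x \<longleftrightarrow> l < 2 * card {i. i < l \<and> wo x (mem s (j * G + i)) \<le> \<rho>}"

lemma pass_cong: "(\<And>i. i < l \<Longrightarrow> mem s (j * G + i) = mem s' (j * G + i)) \<Longrightarrow> pass s j l \<rho> x = pass s' j l \<rho> x"
  unfolding pass_def by (metis (no_types, lifting) Collect_cong)

text \<open>For \<open>j = 0\<close> the previous size counts as 0, so the test only asks for a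
  nonempty set.\<close>

definition grows :: "(nat \<Rightarrow> nat) \<Rightarrow> nat \<Rightarrow> bool" where
  "grows z j \<longleftrightarrow> 11 * (if j = 0 then 0 else z (j - 1)) < 10 * z j"

lemma ST_Scale:
  fixes s :: state and n H l b :: nat
  defines "Z \<equiv> \<lambda>j. {x. x < n \<and> pass s 7 l (2 * Suc j * b) x}"
  assumes G: "regs s ''G'' = G" and n: "regs s ''n'' = n" "n \<le> G" and l: "regs s ''bl'' = l" "l \<le> H"
    and H: "H \<le> G" and b: "regs s ''br'' = b" "2 * H * b < 2 ^ word_size E"
    and j: "regs s ''j'' = j" "j < H" and prev: "regs s ''prev'' = (if j = 0 then 0 else card (Z (j - 1)))"
    and dn: "regs s ''done'' = 0"
    and \<tau>: "n * (H * 8 + 13) + 11 \<le> \<tau>"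
  shows "ST E Scale s \<tau> \<sigma> (\<lambda>s'. regs s' ''thr'' = 2 * Suc j * b \<and> regs s' ''zl'' = card (Z j) \<and>
     bij_betw (\<lambda>i. mem s' (8 * G + i)) {..<card (Z j)} (Z j) \<and> mem_frame G 8 s s' \<and>
     (if grows (\<lambda>j. card (Z j)) j then regs s' ''prev'' = card (Z j) \<and> regs s' ''done'' = 0 else regs s' ''done'' \<noteq> 0))"
proof -
  have "2 * Suc j * b \<le> 2 * H * b" using j by (intro mult_le_mono) auto
  then have small: "to_word E (2 * Suc j * b) = 2 * Suc j * b" using b by (intro to_word_id) linarith
  have jj: "to_word E (Suc j) = Suc j" "to_word E (2 * Suc j) = 2 * Suc j" "to_word E 2 = 2"
    "to_word E 10 = 10" "to_word E 11 = 11" "to_word E 1 = 1"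
    using j H by (simp_all add: to_word_small)
  let ?s1 = "set_reg E ''thr'' (2 * Suc j * b) s"
  have ev: "eval E s (Mul (Mul (Const 2) (Add (Reg ''j'') (Const 1))) (Reg ''br'')) = 2 * Suc j * b"
    using jj small j b by simp
  have 1: "ST E (Assign ''thr'' (Mul (Mul (Const 2) (Add (Reg ''j'') (Const 1))) (Reg ''br''))) s 1 0 (\<lambda>t. t = ?s1)"
    by (rule HT_Assign, unfold ev) simp_all
  have cZ: "card (Z j) \<le> n" for j unfolding Z_def by (rule card_less_le)
  let ?S2 = "\<lambda>s'. regs s' ''zl'' = card {x. x < n \<and> pass s 7 l (2 * Suc j * b) x} \<and>
     bij_betw (\<lambda>i. mem s' (8 * G + i)) {..<card {x. x < n \<and> pass s 7 l (2 * Suc j * b) x}} {x. x < n \<and> pass s 7 l (2 * Suc j * b) x} \<and> mem_frame G 8 ?s1 s'"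
  have 2: "ST E (Filter 8 ''zl'' (Vote 7 ''bl'') (Less (Reg ''bl'') (Add (Reg ''cnt'') (Reg ''cnt'')))) ?s1 (n * (H * 8 + 5 + 8) + 5) 0 ?S2"
  proof (rule ST_Filter[where \<tau> = "H * 8 + 5"])
    fix s' :: state and x
    assume s': "x < n" "regs s' ''x'' = x" "\<forall>y. y \<notin> {''zl'', ''x''} \<union> mods (Vote 7 ''bl'') \<longrightarrow> regs s' y = regs ?s1 y" "mem_frame G 8 ?s1 s'"
    have r: "regs s' ''G'' = G" "regs s' ''bl'' = l" "regs s' ''thr'' = 2 * Suc j * b"
      using s'(3) G l small by simp_all
    have me: "mem s' (7 * G + i) = mem s (7 * G + i)" if "i < l" for i
      using mem_frameD[OF s'(4), of i 7] that l H by simp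
    have lG: "l \<le> G" using l H by simp
    have v: "ST E (Vote 7 ''bl'') s' (H * 8 + 5) 0 (\<lambda>s''. regs s'' ''cnt'' = card {i. i < l \<and> wo (regs s' ''x'') (mem s' (7 * G + i)) \<le> regs s' ''thr''})"
      by (rule ST_Vote[OF r(1) _ r(2) lG]) (use l in simp_all)
    show "ST E (Vote 7 ''bl'') s' (H * 8 + 5) 0
        (\<lambda>s''. (eval E s'' (Less (Reg ''bl'') (Add (Reg ''cnt'') (Reg ''cnt''))) \<noteq> 0) = pass s 7 l (2 * Suc j * b) x)"
    proof (rule ST_conseq[OF v order_refl order_refl])
      fix s'' :: state assume s'': "regs s'' ''cnt'' = card {i. i < l \<and> wo (regs s' ''x'') (mem s' (7 * G + i)) \<le> regs s' ''thr''}"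
        "\<forall>x. x \<notin> mods (Vote 7 ''bl'') \<longrightarrow> regs s'' x = regs s' x"
      let ?c = "card {i. i < l \<and> wo (regs s' ''x'') (mem s' (7 * G + i)) \<le> regs s' ''thr''}"
      have "?c \<le> l" by (rule card_less_le)
      then have "to_word E (?c + ?c) = ?c + ?c" using lG by (intro to_word_small) linarith
      moreover have "regs s'' ''bl'' = l" using s''(2) r by simp
      moreover have "pass s 7 l (2 * Suc j * b) x = (l < 2 * ?c)"
        using pass_cong[of l s 7 s' "2 * Suc j * b" x] me unfolding pass_def r s'(2) by simp
      ultimately show "(eval E s'' (Less (Reg ''bl'') (Add (Reg ''cnt'') (Reg ''cnt''))) \<noteq> 0) = pass s 7 l (2 * Suc j * b) x"
        using s''(1) by (simp add: mult_2)
    qed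
  qed (use G n in simp_all)
  let ?post = "\<lambda>s'. regs s' ''thr'' = 2 * Suc j * b \<and> regs s' ''zl'' = card (Z j) \<and>
     bij_betw (\<lambda>i. mem s' (8 * G + i)) {..<card (Z j)} (Z j) \<and> mem_frame G 8 s s' \<and>
     (if grows (\<lambda>j. card (Z j)) j then regs s' ''prev'' = card (Z j) \<and> regs s' ''done'' = 0 else regs s' ''done'' \<noteq> 0)"
  let ?c = "If (Less (Mul (Const 11) (Reg ''prev'')) (Mul (Const 10) (Reg ''zl''))) (Assign ''prev'' (Reg ''zl'')) (Assign ''done'' (Const 1))"
  have 3: "ST E ?c s2 2 0 ?post"
    if "?S2 s2" "\<forall>x. x \<notin> mods (Filter 8 ''zl'' (Vote 7 ''bl'') (Less (Reg ''bl'') (Add (Reg ''cnt'') (Reg ''cnt'')))) \<longrightarrow> regs s2 x = regs ?s1 x" for s2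
  proof -
    have q: "regs s2 ''thr'' = 2 * Suc j * b" "regs s2 ''prev'' = (if j = 0 then 0 else card (Z (j - 1)))" "regs s2 ''done'' = 0"
      using that(2) prev dn small by simp_all
    have z: "regs s2 ''zl'' = card (Z j)" "bij_betw (\<lambda>i. mem s2 (8 * G + i)) {..<card (Z j)} (Z j)" "mem_frame G 8 s s2"
      using that(1) by (simp_all add: Z_def)
    have w: "to_word E (11 * regs s2 ''prev'') = 11 * regs s2 ''prev''" "to_word E (10 * regs s2 ''zl'') = 10 * regs s2 ''zl''"
      "to_word E (card (Z j)) = card (Z j)"
      using cZ[of j] cZ[of "j - 1"] n q z by (simp_all add: to_word_small)
    have cond: "eval E s2 (Less (Mul (Const 11) (Reg ''prev'')) (Mul (Const 10) (Reg ''zl''))) \<noteq> 0 \<longleftrightarrow> grows (\<lambda>j. card (Z j)) j"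
      using w z q jj by (simp add: grows_def)
    show ?thesis
    proof (rule HT_If[where \<tau>a = 1])
      assume "eval E s2 (Less (Mul (Const 11) (Reg ''prev'')) (Mul (Const 10) (Reg ''zl''))) \<noteq> 0"
      then have "grows (\<lambda>j. card (Z j)) j" using cond by blast
      then show "ST E (Assign ''prev'' (Reg ''zl'')) s2 1 0 ?post"
        using q z w by (intro HT_Assign) simp_all
    next
      assume "eval E s2 (Less (Mul (Const 11) (Reg ''prev'')) (Mul (Const 10) (Reg ''zl''))) = 0"
      then have "\<not> grows (\<lambda>j. card (Z j)) j" using cond by blast
      then show "ST E (Assign ''done'' (Const 1)) s2 1 0 ?post"
        using q z w jj by (intro HT_Assign) simp_all
    qed simp
  qed
  have 4: "ST E (Seq (Filter 8 ''zl'' (Vote 7 ''bl'') (Less (Reg ''bl'') (Add (Reg ''cnt'') (Reg ''cnt'')))) ?c) ?s1 (n * (H * 8 + 13) + 8) 0 ?post"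
    by (rule ST_Seq[OF 2, where \<tau>b = 2 and \<sigma>b = 0]) (use 3 in \<open>simp_all add: add.assoc\<close>)
  show ?thesis
    unfolding Scale_def
    by (rule ST_Seq[OF 1, where \<tau>b = "n * (H * 8 + 13) + 8" and \<sigma>b = 0]) (use 4 \<tau> in simp_all)
qed

text \<open>The loop has no early exit; the flag \<open>done\<close> makes the remaining rounds
  idle, so the registers keep the data of the first stalled scale. The alternative that all scales
  grow is a possible outcome for a bad pattern and is refuted for good ones by
  \<open>growth_stops\<close>.\<close>

lemma ST_Scales:
  fixes s :: state and n H l b :: nat
  defines "Z \<equiv> \<lambda>j. {x. x < n \<and> pass s 7 l (2 * Suc j * b) x}"
  assumes G: "regs s ''G'' = G" and n: "regs s ''n'' = n" "n \<le> G" and l: "regs s ''bl'' = l" "l \<le> H"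
    and H: "regs s ''h'' = H" "H \<le> G" "0 < H" and b: "regs s ''br'' = b" "2 * H * b < 2 ^ word_size E"
    and z: "regs s ''prev'' = 0" "regs s ''done'' = 0"
    and \<tau>: "H * (n * (H * 8 + 13) + 15) + 3 \<le> \<tau>"
  shows "ST E Scales s \<tau> \<sigma> (\<lambda>s'. mem_frame G 8 s s' \<and> (\<exists>j<H. regs s' ''thr'' = 2 * Suc j * b \<and> regs s' ''zl'' = card (Z j) \<and>
     bij_betw (\<lambda>i. mem s' (8 * G + i)) {..<card (Z j)} (Z j) \<and>
     (\<not> grows (\<lambda>j. card (Z j)) j \<or> (\<forall>j<H. grows (\<lambda>j. card (Z j)) j))))"
  unfolding Scales_def
proof -
  let ?L = "\<lambda>j s'. regs s' ''thr'' = 2 * Suc j * b \<and> regs s' ''zl'' = card (Z j) \<and>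
     bij_betw (\<lambda>i. mem s' (8 * G + i)) {..<card (Z j)} (Z j)"
  let ?gr = "grows (\<lambda>j. card (Z j))"
  let ?I = "\<lambda>k s'. mem_frame G 8 s s' \<and>
     (if regs s' ''done'' = 0 then (\<forall>j<k. ?gr j) \<and> regs s' ''prev'' = (if k = 0 then 0 else card (Z (k - 1))) \<and> (0 < k \<longrightarrow> ?L (k - 1) s')
      else (\<exists>j<k. ?L j s' \<and> \<not> ?gr j))"
  let ?b = "If (Reg ''done'') Skip Scale"
  show "ST E (For ''j'' (Reg ''h'') ?b) s \<tau> \<sigma> (\<lambda>s'. mem_frame G 8 s s' \<and> (\<exists>j<H. regs s' ''thr'' = 2 * Suc j * b \<and> regs s' ''zl'' = card (Z j) \<and>
     bij_betw (\<lambda>i. mem s' (8 * G + i)) {..<card (Z j)} (Z j) \<and> (\<not> ?gr j \<or> (\<forall>j<H. ?gr j))))"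
  proof (rule ST_For[where N = H and \<tau> = "n * (H * 8 + 13) + 12" and \<sigma> = 0 and Inv = ?I])
    fix k and t :: state
    assume t: "k < H" "?I k t" "regs t ''j'' = k" "\<forall>x. x \<noteq> ''j'' \<longrightarrow> x \<notin> mods ?b \<longrightarrow> regs t x = regs s x"
    have r: "regs t ''G'' = G" "regs t ''n'' = n" "regs t ''bl'' = l" "regs t ''br'' = b"
      using t(4) G n l b by simp_all
    have me: "mem t (7 * G + i) = mem s (7 * G + i)" if "i < l" for i
      using t(2) mem_frameD[of G 8 s t i 7] that l H by simp
    have Zt: "{x. x < n \<and> pass t 7 l (2 * Suc j * b) x} = Z j" for j
      unfolding Z_def using pass_cong[of l t 7 s "2 * Suc j * b"] me by simp
    show "ST E ?b t (n * (H * 8 + 13) + 12) 0 (\<lambda>s''. ?I (Suc k) (set_reg E ''j'' (Suc k) s''))"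
    proof (rule HT_If[where \<tau>a = "n * (H * 8 + 13) + 11"])
      assume d: "eval E t (Reg ''done'') \<noteq> 0"
      then have e: "\<exists>j<k. ?L j t \<and> \<not> ?gr j" using t(2) by simp
      then have "\<exists>j<Suc k. ?L j t \<and> \<not> ?gr j" using less_SucI by blast
      then show "ST E Skip t (n * (H * 8 + 13) + 11) 0 (\<lambda>s''. ?I (Suc k) (set_reg E ''j'' (Suc k) s''))"
        using d t(2) by (intro HT_Skip) simp_all
    next
      assume d: "eval E t (Reg ''done'') = 0"
      then have p: "regs t ''prev'' = (if k = 0 then 0 else card (Z (k - 1)))" "regs t ''done'' = 0" "\<forall>j<k. ?gr j" "mem_frame G 8 s t"
        using t(2) by simp_all
      note sc = ST_Scale[OF r(1,2) n(2) r(3) l(2) H(2) r(4) b(2) t(3,1), unfolded Zt, OF p(1,2) order_refl, of 0]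
      show "ST E Scale t (n * (H * 8 + 13) + 11) 0 (\<lambda>s''. ?I (Suc k) (set_reg E ''j'' (Suc k) s''))"
      proof (rule ST_conseq[OF sc order_refl order_refl])
        fix s' :: state
        assume s': "regs s' ''thr'' = 2 * Suc k * b \<and> regs s' ''zl'' = card (Z k) \<and>
          bij_betw (\<lambda>i. mem s' (8 * G + i)) {..<card (Z k)} (Z k) \<and> mem_frame G 8 t s' \<and>
          (if ?gr k then regs s' ''prev'' = card (Z k) \<and> regs s' ''done'' = 0 else regs s' ''done'' \<noteq> 0)"
        have f: "mem_frame G 8 s s'" using s' p(4) mem_frame_trans by blast
        show "?I (Suc k) (set_reg E ''j'' (Suc k) s')"
        proof (cases "?gr k")
          case True
          then show ?thesis using s' f p(3) by (simp add: less_Suc_eq)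
        next
          case False
          then have "?L k s' \<and> \<not> ?gr k" "regs s' ''done'' \<noteq> 0" using s' by simp_all
          then show ?thesis using f by (simp del: mult_Suc_right mult_Suc) blast
        qed
      qed
    qed simp
  next
    fix s' :: state assume I: "?I H s'"
    show "mem_frame G 8 s s' \<and> (\<exists>j<H. regs s' ''thr'' = 2 * Suc j * b \<and> regs s' ''zl'' = card (Z j) \<and>
     bij_betw (\<lambda>i. mem s' (8 * G + i)) {..<card (Z j)} (Z j) \<and> (\<not> ?gr j \<or> (\<forall>j<H. ?gr j)))"
    proof (cases "regs s' ''done'' = 0")
      case True
      then have "?L (H - 1) s'" "\<forall>j<H. ?gr j" "H - 1 < H" using I H(3) by simp_all
      then show ?thesis using I by blast
    next
      case False
      then show ?thesis using I by (simp del: mult_Suc_right mult_Suc) blast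
    qed
  qed (use G H z \<tau> in \<open>simp_all add: add.assoc\<close>)
qed

lemma ST_Clear:
  assumes "regs s ''G'' = G" "regs s ''n'' = n" "n \<le> G" "n * 4 + 3 \<le> \<tau>"
  shows "ST E Clear s \<tau> \<sigma> (\<lambda>s'. (\<forall>x<n. mem s' (4 * G + x) = 0) \<and> mem_frame G 4 s s')"
  unfolding Clear_def
proof (rule ST_For[where N = n and \<tau> = 1 and \<sigma> = 0 and Inv = "\<lambda>k s'. (\<forall>x<k. mem s' (4 * G + x) = 0) \<and> mem_frame G 4 s s'"])
  fix i and t :: state
  assume t: "i < n" "(\<forall>x<i. mem t (4 * G + x) = 0) \<and> mem_frame G 4 s t" "regs t ''x'' = i"
    "\<forall>x. x \<noteq> ''x'' \<longrightarrow> x \<notin> mods (Put 4 (Reg ''x'') (Const 0)) \<longrightarrow> regs t x = regs s x"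
  show "ST E (Put 4 (Reg ''x'') (Const 0)) t 1 0 (\<lambda>s''. (\<forall>x<Suc i. mem (set_reg E ''x'' (Suc i) s'') (4 * G + x) = 0) \<and> mem_frame G 4 s (set_reg E ''x'' (Suc i) s''))"
    by (rule ST_Put[where i = i]) (use t assms mem_frame_upd[of i G 4 s t 0] in \<open>simp_all add: less_Suc_eq\<close>)
qed (use assms in simp_all)

lemma ST_Mark:
  assumes G: "regs s ''G'' = G" and N: "regs s ''N'' = N" "N \<le> G" and n: "n \<le> G"
    and T: "\<And>i. i < N \<Longrightarrow> mem s (3 * G + i) < n" and z: "\<And>x. x < n \<Longrightarrow> mem s (4 * G + x) = 0" and \<tau>: "N * 4 + 3 \<le> \<tau>"
  shows "ST E Mark s \<tau> \<sigma> (\<lambda>s'. (\<forall>x<n. mem s' (4 * G + x) \<noteq> 0 \<longleftrightarrow> (\<exists>i<N. mem s (3 * G + i) = x)) \<and> mem_frame G 4 s s')"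
  unfolding Mark_def
proof (rule ST_For[where N = N and \<tau> = 1 and \<sigma> = 0
      and Inv = "\<lambda>k s'. (\<forall>x<n. mem s' (4 * G + x) \<noteq> 0 \<longleftrightarrow> (\<exists>i<k. mem s (3 * G + i) = x)) \<and> mem_frame G 4 s s'"])
  fix i and t :: state
  assume t: "i < N" "(\<forall>x<n. mem t (4 * G + x) \<noteq> 0 \<longleftrightarrow> (\<exists>i'<i. mem s (3 * G + i') = x)) \<and> mem_frame G 4 s t" "regs t ''i'' = i"
    "\<forall>x. x \<noteq> ''i'' \<longrightarrow> x \<notin> mods (Put 4 (Ar 3 (Reg ''i'')) (Const 1)) \<longrightarrow> regs t x = regs s x"
  have r: "regs t ''G'' = G" using t(4) G by simp
  have y: "mem s (3 * G + i) < G" using T[OF t(1)] n by simp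
  have ar: "eval E t (Ar 3 (Reg ''i'')) = mem s (3 * G + i)"
    using eval_Ar[OF r, of 3 "Reg ''i''" i] t N mem_frameD[of G 4 s t i 3] by simp
  have f: "mem_frame G 4 s (t\<lparr>mem := (mem t)(4 * G + mem s (3 * G + i) := Suc 0)\<rparr>)"
    using mem_frame_upd[OF y] t(2) by simp
  show "ST E (Put 4 (Ar 3 (Reg ''i'')) (Const 1)) t 1 0 (\<lambda>s''. (\<forall>x<n. mem (set_reg E ''i'' (Suc i) s'') (4 * G + x) \<noteq> 0 \<longleftrightarrow> (\<exists>i'<Suc i. mem s (3 * G + i') = x)) \<and> mem_frame G 4 s (set_reg E ''i'' (Suc i) s''))"
    by (rule ST_Put[where i = "mem s (3 * G + i)"]) (use r ar y f t(2) in \<open>auto simp: less_Suc_eq to_word_small\<close>)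
qed (use assms in simp_all)

lemma ST_Absorb:
  fixes s :: state and n H :: nat
  assumes G: "regs s ''G'' = G" and n: "regs s ''n'' = n" "n \<le> G" and H: "regs s ''h'' = H" "H \<le> G"
    and \<tau>: "n * (H * 8 + 12) + 3 \<le> \<tau>"
  shows "ST E Absorb s \<tau> \<sigma> (\<lambda>s'. (\<forall>x<n. mem s' (1 * G + x) = (if mem s (1 * G + x) = 0 \<and> pass s 9 H (regs s ''thr'') x
       then regs s ''ncl'' else mem s (1 * G + x))) \<and> mem_frame G 1 s s')"
  unfolding Absorb_def
proof -
  let ?v = "\<lambda>x. if mem s (1 * G + x) = 0 \<and> pass s 9 H (regs s ''thr'') x then regs s ''ncl'' else mem s (1 * G + x)"
  let ?I = "\<lambda>k s'. (\<forall>x<n. mem s' (1 * G + x) = (if x < k then ?v x else mem s (1 * G + x))) \<and> mem_frame G 1 s s'"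
  let ?i = "If (Less (Reg ''h'') (Add (Reg ''cnt'') (Reg ''cnt''))) (Put 1 (Reg ''x'') (Reg ''ncl'')) Skip"
  let ?b = "If (Ar 1 (Reg ''x'')) Skip (Seq (Vote 9 ''h'') ?i)"
  show "ST E (For ''x'' (Reg ''n'') ?b) s \<tau> \<sigma> (\<lambda>s'. (\<forall>x<n. mem s' (1 * G + x) = ?v x) \<and> mem_frame G 1 s s')"
  proof (rule ST_For[where N = n and \<tau> = "H * 8 + 9" and \<sigma> = 0 and Inv = ?I])
    fix x and t :: state
    assume t: "x < n" "?I x t" "regs t ''x'' = x" "\<forall>y. y \<noteq> ''x'' \<longrightarrow> y \<notin> mods ?b \<longrightarrow> regs t y = regs s y"
    have r: "regs t ''G'' = G" "regs t ''h'' = H" "regs t ''thr'' = regs s ''thr''" "regs t ''ncl'' = regs s ''ncl''"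
      using t(4) G H by simp_all
    have xG: "x < G" using t(1) n by simp
    have ar: "eval E t (Ar 1 (Reg ''x'')) = mem s (1 * G + x)"
      using eval_Ar[OF r(1), of 1 "Reg ''x''" x] t xG by simp
    have keep: "?I (Suc x) (set_reg E ''x'' (Suc x) t')" if "?v x = mem s (1 * G + x)" "mem t' = mem t" for t' :: state
      using t(1,2) that by (auto simp: less_Suc_eq mem_frame_def)
    show "ST E ?b t (H * 8 + 9) 0 (\<lambda>s''. ?I (Suc x) (set_reg E ''x'' (Suc x) s''))"
    proof (rule HT_If[where \<tau>a = "H * 8 + 8"])
      assume "eval E t (Ar 1 (Reg ''x'')) \<noteq> 0"
      then have "?v x = mem s (1 * G + x)" using ar by simp
      from keep[OF this refl] show "ST E Skip t (H * 8 + 8) 0 (\<lambda>s''. ?I (Suc x) (set_reg E ''x'' (Suc x) s''))"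
        by (intro HT_Skip) simp_all
    next
      assume "eval E t (Ar 1 (Reg ''x'')) = 0"
      then have z: "mem s (1 * G + x) = 0" using ar by simp
      have v: "ST E (Vote 9 ''h'') t (H * 8 + 5) 0 (\<lambda>s''. regs s'' ''cnt'' = card {i. i < H \<and> wo (regs t ''x'') (mem t (9 * G + i)) \<le> regs t ''thr''})"
        by (rule ST_Vote[OF r(1) _ r(2) H(2)]) simp_all
      show "ST E (Seq (Vote 9 ''h'') ?i) t (H * 8 + 8) 0 (\<lambda>s''. ?I (Suc x) (set_reg E ''x'' (Suc x) s''))"
      proof (rule ST_Seq[OF v, where \<tau>b = 2 and \<sigma>b = 0])
        fix t1 :: state assume t1: "regs t1 ''cnt'' = card {i. i < H \<and> wo (regs t ''x'') (mem t (9 * G + i)) \<le> regs t ''thr''}"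
          "\<forall>y. y \<notin> mods (Vote 9 ''h'') \<longrightarrow> regs t1 y = regs t y" "\<not> stores (Vote 9 ''h'') \<longrightarrow> mem t1 = mem t"
        let ?c = "card {i. i < H \<and> wo (regs t ''x'') (mem t (9 * G + i)) \<le> regs t ''thr''}"
        have r1: "regs t1 ''G'' = G" "regs t1 ''h'' = H" "regs t1 ''x'' = x" "regs t1 ''ncl'' = regs s ''ncl''" "mem t1 = mem t"
          using t1(2,3) r t(3) by simp_all
        have "?c \<le> H" by (rule card_less_le)
        then have w: "to_word E (?c + ?c) = ?c + ?c" using H by (intro to_word_small) linarith
        have me: "mem t (9 * G + i) = mem s (9 * G + i)" if "i < H" for i
          using t(2) mem_frameD[of G 1 s t i 9] that H by simp
        have pe: "pass s 9 H (regs s ''thr'') x \<longleftrightarrow> H < 2 * ?c"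
          using pass_cong[of H t 9 s "regs s ''thr''" x] me unfolding pass_def r t(3) by simp
        have cond: "eval E t1 (Less (Reg ''h'') (Add (Reg ''cnt'') (Reg ''cnt''))) \<noteq> 0 \<longleftrightarrow> pass s 9 H (regs s ''thr'') x"
          using r1(2) t1(1) w pe by (simp add: mult_2)
        show "ST E ?i t1 2 0 (\<lambda>s''. ?I (Suc x) (set_reg E ''x'' (Suc x) s''))"
        proof (rule HT_If[where \<tau>a = 1])
          assume "eval E t1 (Less (Reg ''h'') (Add (Reg ''cnt'') (Reg ''cnt''))) = 0"
          then have "?v x = mem s (1 * G + x)" using cond by simp
          from keep[OF this r1(5)] show "ST E Skip t1 1 0 (\<lambda>s''. ?I (Suc x) (set_reg E ''x'' (Suc x) s''))"
            by (intro HT_Skip) simp_all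
        next
          assume "eval E t1 (Less (Reg ''h'') (Add (Reg ''cnt'') (Reg ''cnt''))) \<noteq> 0"
          then have "pass s 9 H (regs s ''thr'') x" using cond by blast
          then have vx: "?v x = regs s ''ncl''" using z by simp
          have f: "mem_frame G 1 s (t1\<lparr>mem := (mem t)(1 * G + x := regs s ''ncl'')\<rparr>)"
            using mem_frame_upd[OF xG, of 1 s t "regs s ''ncl''"] t(2) by (simp add: mem_frame_def)
          have "?I (Suc x) (set_reg E ''x'' (Suc x) (t1\<lparr>mem := (mem t)(1 * G + x := regs s ''ncl'')\<rparr>))"
            using f t(2) vx by (simp add: less_Suc_eq)
          then show "ST E (Put 1 (Reg ''x'') (Reg ''ncl'')) t1 1 0 (\<lambda>s''. ?I (Suc x) (set_reg E ''x'' (Suc x) s''))"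
            using r1 xG by (intro ST_Put[where i = x]) simp_all
        qed simp
      qed simp_all
    qed simp
  qed (use G n \<tau> in \<open>simp_all add: add.assoc\<close>)
qed

end

section \<open>Concentration inequalities\<close>

lemma hoeffding_Pi_pmf:
  fixes f :: "'b \<Rightarrow> real" and p :: "'b pmf" and dflt :: 'b and I J :: "'i set" and a b \<epsilon> :: real
  assumes I: "finite I" and J: "J \<subseteq> I" "J \<noteq> {}" and f: "\<And>x. x \<in> set_pmf p \<Longrightarrow> f x \<in> {a..b}" and ab: "a < b"
    and e: "\<epsilon> \<ge> 0"
  defines "P \<equiv> measure_pmf (Pi_pmf I dflt (\<lambda>_. p))"
  defines "\<mu> \<equiv> card J * measure_pmf.expectation p f"
  shows "measure P {\<omega>. (\<Sum>i\<in>J. f (\<omega> i)) \<ge> \<mu> + \<epsilon>} \<le> exp (- 2 * \<epsilon>\<^sup>2 / (card J * (b - a)\<^sup>2))"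
    and "measure P {\<omega>. \<bar>(\<Sum>i\<in>J. f (\<omega> i)) - \<mu>\<bar> \<ge> \<epsilon>} \<le> 2 * exp (- 2 * \<epsilon>\<^sup>2 / (card J * (b - a)\<^sup>2))"
proof -
  have fJ: "finite J" using I J finite_subset by blast
  interpret P: prob_space P unfolding P_def by (rule measure_pmf.prob_space_axioms)
  have comp: "map_pmf (\<lambda>\<omega>. \<omega> i) (Pi_pmf I dflt (\<lambda>_. p)) = p" if "i \<in> J" for i
    using Pi_pmf_component[OF I, of i dflt "\<lambda>_. p"] that J by auto
  have E: "P.expectation (\<lambda>\<omega>. f (\<omega> i)) = measure_pmf.expectation p f" if "i \<in> J" for i
    unfolding P_def by (subst comp[OF that, symmetric]) simp
  have ind: "P.indep_vars (\<lambda>_. borel) (\<lambda>i \<omega>. f (\<omega> i)) J"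
  proof -
    have "P.indep_vars (\<lambda>_. count_space UNIV) (\<lambda>i \<omega>. \<omega> i) J"
      unfolding P_def using indep_vars_Pi_pmf[OF I, of dflt "\<lambda>_. p"] J(1)
      by (rule prob_space.indep_vars_subset[OF measure_pmf.prob_space_axioms])
    then show ?thesis by (rule P.indep_vars_compose2) auto
  qed
  interpret H: Hoeffding_ineq P J "\<lambda>i \<omega>. f (\<omega> i)" "\<lambda>_. a" "\<lambda>_. b" \<mu>
  proof unfold_locales
    show "AE \<omega> in P. f (\<omega> i) \<in> {a..b}" if "i \<in> J" for i
    proof -
      have "\<omega> i \<in> set_pmf p" if \<omega>: "\<omega> \<in> set_pmf (Pi_pmf I dflt (\<lambda>_. p))" for \<omega>
        using \<omega> \<open>i \<in> J\<close> J(1) I by (auto simp: set_Pi_pmf PiE_dflt_def)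
      then show ?thesis unfolding P_def AE_measure_pmf_iff using f by blast
    qed
    show "\<mu> \<equiv> \<Sum>i\<in>J. P.expectation (\<lambda>\<omega>. f (\<omega> i))"
      unfolding \<mu>_def by (rule eq_reflection) (simp add: E)
  qed (use fJ ind in auto)
  have pos: "0 < (\<Sum>i\<in>J. (b - a)\<^sup>2)" using ab J fJ by (simp add: card_gt_0_iff)
  have sp: "space P = UNIV" by (simp add: P_def)
  show "measure P {\<omega>. (\<Sum>i\<in>J. f (\<omega> i)) \<ge> \<mu> + \<epsilon>} \<le> exp (- 2 * \<epsilon>\<^sup>2 / (card J * (b - a)\<^sup>2))"
    using H.Hoeffding_ineq_ge[OF e pos] by (simp add: sp)
  show "measure P {\<omega>. \<bar>(\<Sum>i\<in>J. f (\<omega> i)) - \<mu>\<bar> \<ge> \<epsilon>} \<le> 2 * exp (- 2 * \<epsilon>\<^sup>2 / (card J * (b - a)\<^sup>2))"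
    using H.Hoeffding_ineq_abs_ge[OF e pos] by (simp add: sp)
qed

lemma exp_le_half_power: "exp (- x) \<le> (1 / 2) powr x" if "0 \<le> x" for x :: real
proof -
  have "(1 / 2 :: real) powr x = exp (- (x * ln 2))" by (simp add: powr_def ln_div)
  moreover have "x * ln 2 \<le> x * 1" using that ln_2_less_1 by (intro mult_left_mono) auto
  ultimately show ?thesis by simp
qed

text \<open>A set of at most \<open>k\<close> elements is encoded as a list of length exactly
  \<open>k\<close> over the elements and a padding symbol \<open>None\<close>.\<close>

lemma card_subsets_le:
  assumes "finite X"
  shows "card {C. C \<subseteq> X \<and> card C \<le> k} \<le> (card X + 1) ^ k"
proof -
  let ?A = "insert None (Some ` X)"
  let ?L = "{l. set l \<subseteq> ?A \<and> length l = k}"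
  have "{C. C \<subseteq> X \<and> card C \<le> k} \<subseteq> (\<lambda>l. {x. Some x \<in> set l}) ` ?L"
  proof
    fix C assume "C \<in> {C. C \<subseteq> X \<and> card C \<le> k}"
    then have C: "C \<subseteq> X" "card C \<le> k" by auto
    then obtain xs where xs: "set xs = C" "distinct xs" using assms finite_distinct_list finite_subset by metis
    then have "length xs = card C" using distinct_card by metis
    then have "map Some xs @ replicate (k - card C) None \<in> ?L" using C xs by auto
    moreover have "C = {x. Some x \<in> set (map Some xs @ replicate (k - card C) None)}" using xs by auto
    ultimately show "C \<in> (\<lambda>l. {x. Some x \<in> set l}) ` ?L" by (rule rev_image_eqI)
  qed
  moreover have fin: "finite ?L" by (rule finite_lists_length_eq) (use assms in auto)
  ultimately have "card {C. C \<subseteq> X \<and> card C \<le> k} \<le> card ?L"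
    by (meson card_image_le card_mono finite_imageI le_trans)
  also have "\<dots> = card ?A ^ k" by (rule card_lists_length_eq) (use assms in auto)
  also have "card ?A = card X + 1" using assms by (subst card_insert_disjoint) (auto simp: card_image)
  finally show ?thesis .
qed

lemma prob_union_bound:
  fixes \<delta> :: real
  assumes "finite I" "\<And>i. i \<in> I \<Longrightarrow> measure_pmf.prob M {\<omega>. P i \<omega>} \<le> \<delta>"
  shows "measure_pmf.prob M {\<omega>. \<exists>i\<in>I. P i \<omega>} \<le> card I * \<delta>"
proof -
  have "{\<omega>. \<exists>i\<in>I. P i \<omega>} = (\<Union>i\<in>I. {\<omega>. P i \<omega>})" by auto
  then have "measure_pmf.prob M {\<omega>. \<exists>i\<in>I. P i \<omega>} \<le> (\<Sum>i\<in>I. measure_pmf.prob M {\<omega>. P i \<omega>})"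
    using assms(1) by (auto intro!: measure_pmf.finite_measure_subadditive_finite)
  also have "\<dots> \<le> (\<Sum>i\<in>I. \<delta>)" using assms(2) by (rule sum_mono)
  finally show ?thesis by simp
qed

section \<open>Independent uniform samples\<close>

context
  fixes U :: "nat set" and N :: nat
  assumes U: "finite U" "U \<noteq> {}"
begin

abbreviation samples :: "(nat \<Rightarrow> nat) pmf" where
  "samples \<equiv> Pi_pmf {..<N} 0 (\<lambda>_. pmf_of_set U)"

lemma prob_samples_in:
  assumes "J \<subseteq> {..<N}"
  shows "measure_pmf.prob samples {\<omega>. \<forall>i\<in>J. \<omega> i \<in> A} = (card (U \<inter> A) / card U) ^ card J"
proof -
  have "{\<omega>. \<forall>i\<in>J. \<omega> i \<in> A} = Pi {..<N} (\<lambda>i. if i \<in> J then A else UNIV)"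
    using assms by (auto simp: Pi_def)
  then have "measure_pmf.prob samples {\<omega>. \<forall>i\<in>J. \<omega> i \<in> A} = (\<Prod>i<N. measure_pmf.prob (pmf_of_set U) (if i \<in> J then A else UNIV))"
    by (simp add: measure_Pi_pmf_Pi)
  also have "\<dots> = (\<Prod>i<N. if i \<in> J then measure_pmf.prob (pmf_of_set U) A else 1)"
    by (rule prod.cong) auto
  also have "\<dots> = measure_pmf.prob (pmf_of_set U) A ^ card J"
    using assms by (simp add: prod.If_cases Int_absorb1)
  finally show ?thesis using U by (simp add: measure_pmf_of_set)
qed

lemma prob_samples_miss:
  assumes "l \<le> N" "A \<subseteq> U"
  shows "measure_pmf.prob samples {\<omega>. \<forall>i<l. \<omega> i \<notin> A} = (1 - card A / card U) ^ l"
proof -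
  have "card (U \<inter> - A) = card U - card A" using assms U by (simp add: Diff_eq[symmetric] card_Diff_subset finite_subset)
  moreover have "card A \<le> card U" "card U > 0" using assms U by (auto intro: card_mono)
  ultimately have "real (card (U \<inter> - A)) / card U = 1 - card A / card U" by (simp add: of_nat_diff field_simps)
  moreover have "measure_pmf.prob samples {\<omega>. \<forall>i\<in>{..<l}. \<omega> i \<in> - A} = (card (U \<inter> - A) / card U) ^ card {..<l}"
    using assms by (intro prob_samples_in) auto
  ultimately show ?thesis by (simp add: Ball_def)
qed

text \<open>If the sample meets \<open>A\<close> in a set \<open>H\<close> of at most
  \<open>h\<close> points, then every draw avoids \<open>A - H\<close>; the union bound runs over
  the possible \<open>H\<close>. Distinct points have to be counted, not draws, because repeated
  points would not give independent voters.\<close>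

lemma prob_few_distinct_hits:
  assumes "A \<subseteq> U"
  shows "measure_pmf.prob samples {\<omega>. card (\<omega> ` {..<N} \<inter> A) \<le> h} \<le>
    real ((card U + 1) ^ h) * (1 - (real (card A) - h) / card U) ^ N"
proof -
  let ?F = "{H. H \<subseteq> A \<and> card H \<le> h}"
  have fA: "finite A" using assms U finite_subset by blast
  have "measure_pmf.prob samples {\<omega>. card (\<omega> ` {..<N} \<inter> A) \<le> h} \<le> measure_pmf.prob samples {\<omega>. \<exists>H\<in>?F. \<forall>i<N. \<omega> i \<notin> A - H}"
  proof (intro measure_pmf.finite_measure_mono subsetI)
    fix \<omega> assume "\<omega> \<in> {\<omega>. card (\<omega> ` {..<N} \<inter> A) \<le> h}"
    then show "\<omega> \<in> {\<omega>. \<exists>H\<in>?F. \<forall>i<N. \<omega> i \<notin> A - H}"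
      by (intro CollectI bexI[of _ "\<omega> ` {..<N} \<inter> A"]) auto
  qed simp
  also have "\<dots> \<le> card ?F * (1 - (real (card A) - h) / card U) ^ N"
  proof (rule prob_union_bound)
    fix H assume H: "H \<in> ?F"
    then have "card (A - H) = card A - card H" using fA by (intro card_Diff_subset) (auto intro: finite_subset)
    then have "real (card A) - h \<le> card (A - H)" using H by auto
    then have "1 - card (A - H) / card U \<le> 1 - (real (card A) - h) / card U" by (simp add: divide_right_mono)
    moreover have "card (A - H) \<le> card U" using assms U by (intro card_mono) auto
    then have "0 \<le> 1 - card (A - H) / card U" by (cases "card U = 0") (simp_all add: divide_le_eq_1)
    moreover have "measure_pmf.prob samples {\<omega>. \<forall>i<N. \<omega> i \<notin> A - H} = (1 - card (A - H) / card U) ^ N"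
      by (rule prob_samples_miss) (use assms in auto)
    ultimately show "measure_pmf.prob samples {\<omega>. \<forall>i<N. \<omega> i \<notin> A - H} \<le> (1 - (real (card A) - h) / card U) ^ N"
      by (simp only: power_mono)
  qed (use fA in auto)
  also have "\<dots> \<le> real ((card U + 1) ^ h) * (1 - (real (card A) - h) / card U) ^ N"
  proof (rule mult_right_mono)
    have "?F \<subseteq> {H. H \<subseteq> U \<and> card H \<le> h}" using assms by auto
    then have "card ?F \<le> card {H. H \<subseteq> U \<and> card H \<le> h}" using U by (intro card_mono) auto
    then show "real (card ?F) \<le> real ((card U + 1) ^ h)" using card_subsets_le[OF U(1), of h] by linarith
    have "card A \<le> card U" using assms U by (intro card_mono) auto
    then have "(real (card A) - h) / card U \<le> 1" using U by (simp add: divide_le_eq_1 card_gt_0_iff)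
    then show "0 \<le> (1 - (real (card A) - h) / card U) ^ N" by simp
  qed
  finally show ?thesis .
qed

text \<open>Union bound over the index sets of size \<open>h\<close>, of which there are at most
  \<open>N ^ h\<close>.\<close>

lemma prob_many_hits:
  assumes "R \<subseteq> U"
  shows "measure_pmf.prob samples {\<omega>. h \<le> card {i. i < N \<and> \<omega> i \<in> R}} \<le> (N * card R / card U) ^ h"
proof -
  let ?F = "{J. J \<subseteq> {..<N} \<and> card J = h}"
  have "measure_pmf.prob samples {\<omega>. h \<le> card {i. i < N \<and> \<omega> i \<in> R}} \<le> measure_pmf.prob samples {\<omega>. \<exists>J\<in>?F. \<forall>i\<in>J. \<omega> i \<in> R}"
  proof (intro measure_pmf.finite_measure_mono subsetI)
    fix \<omega> assume "\<omega> \<in> {\<omega>. h \<le> card {i. i < N \<and> \<omega> i \<in> R}}"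
    then obtain J where "J \<subseteq> {i. i < N \<and> \<omega> i \<in> R}" "card J = h" using obtain_subset_with_card_n[of h "{i. i < N \<and> \<omega> i \<in> R}"] by auto
    then show "\<omega> \<in> {\<omega>. \<exists>J\<in>?F. \<forall>i\<in>J. \<omega> i \<in> R}" by (intro CollectI bexI[of _ J]) auto
  qed simp
  also have "\<dots> \<le> card ?F * (card R / card U) ^ h"
  proof (rule prob_union_bound)
    have "?F \<subseteq> Pow {..<N}" by auto
    then show "finite ?F" by (rule finite_subset) simp
    fix J assume "J \<in> ?F"
    then show "measure_pmf.prob samples {\<omega>. \<forall>i\<in>J. \<omega> i \<in> R} \<le> (card R / card U) ^ h"
      using prob_samples_in[of J R] assms by (auto simp: Int_absorb1)
  qed
  also have "\<dots> \<le> real (N ^ h) * (card R / card U) ^ h"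
  proof (rule mult_right_mono)
    have "card ?F = N choose h" using n_subsets[of "{..<N}" h] by simp
    moreover have "N choose h \<le> N ^ h" by (cases "h \<le> N") (simp_all add: binomial_le_pow binomial_eq_0)
    ultimately show "real (card ?F) \<le> real (N ^ h)" by (simp only: of_nat_le_iff)
  qed simp
  finally show ?thesis by (simp add: power_mult_distrib[symmetric])
qed

text \<open>Bad draws must exceed their mean by 1/25 of the sample to go from 23/50 to 1/2.
  Hoeffding gives the exponent \<open>2 / 625\<close> per draw, which is more than
  \<open>1 / 320\<close>.\<close>

lemma prob_majority_bad:
  assumes bad: "real (card {z \<in> U. bad z}) \<le> 23 / 50 * card U" and N: "0 < N"
  shows "measure_pmf.prob samples {\<omega>. N \<le> 2 * card {i. i < N \<and> bad (\<omega> i)}} \<le> exp (- (real N / 320))"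
proof -
  let ?f = "\<lambda>z. of_bool (bad z) :: real"
  have "measure_pmf.expectation (pmf_of_set U) ?f = card {z \<in> U. bad z} / card U"
    using U by (simp add: integral_pmf_of_set of_bool_def sum.If_cases Int_def)
  also have "\<dots> \<le> 23 / 50" using bad U by (simp add: divide_le_eq card_gt_0_iff)
  finally have E: "N * measure_pmf.expectation (pmf_of_set U) ?f \<le> N * (23 / 50)" by (intro mult_left_mono) auto
  have "measure_pmf.prob samples {\<omega>. N \<le> 2 * card {i. i < N \<and> bad (\<omega> i)}} \<le>
     measure_pmf.prob samples {\<omega>. (\<Sum>i\<in>{..<N}. ?f (\<omega> i)) \<ge> card {..<N} * measure_pmf.expectation (pmf_of_set U) ?f + N / 25}"
  proof (intro measure_pmf.finite_measure_mono subsetI)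
    fix \<omega> assume "\<omega> \<in> {\<omega>. N \<le> 2 * card {i. i < N \<and> bad (\<omega> i)}}"
    then have "real N \<le> 2 * real (card {i. i < N \<and> bad (\<omega> i)})" by simp
    moreover have "(\<Sum>i\<in>{..<N}. ?f (\<omega> i)) = card {i. i < N \<and> bad (\<omega> i)}"
      by (simp add: of_bool_def sum.If_cases Int_def)
    ultimately show "\<omega> \<in> {\<omega>. (\<Sum>i\<in>{..<N}. ?f (\<omega> i)) \<ge> card {..<N} * measure_pmf.expectation (pmf_of_set U) ?f + N / 25}"
      using E by simp
  qed simp
  also have "\<dots> \<le> exp (- 2 * (N / 25)\<^sup>2 / (card {..<N} * (1 - 0 :: real)\<^sup>2))"
    by (rule hoeffding_Pi_pmf(1)) (use N in \<open>auto simp: lessThan_empty_iff\<close>)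
  also have "- 2 * (N / 25)\<^sup>2 / (card {..<N} * (1 - 0 :: real)\<^sup>2) = - (2 / 625) * N"
    using N by (simp add: power2_eq_square field_simps)
  also have "exp (- (2 / 625) * N) \<le> exp (- (real N / 320))" by (simp add: field_simps)
  finally show ?thesis .
qed

end

section \<open>Corruption patterns\<close>

lemma finite_pairs: "finite (pairs n)"
proof -
  have "pairs n \<subseteq> (\<lambda>(x, y). {x, y}) ` ({..<n} \<times> {..<n})" by (auto simp: pairs_def)
  then show ?thesis by (rule finite_subset) auto
qed

lemma corruption_tail:
  assumes "Q \<subseteq> pairs n" "Q \<noteq> {}" "0 \<le> \<epsilon>"
  shows "measure_pmf.prob (corruption n) {K. card {q \<in> Q. K q} \<ge> card Q / 3 + \<epsilon>} \<le> exp (- 2 * \<epsilon>\<^sup>2 / card Q)"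
proof -
  have fQ: "finite Q" using assms finite_pairs finite_subset by blast
  have "measure_pmf.expectation (bernoulli_pmf (1/3)) (of_bool :: bool \<Rightarrow> real) = 1 / 3"
    by (subst integral_bernoulli_pmf) auto
  moreover have "(\<Sum>q\<in>Q. of_bool (K q)) = real (card {q \<in> Q. K q})" for K
    using fQ by (simp add: of_bool_def sum.If_cases Int_def)
  ultimately show ?thesis
    using hoeffding_Pi_pmf(1)[OF finite_pairs assms(1,2), of "bernoulli_pmf (1/3)" "of_bool :: bool \<Rightarrow> real" 0 1 \<epsilon> False] assms(3)
    by (simp add: corruption_def)
qed

text \<open>If \<open>m\<close> points each have half of their \<open>h\<close> voters corrupted,
  then about half of the \<open>m * h\<close> pairs between the two sets are corrupted, against an
  expected third. The exponent \<open>m * h / 50\<close> grows with both sizes, so it can beat the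
  number of choices for both sets, at most \<open>(n + 1) ^ m * (n + 1) ^ h\<close>.\<close>

lemma corruption_bipartite:
  fixes m h n :: nat
  assumes m: "0 < m" and h: "100 * m \<le> h"
  shows "measure_pmf.prob (corruption n) {K. \<exists>B. B \<subseteq> {..<n} \<and> card B = h \<and>
      m \<le> card {y. y < n \<and> h \<le> 2 * card {b \<in> B. K {y, b}}}} \<le> real ((n + 1) ^ m * (n + 1) ^ h) * exp (- (real m * real h / 50))"
proof -
  let ?I = "{A. A \<subseteq> {..<n} \<and> card A \<le> m} \<times> {B. B \<subseteq> {..<n} \<and> card B \<le> h}"
  let ?Q = "\<lambda>(A, B). (\<lambda>(a, b). {a, b}) ` (A \<times> B)"
  let ?P = "\<lambda>(A, B) K. A \<inter> B = {} \<and> card A = m \<and> card {q \<in> ?Q (A, B). K q} \<ge> 49 / 100 * (m * h)"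
  have sub: "{K. \<exists>B. B \<subseteq> {..<n} \<and> card B = h \<and> m \<le> card {y. y < n \<and> h \<le> 2 * card {b \<in> B. K {y, b}}}} \<subseteq>
      {K. \<exists>i\<in>?I. ?P i K}"
  proof
    fix K assume "K \<in> {K. \<exists>B. B \<subseteq> {..<n} \<and> card B = h \<and> m \<le> card {y. y < n \<and> h \<le> 2 * card {b \<in> B. K {y, b}}}}"
    then obtain B where B: "B \<subseteq> {..<n}" "card B = h" "m \<le> card {y. y < n \<and> h \<le> 2 * card {b \<in> B. K {y, b}}}" by blast
    then obtain A where A: "A \<subseteq> {y. y < n \<and> h \<le> 2 * card {b \<in> B. K {y, b}}}" "card A = m"
      using obtain_subset_with_card_n[of m "{y. y < n \<and> h \<le> 2 * card {b \<in> B. K {y, b}}}"] by auto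
    have An: "A \<subseteq> {..<n}" using A(1) by auto
    then have fA: "finite A" "finite B" using B(1) by (simp_all add: finite_subset[OF _ finite_lessThan])
    \<comment> \<open>Voters that are themselves among the misjudged points are dropped: for
      disjoint sets the pairs \<open>{y, b}\<close> are distinct and lie in \<open>pairs n\<close>.
      At most \<open>m\<close> voters are lost.\<close>
    let ?B = "B - A"
    have "real h / 2 - m \<le> card {b \<in> ?B. K {y, b}}" if y: "y \<in> A" for y
    proof -
      have "{b \<in> B. K {y, b}} \<subseteq> {b \<in> ?B. K {y, b}} \<union> A" by auto
      then have "card {b \<in> B. K {y, b}} \<le> card ({b \<in> ?B. K {y, b}} \<union> A)" using fA by (intro card_mono) auto
      also have "\<dots> \<le> card {b \<in> ?B. K {y, b}} + card A" by (rule card_Un_le)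
      finally have "card {b \<in> B. K {y, b}} \<le> card {b \<in> ?B. K {y, b}} + m" using A(2) by simp
      moreover have "h \<le> 2 * card {b \<in> B. K {y, b}}" using A(1) y by blast
      ultimately have "h \<le> 2 * (card {b \<in> ?B. K {y, b}} + m)" by (meson le_trans mult_le_mono2)
      then have "real h \<le> real (2 * (card {b \<in> ?B. K {y, b}} + m))" by (simp only: of_nat_le_iff)
      then show ?thesis by simp
    qed
    then have "(\<Sum>y\<in>A. real h / 2 - m) \<le> (\<Sum>y\<in>A. real (card {b \<in> ?B. K {y, b}}))" by (rule sum_mono)
    also have "\<dots> = real (card (SIGMA y:A. {b \<in> ?B. K {y, b}}))" using fA by (simp add: card_SigmaI)
    also have "card (SIGMA y:A. {b \<in> ?B. K {y, b}}) = card ((\<lambda>(y, b). {y, b}) ` (SIGMA y:A. {b \<in> ?B. K {y, b}}))"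
      by (rule card_image[symmetric]) (auto simp: inj_on_def doubleton_eq_iff)
    also have "(\<lambda>(y, b). {y, b}) ` (SIGMA y:A. {b \<in> ?B. K {y, b}}) = {q \<in> ?Q (A, ?B). K q}" by auto
    finally have "m * (real h / 2 - m) \<le> card {q \<in> ?Q (A, ?B). K q}" using A by simp
    \<comment> \<open>Losing \<open>m \<le> h / 100\<close> voters costs one hundredth of
      \<open>h\<close>; 49/100 still exceeds 1/3 by more than the 1/10 used as the deviation
      below.\<close>
    moreover have "49 / 100 * (m * h) \<le> m * (real h / 2 - m)"
    proof -
      have "49 / 100 * real h \<le> real h / 2 - m" using h by linarith
      then have "m * (49 / 100 * real h) \<le> m * (real h / 2 - m)" by (intro mult_left_mono) auto
      then show ?thesis by (simp add: mult_ac)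
    qed
    moreover have "card ?B \<le> h" using B fA by (metis card_mono Diff_subset)
    ultimately show "K \<in> {K. \<exists>i\<in>?I. ?P i K}"
      using A(2) B(1) An by (intro CollectI bexI[of _ "(A, ?B)"]) (simp_all add: Int_Diff, blast+)
  qed
  have "measure_pmf.prob (corruption n) {K. ?P i K} \<le> exp (- (real m * real h / 50))" if i: "i \<in> ?I" for i
  proof -
    obtain A B where AB: "i = (A, B)" "A \<subseteq> {..<n}" "B \<subseteq> {..<n}" "card B \<le> h" using i by auto
    have fA: "finite A" "finite B" using AB finite_subset by auto
    show ?thesis
    proof (cases "A \<inter> B = {} \<and> card A = m \<and> ?Q (A, B) \<noteq> {}")
      case True
      have Qp: "?Q (A, B) \<subseteq> pairs n"
      proof
        fix q assume "q \<in> ?Q (A, B)"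
        then obtain a b where ab: "a \<in> A" "b \<in> B" "q = {a, b}" by auto
        then have "a < n" "b < n" "a \<noteq> b" using AB(2,3) True by auto
        then show "q \<in> pairs n" using ab unfolding pairs_def by blast
      qed
      have "card (?Q (A, B)) \<le> card (A \<times> B)" unfolding prod.case using fA by (intro card_image_le) simp
      also have "\<dots> = m * card B" using True by (simp add: card_cartesian_product)
      also have "\<dots> \<le> m * h" using AB(4) by simp
      finally have cQ: "card (?Q (A, B)) \<le> m * h" .
      have cQ0: "0 < card (?Q (A, B))" using True finite_subset[OF Qp finite_pairs] by (simp add: card_gt_0_iff)
      have "{K. ?P i K} \<subseteq> {K. card {q \<in> ?Q (A, B). K q} \<ge> card (?Q (A, B)) / 3 + (m * h) / 10}"
      proof
        fix K assume "K \<in> {K. ?P i K}"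
        then have "49 / 100 * (real (m * h)) \<le> card {q \<in> ?Q (A, B). K q}" using AB by simp
        moreover have "real (card (?Q (A, B))) \<le> real (m * h)" using cQ by (simp only: of_nat_le_iff)
        ultimately show "K \<in> {K. card {q \<in> ?Q (A, B). K q} \<ge> card (?Q (A, B)) / 3 + (m * h) / 10}" by simp
      qed
      then have "measure_pmf.prob (corruption n) {K. ?P i K} \<le> measure_pmf.prob (corruption n) {K. card {q \<in> ?Q (A, B). K q} \<ge> card (?Q (A, B)) / 3 + (m * h) / 10}"
        by (rule measure_pmf.finite_measure_mono) simp
      also have "\<dots> \<le> exp (- 2 * ((m * h) / 10)\<^sup>2 / card (?Q (A, B)))"
        by (rule corruption_tail[OF Qp]) (use True in auto)
      also have "\<dots> \<le> exp (- (real m * real h / 50))"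
      proof -
        have "real (m * h) * card (?Q (A, B)) \<le> real (m * h) * real (m * h)" using cQ by (intro mult_left_mono of_nat_mono) simp_all
        then have "real m * real h / 50 \<le> 2 * ((m * h) / 10)\<^sup>2 / card (?Q (A, B))"
          using cQ0 by (simp add: power2_eq_square field_simps)
        then show ?thesis by simp
      qed
      finally show ?thesis .
    next
      case False
      have "{K. ?P i K} = {}"
      proof (cases "A \<inter> B = {} \<and> card A = m")
        case True
        then have e: "?Q (A, B) = {}" using False by blast
        have "0 < 49 / 100 * real (m * h)" using m h by simp
        then show ?thesis unfolding AB(1) prod.case using e by auto
      qed (auto simp: AB)
      then show ?thesis by simp
    qed
  qed
  then have "measure_pmf.prob (corruption n) {K. \<exists>i\<in>?I. ?P i K} \<le> card ?I * exp (- (real m * real h / 50))"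
    by (intro prob_union_bound) auto
  also have "\<dots> \<le> real ((n + 1) ^ m * (n + 1) ^ h) * exp (- (real m * real h / 50))"
  proof (rule mult_right_mono)
    have "card ?I \<le> (n + 1) ^ m * (n + 1) ^ h"
      unfolding card_cartesian_product using card_subsets_le[of "{..<n}" m] card_subsets_le[of "{..<n}" h]
      by (intro mult_le_mono) auto
    then show "real (card ?I) \<le> real ((n + 1) ^ m * (n + 1) ^ h)" by (simp only: of_nat_le_iff)
  qed simp
  finally have fin: "measure_pmf.prob (corruption n) {K. \<exists>i\<in>?I. ?P i K} \<le> real ((n + 1) ^ m * (n + 1) ^ h) * exp (- (real m * real h / 50))" .
  show ?thesis by (rule order_trans[OF measure_pmf.finite_measure_mono[OF sub] fin]) simp
qed

text \<open>A ball is described by its centre \<open>t\<close> and a point \<open>y\<close> on its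
  boundary, so \<open>n ^ 3\<close> triples cover all balls and all \<open>x\<close>. The gap
  between 7/20 and 1/3 is 1/60, and Hoeffding turns it into \<open>1 / 1800\<close> per member. The
  point \<open>x\<close> is left out because it forms no pair with itself.\<close>

lemma corruption_balls:
  fixes d :: "nat \<Rightarrow> nat \<Rightarrow> nat" and h n :: nat and Bl :: "nat \<Rightarrow> nat \<Rightarrow> nat set"
  assumes h: "0 < h"
  defines "Bl \<equiv> \<lambda>t y. {z. z < n \<and> d t z \<le> d t y}"
  shows "measure_pmf.prob (corruption n) {K. \<exists>x<n. \<exists>t<n. \<exists>y<n. h + 1 \<le> card (Bl t y) \<and>
      7 / 20 * real (card (Bl t y)) < card {z \<in> Bl t y. K {x, z} \<and> z \<noteq> x}} \<le> real (n ^ 3) * exp (- (real h / 1800))"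
proof -
  let ?I = "{..<n} \<times> {..<n} \<times> {..<n}"
  let ?P = "\<lambda>(x, t, y) K. h + 1 \<le> card (Bl t y) \<and> 7 / 20 * real (card (Bl t y)) < card {z \<in> Bl t y. K {x, z} \<and> z \<noteq> x}"
  have "measure_pmf.prob (corruption n) {K. ?P i K} \<le> exp (- (real h / 1800))" if "i \<in> ?I" for i
  proof -
    obtain x t y where i: "i = (x, t, y)" "x < n" "t < n" "y < n" using \<open>i \<in> ?I\<close> by auto
    let ?B = "Bl t y - {x}"
    let ?Q = "(\<lambda>z. {x, z}) ` ?B"
    have fB: "finite (Bl t y)" by (simp add: Bl_def)
    show ?thesis
    proof (cases "h + 1 \<le> card (Bl t y)")
      case True
      have inj: "inj_on (\<lambda>z. {x, z}) ?B" by (auto simp: inj_on_def doubleton_eq_iff)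
      have cB: "h \<le> card ?B" "card ?B \<le> card (Bl t y)" using True fB by (auto simp: card_Diff_singleton_if intro: card_mono)
      have cQ: "card ?Q = card ?B" using inj by (rule card_image)
      have Qp: "?Q \<subseteq> pairs n" using i unfolding pairs_def by (fastforce simp: Bl_def)
      have eq: "card {q \<in> ?Q. K q} = card {z \<in> Bl t y. K {x, z} \<and> z \<noteq> x}" for K
      proof -
        have "{q \<in> ?Q. K q} = (\<lambda>z. {x, z}) ` {z \<in> Bl t y. K {x, z} \<and> z \<noteq> x}" by auto
        then show ?thesis by (simp add: card_image[OF inj_on_subset[OF inj]] subset_iff)
      qed
      have "measure_pmf.prob (corruption n) {K. ?P i K} \<le> measure_pmf.prob (corruption n) {K. card {q \<in> ?Q. K q} \<ge> card ?Q / 3 + card ?B / 60}"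
      proof (intro measure_pmf.finite_measure_mono subsetI)
        fix K assume "K \<in> {K. ?P i K}"
        then show "K \<in> {K. card {q \<in> ?Q. K q} \<ge> card ?Q / 3 + card ?B / 60}" using cB(2) unfolding i(1) mem_Collect_eq eq cQ by auto
      qed simp
      also have "\<dots> \<le> exp (- 2 * (card ?B / 60)\<^sup>2 / card ?Q)"
      proof (intro corruption_tail[OF Qp])
        show "?Q \<noteq> {}"
        proof
          assume "?Q = {}"
          then have "card ?Q = 0" by (simp only: card.empty)
          then show False using cQ cB(1) h by linarith
        qed
      qed simp
      also have "\<dots> \<le> exp (- (real h / 1800))"
      proof -
        have "2 * (card ?B / 60)\<^sup>2 / card ?Q = card ?B / 1800"
          using cB h unfolding cQ by (simp add: power2_eq_square)
        then show ?thesis using cB by simp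
      qed
      finally show ?thesis .
    qed (simp add: i)
  qed
  then have "measure_pmf.prob (corruption n) {K. \<exists>i\<in>?I. ?P i K} \<le> card ?I * exp (- (real h / 1800))"
    by (intro prob_union_bound) auto
  moreover have "{K. \<exists>i\<in>?I. ?P i K} = {K. \<exists>x<n. \<exists>t<n. \<exists>y<n. h + 1 \<le> card (Bl t y) \<and>
      7 / 20 * real (card (Bl t y)) < card {z \<in> Bl t y. K {x, z} \<and> z \<noteq> x}}" by auto
  ultimately show ?thesis by (simp add: card_cartesian_product power3_eq_cube mult.assoc)
qed

lemma obtain_maximizer:
  fixes f :: "'a \<Rightarrow> nat"
  assumes "finite S" "S \<noteq> {}"
  obtains y where "y \<in> S" "\<And>z. z \<in> S \<Longrightarrow> f z \<le> f y"
proof -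
  have "Max (f ` S) \<in> f ` S" using assms by (intro Max_in) auto
  then obtain y where "y \<in> S" "f y = Max (f ` S)" by auto
  then show thesis using that assms(1) by (metis Max_ge finite_imageI imageI)
qed

text \<open>The budget of the second vote: relative to \<open>z\<close>, the loss is at most 1/11
  (no growth), plus 1/99 (misjudged points), plus 7/20 of 100/99 (corruption in the ball). This sums
  to 5/11, which is below 23/50.\<close>

lemma witness_arith:
  fixes a b c e z z' m :: real
  assumes "a \<le> b + c" "c \<le> 7 / 20 * e" "10 * z \<le> 11 * z'" "99 * m \<le> z" "b + z' \<le> z + m" "e \<le> z + m" "0 \<le> m"
  shows "a \<le> 23 / 50 * z"
  using assms by linarith

locale points =
  fixes n :: nat and d :: "nat \<Rightarrow> nat \<Rightarrow> nat"
  assumes sym: "x < n \<Longrightarrow> y < n \<Longrightarrow> d x y = d y x"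
    and tri: "x < n \<Longrightarrow> y < n \<Longrightarrow> z < n \<Longrightarrow> d x z \<le> d x y + d y z"
    and self: "x < n \<Longrightarrow> d x x = 0"
begin

text \<open>The clauses quantify over all voter sets and all balls, so they apply to sets that the
  program selects adaptively from weak answers. Balls are given by a centre and a boundary point,
  which keeps their number polynomial.\<close>

definition good_pattern :: "nat \<Rightarrow> nat \<Rightarrow> (nat set \<Rightarrow> bool) \<Rightarrow> bool" where
  "good_pattern m h K \<longleftrightarrow> (\<forall>x<n. \<not> K {x}) \<and>
     (\<forall>B. B \<subseteq> {..<n} \<and> card B = h \<longrightarrow> card {y. y < n \<and> h \<le> 2 * card {b \<in> B. K {y, b}}} < m) \<and>
     (\<forall>x<n. \<forall>t<n. \<forall>y<n. h \<le> card {z. z < n \<and> d t z \<le> d t y} \<longrightarrow>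
        real (card {z. z < n \<and> d t z \<le> d t y \<and> K {x, z}}) \<le> 7 / 20 * card {z. z < n \<and> d t z \<le> d t y})"

lemma prob_bad_pattern:
  assumes m: "0 < m" and h: "100 * m \<le> h"
  shows "measure_pmf.prob (corruption n) {K. \<not> good_pattern m h K} \<le>
    real ((n + 1) ^ m * (n + 1) ^ h) * exp (- (real m * real h / 50)) + real (n ^ 3) * exp (- (real (h - 1) / 1800))"
proof -
  let ?A = "{K. \<exists>B. B \<subseteq> {..<n} \<and> card B = h \<and> m \<le> card {y. y < n \<and> h \<le> 2 * card {b \<in> B. K {y, b}}}}"
  let ?Bl = "\<lambda>t y. {z. z < n \<and> d t z \<le> d t y}"
  let ?B = "{K. \<exists>x<n. \<exists>t<n. \<exists>y<n. (h - 1) + 1 \<le> card (?Bl t y) \<and>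
      7 / 20 * real (card (?Bl t y)) < card {z \<in> ?Bl t y. K {x, z} \<and> z \<noteq> x}}"
  \<comment> \<open>\<open>corruption_balls\<close> is applied with \<open>h - 1\<close>, the number
    of members that surely remain after \<open>x\<close> is removed from a ball with
    \<open>h\<close> points.\<close>
  have h1: "h - 1 + 1 = h" "0 < h - 1" using m h by auto
  have "measure_pmf.prob (corruption n) {K. \<not> good_pattern m h K} \<le> measure_pmf.prob (corruption n) (?A \<union> ?B)"
  proof (rule measure_pmf.finite_measure_mono_AE)
    show "AE K in measure_pmf (corruption n). K \<in> {K. \<not> good_pattern m h K} \<longrightarrow> K \<in> ?A \<union> ?B"
      unfolding AE_measure_pmf_iff
    proof (intro ballI impI)
      fix K assume K: "K \<in> set_pmf (corruption n)" "K \<in> {K. \<not> good_pattern m h K}"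
      \<comment> \<open>A singleton is not a pair, and outside \<open>pairs n\<close> a pattern
        takes the default value \<open>False\<close>.\<close>
      have "{x} \<notin> pairs n" for x by (auto simp: pairs_def doubleton_eq_iff)
      then have nK: "\<not> K {x}" for x
        using subsetD[OF set_Pi_pmf_subset[OF finite_pairs] K(1)[unfolded corruption_def]] by simp
      show "K \<in> ?A \<union> ?B"
      proof (rule ccontr)
        assume n: "K \<notin> ?A \<union> ?B"
        have 1: "card {y. y < n \<and> h \<le> 2 * card {b \<in> B. K {y, b}}} < m" if "B \<subseteq> {..<n}" "card B = h" for B
        proof (rule ccontr)
          assume "\<not> ?thesis"
          then have "K \<in> ?A" using that by (intro CollectI exI[of _ B] conjI) simp_all
          with n show False by (simp only: Un_iff simp_thms)
        qed
        have 2: "real (card {z. z < n \<and> d t z \<le> d t y \<and> K {x, z}}) \<le> 7 / 20 * card (?Bl t y)"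
          if "x < n" "t < n" "y < n" "h \<le> card (?Bl t y)" for x t y
        proof -
          have "{z \<in> ?Bl t y. K {x, z} \<and> z \<noteq> x} = {z. z < n \<and> d t z \<le> d t y \<and> K {x, z}}" using nK by auto
          moreover have "\<not> 7 / 20 * real (card (?Bl t y)) < card {z \<in> ?Bl t y. K {x, z} \<and> z \<noteq> x}"
          proof
            assume "7 / 20 * real (card (?Bl t y)) < card {z \<in> ?Bl t y. K {x, z} \<and> z \<noteq> x}"
            then have "K \<in> ?B" unfolding h1(1) using that
              by (intro CollectI exI[of _ x] exI[of _ t] exI[of _ y] conjI)
            with n show False by (simp only: Un_iff simp_thms)
          qed
          ultimately show ?thesis by simp
        qed
        have "good_pattern m h K" unfolding good_pattern_def by (intro conjI allI impI) (use nK 1 2 in auto)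
        then show False using K(2) by simp
      qed
    qed
  qed simp
  also have "\<dots> \<le> measure_pmf.prob (corruption n) ?A + measure_pmf.prob (corruption n) ?B" by (rule measure_Un_le) auto
  also have "\<dots> \<le> real ((n + 1) ^ m * (n + 1) ^ h) * exp (- (real m * real h / 50)) + real (n ^ 3) * exp (- (real (h - 1) / 1800))"
    by (intro add_mono corruption_bipartite[OF m h] corruption_balls[OF h1(2)])
  finally show ?thesis .
qed

section \<open>Testing proximity by majority votes\<close>

context
  fixes m h :: nat and K :: "nat set \<Rightarrow> bool" and wo :: "nat \<Rightarrow> nat \<Rightarrow> nat"
  assumes K: "good_pattern m h K" and m: "0 < m" and h: "100 * m \<le> h"
    and wo: "\<And>x y. x < n \<Longrightarrow> y < n \<Longrightarrow> \<not> K {x, y} \<Longrightarrow> wo x y = d x y"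
begin

context
  fixes t r :: nat and B :: "nat set"
  assumes t: "t < n" and B: "B \<subseteq> {..<n}" "card B = h" "\<And>b. b \<in> B \<Longrightarrow> d t b \<le> r"
begin

definition Bad :: "nat set" where
  "Bad = {y. y < n \<and> h \<le> 2 * card {b \<in> B. K {y, b}}}"

definition Zs :: "nat \<Rightarrow> nat set" where
  "Zs j = {y. y < n \<and> h < 2 * card {b \<in> B. wo y b \<le> 2 * Suc j * r}}"

lemma finB: "finite B" using B finite_subset by blast

lemma card_Bad: "card Bad < m"
  using K B unfolding good_pattern_def Bad_def by blast

lemma fin_Bad [simp]: "finite Bad" "finite (Zs j)" by (simp_all add: Bad_def Zs_def)

lemma Zs_mono: "j \<le> j' \<Longrightarrow> Zs j \<subseteq> Zs j'"
proof
  fix y assume *: "j \<le> j'" "y \<in> Zs j"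
  have "2 * Suc j * r \<le> 2 * Suc j' * r" using *(1) by (intro mult_le_mono) auto
  then have "{b \<in> B. wo y b \<le> 2 * Suc j * r} \<subseteq> {b \<in> B. wo y b \<le> 2 * Suc j' * r}"
    by (intro Collect_mono) (meson order_trans)
  then have "card {b \<in> B. wo y b \<le> 2 * Suc j * r} \<le> card {b \<in> B. wo y b \<le> 2 * Suc j' * r}"
    using finB by (intro card_mono) auto
  then show "y \<in> Zs j'" using *(2) by (auto simp: Zs_def)
qed

text \<open>Inner half of a sandwich: an honest voter within \<open>r\<close> of \<open>t\<close>
  sees \<open>y\<close> at distance at most \<open>(2 * j + 1) * r + r\<close>, which is exactly the
  threshold of scale \<open>j\<close>, and honest voters are a strict majority.\<close>

lemma near_in_Zs:
  assumes "y < n" "y \<notin> Bad" "d t y \<le> (2 * j + 1) * r"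
  shows "y \<in> Zs j"
proof -
  have "B - {b \<in> B. K {y, b}} \<subseteq> {b \<in> B. wo y b \<le> 2 * Suc j * r}"
  proof
    fix b assume b: "b \<in> B - {b \<in> B. K {y, b}}"
    then have bn: "b < n" using B by auto
    have "wo y b = d y b" using b bn assms wo by auto
    also have "\<dots> \<le> d y t + d t b" using tri assms t bn by blast
    also have "\<dots> \<le> (2 * j + 1) * r + r" using assms sym[of y t] t B(3)[of b] b by fastforce
    finally show "b \<in> {b \<in> B. wo y b \<le> 2 * Suc j * r}" using b by (auto simp: algebra_simps)
  qed
  then have "card (B - {b \<in> B. K {y, b}}) \<le> card {b \<in> B. wo y b \<le> 2 * Suc j * r}"
    using finB by (intro card_mono) auto
  moreover have "card (B - {b \<in> B. K {y, b}}) = h - card {b \<in> B. K {y, b}}"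
    using finB B by (subst card_Diff_subset) auto
  moreover have "2 * card {b \<in> B. K {y, b}} < h" using assms by (auto simp: Bad_def)
  ultimately show ?thesis using assms by (auto simp: Zs_def)
qed

text \<open>Outer half of the sandwich: among the accepting voters one is honest, and the detour
  through it adds \<open>r\<close> to the threshold. The outer radius of scale \<open>j\<close> is
  the inner radius of scale \<open>j + 1\<close>, so up to \<open>Bad\<close> the accepted sets
  interleave with true balls; this fixes the spacing \<open>2 * r\<close> of the thresholds.\<close>

lemma Zs_near:
  assumes "y \<in> Zs j" "y \<notin> Bad"
  shows "d t y \<le> (2 * j + 3) * r"
proof -
  have y: "y < n" "h < 2 * card {b \<in> B. wo y b \<le> 2 * Suc j * r}" "2 * card {b \<in> B. K {y, b}} < h"
    using assms by (auto simp: Zs_def Bad_def)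
  have "\<not> {b \<in> B. wo y b \<le> 2 * Suc j * r} \<subseteq> {b \<in> B. K {y, b}}"
  proof
    assume "{b \<in> B. wo y b \<le> 2 * Suc j * r} \<subseteq> {b \<in> B. K {y, b}}"
    then have "card {b \<in> B. wo y b \<le> 2 * Suc j * r} \<le> card {b \<in> B. K {y, b}}" using finB by (intro card_mono) auto
    then show False using y by linarith
  qed
  then obtain b where b: "b \<in> B" "wo y b \<le> 2 * Suc j * r" "\<not> K {y, b}" by blast
  then have bn: "b < n" using B by auto
  have "d t y \<le> d t b + d b y" using tri t bn y by blast
  also have "\<dots> \<le> r + 2 * Suc j * r" using B(3)[OF b(1)] b wo[OF y(1) bn] sym[OF bn y(1)] by simp
  finally show ?thesis by (simp add: algebra_simps)
qed

text \<open>The voters themselves lie within \<open>r\<close> of \<open>t\<close>, so all of them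
  outside \<open>Bad\<close> are accepted at every scale.\<close>

lemma card_Zs_ge: "h - m \<le> card (Zs j)"
proof -
  have "B - Bad \<subseteq> Zs j"
  proof
    fix b assume b: "b \<in> B - Bad"
    then have "d t b \<le> (2 * j + 1) * r" using B(3)[of b] by (simp add: trans_le_add1)
    then show "b \<in> Zs j" using B(1) b by (intro near_in_Zs) auto
  qed
  then have "card (B - Bad) \<le> card (Zs j)" by (intro card_mono) auto
  moreover have "h - card Bad \<le> card (B - Bad)" using B(2) diff_card_le_card_Diff[of Bad B] by simp
  ultimately show ?thesis using card_Bad by linarith
qed

text \<open>Growth at all scales would start from at least one point and multiply by more than 11/10
  each time, exceeding \<open>n\<close> within \<open>H\<close> scales.\<close>

lemma growth_stops:
  assumes "real n < (11 / 10) ^ (H - 1)" "0 < H"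
  shows "\<exists>j<H. \<not> 11 * (if j = 0 then 0 else card (Zs (j - 1))) < 10 * card (Zs j)"
proof (rule ccontr)
  assume "\<not> ?thesis"
  then have g: "11 * (if j = 0 then 0 else card (Zs (j - 1))) < 10 * card (Zs j)" if "j < H" for j using that by blast
  have "(11 / 10) ^ j \<le> real (card (Zs j))" if "j < H" for j
    using that
  proof (induction j)
    case 0
    then show ?case using g[of 0] by simp
  next
    case (Suc j)
    then have "(11 / 10) ^ j \<le> real (card (Zs j))" by simp
    moreover have "11 * real (card (Zs j)) \<le> 10 * real (card (Zs (Suc j)))" using g[OF Suc.prems] by simp
    ultimately show ?case by simp
  qed
  then have "(11 / 10) ^ (H - 1) \<le> real (card (Zs (H - 1)))" using assms by simp
  moreover have "card (Zs (H - 1)) \<le> n" unfolding Zs_def by (rule card_mono[of "{..<n}", simplified]) auto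
  ultimately show False using assms by linarith
qed

text \<open>A member \<open>z\<close> of the accepted set can mislead \<open>x\<close> in two ways.
  It may lie outside the true ball of radius \<open>(2 * j + 1) * r\<close>; but that ball contains
  the previous accepted set up to \<open>Bad\<close>, which is nearly as large. Or its pair with
  \<open>x\<close> may be corrupted; but inside the ball this happens for at most 7/20 of the
  members, and the ball is hardly larger than the accepted set.\<close>

lemma few_bad_witnesses:
  assumes j: "\<not> 11 * (if j = 0 then 0 else card (Zs (j - 1))) < 10 * card (Zs j)" and x: "x < n"
  shows "real (card {z \<in> Zs j. (2 * j + 1) * r < d t z \<or> K {x, z}}) \<le> 23 / 50 * card (Zs j)"
proof -
  have "0 < card (Zs j)" using card_Zs_ge[of j] m h by linarith
  \<comment> \<open>At scale 0 a stall would mean an empty set, contradicting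
    \<open>card_Zs_ge\<close>; so a stalled scale has a predecessor.\<close>
  then have j0: "0 < j" using j by (cases j) auto
  let ?Bl = "{z. z < n \<and> d t z \<le> (2 * j + 1) * r}"
  have fBl: "finite ?Bl" by simp
  have "Zs (j - 1) - Bad \<subseteq> ?Bl"
  proof
    fix y assume "y \<in> Zs (j - 1) - Bad"
    then have "d t y \<le> (2 * (j - 1) + 3) * r" "y < n" using Zs_near by (auto simp: Zs_def)
    moreover have "2 * (j - 1) + 3 = 2 * j + 1" using j0 by simp
    ultimately show "y \<in> ?Bl" by (simp only: mem_Collect_eq)
  qed
  then have "{z \<in> Zs j. (2 * j + 1) * r < d t z} \<subseteq> (Zs j - Zs (j - 1)) \<union> Bad" by auto
  then have "card {z \<in> Zs j. (2 * j + 1) * r < d t z} \<le> card ((Zs j - Zs (j - 1)) \<union> Bad)" by (intro card_mono) auto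
  also have "\<dots> \<le> card (Zs j - Zs (j - 1)) + card Bad" by (rule card_Un_le)
  also have "card (Zs j - Zs (j - 1)) = card (Zs j) - card (Zs (j - 1))" using Zs_mono[of "j - 1" j] by (intro card_Diff_subset) auto
  finally have 1: "card {z \<in> Zs j. (2 * j + 1) * r < d t z} + card (Zs (j - 1)) \<le> card (Zs j) + m"
    using card_Bad card_mono[OF fin_Bad(2) Zs_mono[of "j - 1" j]] by linarith
  have BBl: "B \<subseteq> ?Bl" using B(1) B(3) by (auto simp: trans_le_add1)
  then have hB: "h \<le> card ?Bl" using card_mono[OF fBl BBl] B(2) by simp
  have 2: "real (card {z \<in> ?Bl. K {x, z}}) \<le> 7 / 20 * card ?Bl"
  proof -
    have ne: "?Bl \<noteq> {}" 
    proof
      assume "?Bl = {}"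
      then have "h \<le> card ({} :: nat set)" using hB by (simp only:)
      then show False using m h by simp
    qed
    \<comment> \<open>\<open>good_pattern\<close> speaks only of balls with a point on the boundary;
      shrinking the radius to the farthest member leaves the ball unchanged.\<close>
    then obtain y where y: "y \<in> ?Bl" "\<And>z. z \<in> ?Bl \<Longrightarrow> d t z \<le> d t y" using obtain_maximizer[OF fBl] by blast
    have "?Bl = {z. z < n \<and> d t z \<le> d t y}"
    proof (intro equalityI subsetI)
      fix z assume "z \<in> {z. z < n \<and> d t z \<le> d t y}"
      then have "z < n" "d t z \<le> d t y" by blast+
      moreover have "d t y \<le> (2 * j + 1) * r" using y(1) by blast
      ultimately show "z \<in> ?Bl" using order_trans by blast
    qed (use y(2) in blast)
    moreover have "{z \<in> ?Bl. K {x, z}} = {z. z < n \<and> d t z \<le> (2 * j + 1) * r \<and> K {x, z}}" by auto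
    moreover have "{z. z < n \<and> d t z \<le> (2 * j + 1) * r \<and> K {x, z}} = {z. z < n \<and> d t z \<le> d t y \<and> K {x, z}}"
      using calculation(1) by blast
    moreover have "y < n" using y by simp
    ultimately show ?thesis using K x t hB unfolding good_pattern_def by (metis (no_types, lifting))
  qed
  have "?Bl - Bad \<subseteq> Zs j" using near_in_Zs by auto
  then have "?Bl \<subseteq> Zs j \<union> Bad" by auto
  then have "card ?Bl \<le> card (Zs j \<union> Bad)" by (intro card_mono) auto
  then have 3: "card ?Bl \<le> card (Zs j) + m" using card_Un_le[of "Zs j" Bad] card_Bad by linarith
  have "{z \<in> Zs j. (2 * j + 1) * r < d t z \<or> K {x, z}} \<subseteq> {z \<in> Zs j. (2 * j + 1) * r < d t z} \<union> {z \<in> ?Bl. K {x, z}}"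
    by (auto simp: Zs_def)
  then have "card {z \<in> Zs j. (2 * j + 1) * r < d t z \<or> K {x, z}} \<le> card ({z \<in> Zs j. (2 * j + 1) * r < d t z} \<union> {z \<in> ?Bl. K {x, z}})"
    by (intro card_mono) auto
  also have "\<dots> \<le> card {z \<in> Zs j. (2 * j + 1) * r < d t z} + card {z \<in> ?Bl. K {x, z}}" by (rule card_Un_le)
  finally have 4: "real (card {z \<in> Zs j. (2 * j + 1) * r < d t z \<or> K {x, z}}) \<le>
     real (card {z \<in> Zs j. (2 * j + 1) * r < d t z}) + real (card {z \<in> ?Bl. K {x, z}})" by linarith
  have 5: "10 * real (card (Zs j)) \<le> 11 * real (card (Zs (j - 1)))" using j j0 by simp
  have 6: "99 * real m \<le> card (Zs j)" using card_Zs_ge[of j] h by linarith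
  have 7: "real (card {z \<in> Zs j. (2 * j + 1) * r < d t z}) + real (card (Zs (j - 1))) \<le> real (card (Zs j)) + m" using 1 by linarith
  have 8: "real (card ?Bl) \<le> real (card (Zs j)) + m" using 3 by linarith
  show ?thesis by (rule witness_arith[OF 4 2 5 6 7 8 of_nat_0_le_iff])
qed

text \<open>Unlike the first vote, this one errs on no point, provided that good witnesses form a
  majority for each. Completeness needs \<open>r + (2 * j + 1) * r\<close>, the threshold itself;
  soundness gives \<open>(4 * j + 3) * r\<close>, rounded up. The gap between \<open>r\<close> and
  \<open>4 * Suc j * r\<close> is the price: points in between may go either way.\<close>

lemma vote_correct:
  fixes \<omega> :: "nat \<Rightarrow> nat"
  assumes x: "x < n" and \<omega>: "\<And>i. i < H \<Longrightarrow> \<omega> i < n"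
    and maj: "2 * card {i. i < H \<and> ((2 * j + 1) * r < d t (\<omega> i) \<or> K {x, \<omega> i})} < H"
  shows "d t x \<le> r \<Longrightarrow> H < 2 * card {i. i < H \<and> wo x (\<omega> i) \<le> 2 * Suc j * r}"
    and "H < 2 * card {i. i < H \<and> wo x (\<omega> i) \<le> 2 * Suc j * r} \<Longrightarrow> d t x \<le> 4 * Suc j * r"
proof -
  let ?bad = "{i. i < H \<and> ((2 * j + 1) * r < d t (\<omega> i) \<or> K {x, \<omega> i})}"
  let ?good = "{i. i < H \<and> wo x (\<omega> i) \<le> 2 * Suc j * r}"
  {
    assume dx: "d t x \<le> r"
    have "{..<H} - ?bad \<subseteq> ?good"
    proof
      fix i assume i: "i \<in> {..<H} - ?bad"
      then have "wo x (\<omega> i) = d x (\<omega> i)" using wo x \<omega> by auto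
      also have "\<dots> \<le> d x t + d t (\<omega> i)" using tri x t \<omega> i by auto
      also have "\<dots> \<le> r + (2 * j + 1) * r" using dx i sym[OF x t] by auto
      finally show "i \<in> ?good" using i by (auto simp: algebra_simps)
    qed
    then have "card ({..<H} - ?bad) \<le> card ?good" by (intro card_mono) auto
    moreover have "card ({..<H} - ?bad) = H - card ?bad" by (subst card_Diff_subset) auto
    ultimately show "H < 2 * card ?good" using maj by linarith
  }
  {
    assume p: "H < 2 * card ?good"
    have "\<not> ?good \<subseteq> ?bad"
    proof
      assume "?good \<subseteq> ?bad"
      then have "card ?good \<le> card ?bad" by (intro card_mono) auto
      then show False using p maj by linarith
    qed
    then obtain i where i0: "i \<in> ?good" "i \<notin> ?bad" by blast
    then have i: "i < H" "wo x (\<omega> i) \<le> 2 * Suc j * r" by blast+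
    have i': "\<not> (2 * j + 1) * r < d t (\<omega> i)" "\<not> K {x, \<omega> i}" using i0(2) i(1) by blast+
    have "d t x \<le> d t (\<omega> i) + d (\<omega> i) x" using tri t x \<omega>[OF i(1)] by blast
    also have "\<dots> \<le> (2 * j + 1) * r + 2 * Suc j * r"
      using i(2) i' wo[OF x \<omega>[OF i(1)] i'(2)] sym[OF x \<omega>[OF i(1)]] by (intro add_mono) linarith+
    also have "\<dots> \<le> 4 * Suc j * r" by (simp add: algebra_simps)
    finally show "d t x \<le> 4 * Suc j * r" .
  }
qed

end

end

section \<open>Uniform samples of an unclustered set\<close>

definition near :: "nat set \<Rightarrow> nat \<Rightarrow> nat" where
  "near C x = Min (d x ` C)"

lemma near_le: "finite C \<Longrightarrow> c \<in> C \<Longrightarrow> near C x \<le> d x c"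
  by (simp add: near_def)

lemma near_attained:
  assumes "finite C" "C \<noteq> {}"
  obtains c where "c \<in> C" "near C x = d x c"
proof -
  have "Min (d x ` C) \<in> d x ` C" using assms by (intro Min_in) auto
  then obtain c where "c \<in> C" "Min (d x ` C) = d x c" by blast
  then show thesis using that unfolding near_def by blast
qed

lemma near_Lipschitz:
  assumes "C \<subseteq> {..<n}" "C \<noteq> {}" "x < n" "y < n"
  shows "near C x \<le> d x y + near C y"
proof -
  have fC: "finite C" using assms finite_subset by blast
  obtain c where c: "c \<in> C" "near C y = d y c" using near_attained[OF fC assms(2)] by blast
  have "near C x \<le> d x c" using near_le[OF fC c(1)] .
  also have "\<dots> \<le> d x y + d y c" using tri assms c by blast
  finally show ?thesis using c by simp
qed

text \<open>The points served by \<open>c\<close> whose cost is at most twice the average over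
  \<open>U\<close>, multiplied out to avoid division. With ties a point may belong to several
  cores.\<close>

definition core :: "nat set \<Rightarrow> nat set \<Rightarrow> nat \<Rightarrow> nat set" where
  "core C U c = {x \<in> U. card U * near C x \<le> 2 * (\<Sum>x\<in>U. near C x) \<and> d x c = near C x}"

definition large :: "nat \<Rightarrow> nat set \<Rightarrow> nat set \<Rightarrow> nat set" where
  "large k C U = {c \<in> C. card U \<le> 4 * k * card (core C U c)}"

lemma core_diam:
  assumes "U \<subseteq> {..<n}" "C \<subseteq> {..<n}" "c \<in> C" "x \<in> core C U c" "y \<in> core C U c"
  shows "card U * d x y \<le> 4 * (\<Sum>x\<in>U. near C x)"
proof -
  have "x < n" "y < n" "c < n" using assms by (auto simp: core_def)
  then have "d x y \<le> d x c + d c y" using tri by blast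
  also have "\<dots> = near C x + near C y" using assms sym[of c y] by (auto simp: core_def)
  finally have "card U * d x y \<le> card U * near C x + card U * near C y"
    by (metis distrib_left mult_le_mono2)
  then show ?thesis using assms by (auto simp: core_def)
qed

text \<open>By Markov's inequality at most half of \<open>U\<close> costs more than twice the
  average. At most \<open>k\<close> cores fail to be large, each smaller than a
  \<open>1 / (4 * k)\<close> fraction, so they account for at most another quarter.\<close>

lemma core_cover:
  assumes U: "U \<subseteq> {..<n}" and C: "C \<subseteq> {..<n}" "C \<noteq> {}" "card C \<le> k"
  shows "card U \<le> 4 * card (\<Union>c\<in>large k C U. core C U c)"
proof -
  let ?S = "\<Sum>x\<in>U. near C x" and ?u = "card U"
  have fU: "finite U" and fC: "finite C" using U C finite_subset by auto
  let ?bad = "{x \<in> U. 2 * ?S < ?u * near C x}"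
  have bad: "2 * card ?bad \<le> ?u"
  proof (cases "?S = 0")
    case True
    then have "near C x = 0" if "x \<in> U" for x using fU that by simp
    then have "?bad = {}" by auto
    then show ?thesis by (simp only: card.empty)
  next
    case False
    have "card ?bad * (2 * ?S) \<le> (\<Sum>x\<in>?bad. ?u * near C x)"
      using sum_bounded_below[of ?bad "2 * ?S" "\<lambda>x. ?u * near C x"] by (simp add: less_imp_le)
    also have "\<dots> \<le> (\<Sum>x\<in>U. ?u * near C x)" using fU by (intro sum_mono2) auto
    also have "\<dots> = ?u * ?S" by (simp add: sum_distrib_left)
    finally show ?thesis using False by (simp add: mult_ac)
  qed
  have "U \<subseteq> ?bad \<union> (\<Union>c\<in>large k C U. core C U c) \<union> (\<Union>c\<in>C - large k C U. core C U c)"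
  proof
    fix x assume x: "x \<in> U"
    obtain c where "c \<in> C" "near C x = d x c" using near_attained[OF fC C(2)] by blast
    then show "x \<in> ?bad \<union> (\<Union>c\<in>large k C U. core C U c) \<union> (\<Union>c\<in>C - large k C U. core C U c)"
      using x by (auto simp: core_def not_less)
  qed
  moreover have fin: "finite (core C U c)" for c using fU by (simp add: core_def)
  moreover have fl: "finite (large k C U)" using fC by (simp add: large_def)
  ultimately have "?u \<le> card (?bad \<union> (\<Union>c\<in>large k C U. core C U c) \<union> (\<Union>c\<in>C - large k C U. core C U c))"
    using fU fC by (intro card_mono) auto
  also have "\<dots> \<le> card ?bad + card (\<Union>c\<in>large k C U. core C U c) + card (\<Union>c\<in>C - large k C U. core C U c)"
    by (meson card_Un_le add_le_mono1 le_trans)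
  finally have 1: "?u \<le> card ?bad + card (\<Union>c\<in>large k C U. core C U c) + card (\<Union>c\<in>C - large k C U. core C U c)" .
  have "card (\<Union>c\<in>C - large k C U. core C U c) \<le> (\<Sum>c\<in>C - large k C U. card (core C U c))"
    using fC by (intro card_UN_le) auto
  then have "4 * k * card (\<Union>c\<in>C - large k C U. core C U c) \<le> (\<Sum>c\<in>C - large k C U. 4 * k * card (core C U c))"
    by (simp add: sum_distrib_left[symmetric])
  also have "\<dots> \<le> (\<Sum>c\<in>C - large k C U. ?u)" by (intro sum_mono) (auto simp: large_def)
  also have "\<dots> \<le> k * ?u" using C(3) card_mono[OF fC, of "C - large k C U"] by (auto intro!: mult_le_mono1)
  finally have "4 * card (\<Union>c\<in>C - large k C U. core C U c) \<le> ?u \<or> k = 0" by (cases "k = 0") (simp_all add: mult_ac)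
  moreover have "k \<noteq> 0" using C fC by (metis card_eq_0_iff le_zero_eq)
  ultimately show ?thesis using 1 bad by linarith
qed

text \<open>The members \<open>y\<close> of \<open>U\<close> for which the ball around
  \<open>t\<close> reaching out to \<open>y\<close> holds less than a \<open>1 / (2 * N)\<close>
  fraction of \<open>U\<close>.\<close>

definition sparse :: "nat \<Rightarrow> nat set \<Rightarrow> nat \<Rightarrow> nat set" where
  "sparse N U t = {y \<in> U. 2 * N * card {z \<in> U. d t z \<le> d t y} < card U}"

text \<open>Balls around a fixed centre are nested, so the ball reaching to the farthest sparse
  point contains all sparse points and is itself too small.\<close>

lemma card_sparse:
  assumes "finite U"
  shows "2 * N * card (sparse N U t) \<le> card U"
proof (cases "sparse N U t = {}")
  case False
  have fin: "finite (sparse N U t)" using assms by (simp add: sparse_def)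
  then obtain y where y: "y \<in> sparse N U t" "\<And>z. z \<in> sparse N U t \<Longrightarrow> d t z \<le> d t y"
    using obtain_maximizer[OF fin False] by blast
  then have "sparse N U t \<subseteq> {z \<in> U. d t z \<le> d t y}" by (auto simp: sparse_def)
  then have "card (sparse N U t) \<le> card {z \<in> U. d t z \<le> d t y}" using assms by (intro card_mono) auto
  then have "2 * N * card (sparse N U t) \<le> 2 * N * card {z \<in> U. d t z \<le> d t y}" by simp
  also have "\<dots> < card U" using y by (simp add: sparse_def)
  finally show ?thesis by simp
qed simp

text \<open>The first clause supplies a candidate centre in a large core, the second makes its core
  contribute \<open>h\<close> distinct voters, and the third forbids balls that catch
  \<open>h\<close> samples while containing few points. The third is uniform in \<open>t\<close>
  because the centre is selected from the sample itself.\<close>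

definition good_sample :: "nat \<Rightarrow> nat \<Rightarrow> nat \<Rightarrow> nat set \<Rightarrow> nat set \<Rightarrow> (nat \<Rightarrow> nat) \<Rightarrow> bool" where
  "good_sample k h N C U \<omega> \<longleftrightarrow> (\<exists>i<h. \<omega> i \<in> (\<Union>c\<in>large k C U. core C U c)) \<and>
     (\<forall>c\<in>large k C U. h \<le> card (\<omega> ` {..<N} \<inter> core C U c)) \<and>
     (\<forall>t\<in>U. card {i. i < N \<and> \<omega> i \<in> sparse N U t} < h)"

text \<open>The three summands match the clauses of \<open>good_sample\<close>. Large cores cover a
  quarter of \<open>U\<close>. A large core has \<open>card U / (4 * k)\<close> points, and since
  \<open>8 * k * h < card U\<close>, discarding \<open>h\<close> of them leaves a
  \<open>1 / (8 * k)\<close> fraction. A sparse set is expected to receive at most half a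
  sample.\<close>

lemma prob_bad_sample:
  assumes U: "U \<subseteq> {..<n}" "8 * k * h < card U" and C: "C \<subseteq> {..<n}" "C \<noteq> {}" "card C \<le> k" and h: "h \<le> N" "0 < h"
  shows "measure_pmf.prob (Pi_pmf {..<N} 0 (\<lambda>_. pmf_of_set U)) {\<omega>. \<not> good_sample k h N C U \<omega>} \<le>
    (3 / 4) ^ h + real k * (real ((n + 1) ^ h) * (1 - 1 / (8 * real k)) ^ N) + real n * (1 / 2) ^ h"
proof -
  let ?M = "Pi_pmf {..<N} 0 (\<lambda>_. pmf_of_set U)"
  let ?A = "\<Union>c\<in>large k C U. core C U c"
  have fU: "finite U" "U \<noteq> {}" and fC: "finite C" using U C finite_subset by auto
  have k: "0 < k" using C fC by (metis card_eq_0_iff le_zero_eq neq0_conv)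
  have u: "0 < card U" using U by linarith
  have cu: "card U \<le> n" using card_mono[OF finite_lessThan U(1)] by simp
  have "?A \<subseteq> U" by (auto simp: core_def)
  have 1: "measure_pmf.prob ?M {\<omega>. \<forall>i<h. \<omega> i \<notin> ?A} \<le> (3 / 4) ^ h"
  proof -
    have "real (card U) \<le> 4 * card ?A" using core_cover[OF U(1) C] by linarith
    then have "1 - card ?A / card U \<le> 3 / 4" using u by (simp add: field_simps)
    moreover have "card ?A \<le> card U" using fU \<open>?A \<subseteq> U\<close> by (intro card_mono) auto
    then have "0 \<le> 1 - card ?A / card U" using u by simp
    ultimately show ?thesis unfolding prob_samples_miss[OF fU h(1) \<open>?A \<subseteq> U\<close>] by (intro power_mono)
  qed
  have 2: "measure_pmf.prob ?M {\<omega>. \<exists>c\<in>large k C U. card (\<omega> ` {..<N} \<inter> core C U c) < h} \<le>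
      real k * (real ((n + 1) ^ h) * (1 - 1 / (8 * real k)) ^ N)"
  proof -
    have "measure_pmf.prob ?M {\<omega>. \<exists>c\<in>large k C U. card (\<omega> ` {..<N} \<inter> core C U c) < h} \<le>
        card (large k C U) * (real ((n + 1) ^ h) * (1 - 1 / (8 * real k)) ^ N)"
    proof (rule prob_union_bound)
      fix c assume c: "c \<in> large k C U"
      have sub: "core C U c \<subseteq> U" by (auto simp: core_def)
      have "measure_pmf.prob ?M {\<omega>. card (\<omega> ` {..<N} \<inter> core C U c) < h} \<le> measure_pmf.prob ?M {\<omega>. card (\<omega> ` {..<N} \<inter> core C U c) \<le> h}"
        by (intro measure_pmf.finite_measure_mono) auto
      also have "\<dots> \<le> real ((card U + 1) ^ h) * (1 - (real (card (core C U c)) - h) / card U) ^ N"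
        by (rule prob_few_distinct_hits[OF fU sub])
      also have "\<dots> \<le> real ((n + 1) ^ h) * (1 - 1 / (8 * real k)) ^ N"
      proof (intro mult_mono power_mono of_nat_mono)
        have "real (card U) \<le> real (4 * k * card (core C U c))" using c by (simp only: large_def of_nat_le_iff mem_Collect_eq)
        moreover have "real (8 * k * h) < real (card U)" using U by (simp only: of_nat_less_iff)
        ultimately have "real (card U) \<le> 8 * k * (real (card (core C U c)) - h)" by (simp add: algebra_simps)
        then show "1 - (real (card (core C U c)) - h) / card U \<le> 1 - 1 / (8 * real k)"
          using u k by (simp add: field_simps)
        have "card (core C U c) \<le> card U" using sub fU by (intro card_mono)
        then have "(real (card (core C U c)) - h) / card U \<le> 1" using u by (simp add: divide_le_eq_1)
        then show "0 \<le> 1 - (real (card (core C U c)) - h) / card U" "0 \<le> (1 - (real (card (core C U c)) - h) / card U) ^ N"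
          by simp_all
      qed (use cu in auto)
      finally show "measure_pmf.prob ?M {\<omega>. card (\<omega> ` {..<N} \<inter> core C U c) < h} \<le> real ((n + 1) ^ h) * (1 - 1 / (8 * real k)) ^ N" .
    qed (use fC in \<open>simp add: large_def\<close>)
    also have "\<dots> \<le> real k * (real ((n + 1) ^ h) * (1 - 1 / (8 * real k)) ^ N)"
    proof (rule mult_right_mono)
      have "card (large k C U) \<le> card C" using fC by (intro card_mono) (auto simp: large_def)
      then show "real (card (large k C U)) \<le> real k" using C by linarith
      have "1 / (8 * real k) \<le> 1" using k by (simp add: divide_le_eq_1)
      then show "0 \<le> real ((n + 1) ^ h) * (1 - 1 / (8 * real k)) ^ N" by simp
    qed
    finally show ?thesis .
  qed
  have 3: "measure_pmf.prob ?M {\<omega>. \<exists>t\<in>U. h \<le> card {i. i < N \<and> \<omega> i \<in> sparse N U t}} \<le> real n * (1 / 2) ^ h"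
  proof -
    have "measure_pmf.prob ?M {\<omega>. \<exists>t\<in>U. h \<le> card {i. i < N \<and> \<omega> i \<in> sparse N U t}} \<le> card U * (1 / 2) ^ h"
    proof (rule prob_union_bound[OF fU(1)])
      fix t
      have "measure_pmf.prob ?M {\<omega>. h \<le> card {i. i < N \<and> \<omega> i \<in> sparse N U t}} \<le> (N * card (sparse N U t) / card U) ^ h"
        by (rule prob_many_hits[OF fU]) (auto simp: sparse_def)
      also have "\<dots> \<le> (1 / 2) ^ h"
      proof (intro power_mono)
        have "real (2 * N * card (sparse N U t)) \<le> real (card U)" using card_sparse[OF fU(1)] by (simp only: of_nat_le_iff)
        then show "real (N * card (sparse N U t)) / card U \<le> 1 / 2" using u by (simp add: field_simps)
      qed simp
      finally show "measure_pmf.prob ?M {\<omega>. h \<le> card {i. i < N \<and> \<omega> i \<in> sparse N U t}} \<le> (1 / 2) ^ h" .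
    qed
    also have "\<dots> \<le> real n * (1 / 2) ^ h" using cu by (intro mult_right_mono) auto
    finally show ?thesis .
  qed
  have "{\<omega>. \<not> good_sample k h N C U \<omega>} \<subseteq> ({\<omega>. \<forall>i<h. \<omega> i \<notin> ?A} \<union> {\<omega>. \<exists>c\<in>large k C U. card (\<omega> ` {..<N} \<inter> core C U c) < h}) \<union>
      {\<omega>. \<exists>t\<in>U. h \<le> card {i. i < N \<and> \<omega> i \<in> sparse N U t}}"
    unfolding good_sample_def not_less[symmetric] by blast
  then have "measure_pmf.prob ?M {\<omega>. \<not> good_sample k h N C U \<omega>} \<le> measure_pmf.prob ?M (({\<omega>. \<forall>i<h. \<omega> i \<notin> ?A} \<union> {\<omega>. \<exists>c\<in>large k C U. card (\<omega> ` {..<N} \<inter> core C U c) < h}) \<union>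
      {\<omega>. \<exists>t\<in>U. h \<le> card {i. i < N \<and> \<omega> i \<in> sparse N U t}})"
    by (intro measure_pmf.finite_measure_mono) auto
  also have "\<dots> \<le> measure_pmf.prob ?M ({\<omega>. \<forall>i<h. \<omega> i \<notin> ?A} \<union> {\<omega>. \<exists>c\<in>large k C U. card (\<omega> ` {..<N} \<inter> core C U c) < h}) +
      measure_pmf.prob ?M {\<omega>. \<exists>t\<in>U. h \<le> card {i. i < N \<and> \<omega> i \<in> sparse N U t}}" by (rule measure_Un_le) auto
  also have "\<dots> \<le> (measure_pmf.prob ?M {\<omega>. \<forall>i<h. \<omega> i \<notin> ?A} + measure_pmf.prob ?M {\<omega>. \<exists>c\<in>large k C U. card (\<omega> ` {..<N} \<inter> core C U c) < h}) +
      measure_pmf.prob ?M {\<omega>. \<exists>t\<in>U. h \<le> card {i. i < N \<and> \<omega> i \<in> sparse N U t}}"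
    by (intro add_right_mono measure_Un_le) auto
  also have "\<dots> \<le> (3 / 4) ^ h + real k * (real ((n + 1) ^ h) * (1 - 1 / (8 * real k)) ^ N) + real n * (1 / 2) ^ h"
    by (intro add_mono 1 2 3)
  finally show ?thesis .
qed

text \<open>Some sample among the first \<open>h\<close> lies in a large core, and the farthest
  sample of the same core serves as \<open>y\<close>. Two core points are each within twice the
  average cost of their common centre, whence the factor 4.\<close>

lemma good_sample_best:
  assumes U: "U \<subseteq> {..<n}" and C: "C \<subseteq> {..<n}" and g: "good_sample k h N C U \<omega>" and h: "0 < h"
  defines "T \<equiv> \<omega> ` {..<N}"
  obtains i y where "i < h" "y \<in> T" "h \<le> card {y' \<in> T. d (\<omega> i) y' \<le> d (\<omega> i) y}"
    "card U * d (\<omega> i) y \<le> 4 * (\<Sum>x\<in>U. near C x)"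
proof -
  obtain i c where i: "i < h" "c \<in> large k C U" "\<omega> i \<in> core C U c" using g by (auto simp: good_sample_def)
  let ?Q = "T \<inter> core C U c"
  have hQ: "h \<le> card ?Q" using g i by (auto simp: good_sample_def T_def)
  have fT: "finite T" by (simp add: T_def)
  have ne: "?Q \<noteq> {}" using hQ h by (intro notI) (simp only: card.empty)
  have fQ: "finite ?Q" using fT by simp
  obtain y where y: "y \<in> ?Q" "\<And>z. z \<in> ?Q \<Longrightarrow> d (\<omega> i) z \<le> d (\<omega> i) y"
    using obtain_maximizer[OF fQ ne, of "d (\<omega> i)"] by blast
  then have "?Q \<subseteq> {y' \<in> T. d (\<omega> i) y' \<le> d (\<omega> i) y}" by auto
  then have "card ?Q \<le> card {y' \<in> T. d (\<omega> i) y' \<le> d (\<omega> i) y}" using fT by (intro card_mono) auto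
  moreover have "card U * d (\<omega> i) y \<le> 4 * (\<Sum>x\<in>U. near C x)"
    using i y(1) by (intro core_diam[OF U C, of c]) (auto simp: large_def)
  ultimately show thesis using that[OF i(1), of y] y(1) hQ by auto
qed

text \<open>The \<open>h\<close> voters cannot all be sparse, since fewer than \<open>h\<close>
  draws are; one non-sparse voter within \<open>r\<close> of \<open>t\<close> already forces the
  ball of radius \<open>r\<close> to be rich.\<close>

lemma good_sample_rich:
  assumes U: "finite U" and g: "good_sample k h N C U \<omega>" and t: "t \<in> U" and \<omega>: "\<And>i. i < N \<Longrightarrow> \<omega> i \<in> U"
    and B: "B \<subseteq> \<omega> ` {..<N}" "card B = h" "\<And>b. b \<in> B \<Longrightarrow> d t b \<le> r"
  shows "card U \<le> 2 * N * card {z \<in> U. d t z \<le> r}"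
proof -
  have "\<not> B \<subseteq> sparse N U t"
  proof
    assume "B \<subseteq> sparse N U t"
    then have "B \<subseteq> \<omega> ` {i. i < N \<and> \<omega> i \<in> sparse N U t}" using B(1) by auto
    then have "h \<le> card {i. i < N \<and> \<omega> i \<in> sparse N U t}" using surj_card_le[of "{i. i < N \<and> \<omega> i \<in> sparse N U t}" B \<omega>] B(2) by simp
    then show False using g t by (auto simp: good_sample_def)
  qed
  then obtain b where b: "b \<in> B" "b \<notin> sparse N U t" by blast
  then have "b \<in> U" using B(1) \<omega> by auto
  then have "card U \<le> 2 * N * card {z \<in> U. d t z \<le> d t b}" using b by (auto simp: sparse_def)
  also have "\<dots> \<le> 2 * N * card {z \<in> U. d t z \<le> r}"
    using U B(3)[OF b(1)] by (intro mult_le_mono2 card_mono) auto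
  finally show ?thesis .
qed

section \<open>Sampling a cluster\<close>

text \<open>The cost function \<open>near C\<close> is 1-Lipschitz, so on a cluster of radius
  \<open>\<nu>\<close> it varies within an interval of length \<open>2 * \<nu>\<close>, however far
  the centres in \<open>C\<close> are. Allowing an error proportional to
  \<open>card P * \<nu>\<close> therefore gives an exponent that depends on neither the cluster nor
  \<open>C\<close>, and the union bound over \<open>C\<close> costs
  \<open>(n + 1) ^ k\<close>.\<close>

lemma prob_cluster_sample:
  fixes \<eta> :: real and M \<nu> :: nat
  assumes P: "P \<subseteq> {..<n}" "P \<noteq> {}" and t: "t < n" "\<And>x. x \<in> P \<Longrightarrow> d t x \<le> \<nu>" and M: "0 < M" and \<eta>: "0 < \<eta>"
  shows "measure_pmf.prob (Pi_pmf {..<M} 0 (\<lambda>_. pmf_of_set P))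
     {\<omega>. \<exists>C. C \<subseteq> {..<n} \<and> C \<noteq> {} \<and> card C \<le> k \<and>
        \<eta> * (2 * card P * \<nu>) < \<bar>card P / M * (\<Sum>i<M. real (near C (\<omega> i))) - (\<Sum>x\<in>P. real (near C x))\<bar>}
     \<le> real ((n + 1) ^ k) * (2 * exp (- 2 * M * \<eta>\<^sup>2))"
proof -
  let ?I = "{C. C \<subseteq> {..<n} \<and> card C \<le> k}"
  let ?M = "Pi_pmf {..<M} 0 (\<lambda>_. pmf_of_set P)"
  have fP: "finite P" using P finite_subset by blast
  have cP: "0 < card P" using P fP by (simp add: card_gt_0_iff)
  let ?dev = "\<lambda>C \<omega>. \<bar>card P / M * (\<Sum>i<M. real (near C (\<omega> i))) - (\<Sum>x\<in>P. real (near C x))\<bar>"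
  have one: "measure_pmf.prob ?M {\<omega>. C \<noteq> {} \<and> \<eta> * (2 * card P * \<nu>) < ?dev C \<omega>} \<le> 2 * exp (- 2 * M * \<eta>\<^sup>2)"
    if C: "C \<subseteq> {..<n}" for C
  proof (cases "C = {}")
    case False
    have lip: "real (near C x) \<in> {real (near C t) - \<nu>..real (near C t) + \<nu>}" if x: "x \<in> P" for x
    proof -
      have xn: "x < n" using x P by auto
      then have "near C x \<le> d x t + near C t" "near C t \<le> d t x + near C x" "d x t = d t x"
        using near_Lipschitz[OF C False xn t(1)] near_Lipschitz[OF C False t(1) xn] sym[OF xn t(1)] by auto
      then show ?thesis using t(2)[OF x] by auto
    qed
    have E: "measure_pmf.expectation (pmf_of_set P) (\<lambda>x. real (near C x)) = (\<Sum>x\<in>P. real (near C x)) / card P"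
      using fP P by (simp add: integral_pmf_of_set)
    have dev: "?dev C \<omega> = card P / M * \<bar>(\<Sum>i<M. real (near C (\<omega> i))) - M * ((\<Sum>x\<in>P. real (near C x)) / card P)\<bar>" for \<omega>
    proof -
      have "card P / M * (\<Sum>i<M. real (near C (\<omega> i))) - (\<Sum>x\<in>P. real (near C x)) =
          card P / M * ((\<Sum>i<M. real (near C (\<omega> i))) - M * ((\<Sum>x\<in>P. real (near C x)) / card P))"
        using M cP by (simp add: field_simps)
      then show ?thesis by (simp add: abs_mult)
    qed
    show ?thesis
    \<comment> \<open>For radius 0 Hoeffding's interval degenerates; the cost is then constant on
      \<open>P\<close> and the estimate is exact.\<close>
    proof (cases "\<nu> = 0")
      case True
      have "?dev C \<omega> \<le> 0" if \<omega>: "\<omega> \<in> set_pmf ?M" for \<omega>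
      proof -
        have "\<omega> i \<in> P" if "i < M" for i
          using \<omega> that fP P by (auto simp: set_Pi_pmf PiE_dflt_def set_pmf_of_set)
        then have "(\<Sum>i<M. real (near C (\<omega> i))) = M * near C t" using lip True by (simp add: sum.cong)
        moreover have "(\<Sum>x\<in>P. real (near C x)) = card P * near C t" using lip True by (simp add: sum.cong)
        ultimately show ?thesis using M by simp
      qed
      then have "measure_pmf.prob ?M {\<omega>. C \<noteq> {} \<and> \<eta> * (2 * card P * \<nu>) < ?dev C \<omega>} = 0"
        using True by (subst measure_pmf.prob_eq_0) (auto simp: AE_measure_pmf_iff not_less)
      then show ?thesis by simp
    next
      case False
      have "measure_pmf.prob ?M {\<omega>. C \<noteq> {} \<and> \<eta> * (2 * card P * \<nu>) < ?dev C \<omega>} \<le>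
         measure_pmf.prob ?M {\<omega>. \<bar>(\<Sum>i\<in>{..<M}. real (near C (\<omega> i))) - card {..<M} * measure_pmf.expectation (pmf_of_set P) (\<lambda>x. real (near C x))\<bar> \<ge> \<eta> * M * (2 * \<nu>)}"
      proof (intro measure_pmf.finite_measure_mono subsetI)
        fix \<omega> assume "\<omega> \<in> {\<omega>. C \<noteq> {} \<and> \<eta> * (2 * card P * \<nu>) < ?dev C \<omega>}"
        then have "\<eta> * (2 * card P * \<nu>) < card P / M * \<bar>(\<Sum>i<M. real (near C (\<omega> i))) - M * ((\<Sum>x\<in>P. real (near C x)) / card P)\<bar>"
          unfolding dev by simp
        then have "card P * (\<eta> * M * (2 * \<nu>)) < card P * \<bar>(\<Sum>i<M. real (near C (\<omega> i))) - M * ((\<Sum>x\<in>P. real (near C x)) / card P)\<bar>"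
          using M by (simp add: field_simps)
        then show "\<omega> \<in> {\<omega>. \<bar>(\<Sum>i\<in>{..<M}. real (near C (\<omega> i))) - card {..<M} * measure_pmf.expectation (pmf_of_set P) (\<lambda>x. real (near C x))\<bar> \<ge> \<eta> * M * (2 * \<nu>)}"
          using cP unfolding E by simp
      qed simp
      also have "\<dots> \<le> 2 * exp (- 2 * (\<eta> * M * (2 * \<nu>))\<^sup>2 / (card {..<M} * ((real (near C t) + \<nu>) - (real (near C t) - \<nu>))\<^sup>2))"
        by (rule hoeffding_Pi_pmf(2)) (use lip fP P M \<eta> False in \<open>auto simp: set_pmf_of_set lessThan_empty_iff\<close>)
      also have "- 2 * (\<eta> * M * (2 * \<nu>))\<^sup>2 / (card {..<M} * ((real (near C t) + \<nu>) - (real (near C t) - \<nu>))\<^sup>2) = - 2 * M * \<eta>\<^sup>2"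
        using M False by (simp add: power2_eq_square field_simps)
      finally show ?thesis .
    qed
  qed simp
  have "measure_pmf.prob ?M {\<omega>. \<exists>C\<in>?I. C \<noteq> {} \<and> \<eta> * (2 * card P * \<nu>) < ?dev C \<omega>} \<le> card ?I * (2 * exp (- 2 * M * \<eta>\<^sup>2))"
    by (rule prob_union_bound) (use one in auto)
  also have "\<dots> \<le> real ((n + 1) ^ k) * (2 * exp (- 2 * M * \<eta>\<^sup>2))"
    using card_subsets_le[of "{..<n}" k] by (intro mult_right_mono of_nat_mono) auto
  also have "{\<omega>. \<exists>C\<in>?I. C \<noteq> {} \<and> \<eta> * (2 * card P * \<nu>) < ?dev C \<omega>} = {\<omega>. \<exists>C. C \<subseteq> {..<n} \<and> C \<noteq> {} \<and> card C \<le> k \<and> \<eta> * (2 * card P * \<nu>) < ?dev C \<omega>}"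
    by auto
  finally show ?thesis .
qed

end

section \<open>One clustering step\<close>

definition Scan :: com where
  "Scan = Seq (Assign ''prev'' (Const 0)) (Seq (Assign ''done'' (Const 0)) Scales)"

definition Ballc :: "strong_mode \<Rightarrow> com" where
  "Ballc mode = Seq (Assign ''t'' (Reg ''bt'')) (Seq (Dists mode) (Seq Collect_ball Scan))"

definition Choose :: "strong_mode \<Rightarrow> com" where
  "Choose mode = Seq (Assign ''bf'' (Const 0)) (Seq (Assign ''br'' (Const 0)) (Seq (Assign ''bt'' (Const 0)) (Seq (Best mode) (Ballc mode))))"

text \<open>Marking the samples and then filtering the marked points removes repetitions: voters
  have to be distinct points.\<close>

definition Prep :: "strong_mode \<Rightarrow> com" where
  "Prep mode = Seq Clear (Seq Mark (Seq (Filter 5 ''tl'' Skip (Ar 4 (Reg ''x''))) (Choose mode)))"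

lemma mods_prep [simp]:
  "mods Scan = {''prev'', ''done'', ''j'', ''thr'', ''zl'', ''x'', ''cnt'', ''vi'', ''w''}"
  "mods (Ballc mode) = {''t'', ''i'', ''dd'', ''bl'', ''prev'', ''done'', ''j'', ''thr'', ''zl'', ''x'', ''cnt'', ''vi'', ''w''}"
  "mods (Choose mode) = {''bf'', ''br'', ''bt'', ''c'', ''t'', ''i'', ''dd'', ''cnt'', ''vi'', ''bl'', ''prev'', ''done'', ''j'', ''thr'', ''zl'', ''x'', ''w''}"
  "mods (Prep mode) = {''tl'', ''bf'', ''br'', ''bt'', ''c'', ''t'', ''i'', ''dd'', ''cnt'', ''vi'', ''bl'', ''prev'', ''done'', ''j'', ''thr'', ''zl'', ''x'', ''w''}"
  unfolding Scan_def Ballc_def Choose_def Prep_def by auto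

lemma stores_prep [simp]: "stores Scan" "stores (Ballc mode)" "stores (Choose mode)" "stores (Prep mode)"
  unfolding Scan_def Ballc_def Choose_def Prep_def by auto

text \<open>The bound \<open>dist_small\<close> covers the largest threshold of the scan,
  \<open>2 * Suc j * br\<close> with \<open>j < h\<close> and \<open>br\<close> a true
  distance.\<close>

locale clustering = machine E G + points n d for E G n d +
  fixes h N :: nat
  assumes env: "num_points E = n" "true_dist E = d"
    and sizes: "n \<le> G" "h \<le> G" "N \<le> G" "0 < h" "h \<le> N"
    and dist_small: "\<And>x y. x < n \<Longrightarrow> y < n \<Longrightarrow> 2 * h * d x y < 2 ^ word_size E"
begin

lemma td_eq: "x < n \<Longrightarrow> y < n \<Longrightarrow> td x y = d x y"
proof -
  assume *: "x < n" "y < n"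
  have "d x y \<le> 2 * h * d x y" using sizes by simp
  then have "d x y < 2 ^ word_size E" using dist_small[OF *] by linarith
  then show ?thesis using * by (simp add: answer_def env to_word_id)
qed

definition fixed :: "state \<Rightarrow> bool" where
  "fixed s \<longleftrightarrow> regs s ''G'' = G \<and> regs s ''n'' = n \<and> regs s ''h'' = h \<and> regs s ''N'' = N"

text \<open>The set that the machine actually computes, meaningful for a voter set of any size; it
  agrees with \<open>Zs\<close> as soon as \<open>card B = h\<close>.\<close>

definition ZZ :: "nat set \<Rightarrow> nat \<Rightarrow> nat \<Rightarrow> nat set" where
  "ZZ B b j = {x. x < n \<and> card B < 2 * card {b' \<in> B. wo x b' \<le> 2 * Suc j * b}}"

definition scanned :: "nat set \<Rightarrow> nat \<Rightarrow> nat \<Rightarrow> state \<Rightarrow> bool" where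
  "scanned B b j s \<longleftrightarrow> j < h \<and> regs s ''thr'' = 2 * Suc j * b \<and> regs s ''zl'' = card (ZZ B b j) \<and>
     bij_betw (\<lambda>i. mem s (8 * G + i)) {..<card (ZZ B b j)} (ZZ B b j) \<and>
     (\<not> grows (\<lambda>j. card (ZZ B b j)) j \<or> (\<forall>j<h. grows (\<lambda>j. card (ZZ B b j)) j))"

lemma pass_image:
  assumes "inj_on (\<lambda>i. mem s (j * G + i)) {..<l}"
  shows "pass s j l \<rho> x \<longleftrightarrow> card ((\<lambda>i. mem s (j * G + i)) ` {..<l}) <
     2 * card {b \<in> (\<lambda>i. mem s (j * G + i)) ` {..<l}. wo x b \<le> \<rho>}"
proof -
  let ?f = "\<lambda>i. mem s (j * G + i)"
  have "{b \<in> ?f ` {..<l}. wo x b \<le> \<rho>} = ?f ` {i. i < l \<and> wo x (?f i) \<le> \<rho>}" by auto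
  moreover have "inj_on ?f {i. i < l \<and> wo x (?f i) \<le> \<rho>}" by (rule inj_on_subset[OF assms]) auto
  ultimately have "card {b \<in> ?f ` {..<l}. wo x b \<le> \<rho>} = card {i. i < l \<and> wo x (?f i) \<le> \<rho>}"
    by (simp add: card_image)
  then show ?thesis using card_image[OF assms] by (simp add: pass_def)
qed

lemma ST_Scan:
  assumes f: "fixed s" and l: "regs s ''bl'' = l" "l \<le> h" and b: "regs s ''br'' = b" "2 * h * b < 2 ^ word_size E"
    and inj: "inj_on (\<lambda>i. mem s (7 * G + i)) {..<l}"
    and \<tau>: "h * (n * (h * 8 + 13) + 15) + 7 \<le> \<tau>"
  shows "ST E Scan s \<tau> \<sigma> (\<lambda>s'. mem_frame G 8 s s' \<and> (\<exists>j. scanned ((\<lambda>i. mem s (7 * G + i)) ` {..<l}) b j s'))"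
proof -
  let ?B = "(\<lambda>i. mem s (7 * G + i)) ` {..<l}"
  let ?s1 = "set_reg E ''prev'' 0 s" 
  let ?s2 = "set_reg E ''done'' 0 ?s1"
  have Z: "{x. x < n \<and> pass ?s2 7 l (2 * Suc j * b) x} = ZZ ?B b j" for j
    using pass_image[of ?s2 7 l] inj by (simp add: ZZ_def)
  have 3: "ST E Scales ?s2 (h * (n * (h * 8 + 13) + 15) + 3) 0 (\<lambda>s'. mem_frame G 8 s s' \<and> (\<exists>j. scanned ?B b j s'))"
  proof (rule ST_conseq[OF ST_Scales[where n = n and H = h and l = l and b = b, OF _ _ sizes(1) _ l(2) _ sizes(2,4) _ b(2) _ _ order_refl, of ?s2 0]])
    fix s' :: state
    assume "mem_frame G 8 ?s2 s' \<and> (\<exists>j<h. regs s' ''thr'' = 2 * Suc j * b \<and>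
        regs s' ''zl'' = card {x. x < n \<and> pass ?s2 7 l (2 * Suc j * b) x} \<and>
        bij_betw (\<lambda>i. mem s' (8 * G + i)) {..<card {x. x < n \<and> pass ?s2 7 l (2 * Suc j * b) x}} {x. x < n \<and> pass ?s2 7 l (2 * Suc j * b) x} \<and>
        (\<not> grows (\<lambda>j. card {x. x < n \<and> pass ?s2 7 l (2 * Suc j * b) x}) j \<or> (\<forall>j<h. grows (\<lambda>j. card {x. x < n \<and> pass ?s2 7 l (2 * Suc j * b) x}) j)))"
    then show "mem_frame G 8 s s' \<and> (\<exists>j. scanned ?B b j s')" unfolding Z scanned_def by (simp only: mem_frame_set_reg)
  qed (use f l b in \<open>simp_all add: fixed_def\<close>)
  have 1: "ST E (Assign ''prev'' (Const 0)) s 1 0 (\<lambda>t. t = ?s1)" by (rule HT_Assign) simp_all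
  have 2: "ST E (Assign ''done'' (Const 0)) ?s1 1 0 (\<lambda>t. t = ?s2)" by (rule HT_Assign) simp_all
  have 4: "ST E (Seq (Assign ''done'' (Const 0)) Scales) ?s1 (h * (n * (h * 8 + 13) + 15) + 5) 0 (\<lambda>s'. mem_frame G 8 s s' \<and> (\<exists>j. scanned ?B b j s'))"
    by (rule ST_Seq[OF 2, where \<tau>b = "h * (n * (h * 8 + 13) + 15) + 3" and \<sigma>b = 0]) (use 3 in simp_all)
  show ?thesis
    unfolding Scan_def by (rule ST_Seq[OF 1, where \<tau>b = "h * (n * (h * 8 + 13) + 15) + 5" and \<sigma>b = 0]) (use 4 \<tau> in simp_all)
qed

lemma ST_Ballc:
  fixes s :: state
  defines "T \<equiv> \<lambda>i. mem s (5 * G + i)"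
  assumes f: "fixed s" and N': "regs s ''tl'' = N'" "N' \<le> N" and T: "inj_on T {..<N'}" "\<And>i. i < N' \<Longrightarrow> T i < n"
    and t: "regs s ''bt'' = t" "t < n" and b: "regs s ''br'' = b" "2 * h * b < 2 ^ word_size E"
    and \<tau>: "h * (n * (h * 8 + 13) + 15) + N * 18 + 20 \<le> \<tau>" and \<sigma>: "N * 2 \<le> \<sigma>"
  shows "ST E (Ballc mode) s \<tau> \<sigma> (\<lambda>s'. mem_frames G {6, 7, 8} s s' \<and> (\<exists>B j. scanned B b j s' \<and>
     card B = min h (card {i. i < N' \<and> d t (T i) \<le> b}) \<and> B \<subseteq> T ` {i. i < N' \<and> d t (T i) \<le> b}))"
proof -
  let ?P = "\<lambda>s'. mem_frames G {6, 7, 8} s s' \<and> (\<exists>B j. scanned B b j s' \<and>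
     card B = min h (card {i. i < N' \<and> d t (T i) \<le> b}) \<and> B \<subseteq> T ` {i. i < N' \<and> d t (T i) \<le> b})"
  let ?ts = "h * (n * (h * 8 + 13) + 15)"
  have N'G: "N' \<le> G" using N' sizes by simp
  let ?s1 = "set_reg E ''t'' t s"
  have tw: "to_word E t = t" using t sizes by (simp add: to_word_small)
  have 1: "ST E (Assign ''t'' (Reg ''bt'')) s 1 0 (\<lambda>s'. s' = ?s1)" by (rule HT_Assign) (use t in simp_all)
  have 2: "ST E (Dists mode) ?s1 (N * 10 + 3) (N * 2) (\<lambda>s'. (\<forall>i<N'. mem s' (6 * G + i) = td (regs ?s1 ''t'') (mem ?s1 (5 * G + i))) \<and> mem_frame G 6 ?s1 s')"
    by (rule ST_Dists[OF _ _ N'G]) (use f N' in \<open>simp_all add: fixed_def\<close>)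
  have 3: "ST E (Seq Collect_ball Scan) s2 (N * 8 + ?ts + 13) 0 ?P"
    if s2: "(\<forall>i<N'. mem s2 (6 * G + i) = td (regs ?s1 ''t'') (mem ?s1 (5 * G + i))) \<and> mem_frame G 6 ?s1 s2"
      "\<forall>x. x \<notin> mods (Dists mode) \<longrightarrow> regs s2 x = regs ?s1 x" for s2
  proof -
    have r: "fixed s2" "regs s2 ''tl'' = N'" "regs s2 ''br'' = b" "regs s2 ''G'' = G" "regs s2 ''h'' = h" using s2(2) f N' b by (simp_all add: fixed_def)
    have T2: "mem s2 (5 * G + i) = T i" if "i < N'" for i
      using s2(1) mem_frameD[of G 6 ?s1 s2 i 5] that N'G by (simp add: T_def)
    have D2: "mem s2 (6 * G + i) = d t (T i)" if "i < N'" for i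
      using s2(1) that td_eq[OF t(2) T(2)[OF that]] tw by (simp add: T_def)
    have S: "{i. i < N' \<and> mem s2 (6 * G + i) \<le> regs s2 ''br''} = {i. i < N' \<and> d t (T i) \<le> b}"
      using D2 r(3) by auto
    have inj2: "inj_on (\<lambda>i. mem s2 (5 * G + i)) {..<N'}"
      using T(1) by (rule inj_on_cong[THEN iffD1, rotated]) (simp add: T2)
    have im2: "(\<lambda>i. mem s2 (5 * G + i)) ` {i. i < N' \<and> d t (T i) \<le> b} = T ` {i. i < N' \<and> d t (T i) \<le> b}"
      by (rule image_cong) (use T2 in auto)
    note cb = ST_Collect_ball[OF r(4) r(2) N'G r(5) sizes(2) inj2 order_refl, of 0, unfolded S im2]
    show ?thesis
    proof (rule ST_Seq[OF cb, where \<tau>b = "?ts + 7" and \<sigma>b = 0])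
      fix s3 :: state
      assume s3: "regs s3 ''bl'' = min h (card {i. i < N' \<and> d t (T i) \<le> b}) \<and>
        inj_on (\<lambda>i. mem s3 (7 * G + i)) {..<regs s3 ''bl''} \<and>
        (\<lambda>i. mem s3 (7 * G + i)) ` {..<regs s3 ''bl''} \<subseteq> T ` {i. i < N' \<and> d t (T i) \<le> b} \<and> mem_frame G 7 s2 s3"
        "\<forall>x. x \<notin> mods Collect_ball \<longrightarrow> regs s3 x = regs s2 x"
      have s3': "regs s3 ''bl'' = min h (card {i. i < N' \<and> d t (T i) \<le> b})" "inj_on (\<lambda>i. mem s3 (7 * G + i)) {..<regs s3 ''bl''}"
        "(\<lambda>i. mem s3 (7 * G + i)) ` {..<regs s3 ''bl''} \<subseteq> T ` {i. i < N' \<and> d t (T i) \<le> b}" "mem_frame G 7 s2 s3"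
        using s3(1) by blast+
      have r3: "fixed s3" "regs s3 ''br'' = b" using s3(2) r by (simp_all add: fixed_def)
      have bl: "regs s3 ''bl'' \<le> h" using s3'(1) by simp
      show "ST E Scan s3 (?ts + 7) 0 ?P"
      proof (rule ST_conseq[OF ST_Scan[OF r3(1) refl bl r3(2) b(2) s3'(2) order_refl, of 0] order_refl order_refl])
        fix s' :: state
        assume s': "mem_frame G 8 s3 s' \<and> (\<exists>j. scanned ((\<lambda>i. mem s3 (7 * G + i)) ` {..<regs s3 ''bl''}) b j s')"
        have "mem_frames G {6, 7, 8} s s2" by (rule mem_framesI[of G 6]) (use s2(1) in simp_all)
        moreover have "mem_frames G {6, 7, 8} s2 s3" by (rule mem_framesI[of G 7]) (use s3'(4) in simp_all)
        moreover have "mem_frames G {6, 7, 8} s3 s'" by (rule mem_framesI[of G 8]) (use s' in simp_all)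
        ultimately have "mem_frames G {6, 7, 8} s s'" using mem_frames_trans[OF _ _ subset_refl subset_refl] by blast
        moreover have "card ((\<lambda>i. mem s3 (7 * G + i)) ` {..<regs s3 ''bl''}) = min h (card {i. i < N' \<and> d t (T i) \<le> b})"
          using card_image[OF s3'(2)] s3'(1) by simp
        ultimately show "?P s'" using s' s3'(3) by blast
      qed
    qed (use N' in simp_all)
  qed
  have 4: "ST E (Seq (Dists mode) (Seq Collect_ball Scan)) ?s1 (N * 18 + ?ts + 17) (N * 2) ?P"
    by (rule ST_Seq[OF 2, where \<tau>b = "N * 8 + ?ts + 13" and \<sigma>b = 0]) (use 3 in simp_all)
  show ?thesis
    unfolding Ballc_def by (rule ST_Seq[OF 1, where \<tau>b = "N * 18 + ?ts + 17" and \<sigma>b = "N * 2"]) (use 4 \<tau> \<sigma> in simp_all)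
qed

text \<open>A conditional statement, because no sampled ball need contain \<open>h\<close> samples.
  If one does, then \<open>b\<close> is at most its radius and \<open>B\<close> consists of
  \<open>h\<close> samples within \<open>b\<close> of one of the candidate centres.\<close>

definition chosen :: "(nat \<Rightarrow> nat) \<Rightarrow> nat set \<Rightarrow> nat set \<Rightarrow> nat \<Rightarrow> bool" where
  "chosen \<omega> T B b \<longleftrightarrow> (\<forall>c<h. \<forall>y\<in>T. h \<le> card {y' \<in> T. d (\<omega> c) y' \<le> d (\<omega> c) y} \<longrightarrow>
     b \<le> d (\<omega> c) y \<and> B \<subseteq> T \<and> card B = h \<and> (\<exists>t\<in>\<omega> ` {..<h}. \<forall>b'\<in>B. d t b' \<le> b))"

lemma card_image_Collect:
  "inj_on f {..<N'} \<Longrightarrow> card {y \<in> f ` {..<N'}. P y} = card {i. i < N' \<and> P (f i)}" for N' :: nat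
proof -
  assume inj: "inj_on f {..<N'}"
  have "{y \<in> f ` {..<N'}. P y} = f ` {i. i < N' \<and> P (f i)}" by auto
  moreover have "inj_on f {i. i < N' \<and> P (f i)}" by (rule inj_on_subset[OF inj]) auto
  ultimately show ?thesis by (simp add: card_image)
qed

lemma ST_Choose:
  fixes s :: state
  defines "T \<equiv> \<lambda>i. mem s (5 * G + i)" and "\<omega> \<equiv> \<lambda>i. mem s (3 * G + i)"
  assumes f: "fixed s" and N': "regs s ''tl'' = N'" "N' \<le> N" and T: "inj_on T {..<N'}" "\<And>i. i < N' \<Longrightarrow> T i < n"
    and \<omega>: "\<And>i. i < h \<Longrightarrow> \<omega> i < n"
    and \<tau>: "h * (N * N * 5 + N * 26 + 12) + h * (n * (h * 8 + 13) + 15) + N * 18 + 30 \<le> \<tau>" and \<sigma>: "h * (N * 2) + N * 2 \<le> \<sigma>"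
  shows "ST E (Choose mode) s \<tau> \<sigma> (\<lambda>s'. mem_frames G {6, 7, 8} s s' \<and> (\<exists>B b j. scanned B b j s' \<and>
     B \<subseteq> {..<n} \<and> chosen \<omega> (T ` {..<N'}) B b))"
proof -
  let ?P = "\<lambda>s'. mem_frames G {6, 7, 8} s s' \<and> (\<exists>B b j. scanned B b j s' \<and> B \<subseteq> {..<n} \<and> chosen \<omega> (T ` {..<N'}) B b)"
  let ?tb = "h * (n * (h * 8 + 13) + 15) + N * 18 + 20"
  let ?t1 = "h * (N * N * 5 + N * 26 + 12) + 3"
  let ?s3 = "set_reg E ''bt'' 0 (set_reg E ''br'' 0 (set_reg E ''bf'' 0 s))"
  have N'G: "N' \<le> G" using N' sizes by simp
  have n0: "0 < n" using \<omega>[of 0] sizes by simp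
  define val where "val = (\<lambda>(c, i). td (\<omega> c) (T i))"
  define ok where "ok = (\<lambda>(c, i). h \<le> card {i'. i' < N' \<and> val (c, i') \<le> val (c, i)})"
  have "ST E (Best mode) ?s3 (h * (N' * N' * 5 + N' * 26 + 12) + 3) (h * (N' * 2)) (\<lambda>s'. best_inv ok val \<omega> ({..<h} \<times> {..<N'}) s' \<and> mem_frame G 6 ?s3 s')"
  proof -
    note * = ST_Best[where s = ?s3 and H = h and N = N' and mode = mode, OF _ _ N'G _ sizes(2) _ _ _ _ order_refl order_refl]
    show ?thesis
      unfolding ok_def val_def \<omega>_def T_def
      by (rule *[unfolded set_reg_simps]) (use f N' \<omega> sizes in \<open>auto simp: fixed_def \<omega>_def intro: less_imp_le order_trans\<close>)
  qed
  then have best: "ST E (Best mode) ?s3 ?t1 (h * (N * 2)) (\<lambda>s'. best_inv ok val \<omega> ({..<h} \<times> {..<N'}) s' \<and> mem_frame G 6 ?s3 s')"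
  proof (rule ST_conseq)
    show "h * (N' * N' * 5 + N' * 26 + 12) + 3 \<le> ?t1" using N'(2) by (intro add_mono mult_le_mono) auto
    show "h * (N' * 2) \<le> h * (N * 2)" using N'(2) by simp
  qed simp
  have valE: "val (c, i) = d (\<omega> c) (T i)" if "c < h" "i < N'" for c i
    using td_eq[OF \<omega> T(2)] that by (simp add: val_def)
  have okE: "ok (c, i) \<longleftrightarrow> h \<le> card {y' \<in> T ` {..<N'}. d (\<omega> c) y' \<le> d (\<omega> c) (T i)}" if "c < h" "i < N'" for c i
  proof -
    have "{i'. i' < N' \<and> val (c, i') \<le> val (c, i)} = {i'. i' < N' \<and> d (\<omega> c) (T i') \<le> d (\<omega> c) (T i)}" using valE that by auto
    then show ?thesis using card_image_Collect[OF T(1), of "\<lambda>y. d (\<omega> c) y \<le> d (\<omega> c) (T i)"] by (simp add: ok_def)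
  qed
  have 5: "ST E (Ballc mode) s4 ?tb (N * 2) ?P"
    if s4: "best_inv ok val \<omega> ({..<h} \<times> {..<N'}) s4 \<and> mem_frame G 6 ?s3 s4" "\<forall>x. x \<notin> mods (Best mode) \<longrightarrow> regs s4 x = regs ?s3 x" for s4
  proof -
    have r: "fixed s4" "regs s4 ''tl'' = N'" using s4(2) f N' by (simp_all add: fixed_def)
    have T4: "mem s4 (5 * G + i) = T i" if "i < N'" for i
      using s4(1) mem_frameD[of G 6 ?s3 s4 i 5] that N'G by (simp add: T_def)
    define b t where "b = regs s4 ''br''" and "t = regs s4 ''bt''"
    \<comment> \<open>If no pair qualified, centre and radius keep the default 0, which still
      satisfies \<open>t < n\<close> and the word bound; the scan can then proceed although its
      result carries no guarantee.\<close>
    have cases: "(regs s4 ''bf'' = 0 \<and> b = 0 \<and> t = 0) \<or> (\<exists>c i. c < h \<and> i < N' \<and> ok (c, i) \<and> b = val (c, i) \<and> t = \<omega> c)"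
      using s4(1) unfolding best_inv_def b_def t_def by force
    have tn: "t < n" using cases n0 \<omega> by auto
    have bs: "2 * h * b < 2 ^ word_size E" using cases valE dist_small \<omega> T(2) by auto
    have inj4: "inj_on (\<lambda>i. mem s4 (5 * G + i)) {..<N'}"
      using T(1) by (rule inj_on_cong[THEN iffD1, rotated]) (simp add: T4)
    have S: "{i. i < N' \<and> d t (mem s4 (5 * G + i)) \<le> b} = {i. i < N' \<and> d t (T i) \<le> b}" using T4 by auto
    have im: "(\<lambda>i. mem s4 (5 * G + i)) ` {i. i < N' \<and> d t (T i) \<le> b} = T ` {i. i < N' \<and> d t (T i) \<le> b}"
      by (rule image_cong) (use T4 in auto)
    have T4n: "mem s4 (5 * G + i) < n" if "i < N'" for i using T4[OF that] T(2)[OF that] by simp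
    show ?thesis
    proof (rule ST_conseq[OF ST_Ballc[OF r(1,2) N'(2) inj4 T4n t_def[symmetric] tn b_def[symmetric] bs order_refl order_refl, of mode, unfolded S im] order_refl order_refl])
      fix s' :: state
      assume s': "mem_frames G {6, 7, 8} s4 s' \<and> (\<exists>B j. scanned B b j s' \<and>
        card B = min h (card {i. i < N' \<and> d t (T i) \<le> b}) \<and> B \<subseteq> T ` {i. i < N' \<and> d t (T i) \<le> b})"
      have "mem_frames G {6, 7, 8} s s4" by (rule mem_framesI[of G 6]) (use s4(1) in simp_all)
      then have fr: "mem_frames G {6, 7, 8} s s'" using s' mem_frames_trans[OF _ _ subset_refl subset_refl] by blast
      from s' obtain B j where B: "scanned B b j s'" "card B = min h (card {i. i < N' \<and> d t (T i) \<le> b})" "B \<subseteq> T ` {i. i < N' \<and> d t (T i) \<le> b}" by blast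
      have "B \<subseteq> {..<n}" using B(3) T(2) by auto
      moreover have "chosen \<omega> (T ` {..<N'}) B b"
        unfolding chosen_def
      proof (intro allI impI ballI)
        fix c y assume c: "c < h" "y \<in> T ` {..<N'}" "h \<le> card {y' \<in> T ` {..<N'}. d (\<omega> c) y' \<le> d (\<omega> c) y}"
        then obtain i where i: "i < N'" "y = T i" by auto
        then have "ok (c, i)" using okE[OF c(1) i(1)] c(3) by simp
        then have bf: "regs s4 ''bf'' \<noteq> 0" "b \<le> val (c, i)" using s4(1) c(1) i(1) unfolding best_inv_def b_def by blast+
        then have "\<exists>c i. c < h \<and> i < N' \<and> ok (c, i) \<and> b = val (c, i) \<and> t = \<omega> c" using cases by simp
        then obtain c' i' where c': "c' < h" "i' < N'" "ok (c', i')" "b = val (c', i')" "t = \<omega> c'" by blast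
        have "h \<le> card {i. i < N' \<and> d t (T i) \<le> b}"
          using okE[OF c'(1,2)] c'(3) card_image_Collect[OF T(1), of "\<lambda>y. d (\<omega> c') y \<le> d (\<omega> c') (T i')"] valE[OF c'(1,2)] c'(4,5) by simp
        then show "b \<le> d (\<omega> c) y \<and> B \<subseteq> T ` {..<N'} \<and> card B = h \<and> (\<exists>t\<in>\<omega> ` {..<h}. \<forall>b'\<in>B. d t b' \<le> b)"
          using bf(2) valE[OF c(1) i(1)] i B(2,3) c'(1,5) by auto
      qed
      ultimately show "?P s'" using fr B(1) by blast
    qed
  qed
  have 6: "ST E (Seq (Best mode) (Ballc mode)) ?s3 (?t1 + ?tb + 1) (h * (N * 2) + N * 2) ?P"
    by (rule ST_Seq[OF best, where \<tau>b = ?tb and \<sigma>b = "N * 2"]) (use 5 in simp_all)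
  have a: "ST E (Assign x (Const 0)) s' 1 0 (\<lambda>t. t = set_reg E x 0 s')" for x s' by (rule HT_Assign) simp_all
  have 7: "ST E (Seq (Assign ''bt'' (Const 0)) (Seq (Best mode) (Ballc mode))) (set_reg E ''br'' 0 (set_reg E ''bf'' 0 s)) (?t1 + ?tb + 3) (h * (N * 2) + N * 2) ?P"
    by (rule ST_Seq[OF a, where \<tau>b = "?t1 + ?tb + 1" and \<sigma>b = "h * (N * 2) + N * 2"]) (use 6 in simp_all)
  have 8: "ST E (Seq (Assign ''br'' (Const 0)) (Seq (Assign ''bt'' (Const 0)) (Seq (Best mode) (Ballc mode)))) (set_reg E ''bf'' 0 s) (?t1 + ?tb + 5) (h * (N * 2) + N * 2) ?P"
    by (rule ST_Seq[OF a, where \<tau>b = "?t1 + ?tb + 3" and \<sigma>b = "h * (N * 2) + N * 2"]) (use 7 in simp_all)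
  show ?thesis
    unfolding Choose_def by (rule ST_Seq[OF a, where \<tau>b = "?t1 + ?tb + 5" and \<sigma>b = "h * (N * 2) + N * 2"]) (use 8 \<tau> \<sigma> in simp_all)
qed

lemma ST_Prep:
  fixes s :: state
  defines "\<omega> \<equiv> \<lambda>i. mem s (3 * G + i)"
  assumes f: "fixed s" and \<omega>: "\<And>i. i < N \<Longrightarrow> \<omega> i < n"
    and \<tau>: "h * (N * N * 5 + N * 26 + 12) + h * (n * (h * 8 + 13) + 15) + N * 22 + n * 13 + 50 \<le> \<tau>" and \<sigma>: "h * (N * 2) + N * 2 \<le> \<sigma>"
  shows "ST E (Prep mode) s \<tau> \<sigma> (\<lambda>s'. mem_frames G {4, 5, 6, 7, 8} s s' \<and> (\<exists>B b j. scanned B b j s' \<and>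
     B \<subseteq> {..<n} \<and> chosen \<omega> (\<omega> ` {..<N}) B b))"
proof -
  let ?P = "\<lambda>s'. mem_frames G {4, 5, 6, 7, 8} s s' \<and> (\<exists>B b j. scanned B b j s' \<and> B \<subseteq> {..<n} \<and> chosen \<omega> (\<omega> ` {..<N}) B b)"
  let ?tc = "h * (N * N * 5 + N * 26 + 12) + h * (n * (h * 8 + 13) + 15) + N * 18 + 30"
  let ?sc = "h * (N * 2) + N * 2"
  have r: "regs s ''G'' = G" "regs s ''n'' = n" "regs s ''N'' = N" using f by (simp_all add: fixed_def)
  let ?F = "Filter 5 ''tl'' Skip (Ar 4 (Reg ''x''))"
  have c1: "ST E Clear s (n * 4 + 3) 0 (\<lambda>s'. (\<forall>x<n. mem s' (4 * G + x) = 0) \<and> mem_frame G 4 s s')"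
    by (rule ST_Clear[OF r(1,2) sizes(1) order_refl])
  have c3: "ST E (Seq ?F (Choose mode)) s2 (n * 9 + 5 + ?tc + 1) ?sc ?P"
    if s2: "\<forall>x<n. mem s2 (4 * G + x) \<noteq> 0 \<longleftrightarrow> (\<exists>i<N. \<omega> i = x)" "mem_frame G 4 s s2" "fixed s2" for s2
  proof -
    have r2: "regs s2 ''G'' = G" "regs s2 ''n'' = n" using s2(3) by (simp_all add: fixed_def)
    let ?T = "{x. x < n \<and> (\<exists>i<N. \<omega> i = x)}"
    have Teq: "?T = \<omega> ` {..<N}" using \<omega> by auto
    have cT: "card ?T \<le> N" unfolding Teq using card_image_le[of "{..<N}" \<omega>] by simp
    have fl: "ST E ?F s2 (n * (1 + 8) + 5) 0 (\<lambda>s'. regs s' ''tl'' = card ?T \<and>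
        bij_betw (\<lambda>i. mem s' (5 * G + i)) {..<card ?T} ?T \<and> mem_frame G 5 s2 s')"
    proof (rule ST_Filter[where \<tau> = 1 and P = "\<lambda>x. \<exists>i<N. \<omega> i = x"])
      fix s' :: state and x
      assume s': "x < n" "regs s' ''x'' = x" "\<forall>y. y \<notin> {''tl'', ''x''} \<union> mods Skip \<longrightarrow> regs s' y = regs s2 y" "mem_frame G 5 s2 s'"
      have g: "regs s' ''G'' = G" using s'(3) r2 by simp
      have xG: "x < G" using s'(1) sizes by simp
      have "eval E s' (Ar 4 (Reg ''x'')) = mem s2 (4 * G + x)"
        using eval_Ar[OF g, of 4 "Reg ''x''" x] s'(2) xG mem_frameD[OF s'(4) xG, of 4] by simp
      then have "(eval E s' (Ar 4 (Reg ''x'')) \<noteq> 0) = (\<exists>i<N. \<omega> i = x)" using s2(1) s'(1) by simp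
      then show "ST E Skip s' 1 0 (\<lambda>s''. (eval E s'' (Ar 4 (Reg ''x'')) \<noteq> 0) = (\<exists>i<N. \<omega> i = x))"
        by (intro HT_Skip) simp_all
    qed (use r2 sizes in simp_all)
    show ?thesis
    proof (rule ST_Seq[OF fl, where \<tau>b = ?tc and \<sigma>b = ?sc])
      fix s3 :: state
      assume s3: "regs s3 ''tl'' = card ?T \<and> bij_betw (\<lambda>i. mem s3 (5 * G + i)) {..<card ?T} ?T \<and> mem_frame G 5 s2 s3"
        "\<forall>x. x \<notin> mods ?F \<longrightarrow> regs s3 x = regs s2 x"
      have f3: "fixed s3" using s3(2) s2(3) by (simp add: fixed_def)
      have bij: "inj_on (\<lambda>i. mem s3 (5 * G + i)) {..<card ?T}" "(\<lambda>i. mem s3 (5 * G + i)) ` {..<card ?T} = ?T"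
        using s3(1) by (auto simp: bij_betw_def)
      then have Tn: "mem s3 (5 * G + i) < n" if "i < card ?T" for i using that by blast
      have \<omega>3: "mem s3 (3 * G + i) = \<omega> i" if "i < N" for i
      proof -
        have "i < G" using that sizes by simp
        then show ?thesis using mem_frameD[of G 5 s2 s3 i 3] mem_frameD[of G 4 s s2 i 3] s3(1) s2(2) by (simp add: \<omega>_def)
      qed
      have \<omega>3n: "mem s3 (3 * G + i) < n" if "i < h" for i
        using \<omega>3[of i] \<omega>[of i] that sizes by simp
      have ch: "chosen (\<lambda>i. mem s3 (3 * G + i)) X B b = chosen \<omega> X B b" for X B b
      proof -
        have "(\<lambda>i. mem s3 (3 * G + i)) ` {..<h} = \<omega> ` {..<h}" by (rule image_cong) (use \<omega>3 sizes in auto)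
        moreover have "mem s3 (3 * G + c) = \<omega> c" if "c < h" for c using \<omega>3[of c] that sizes by simp
        ultimately show ?thesis unfolding chosen_def by (simp cong: conj_cong imp_cong)
      qed
      show "ST E (Choose mode) s3 ?tc ?sc ?P"
      proof (rule ST_conseq[OF ST_Choose[OF f3 conjunct1[OF s3(1)] cT bij(1) Tn \<omega>3n order_refl order_refl, of mode, unfolded bij(2), unfolded ch, unfolded Teq] order_refl order_refl])
        fix s' :: state
        assume s': "mem_frames G {6, 7, 8} s3 s' \<and> (\<exists>B b j. scanned B b j s' \<and> B \<subseteq> {..<n} \<and> chosen \<omega> (\<omega> ` {..<N}) B b)"
        have "mem_frames G {4, 5} s s3" 
          by (rule mem_frames_trans[OF mem_framesI[of G 4 _ _ "{4}"] mem_framesI[of G 5 _ _ "{5}"]]) (use s2(2) s3(1) in auto)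
        then have "mem_frames G {4, 5, 6, 7, 8} s s'" using s' by (auto intro: mem_frames_trans)
        then show "?P s'" using s' by blast
      qed
    qed simp_all
  qed
  have c2: "ST E (Seq Mark (Seq ?F (Choose mode))) s1 (N * 4 + 3 + (n * 9 + 5 + ?tc + 1) + 1) ?sc ?P"
    if s1: "\<forall>x<n. mem s1 (4 * G + x) = 0" "mem_frame G 4 s s1" "\<forall>x. x \<notin> mods Clear \<longrightarrow> regs s1 x = regs s x" for s1
  proof -
    have r1: "regs s1 ''G'' = G" "regs s1 ''N'' = N" "fixed s1" using s1(3) f by (simp_all add: fixed_def)
    have \<omega>1: "mem s1 (3 * G + i) = \<omega> i" if "i < N" for i
      using mem_frameD[OF s1(2), of i 3] that sizes by (simp add: \<omega>_def)
    have m: "ST E Mark s1 (N * 4 + 3) 0 (\<lambda>s'. (\<forall>x<n. mem s' (4 * G + x) \<noteq> 0 \<longleftrightarrow> (\<exists>i<N. mem s1 (3 * G + i) = x)) \<and> mem_frame G 4 s1 s')"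
      by (rule ST_Mark[OF r1(1,2) sizes(3,1) _ _ order_refl]) (use \<omega>1 \<omega> s1(1) in simp_all)
    show ?thesis
    proof (rule ST_Seq[OF m, where \<tau>b = "n * 9 + 5 + ?tc + 1" and \<sigma>b = ?sc])
      fix s2 :: state
      assume s2: "(\<forall>x<n. mem s2 (4 * G + x) \<noteq> 0 \<longleftrightarrow> (\<exists>i<N. mem s1 (3 * G + i) = x)) \<and> mem_frame G 4 s1 s2"
        "\<forall>x. x \<notin> mods Mark \<longrightarrow> regs s2 x = regs s1 x"
      have e: "(\<exists>i<N. mem s1 (3 * G + i) = x) = (\<exists>i<N. \<omega> i = x)" for x using \<omega>1 by auto
      show "ST E (Seq ?F (Choose mode)) s2 (n * 9 + 5 + ?tc + 1) ?sc ?P"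
        by (rule c3) (use s2 e r1(3) s1(2) mem_frame_trans in \<open>auto simp: fixed_def\<close>)
    qed simp_all
  qed
  show ?thesis
    unfolding Prep_def
    by (rule ST_Seq[OF c1, where \<tau>b = "N * 4 + 3 + (n * 9 + 5 + ?tc + 1) + 1" and \<sigma>b = ?sc]) (use c2 \<tau> \<sigma> in simp_all)
qed

end

section \<open>The clustering loop\<close>

definition StepMain :: "strong_mode \<Rightarrow> com" where
  "StepMain mode = Seq (Sample 3 2 ''u'' ''N'') (Seq (Prep mode)
     (If (Less (Const 0) (Reg ''zl'')) (Seq (Sample 9 8 ''zl'' ''h'') (Seq (Incr ''ncl'') Absorb)) Skip))"

definition Steps :: "strong_mode \<Rightarrow> com" where
  "Steps mode = For ''st'' (Reg ''S'') (Seq (Filter 2 ''u'' Skip (Eql (Ar 1 (Reg ''x'')) (Const 0)))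
     (If (Less (Reg ''T'') (Reg ''u'')) (StepMain mode) Skip))"

lemma mods_StepMain [simp]:
  "mods (StepMain mode) = {''ncl'', ''p'', ''tl'', ''bf'', ''br'', ''bt'', ''c'', ''t'', ''i'', ''dd'', ''cnt'', ''vi'', ''bl'', ''prev'', ''done'', ''j'', ''thr'', ''zl'', ''x'', ''w''}"
  "mods (Steps mode) = {''st'', ''u'', ''ncl'', ''p'', ''tl'', ''bf'', ''br'', ''bt'', ''c'', ''t'', ''i'', ''dd'', ''cnt'', ''vi'', ''bl'', ''prev'', ''done'', ''j'', ''thr'', ''zl'', ''x'', ''w''}"
  unfolding StepMain_def Steps_def by auto

lemma stores_StepMain [simp]: "stores (StepMain mode)" "stores (Steps mode)"
  unfolding StepMain_def Steps_def by auto

text \<open>Each of the \<open>p\<close> removed terms of the harmonic sum is at least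
  \<open>1 / u\<close>. A step that clusters \<open>p\<close> of \<open>u\<close> points at cost
  proportional to \<open>p / u\<close> is thereby paid by a telescoping difference.\<close>

lemma harm_diff_ge:
  assumes "p \<le> u" "0 < u"
  shows "real p / real u \<le> harm u - harm (u - p)"
proof -
  have "(\<Sum>i\<in>{u - p<..u}. 1 / real u) \<le> (\<Sum>i\<in>{u - p<..u}. inverse (real i))"
    by (rule sum_mono) (auto simp: field_simps)
  moreover have "{1..u} = {1..u - p} \<union> {u - p<..u}" using assms by auto
  then have "harm u = harm (u - p) + (\<Sum>i\<in>{u - p<..u}. inverse (real i))"
    unfolding harm_def by (simp only:) (subst sum.union_disjoint, auto)
  ultimately show ?thesis using assms by simp
qed

text \<open>The pattern \<open>K\<close> is arbitrary here, since time and query bounds must hold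
  for all patterns. The centre set \<open>Cs\<close> is arbitrary as well; it is instantiated by an
  optimal solution only at the end.\<close>

locale coreset_run = clustering E G n d h N for E G n d h N +
  fixes K :: "nat set \<Rightarrow> bool" and m k :: nat and Cs :: "nat set"
  assumes weak: "\<And>x y. x < n \<Longrightarrow> y < n \<Longrightarrow> \<not> K {x, y} \<Longrightarrow> weak_dist E x y = d x y"
    and hm: "0 < m" "100 * m \<le> h"
    and Cs: "Cs \<subseteq> {..<n}" "Cs \<noteq> {}" "card Cs \<le> k"
    and grow: "real n < (11 / 10) ^ (h - 1)"
begin

lemma wo_eq: "x < n \<Longrightarrow> y < n \<Longrightarrow> \<not> K {x, y} \<Longrightarrow> wo x y = d x y"
  using td_eq weak by (simp add: answer_def env)

definition OPT :: nat where
  "OPT = (\<Sum>x<n. near Cs x)"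

abbreviation cl :: "state \<Rightarrow> nat \<Rightarrow> nat" where
  "cl s x \<equiv> mem s (1 * G + x)"

definition Open :: "state \<Rightarrow> nat set" where
  "Open s = {x. x < n \<and> cl s x = 0}"

lemma Open_sub: "Open s \<subseteq> {..<n}" "finite (Open s)"
  by (auto simp: Open_def)

text \<open>Everything the second vote needs, derived from a good pattern and a good sample: the
  ball is cheap because its radius is minimal among the candidates, rich because it holds
  \<open>h\<close> samples, and the scan stalled because growth cannot persist.\<close>

lemma chosen_good:
  assumes K: "good_pattern m h K" and U: "U \<subseteq> {..<n}" and \<omega>: "good_sample k h N Cs U \<omega>" "\<And>i. i < N \<Longrightarrow> \<omega> i \<in> U"
    and B: "B \<subseteq> {..<n}" "chosen \<omega> (\<omega> ` {..<N}) B b"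
    and j: "\<not> grows (\<lambda>j. card (ZZ B b j)) j \<or> (\<forall>j<h. grows (\<lambda>j. card (ZZ B b j)) j)"
  obtains t where "t \<in> U" "card B = h" "\<And>b'. b' \<in> B \<Longrightarrow> d t b' \<le> b" "card U * b \<le> 4 * OPT"
    "card U \<le> 2 * N * card {z \<in> U. d t z \<le> b}" "0 < card (ZZ B b j)"
    "\<And>x. x < n \<Longrightarrow> real (card {z \<in> ZZ B b j. (2 * j + 1) * b < d t z \<or> K {x, z}}) \<le> 23 / 50 * card (ZZ B b j)"
proof -
  obtain i y where iy: "i < h" "y \<in> \<omega> ` {..<N}" "h \<le> card {y' \<in> \<omega> ` {..<N}. d (\<omega> i) y' \<le> d (\<omega> i) y}"
    "card U * d (\<omega> i) y \<le> 4 * (\<Sum>x\<in>U. near Cs x)"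
    using good_sample_best[OF U Cs(1) \<omega>(1) sizes(4)] by blast
  then have b: "b \<le> d (\<omega> i) y" "B \<subseteq> \<omega> ` {..<N}" "card B = h" "\<exists>t\<in>\<omega> ` {..<h}. \<forall>b'\<in>B. d t b' \<le> b"
    using B(2) unfolding chosen_def by blast+
  then obtain t where t: "t \<in> \<omega> ` {..<h}" "\<And>b'. b' \<in> B \<Longrightarrow> d t b' \<le> b" by blast
  have tU: "t \<in> U" using t(1) \<omega>(2) sizes by auto
  have tn: "t < n" using tU U by auto
  have "card U * b \<le> card U * d (\<omega> i) y" using b(1) by simp
  also have "\<dots> \<le> 4 * (\<Sum>x\<in>U. near Cs x)" by (rule iy(4))
  also have "\<dots> \<le> 4 * OPT" unfolding OPT_def using U by (intro mult_le_mono2 sum_mono2) auto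
  finally have 1: "card U * b \<le> 4 * OPT" .
  have 2: "card U \<le> 2 * N * card {z \<in> U. d t z \<le> b}"
    by (rule good_sample_rich[OF _ \<omega>(1) tU \<omega>(2) b(2,3) t(2)]) (use U finite_subset in auto)
  note ctx = K hm wo_eq tn B(1) b(3) t(2)
  have Z: "Zs h (\<lambda>x y. wo x y) b B j = ZZ B b j" for j
  proof -
    have "Zs h (\<lambda>x y. wo x y) b B j = {y. y < n \<and> h < 2 * card {b' \<in> B. wo y b' \<le> 2 * Suc j * b}}"
      by (rule Zs_def[OF K hm _ tn B(1) b(3) t(2)]) (rule wo_eq)
    then show ?thesis by (simp only: ZZ_def b(3))
  qed
  have 3: "h - m \<le> card (ZZ B b j)" for j
    using card_Zs_ge[where wo = "\<lambda>x y. wo x y", OF ctx, of j] unfolding Z .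
  have "\<exists>j<h. \<not> 11 * (if j = 0 then 0 else card (ZZ B b (j - 1))) < 10 * card (ZZ B b j)"
    using growth_stops[where wo = "\<lambda>x y. wo x y", OF ctx grow sizes(4)] unfolding Z .
  then have ng: "\<not> grows (\<lambda>j. card (ZZ B b j)) j" using j unfolding grows_def by blast
  have 4: "real (card {z \<in> ZZ B b j. (2 * j + 1) * b < d t z \<or> K {x, z}}) \<le> 23 / 50 * card (ZZ B b j)" if "x < n" for x
    using few_bad_witnesses[where wo = "\<lambda>x y. wo x y", OF ctx, of j x, unfolded Z] ng that unfolding grows_def by blast
  have 5: "0 < card (ZZ B b j)" using 3[of j] hm by linarith
  show thesis using that[OF tU b(3) t(2) 1 2 5 4] by blast
qed

definition step_sure :: "state \<Rightarrow> state \<Rightarrow> bool" where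
  "step_sure s s' \<longleftrightarrow> fixed s' \<and> regs s ''ncl'' \<le> regs s' ''ncl'' \<and> regs s' ''ncl'' \<le> Suc (regs s ''ncl'') \<and>
     (\<forall>x<n. cl s' x = cl s x \<or> cl s x = 0 \<and> cl s' x = regs s' ''ncl'')"

text \<open>The radius arises as \<open>4 * h * b\<close> with
  \<open>card (Open s) * b \<le> 4 * OPT\<close>, which explains the 16.\<close>

definition step_good :: "state \<Rightarrow> state \<Rightarrow> bool" where
  "step_good s s' \<longleftrightarrow> (\<exists>P t \<nu>. P \<subseteq> Open s \<and> regs s' ''ncl'' = Suc (regs s ''ncl'') \<and>
     (\<forall>x<n. cl s' x = (if x \<in> P then Suc (regs s ''ncl'') else cl s x)) \<and> t < n \<and> (\<forall>x\<in>P. d t x \<le> \<nu>) \<and>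
     card (Open s) * \<nu> \<le> 16 * h * OPT \<and> card (Open s) \<le> 2 * N * card P)"

definition \<delta>1 :: real where
  "\<delta>1 = (3 / 4) ^ h + real k * (real ((n + 1) ^ h) * (1 - 1 / (8 * real k)) ^ N) + real n * (1 / 2) ^ h"

definition \<delta>2 :: real where
  "\<delta>2 = real n * exp (- (real h / 320))"

lemma \<delta>2_nonneg: "0 \<le> \<delta>2" by (simp add: \<delta>2_def)

definition t_prep :: nat where
  "t_prep = h * (N * N * 5 + N * 26 + 12) + h * (n * (h * 8 + 13) + 15) + N * 22 + n * 13 + 50"

definition t_absorb :: nat where
  "t_absorb = n * (h * 8 + 12) + h * 6 + 12"

text \<open>The voter set, radius and scale are fixed before the second sample is drawn, so for each
  point the fraction of bad witnesses is a fixed number and the draws are independent of it. The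
  only randomness here is this sample, with failure \<open>\<delta>2\<close> for all points
  together.\<close>

lemma HT_branch:
  fixes s s2 :: state and \<omega> :: "nat \<Rightarrow> nat"
  assumes U: "\<And>i. i < N \<Longrightarrow> \<omega> i \<in> Open s"
    and f: "fixed s2" and c: "\<And>x. x < n \<Longrightarrow> cl s2 x = cl s x" "regs s2 ''ncl'' = regs s ''ncl''" "regs s ''ncl'' < 15 * G"
    and sc: "scanned B b j s2" and B: "B \<subseteq> {..<n}" "chosen \<omega> (\<omega> ` {..<N}) B b"
  shows "HT E (If (Less (Const 0) (Reg ''zl'')) (Seq (Sample 9 8 ''zl'' ''h'') (Seq (Incr ''ncl'') Absorb)) Skip) s2 (Suc t_absorb) 0 \<delta>2
     (step_sure s) (\<lambda>s'. good_pattern m h K \<and> good_sample k h N Cs (Open s) \<omega> \<longrightarrow> step_good s s')"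
proof -
  let ?hyp = "good_pattern m h K \<and> good_sample k h N Cs (Open s) \<omega>"
  let ?Z = "ZZ B b j"
  have r: "regs s2 ''G'' = G" "regs s2 ''n'' = n" "regs s2 ''h'' = h" using f by (simp_all add: fixed_def)
  have zl: "regs s2 ''zl'' = card ?Z" "bij_betw (\<lambda>i. mem s2 (8 * G + i)) {..<card ?Z} ?Z" "regs s2 ''thr'' = 2 * Suc j * b" "j < h"
    and jj: "\<not> grows (\<lambda>j. card (ZZ B b j)) j \<or> (\<forall>j<h. grows (\<lambda>j. card (ZZ B b j)) j)"
    using sc unfolding scanned_def by blast+
  have Zn: "?Z \<subseteq> {..<n}" by (auto simp: ZZ_def)
  have fZ: "finite ?Z" using Zn finite_subset by blast
  have cZ: "card ?Z \<le> G" using card_mono[OF finite_lessThan Zn] sizes by simp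
  show ?thesis
  proof (rule HT_If[where \<tau>a = t_absorb])
    assume "eval E s2 (Less (Const 0) (Reg ''zl'')) = 0"
    then have "card ?Z = 0" using zl(1) by simp
    then have nz: "\<not> 0 < card ?Z" by simp
    have "\<not> ?hyp"
    proof
      assume hyp: ?hyp
      show False
        by (rule chosen_good[OF conjunct1[OF hyp] Open_sub(1) conjunct2[OF hyp] U B jj]) (assumption | erule notE[OF nz])+
    qed
    moreover have "step_sure s s2" using f c unfolding step_sure_def by simp
    ultimately have "step_sure s s2" "?hyp \<longrightarrow> step_good s s2" by (simp_all only: simp_thms)
    moreover have "1 \<le> t_absorb" by (simp add: t_absorb_def)
    ultimately show "HT E Skip s2 t_absorb 0 \<delta>2 (step_sure s) (\<lambda>s'. ?hyp \<longrightarrow> step_good s s')"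
      using \<delta>2_nonneg by (intro HT_Skip)
  next
    assume "eval E s2 (Less (Const 0) (Reg ''zl'')) \<noteq> 0"
    then have Z0: "0 < card ?Z" using zl(1) by simp
    define bad where "bad = (\<lambda>t x z. (2 * j + 1) * b < d t z \<or> K {x, z})"
    define Q where "Q = (\<lambda>t. t \<in> Open s \<and> card B = h \<and> (\<forall>b'\<in>B. d t b' \<le> b) \<and> card (Open s) * b \<le> 4 * OPT \<and>
        card (Open s) \<le> 2 * N * card {z \<in> Open s. d t z \<le> b} \<and> (\<forall>x<n. real (card {z \<in> ?Z. bad t x z}) \<le> 23 / 50 * card ?Z))"
    \<comment> \<open>The centre is needed to state the event for the second sample, so it is picked
      beforehand; it exists only under \<open>?hyp\<close>.\<close>
    have "\<exists>t. ?hyp \<longrightarrow> Q t"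
    proof (cases ?hyp)
      case True
      show ?thesis
      proof (rule chosen_good[OF conjunct1[OF True] Open_sub(1) conjunct2[OF True] U B jj])
        fix t assume a: "t \<in> Open s" "card B = h" "\<And>b'. b' \<in> B \<Longrightarrow> d t b' \<le> b" "card (Open s) * b \<le> 4 * OPT"
          "card (Open s) \<le> 2 * N * card {z \<in> Open s. d t z \<le> b}"
          "\<And>x. x < n \<Longrightarrow> real (card {z \<in> ?Z. (2 * j + 1) * b < d t z \<or> K {x, z}}) \<le> 23 / 50 * card ?Z"
        have "Q t" unfolding Q_def bad_def by (intro conjI ballI allI impI a)
        then show ?thesis by blast
      qed
    qed blast
    then obtain t where t: "?hyp \<Longrightarrow> Q t" by blast
    \<comment> \<open>As an implication the event holds trivially without \<open>?hyp\<close>, so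
      bad earlier outcomes are not charged again.\<close>
    define Ev where "Ev = (\<lambda>\<omega>' :: nat \<Rightarrow> nat. ?hyp \<longrightarrow> (\<forall>x<n. 2 * card {i. i < h \<and> bad t x (\<omega>' i)} < h))"
    have Ev: "measure_pmf.prob (Pi_pmf {..<h} 0 (\<lambda>_. pmf_of_set ?Z)) {\<omega>'. \<not> Ev \<omega>'} \<le> \<delta>2"
    proof (cases ?hyp)
      case True
      have neZ: "?Z \<noteq> {}" using Z0 by (simp add: card_gt_0_iff)
      have "measure_pmf.prob (Pi_pmf {..<h} 0 (\<lambda>_. pmf_of_set ?Z)) {\<omega>'. \<exists>x\<in>{..<n}. h \<le> 2 * card {i. i < h \<and> bad t x (\<omega>' i)}} \<le>
          card {..<n} * exp (- (real h / 320))"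
        by (rule prob_union_bound[OF finite_lessThan], rule prob_majority_bad[OF fZ neZ _ sizes(4)])
          (use t[OF True] in \<open>simp add: Q_def\<close>)
      moreover have "{\<omega>'. \<not> Ev \<omega>'} = {\<omega>'. \<exists>x\<in>{..<n}. h \<le> 2 * card {i. i < h \<and> bad t x (\<omega>' i)}}"
        using True by (auto simp: Ev_def not_less)
      ultimately show ?thesis by (simp add: \<delta>2_def)
    next
      case False
      have "Ev \<omega>'" for \<omega>' unfolding Ev_def by (rule impI) (rule notE[OF False])
      then show ?thesis using \<delta>2_nonneg by simp
    qed
    have smp: "HT E (Sample 9 8 ''zl'' ''h'') s2 (h * 6 + 3) 0 \<delta>2 (\<lambda>s'. (\<forall>i<h. mem s' (9 * G + i) \<in> ?Z) \<and> mem_frame G 9 s2 s')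
        (\<lambda>s'. Ev (\<lambda>i. if i < h then mem s' (9 * G + i) else 0))"
      by (rule HT_Sample[OF r(1) _ _ _ zl(1) Z0 cZ _ r(3) sizes(2) _ zl(2) Ev order_refl]) simp_all
    show "HT E (Seq (Sample 9 8 ''zl'' ''h'') (Seq (Incr ''ncl'') Absorb)) s2 t_absorb 0 \<delta>2 (step_sure s) (\<lambda>s'. ?hyp \<longrightarrow> step_good s s')"
    proof (rule HT_Seq[OF smp, where \<tau>b = "n * (h * 8 + 12) + 5" and \<sigma>b = 0 and \<delta>b = 0])
      fix s3 :: state
      assume s3: "(\<forall>i<h. mem s3 (9 * G + i) \<in> ?Z) \<and> mem_frame G 9 s2 s3" "\<forall>x. x \<notin> mods (Sample 9 8 ''zl'' ''h'') \<longrightarrow> regs s3 x = regs s2 x"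
      have r3: "regs s3 ''G'' = G" "regs s3 ''n'' = n" "regs s3 ''h'' = h" "regs s3 ''ncl'' = regs s ''ncl''" "regs s3 ''thr'' = 2 * Suc j * b" "regs s3 ''N'' = N"
        using s3(2) r c zl f by (simp_all add: fixed_def)
      have cl3: "cl s3 x = cl s x" if "x < n" for x
        using mem_frameD[of G 9 s2 s3 x 1] s3(1) that sizes c(1)[OF that] by simp
      let ?\<omega> = "\<lambda>i. if i < h then mem s3 (9 * G + i) else 0"
      let ?s4 = "set_reg E ''ncl'' (Suc (regs s ''ncl'')) s3"
      have nw: "to_word E (Suc (regs s ''ncl'')) = Suc (regs s ''ncl'')" using c(3) G_pos by (intro to_word_small) linarith
      have i: "ST E (Incr ''ncl'') s3 1 0 (\<lambda>s'. s' = ?s4)" by (rule ST_Incr) (use r3 c(3) in simp_all)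
      have a: "ST E Absorb ?s4 (n * (h * 8 + 12) + 3) 0 (\<lambda>s'. step_sure s s' \<and> (Ev ?\<omega> \<longrightarrow> ?hyp \<longrightarrow> step_good s s'))"
      proof (rule ST_conseq[OF ST_Absorb[where n = n and H = h, OF _ _ sizes(1) _ sizes(2) order_refl]])
        fix s' :: state
        assume s': "(\<forall>x<n. cl s' x = (if cl ?s4 x = 0 \<and> pass ?s4 9 h (regs ?s4 ''thr'') x then regs ?s4 ''ncl'' else cl ?s4 x)) \<and> mem_frame G 1 ?s4 s'"
          "\<forall>x. x \<notin> mods Absorb \<longrightarrow> regs s' x = regs ?s4 x"
        let ?P = "{x \<in> Open s. h < 2 * card {i. i < h \<and> wo x (mem s3 (9 * G + i)) \<le> 2 * Suc j * b}}"
        have cl': "cl s' x = (if x \<in> ?P then Suc (regs s ''ncl'') else cl s x)" if "x < n" for x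
          using s'(1) cl3[OF that] that r3(5) nw by (simp add: pass_def Open_def)
        have n': "regs s' ''ncl'' = Suc (regs s ''ncl'')" using s'(2) nw by simp
        have "fixed s'" using s'(2) r3 by (simp add: fixed_def)
        then have sure: "step_sure s s'" unfolding step_sure_def using n' cl' by (auto simp: Open_def)
        have "step_good s s'" if ev: "Ev ?\<omega>" and hyp: ?hyp
        proof -
          note Q = t[OF hyp, unfolded Q_def]
          have tn: "t < n" using Q Open_sub(1) by blast
          have om: "?\<omega> i < n" if "i < h" for i using s3(1) that Zn by auto
          have maj: "2 * card {i. i < h \<and> ((2 * j + 1) * b < d t (?\<omega> i) \<or> K {x, ?\<omega> i})} < h" if "x < n" for x
            using ev hyp that unfolding Ev_def bad_def by blast
          have ctx: "good_pattern m h K" "0 < m" "100 * m \<le> h" "\<And>x y. x < n \<Longrightarrow> y < n \<Longrightarrow> \<not> K {x, y} \<Longrightarrow> wo x y = d x y"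
              "t < n" "B \<subseteq> {..<n}" "card B = h" "\<And>b'. b' \<in> B \<Longrightarrow> d t b' \<le> b"
            using hyp hm wo_eq tn B(1) Q by simp_all
          have ceq: "{i. i < h \<and> wo x (?\<omega> i) \<le> 2 * Suc j * b} = {i. i < h \<and> wo x (mem s3 (9 * G + i)) \<le> 2 * Suc j * b}" for x by auto
          have in1: "x \<in> ?P" if "x \<in> Open s" "d t x \<le> b" for x
          proof -
            have xn: "x < n" using that(1) Open_sub(1)[of s] by (simp add: subset_iff)
            have "h < 2 * card {i. i < h \<and> wo x (?\<omega> i) \<le> 2 * Suc j * b}"
              by (rule vote_correct(1)[where wo = "\<lambda>x y. wo x y", OF ctx xn om maj[OF xn] that(2)])
            then show ?thesis using that(1) unfolding ceq by (intro CollectI conjI)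
          qed
          have in2: "d t x \<le> 4 * h * b" if "x \<in> ?P" for x
          proof -
            have x: "x \<in> Open s" "h < 2 * card {i. i < h \<and> wo x (?\<omega> i) \<le> 2 * Suc j * b}"
              using that unfolding ceq by (simp_all only: mem_Collect_eq)
            have xn: "x < n" using x(1) Open_sub(1)[of s] by (simp add: subset_iff)
            have "d t x \<le> 4 * Suc j * b"
              by (rule vote_correct(2)[where wo = "\<lambda>x y. wo x y", OF ctx xn om maj[OF xn] x(2)])
            also have "\<dots> \<le> 4 * h * b" using zl(4) by (intro mult_le_mono) simp_all
            finally show ?thesis .
          qed
          have "{z \<in> Open s. d t z \<le> b} \<subseteq> ?P" by (rule subsetI) (rule in1, simp_all)
          then have "card {z \<in> Open s. d t z \<le> b} \<le> card ?P" by (rule card_mono[rotated]) (use Open_sub(2)[of s] in simp)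
          then have "2 * N * card {z \<in> Open s. d t z \<le> b} \<le> 2 * N * card ?P" by simp
          then have cP: "card (Open s) \<le> 2 * N * card ?P" using Q by linarith
          have "card (Open s) * (4 * h * b) = 4 * h * (card (Open s) * b)" by simp
          also have "\<dots> \<le> 4 * h * (4 * OPT)" using Q by (intro mult_le_mono2) blast
          finally have rad: "card (Open s) * (4 * h * b) \<le> 16 * h * OPT" by simp
          have "?P \<subseteq> Open s" by (rule Collect_restrict)
          then show ?thesis
            unfolding step_good_def
            by (intro exI[of _ ?P] exI[of _ t] exI[of _ "4 * h * b"] conjI allI impI ballI n' cl' tn in2 cP rad)
        qed
        then show "step_sure s s' \<and> (Ev ?\<omega> \<longrightarrow> ?hyp \<longrightarrow> step_good s s')" using sure by blast
      qed (use r3 in simp_all)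
      have "ST E (Seq (Incr ''ncl'') Absorb) s3 (n * (h * 8 + 12) + 5) 0 (\<lambda>s'. step_sure s s' \<and> (Ev ?\<omega> \<longrightarrow> ?hyp \<longrightarrow> step_good s s'))"
        by (rule ST_Seq[OF i, where \<tau>b = "n * (h * 8 + 12) + 3" and \<sigma>b = 0]) (use a in simp_all)
      then show "HT E (Seq (Incr ''ncl'') Absorb) s3 (n * (h * 8 + 12) + 5) 0 0 (step_sure s) (\<lambda>s'. Ev ?\<omega> \<longrightarrow> ?hyp \<longrightarrow> step_good s s')"
        by (rule HT_conseq) simp_all
    qed (simp_all add: t_absorb_def)
  qed simp
qed

lemma chosen_cong: "(\<And>i. i < N \<Longrightarrow> \<omega> i = \<omega>' i) \<Longrightarrow> chosen \<omega> (\<omega> ` {..<N}) B b = chosen \<omega>' (\<omega>' ` {..<N}) B b"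
proof -
  assume e: "\<And>i. i < N \<Longrightarrow> \<omega> i = \<omega>' i"
  have "\<omega> ` {..<N} = \<omega>' ` {..<N}" by (rule image_cong) (use e in auto)
  moreover have "\<omega> ` {..<h} = \<omega>' ` {..<h}" by (rule image_cong) (use e sizes in auto)
  moreover have "\<omega> c = \<omega>' c" if "c < h" for c using e[of c] that sizes by simp
  ultimately show ?thesis unfolding chosen_def by (simp cong: conj_cong imp_cong)
qed

definition t_main :: nat where
  "t_main = N * 6 + 3 + t_prep + t_absorb + 3"

lemma HT_StepMain:
  fixes s :: state
  assumes f: "fixed s" and u: "regs s ''u'' = card (Open s)" "bij_betw (\<lambda>i. mem s (2 * G + i)) {..<card (Open s)} (Open s)"
    and big: "8 * k * h < card (Open s)" and c: "regs s ''ncl'' < 15 * G"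
  shows "HT E (StepMain mode) s t_main (h * (N * 2) + N * 2) (\<delta>1 + \<delta>2) (step_sure s) (\<lambda>s'. good_pattern m h K \<longrightarrow> step_good s s')"
proof -
  have r: "regs s ''G'' = G" "regs s ''N'' = N" using f by (simp_all add: fixed_def)
  have u0: "0 < card (Open s)" using big by simp
  have uG: "card (Open s) \<le> G" using card_mono[OF finite_lessThan Open_sub(1)[of s]] sizes by simp
  have pr: "measure_pmf.prob (Pi_pmf {..<N} 0 (\<lambda>_. pmf_of_set (Open s))) {\<omega>. \<not> good_sample k h N Cs (Open s) \<omega>} \<le> \<delta>1"
    unfolding \<delta>1_def by (rule prob_bad_sample[OF Open_sub(1) big Cs sizes(5,4)])
  have smp: "HT E (Sample 3 2 ''u'' ''N'') s (N * 6 + 3) 0 \<delta>1 (\<lambda>s'. (\<forall>i<N. mem s' (3 * G + i) \<in> Open s) \<and> mem_frame G 3 s s')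
      (\<lambda>s'. good_sample k h N Cs (Open s) (\<lambda>i. if i < N then mem s' (3 * G + i) else 0))"
    by (rule HT_Sample[OF r(1) _ _ _ u(1) u0 uG _ r(2) sizes(3) _ u(2) pr order_refl]) simp_all
  let ?br = "If (Less (Const 0) (Reg ''zl'')) (Seq (Sample 9 8 ''zl'' ''h'') (Seq (Incr ''ncl'') Absorb)) Skip"
  show ?thesis
    unfolding StepMain_def
  proof (rule HT_Seq[OF smp, where \<tau>b = "t_prep + t_absorb + 2" and \<sigma>b = "h * (N * 2) + N * 2" and \<delta>b = \<delta>2])
    fix s1 :: state
    assume s1: "(\<forall>i<N. mem s1 (3 * G + i) \<in> Open s) \<and> mem_frame G 3 s s1" "\<forall>x. x \<notin> mods (Sample 3 2 ''u'' ''N'') \<longrightarrow> regs s1 x = regs s x"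
    let ?\<omega> = "\<lambda>i. if i < N then mem s1 (3 * G + i) else 0"
    have f1: "fixed s1" "regs s1 ''ncl'' = regs s ''ncl''" using s1(2) f by (simp_all add: fixed_def)
    have \<omega>n: "mem s1 (3 * G + i) < n" if "i < N" for i using s1(1) that Open_sub(1) by blast
    have pp: "ST E (Prep mode) s1 t_prep (h * (N * 2) + N * 2) (\<lambda>s'. mem_frames G {4, 5, 6, 7, 8} s1 s' \<and> (\<exists>B b j. scanned B b j s' \<and>
       B \<subseteq> {..<n} \<and> chosen (\<lambda>i. mem s1 (3 * G + i)) ((\<lambda>i. mem s1 (3 * G + i)) ` {..<N}) B b))"
      by (rule ST_Prep[OF f1(1) \<omega>n]) (simp_all add: t_prep_def)
    show "HT E (Seq (Prep mode) ?br) s1 (t_prep + t_absorb + 2) (h * (N * 2) + N * 2) \<delta>2 (step_sure s)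
       (\<lambda>s'. good_sample k h N Cs (Open s) ?\<omega> \<longrightarrow> good_pattern m h K \<longrightarrow> step_good s s')"
    proof (rule HT_Seq[OF pp, where \<tau>b = "Suc t_absorb" and \<sigma>b = 0 and \<delta>b = \<delta>2])
      fix s2 :: state
      assume s2: "mem_frames G {4, 5, 6, 7, 8} s1 s2 \<and> (\<exists>B b j. scanned B b j s2 \<and>
         B \<subseteq> {..<n} \<and> chosen (\<lambda>i. mem s1 (3 * G + i)) ((\<lambda>i. mem s1 (3 * G + i)) ` {..<N}) B b)"
        "\<forall>x. x \<notin> mods (Prep mode) \<longrightarrow> regs s2 x = regs s1 x"
      then obtain B b j where B: "scanned B b j s2" "B \<subseteq> {..<n}" "chosen (\<lambda>i. mem s1 (3 * G + i)) ((\<lambda>i. mem s1 (3 * G + i)) ` {..<N}) B b" by blast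
      have ch: "chosen ?\<omega> (?\<omega> ` {..<N}) B b" using B(3) chosen_cong[of "\<lambda>i. mem s1 (3 * G + i)" ?\<omega>] by simp
      have f2: "fixed s2" "regs s2 ''ncl'' = regs s ''ncl''" using s2(2) f1 by (simp_all add: fixed_def)
      have cl2: "cl s2 x = cl s x" if "x < n" for x
      proof -
        have xG: "x < G" using that sizes by simp
        show ?thesis using mem_framesD[of G "{4, 5, 6, 7, 8}" s1 s2 x 1] mem_frameD[of G 3 s s1 x 1] s1(1) s2(1) xG by simp
      qed
      have \<omega>U: "?\<omega> i \<in> Open s" if "i < N" for i using s1(1) that by simp
      show "HT E ?br s2 (Suc t_absorb) 0 \<delta>2 (step_sure s)
         (\<lambda>s'. True \<longrightarrow> good_sample k h N Cs (Open s) ?\<omega> \<longrightarrow> good_pattern m h K \<longrightarrow> step_good s s')"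
        by (rule HT_conseq[OF HT_branch[OF \<omega>U f2(1) cl2 f2(2) c B(1,2) ch]]) simp_all
    qed (use \<delta>2_nonneg in simp_all)
  qed (use \<delta>2_nonneg in \<open>simp_all add: t_main_def\<close>)
qed

definition radius_ok :: "state \<Rightarrow> (nat \<Rightarrow> nat) \<Rightarrow> (nat \<Rightarrow> nat) \<Rightarrow> bool" where
  "radius_ok s \<nu> t \<longleftrightarrow> (\<forall>x<n. cl s x \<noteq> 0 \<longrightarrow> t (cl s x) < n \<and> d (t (cl s x)) x \<le> \<nu> (cl s x))"

definition spread :: "state \<Rightarrow> (nat \<Rightarrow> nat) \<Rightarrow> real" where
  "spread s \<nu> = (\<Sum>x | x < n \<and> cl s x \<noteq> 0. real (\<nu> (cl s x)))"

definition inv_sure :: "nat \<Rightarrow> state \<Rightarrow> bool" where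
  "inv_sure i s \<longleftrightarrow> fixed s \<and> regs s ''ncl'' \<le> i \<and> (\<forall>x<n. cl s x \<le> regs s ''ncl'')"

text \<open>The sum of cluster radii over all clustered points is charged to the harmonic numbers
  between \<open>card (Open s)\<close> and \<open>n\<close>. The number of open points decays
  geometrically until it is at most \<open>8 * k * h\<close>, where sampling no longer sees large
  cores and steps become idle.\<close>

definition inv_good :: "nat \<Rightarrow> state \<Rightarrow> bool" where
  "inv_good i s \<longleftrightarrow> (\<exists>\<nu> t. radius_ok s \<nu> t \<and> spread s \<nu> \<le> 16 * h * OPT * (harm n - harm (card (Open s)))) \<and>
     (card (Open s) \<le> 8 * k * h \<or> real (card (Open s)) \<le> n * (1 - 1 / (2 * real N)) ^ i)"

text \<open>With \<open>u\<close> open points and \<open>p\<close> newly clustered ones, the step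
  adds \<open>p * \<nu> \<le> (p / u) * 16 * h * OPT\<close>, which \<open>harm_diff_ge\<close>
  absorbs. The decay follows from \<open>u \<le> 2 * N * p\<close>.\<close>

lemma step_good_inv:
  assumes g: "step_good s s'" and i: "inv_good i s" "inv_sure i s" and big: "8 * k * h < card (Open s)"
  shows "inv_good (Suc i) s'"
proof -
  obtain P t \<nu> where P: "P \<subseteq> Open s" "regs s' ''ncl'' = Suc (regs s ''ncl'')"
    "\<And>x. x < n \<Longrightarrow> cl s' x = (if x \<in> P then Suc (regs s ''ncl'') else cl s x)" "t < n" "\<forall>x\<in>P. d t x \<le> \<nu>"
    "card (Open s) * \<nu> \<le> 16 * h * OPT" "card (Open s) \<le> 2 * N * card P"
    using g unfolding step_good_def by blast
  obtain \<nu>0 t0 where o: "radius_ok s \<nu>0 t0" "spread s \<nu>0 \<le> 16 * h * OPT * (harm n - harm (card (Open s)))"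
    using i unfolding inv_good_def by blast
  have len: "cl s x \<le> regs s ''ncl''" if "x < n" for x using i(2) that unfolding inv_sure_def by blast
  let ?q = "Suc (regs s ''ncl'')"
  let ?\<nu> = "\<nu>0(?q := \<nu>)" and ?t = "t0(?q := t)"
  have fP: "finite P" using P(1) Open_sub(2) finite_subset by blast
  have Pn: "x < n \<and> cl s x = 0" if "x \<in> P" for x using that P(1) unfolding Open_def by blast
  \<comment> \<open>The new label is fresh, so overriding \<open>\<nu>0\<close> and
    \<open>t0\<close> at it does not disturb earlier clusters.\<close>
  have cls: "cl s x \<noteq> ?q" if "x < n" for x using len[OF that] by simp
  have rad: "radius_ok s' ?\<nu> ?t"
    unfolding radius_ok_def
  proof (intro allI impI)
    fix x assume x: "x < n" "cl s' x \<noteq> 0"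
    show "?t (cl s' x) < n \<and> d (?t (cl s' x)) x \<le> ?\<nu> (cl s' x)"
    proof (cases "x \<in> P")
      case True
      then show ?thesis using P(3)[OF x(1)] P(4,5) by simp
    next
      case False
      then have e: "cl s' x = cl s x" using P(3)[OF x(1)] by simp
      then show ?thesis using o(1) x cls[OF x(1)] unfolding radius_ok_def by simp
    qed
  qed
  have set_eq: "{x. x < n \<and> cl s' x \<noteq> 0} = {x. x < n \<and> cl s x \<noteq> 0} \<union> P"
    using P(3) Pn by (auto split: if_splits)
  have "spread s' ?\<nu> = (\<Sum>x | x < n \<and> cl s x \<noteq> 0. real (?\<nu> (cl s' x))) + (\<Sum>x\<in>P. real (?\<nu> (cl s' x)))"
    unfolding spread_def set_eq by (rule sum.union_disjoint) (use fP Pn in auto)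
  also have "(\<Sum>x | x < n \<and> cl s x \<noteq> 0. real (?\<nu> (cl s' x))) = spread s \<nu>0"
    unfolding spread_def by (rule sum.cong) (use P(3) Pn cls in auto)
  also have "(\<Sum>x\<in>P. real (?\<nu> (cl s' x))) = card P * real \<nu>" using P(3) Pn by simp
  finally have sp: "spread s' ?\<nu> = spread s \<nu>0 + card P * real \<nu>" .
  have U': "Open s' = Open s - P" using P(3) Pn unfolding Open_def by (auto split: if_splits)
  have cU': "card (Open s') = card (Open s) - card P" unfolding U' using P(1) fP by (rule card_Diff_subset[rotated])
  have cP: "card P \<le> card (Open s)" using P(1) Open_sub(2) by (intro card_mono)
  have u0: "0 < card (Open s)" using big by simp
  have "card P * real \<nu> = real (card P) / card (Open s) * (card (Open s) * \<nu>)" using u0 by simp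
  also have "\<dots> \<le> real (card P) / card (Open s) * (16 * h * OPT)"
    using P(6) by (intro mult_left_mono of_nat_mono) simp_all
  also have "\<dots> \<le> (harm (card (Open s)) - harm (card (Open s) - card P)) * (16 * h * OPT)"
    by (rule mult_right_mono[OF harm_diff_ge[OF cP u0]]) simp
  finally have sp2: "spread s' ?\<nu> \<le> 16 * h * OPT * (harm n - harm (card (Open s')))"
    using o(2) unfolding sp cU' by (simp add: algebra_simps)
  have "real (card (Open s)) \<le> real (2 * N * card P)" using P(7) by (simp only: of_nat_le_iff)
  then have "real (card (Open s)) / (2 * N) \<le> card P" using sizes by (simp add: field_simps)
  then have "real (card (Open s')) \<le> card (Open s) * (1 - 1 / (2 * real N))"
    using cP unfolding cU' by (simp add: of_nat_diff algebra_simps)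
  also have "\<dots> \<le> n * (1 - 1 / (2 * real N)) ^ i * (1 - 1 / (2 * real N))"
  proof (rule mult_right_mono)
    show "real (card (Open s)) \<le> n * (1 - 1 / (2 * real N)) ^ i" using i(1) big unfolding inv_good_def by simp
    show "0 \<le> 1 - 1 / (2 * real N)" using sizes by (simp add: field_simps)
  qed
  finally have "real (card (Open s')) \<le> n * (1 - 1 / (2 * real N)) ^ Suc i" by (simp add: mult_ac)
  then show ?thesis unfolding inv_good_def using rad sp2 by blast
qed

text \<open>Once few points are open a round does nothing, so the number of rounds can be fixed in
  advance. Goodness of the pattern stays a hypothesis of the likely invariant and is paid for only
  once, when averaging over patterns.\<close>

lemma HT_Steps:
  fixes s :: state
  assumes f: "inv_sure 0 s" and S: "regs s ''S'' = S" "S \<le> G" and T: "regs s ''T'' = 8 * k * h"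
    and \<tau>: "S * (n * 9 + t_main + 10) + 3 \<le> \<tau>" and \<sigma>: "S * (h * (N * 2) + N * 2) \<le> \<sigma>"
  shows "HT E (Steps mode) s \<tau> \<sigma> (S * (\<delta>1 + \<delta>2)) (inv_sure S) (\<lambda>s'. good_pattern m h K \<and> inv_good 0 s \<longrightarrow> inv_good S s')"
proof -
  let ?F = "Filter 2 ''u'' Skip (Eql (Ar 1 (Reg ''x'')) (Const 0))"
  let ?b = "Seq ?F (If (Less (Reg ''T'') (Reg ''u'')) (StepMain mode) Skip)"
  let ?Gd = "\<lambda>i s. good_pattern m h K \<longrightarrow> inv_good i s"
  have d0: "0 \<le> \<delta>1"
  proof -
    have "1 / (8 * real k) \<le> 1" using Cs(2,3) by (cases k) (auto simp: field_simps)
    then show ?thesis unfolding \<delta>1_def by simp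
  qed
  have inv_reg: "inv_sure i (set_reg E ''st'' v s') = inv_sure i s'" "inv_good i (set_reg E ''st'' v s') = inv_good i s'" for i v s'
    by (simp_all add: inv_sure_def fixed_def inv_good_def radius_ok_def spread_def Open_def)
  have body: "HT E ?b s1 (n * 9 + t_main + 7) (h * (N * 2) + N * 2) (\<delta>1 + \<delta>2) (inv_sure (Suc i)) (\<lambda>s''. ?Gd i s1 \<longrightarrow> ?Gd (Suc i) s'')"
    if i: "i < S" and s1: "inv_sure i s1" and T1: "regs s1 ''T'' = 8 * k * h" for i s1
  proof -
    have r: "regs s1 ''G'' = G" "regs s1 ''n'' = n" using s1 by (simp_all add: inv_sure_def fixed_def)
    have fl: "ST E ?F s1 (n * (1 + 8) + 5) 0 (\<lambda>s'. regs s' ''u'' = card {x. x < n \<and> cl s1 x = 0} \<and>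
        bij_betw (\<lambda>i. mem s' (2 * G + i)) {..<card {x. x < n \<and> cl s1 x = 0}} {x. x < n \<and> cl s1 x = 0} \<and> mem_frame G 2 s1 s')"
    proof (rule ST_Filter[where \<tau> = 1 and P = "\<lambda>x. cl s1 x = 0"])
      fix s' :: state and x
      assume s': "x < n" "regs s' ''x'' = x" "\<forall>y. y \<notin> {''u'', ''x''} \<union> mods Skip \<longrightarrow> regs s' y = regs s1 y" "mem_frame G 2 s1 s'"
      have g: "regs s' ''G'' = G" using s'(3) r by simp
      have xG: "x < G" using s'(1) sizes by simp
      have "eval E s' (Ar 1 (Reg ''x'')) = cl s1 x"
        using eval_Ar[OF g, of 1 "Reg ''x''" x] s'(2) xG mem_frameD[OF s'(4) xG, of 1] by simp
      then have "(eval E s' (Eql (Ar 1 (Reg ''x'')) (Const 0)) \<noteq> 0) = (cl s1 x = 0)" by simp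
      then show "ST E Skip s' 1 0 (\<lambda>s''. (eval E s'' (Eql (Ar 1 (Reg ''x'')) (Const 0)) \<noteq> 0) = (cl s1 x = 0))"
        by (intro HT_Skip) simp_all
    qed (use r sizes in simp_all)
    show ?thesis
    proof (rule HT_Seq[OF fl, where \<tau>b = "Suc t_main" and \<sigma>b = "h * (N * 2) + N * 2" and \<delta>b = "\<delta>1 + \<delta>2"])
      fix s2 :: state
      assume s2: "regs s2 ''u'' = card {x. x < n \<and> cl s1 x = 0} \<and>
        bij_betw (\<lambda>i. mem s2 (2 * G + i)) {..<card {x. x < n \<and> cl s1 x = 0}} {x. x < n \<and> cl s1 x = 0} \<and> mem_frame G 2 s1 s2"
        "\<forall>x. x \<notin> mods ?F \<longrightarrow> regs s2 x = regs s1 x"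
      have cl2: "cl s2 x = cl s1 x" if "x < n" for x
        using mem_frameD[of G 2 s1 s2 x 1] s2(1) that sizes by simp
      have U2: "{x. x < n \<and> cl s1 x = 0} = Open s2" using cl2 by (auto simp: Open_def)
      have u: "regs s2 ''u'' = card (Open s2)" "bij_betw (\<lambda>i. mem s2 (2 * G + i)) {..<card (Open s2)} (Open s2)"
        using s2(1) unfolding U2 by blast+
      have n2: "regs s2 ''ncl'' = regs s1 ''ncl''" "regs s2 ''T'' = 8 * k * h" using s2(2) T1 by simp_all
      have sure2: "inv_sure i s2" using s1 s2(2) cl2 unfolding inv_sure_def by (simp add: fixed_def)
      have good2: "inv_good i s2" if "inv_good i s1"
      proof -
        have "Open s2 = Open s1" using U2 by (simp add: Open_def)
        moreover have "radius_ok s2 \<nu> t = radius_ok s1 \<nu> t" for \<nu> t using cl2 unfolding radius_ok_def by (simp cong: imp_cong)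
        moreover have "spread s2 \<nu> = spread s1 \<nu>" for \<nu> unfolding spread_def by (rule sum.cong) (use cl2 in auto)
        ultimately show ?thesis using that unfolding inv_good_def by simp
      qed
      show "HT E (If (Less (Reg ''T'') (Reg ''u'')) (StepMain mode) Skip) s2 (Suc t_main) (h * (N * 2) + N * 2) (\<delta>1 + \<delta>2)
          (inv_sure (Suc i)) (\<lambda>s''. True \<longrightarrow> ?Gd i s1 \<longrightarrow> ?Gd (Suc i) s'')"
      proof (rule HT_If[where \<tau>a = t_main])
        assume "eval E s2 (Less (Reg ''T'') (Reg ''u'')) = 0"
        then have small: "card (Open s2) \<le> 8 * k * h" using n2 u(1) by simp
        have "inv_sure (Suc i) s2" using sure2 unfolding inv_sure_def by simp
        moreover have "inv_good i s2 \<Longrightarrow> inv_good (Suc i) s2" using small unfolding inv_good_def by blast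
        ultimately show "HT E Skip s2 t_main (h * (N * 2) + N * 2) (\<delta>1 + \<delta>2) (inv_sure (Suc i)) (\<lambda>s''. True \<longrightarrow> ?Gd i s1 \<longrightarrow> ?Gd (Suc i) s'')"
          using good2 d0 \<delta>2_nonneg by (intro HT_Skip) (simp_all add: t_main_def)
      next
        assume "eval E s2 (Less (Reg ''T'') (Reg ''u'')) \<noteq> 0"
        then have big: "8 * k * h < card (Open s2)" using n2 u(1) by simp
        have "regs s2 ''ncl'' \<le> i" using sure2 unfolding inv_sure_def by blast
        then have nc: "regs s2 ''ncl'' < 15 * G" using i S(2) G_pos by linarith
        have fx: "fixed s2" using sure2 unfolding inv_sure_def by blast
        show "HT E (StepMain mode) s2 t_main (h * (N * 2) + N * 2) (\<delta>1 + \<delta>2) (inv_sure (Suc i)) (\<lambda>s''. True \<longrightarrow> ?Gd i s1 \<longrightarrow> ?Gd (Suc i) s'')"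
        proof (rule HT_conseq[OF HT_StepMain[OF fx u big nc] order_refl order_refl order_refl])
          fix s' :: state assume ss: "step_sure s2 s'"
          have "cl s' x \<le> regs s' ''ncl''" if "x < n" for x
          proof -
            have "cl s2 x \<le> regs s2 ''ncl''" using sure2 that unfolding inv_sure_def by blast
            moreover have "cl s' x = cl s2 x \<or> cl s' x = regs s' ''ncl''" "regs s2 ''ncl'' \<le> regs s' ''ncl''"
              using ss that unfolding step_sure_def by blast+
            ultimately show ?thesis by linarith
          qed
          moreover have "regs s' ''ncl'' \<le> Suc i" "fixed s'" using ss \<open>regs s2 ''ncl'' \<le> i\<close> unfolding step_sure_def by simp_all
          ultimately have "inv_sure (Suc i) s'" unfolding inv_sure_def by blast
          moreover have "step_good s2 s' \<Longrightarrow> inv_good i s1 \<Longrightarrow> inv_good (Suc i) s'"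
            using step_good_inv[OF _ good2 sure2 big] by blast
          ultimately show "inv_sure (Suc i) s' \<and> ((good_pattern m h K \<longrightarrow> step_good s2 s') \<longrightarrow> True \<longrightarrow> ?Gd i s1 \<longrightarrow> ?Gd (Suc i) s')" by blast
        qed
      qed simp
    qed (use d0 \<delta>2_nonneg in simp_all)
  qed
  show ?thesis
    unfolding Steps_def
  proof (rule HT_For[where N = S and \<tau> = "n * 9 + t_main + 7" and \<sigma> = "h * (N * 2) + N * 2" and \<delta> = "\<delta>1 + \<delta>2" and Inv = inv_sure and Gd = ?Gd])
    fix i and s1 :: state
    assume s1: "i < S" "inv_sure i s1" "\<forall>x. x \<noteq> ''st'' \<longrightarrow> x \<notin> mods ?b \<longrightarrow> regs s1 x = regs s x"
    have "regs s1 ''T'' = 8 * k * h" using s1(3) T by simp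
    then show "HT E ?b s1 (n * 9 + t_main + 7) (h * (N * 2) + N * 2) (\<delta>1 + \<delta>2) (\<lambda>s''. inv_sure (Suc i) (set_reg E ''st'' (Suc i) s''))
       (\<lambda>s''. ?Gd i s1 \<longrightarrow> ?Gd (Suc i) (set_reg E ''st'' (Suc i) s''))"
      unfolding inv_reg by (rule body[OF s1(1,2)])
  next
    show "S * (n * 9 + t_main + 7 + 3) + 3 \<le> \<tau>" using \<tau> by (simp add: add.assoc)
  qed (use f S \<sigma> word_gt1 word_gt d0 \<delta>2_nonneg in \<open>simp_all add: inv_reg\<close>)
qed

end

section \<open>Leftover points and the final samples\<close>

definition Singles :: com where
  "Singles = For ''x'' (Reg ''n'') (If (Ar 1 (Reg ''x'')) Skip
     (If (Less (Reg ''ncl'') (Reg ''K'')) (Seq (Incr ''ncl'') (Put 1 (Reg ''x'') (Reg ''ncl''))) Skip))"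

definition Emit :: com where
  "Emit = For ''i'' (Reg ''m'')
     (Seq (Store (Mul (Const 3) (Reg ''out'')) (Ar 3 (Reg ''i'')))
       (Seq (Store (Add (Mul (Const 3) (Reg ''out'')) (Const 1)) (Reg ''pl''))
         (Seq (Store (Add (Mul (Const 3) (Reg ''out'')) (Const 2)) (Reg ''m'')) (Incr ''out''))))"

text \<open>Labels start at 1 since 0 marks unclustered points, hence \<open>q + 1\<close>. A label
  may have no points in unlucky runs; such classes are skipped because there is nothing to
  sample.\<close>

definition Final :: com where
  "Final = For ''q'' (Reg ''ncl'')
     (Seq (Filter 2 ''pl'' Skip (Eql (Ar 1 (Reg ''x'')) (Add (Reg ''q'') (Const 1))))
       (If (Less (Const 0) (Reg ''pl'')) (Seq (Sample 3 2 ''pl'' ''m'') Emit) Skip))"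

definition Main :: "strong_mode \<Rightarrow> com" where
  "Main mode = Seq (Steps mode) (Seq Singles Final)"

lemma mods_final [simp]:
  "mods Singles = {''x'', ''ncl''}" "mods Emit = {''i'', ''out''}" "mods Final = {''q'', ''pl'', ''x'', ''i'', ''p'', ''out''}"
  unfolding Singles_def Emit_def Final_def by auto

lemma stores_final [simp]: "stores Singles" "stores Emit" "stores Final"
  unfolding Singles_def Emit_def Final_def by auto

lemma sum_lessThan_add: "(\<Sum>i<a + b. f i) = (\<Sum>i<a. f i) + (\<Sum>i<b. f (a + i))" for f :: "nat \<Rightarrow> real"
  by (induction b) simp_all

context machine
begin

lemma ST_Emit:
  fixes s :: state and M out pl :: nat
  assumes G: "regs s ''G'' = G" and M: "regs s ''m'' = M" "M \<le> G" and out: "regs s ''out'' = out" "3 * (out + M) \<le> G"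
    and pl: "regs s ''pl'' = pl" and \<tau>: "M * 10 + 3 \<le> \<tau>"
  shows "ST E Emit s \<tau> \<sigma> (\<lambda>s'. regs s' ''out'' = out + M \<and>
     (\<forall>i<M. mem s' (3 * (out + i)) = mem s (3 * G + i) \<and> mem s' (3 * (out + i) + 1) = pl \<and> mem s' (3 * (out + i) + 2) = M) \<and>
     (\<forall>a. a < 3 * out \<or> 3 * (out + M) \<le> a \<longrightarrow> mem s' a = mem s a))"
  unfolding Emit_def
proof -
  let ?b = "Seq (Store (Mul (Const 3) (Reg ''out'')) (Ar 3 (Reg ''i'')))
       (Seq (Store (Add (Mul (Const 3) (Reg ''out'')) (Const 1)) (Reg ''pl''))
         (Seq (Store (Add (Mul (Const 3) (Reg ''out'')) (Const 2)) (Reg ''m'')) (Incr ''out'')))"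
  let ?I = "\<lambda>k s'. regs s' ''out'' = out + k \<and>
     (\<forall>i<k. mem s' (3 * (out + i)) = mem s (3 * G + i) \<and> mem s' (3 * (out + i) + 1) = pl \<and> mem s' (3 * (out + i) + 2) = M) \<and>
     (\<forall>a. a < 3 * out \<or> 3 * (out + k) \<le> a \<longrightarrow> mem s' a = mem s a)"
  show "ST E (For ''i'' (Reg ''m'') ?b) s \<tau> \<sigma> (?I M)"
  proof (rule ST_For[where N = M and \<tau> = 7 and \<sigma> = 0 and Inv = ?I])
    fix k and t :: state
    assume t: "k < M" "?I k t" "regs t ''i'' = k" "\<forall>x. x \<noteq> ''i'' \<longrightarrow> x \<notin> mods ?b \<longrightarrow> regs t x = regs s x"
    have r: "regs t ''G'' = G" "regs t ''m'' = M" "regs t ''pl'' = pl" "regs t ''out'' = out + k"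
      using t(2,4) G M pl by simp_all
    let ?o = "out + k"
    have o: "3 * ?o + 3 \<le> G" using t(1) out(2) by simp
    have w: "to_word E 3 = 3" "to_word E (3 * ?o) = 3 * ?o" "to_word E (3 * ?o + 1) = 3 * ?o + 1" "to_word E (3 * ?o + 2) = 3 * ?o + 2" "to_word E 1 = 1" "to_word E 2 = 2"
      using o by (simp_all add: to_word_small)
    have kG: "k < G" using t(1) M by simp
    have src: "mem t (3 * G + k) = mem s (3 * G + k)" using t(2) o by auto
    have ar: "eval E t (Ar 3 (Reg ''i'')) = mem s (3 * G + k)"
      using eval_Ar[OF r(1), of 3 "Reg ''i''" k] t(3) kG src by simp
    let ?t1 = "t\<lparr>mem := (mem t)(3 * ?o := mem s (3 * G + k))\<rparr>"
    let ?t2 = "t\<lparr>mem := (mem t)(3 * ?o := mem s (3 * G + k), 3 * ?o + 1 := pl)\<rparr>"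
    let ?t3 = "t\<lparr>mem := (mem t)(3 * ?o := mem s (3 * G + k), 3 * ?o + 1 := pl, 3 * ?o + 2 := M)\<rparr>"
    have e1: "eval E t (Mul (Const 3) (Reg ''out'')) = 3 * ?o" using r(4) w by simp
    have e2: "eval E ?t1 (Add (Mul (Const 3) (Reg ''out'')) (Const 1)) = 3 * ?o + 1" using r(4) w by simp
    have e3: "eval E ?t2 (Add (Mul (Const 3) (Reg ''out'')) (Const 2)) = 3 * ?o + 2" using r(4) w by simp
    have 1: "ST E (Store (Mul (Const 3) (Reg ''out'')) (Ar 3 (Reg ''i''))) t 1 0 (\<lambda>t'. t' = ?t1)"
      by (rule HT_Store, unfold e1 ar) simp_all
    have 2: "ST E (Store (Add (Mul (Const 3) (Reg ''out'')) (Const 1)) (Reg ''pl'')) ?t1 1 0 (\<lambda>t'. t' = ?t2)"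
      by (rule HT_Store, unfold e2) (simp_all add: r(3))
    have 3: "ST E (Store (Add (Mul (Const 3) (Reg ''out'')) (Const 2)) (Reg ''m'')) ?t2 1 0 (\<lambda>t'. t' = ?t3)"
      by (rule HT_Store, unfold e3) (simp_all add: r(2))
    have tt: "mem t a = mem s a" if "a < 3 * out \<or> 3 * (out + k) \<le> a" for a using t(2) that by blast
    have post: "?I (Suc k) (set_reg E ''i'' (Suc k) (set_reg E ''out'' (Suc ?o) ?t3))"
    proof -
      have "Suc ?o \<le> 16 * G" using o by simp
      then have so: "to_word E (Suc ?o) = Suc ?o" by (rule to_word_small)
      have "mem ?t3 (3 * (out + i)) = mem s (3 * G + i) \<and> mem ?t3 (3 * (out + i) + 1) = pl \<and> mem ?t3 (3 * (out + i) + 2) = M" if "i < Suc k" for i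
      proof (cases "i = k")
        case False
        then have ik: "i < k" using that by simp
        have "3 * (out + i) + 2 < 3 * ?o" using ik by simp
        then have "mem ?t3 a = mem t a" if "a \<le> 3 * (out + i) + 2" for a using that by simp
        then show ?thesis using t(2) ik by simp
      qed simp
      moreover have "mem ?t3 a = mem s a" if "a < 3 * out \<or> 3 * (out + Suc k) \<le> a" for a
      proof -
        have "a \<noteq> 3 * ?o" "a \<noteq> 3 * ?o + 1" "a \<noteq> 3 * ?o + 2" using that by auto
        then have "mem ?t3 a = mem t a" by simp
        also have "\<dots> = mem s a" by (rule tt) (use that in auto)
        finally show ?thesis .
      qed
      ultimately show ?thesis using so by simp
    qed
    have 4: "ST E (Incr ''out'') ?t3 1 0 (\<lambda>t'. ?I (Suc k) (set_reg E ''i'' (Suc k) t'))"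
    proof (rule ST_Incr)
      show "?I (Suc k) (set_reg E ''i'' (Suc k) (set_reg E ''out'' (Suc (regs ?t3 ''out'')) ?t3))"
        using post r(4) by simp
    qed (use r(4) o in simp_all)
    have 5: "ST E (Seq (Store (Add (Mul (Const 3) (Reg ''out'')) (Const 2)) (Reg ''m'')) (Incr ''out'')) ?t2 3 0 (\<lambda>t'. ?I (Suc k) (set_reg E ''i'' (Suc k) t'))"
      by (rule ST_Seq[OF 3, where \<tau>b = 1 and \<sigma>b = 0]) (use 4 in simp_all)
    have 6: "ST E (Seq (Store (Add (Mul (Const 3) (Reg ''out'')) (Const 1)) (Reg ''pl'')) (Seq (Store (Add (Mul (Const 3) (Reg ''out'')) (Const 2)) (Reg ''m'')) (Incr ''out''))) ?t1 5 0 (\<lambda>t'. ?I (Suc k) (set_reg E ''i'' (Suc k) t'))"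
      by (rule ST_Seq[OF 2, where \<tau>b = 3 and \<sigma>b = 0]) (use 5 in simp_all)
    show "ST E ?b t 7 0 (\<lambda>t'. ?I (Suc k) (set_reg E ''i'' (Suc k) t'))"
      by (rule ST_Seq[OF 1, where \<tau>b = 5 and \<sigma>b = 0]) (use 6 in simp_all)
  next
    fix s' :: state assume "?I M s'"
    then show "?I M s'" .
  qed (use M out \<tau> in simp_all)
qed

end

context coreset_run
begin

text \<open>The cap \<open>Km\<close> on the number of labels holds surely and protects the size
  bound. When the leftover fits under the cap, each leftover point receives its rank among them as a
  new label.\<close>

lemma ST_Singles:
  fixes s :: state
  defines "rk \<equiv> \<lambda>i. card {z. z < i \<and> cl s z = 0}"
  assumes f: "fixed s" and Km: "regs s ''K'' = Km" "Km \<le> G" and ncl: "regs s ''ncl'' \<le> Km" "\<And>x. x < n \<Longrightarrow> cl s x \<le> regs s ''ncl''"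
    and \<tau>: "n * 8 + 3 \<le> \<tau>"
  shows "ST E Singles s \<tau> \<sigma> (\<lambda>s'. regs s' ''ncl'' \<le> Km \<and> (\<forall>x<n. cl s' x \<le> regs s' ''ncl'') \<and>
     (\<forall>x<n. cl s x \<noteq> 0 \<longrightarrow> cl s' x = cl s x) \<and>
     (regs s ''ncl'' + rk n \<le> Km \<longrightarrow> (\<forall>x<n. cl s x = 0 \<longrightarrow> cl s' x = regs s ''ncl'' + rk (Suc x))))"
  unfolding Singles_def
proof -
  let ?i = "If (Less (Reg ''ncl'') (Reg ''K'')) (Seq (Incr ''ncl'') (Put 1 (Reg ''x'') (Reg ''ncl''))) Skip"
  let ?b = "If (Ar 1 (Reg ''x'')) Skip ?i"
  let ?c = "regs s ''ncl''"
  let ?I = "\<lambda>i s'. regs s' ''ncl'' \<le> Km \<and> (\<forall>x<n. cl s' x \<le> regs s' ''ncl'') \<and>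
     (\<forall>x<n. cl s x \<noteq> 0 \<or> i \<le> x \<longrightarrow> cl s' x = cl s x) \<and>
     (?c + rk n \<le> Km \<longrightarrow> regs s' ''ncl'' = ?c + rk i \<and> (\<forall>x<i. cl s x = 0 \<longrightarrow> cl s' x = ?c + rk (Suc x)))"
  have rS: "rk (Suc i) = rk i + (if cl s i = 0 then 1 else 0)" for i
    unfolding rk_def using card_less_Suc[of i "\<lambda>z. cl s z = 0"] .
  have rmono: "rk i \<le> rk i'" if "i \<le> i'" for i i'
    unfolding rk_def using that by (intro card_mono) auto
  show "ST E (For ''x'' (Reg ''n'') ?b) s \<tau> \<sigma> (\<lambda>s'. regs s' ''ncl'' \<le> Km \<and> (\<forall>x<n. cl s' x \<le> regs s' ''ncl'') \<and>
     (\<forall>x<n. cl s x \<noteq> 0 \<longrightarrow> cl s' x = cl s x) \<and>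
     (?c + rk n \<le> Km \<longrightarrow> (\<forall>x<n. cl s x = 0 \<longrightarrow> cl s' x = ?c + rk (Suc x))))"
  proof (rule ST_For[where N = n and \<tau> = 5 and \<sigma> = 0 and Inv = ?I])
    fix x and t :: state
    assume t: "x < n" "?I x t" "regs t ''x'' = x" "\<forall>y. y \<noteq> ''x'' \<longrightarrow> y \<notin> mods ?b \<longrightarrow> regs t y = regs s y"
    have r: "regs t ''G'' = G" "regs t ''K'' = Km" using t(4) f Km by (simp_all add: fixed_def)
    have xG: "x < G" using t(1) sizes by simp
    have clx: "cl t x = cl s x" using t(1,2) by simp
    have ar: "eval E t (Ar 1 (Reg ''x'')) = cl s x"
      using eval_Ar[OF r(1), of 1 "Reg ''x''" x] t(3) xG clx by simp
    have keep: "?I (Suc x) (set_reg E ''x'' (Suc x) t)" if "cl s x \<noteq> 0 \<or> Km \<le> regs t ''ncl''"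
    proof (cases "cl s x = 0")
      case True
      then have ge: "Km \<le> regs t ''ncl''" using that by simp
      have no: "\<not> ?c + rk n \<le> Km"
      proof
        assume le: "?c + rk n \<le> Km"
        then have "regs t ''ncl'' = ?c + rk x" using t(2) by simp
        moreover have "rk (Suc x) \<le> rk n" using t(1) by (intro rmono) simp
        ultimately show False using ge le rS[of x] True by simp
      qed
      show ?thesis using t(2) no by simp
    next
      case False
      have rx: "rk (Suc x) = rk x" using rS[of x] False by simp
      show ?thesis using t(2) False rx by (simp add: less_Suc_eq)
    qed
    show "ST E ?b t 5 0 (\<lambda>s''. ?I (Suc x) (set_reg E ''x'' (Suc x) s''))"
    proof (rule HT_If[where \<tau>a = 4])
      assume "eval E t (Ar 1 (Reg ''x'')) \<noteq> 0"
      then have "cl s x \<noteq> 0 \<or> Km \<le> regs t ''ncl''" using ar by simp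
      then have kI: "?I (Suc x) (set_reg E ''x'' (Suc x) t)" by (rule keep)
      show "ST E Skip t 4 0 (\<lambda>s''. ?I (Suc x) (set_reg E ''x'' (Suc x) s''))"
      proof (rule HT_Skip)
        show "?I (Suc x) (set_reg E ''x'' (Suc x) t)" by (rule kI)
      qed simp_all
    next
      assume "eval E t (Ar 1 (Reg ''x'')) = 0"
      then have z: "cl s x = 0" using ar by simp
      show "ST E ?i t 4 0 (\<lambda>s''. ?I (Suc x) (set_reg E ''x'' (Suc x) s''))"
      proof (rule HT_If[where \<tau>a = 3])
        assume "eval E t (Less (Reg ''ncl'') (Reg ''K'')) = 0"
        then have "cl s x \<noteq> 0 \<or> Km \<le> regs t ''ncl''" using r by simp
        then have kI: "?I (Suc x) (set_reg E ''x'' (Suc x) t)" by (rule keep)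
        show "ST E Skip t 3 0 (\<lambda>s''. ?I (Suc x) (set_reg E ''x'' (Suc x) s''))"
        proof (rule HT_Skip)
        show "?I (Suc x) (set_reg E ''x'' (Suc x) t)" by (rule kI)
      qed simp_all
      next
        assume "eval E t (Less (Reg ''ncl'') (Reg ''K'')) \<noteq> 0"
        then have lt: "regs t ''ncl'' < Km" using r by simp
        define v where "v = Suc (regs t ''ncl'')"
        have vw: "to_word E v = v" using lt Km(2) unfolding v_def by (intro to_word_small) simp
        let ?t1 = "set_reg E ''ncl'' v t"
        have 1: "ST E (Incr ''ncl'') t 1 0 (\<lambda>t'. t' = ?t1)" by (rule ST_Incr) (use lt Km in \<open>simp_all add: v_def\<close>)
        have cl2: "cl (?t1\<lparr>mem := (mem t)(1 * G + x := v)\<rparr>) y = (if y = x then v else cl t y)" for y by simp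
        have I1: "?I (Suc x) (set_reg E ''x'' (Suc x) (?t1\<lparr>mem := (mem t)(1 * G + x := v)\<rparr>))"
        proof -
          let ?u = "set_reg E ''x'' (Suc x) (?t1\<lparr>mem := (mem t)(1 * G + x := v)\<rparr>)"
          have A: "cl t y \<le> v" if "y < n" for y using t(2) that by (simp add: v_def le_SucI)
          have B: "cl t y = cl s y" if "y < n" "cl s y \<noteq> 0 \<or> Suc x \<le> y" for y
          proof -
            have "\<forall>y<n. cl s y \<noteq> 0 \<or> x \<le> y \<longrightarrow> cl t y = cl s y" using t(2) by (elim conjE)
            moreover have "cl s y \<noteq> 0 \<or> x \<le> y" using that(2) by linarith
            ultimately show ?thesis using that(1) by (elim disjE) simp_all
          qed
          have C: "?c + rk (Suc x) = v" "\<forall>y<x. cl s y = 0 \<longrightarrow> cl t y = ?c + rk (Suc y)" if "?c + rk n \<le> Km"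
            using t(2) that rS[of x] z by (simp_all add: v_def)
          have ur: "regs ?u ''ncl'' = v" using vw by simp
          have uc: "cl ?u y = (if y = x then v else cl t y)" for y by simp
          show ?thesis
          proof (intro conjI allI impI)
            show "regs ?u ''ncl'' \<le> Km" unfolding ur using lt by (simp add: v_def)
          next
            fix y assume "y < n"
            then show "cl ?u y \<le> regs ?u ''ncl''" unfolding ur uc using A by simp
          next
            fix y assume y: "y < n" "cl s y \<noteq> 0 \<or> Suc x \<le> y"
            have "y \<noteq> x" using y(2) z by (cases "y = x") simp_all
            then show "cl ?u y = cl s y" unfolding uc using B[OF y] by simp
          next
            assume le: "?c + rk n \<le> Km"
            show "regs ?u ''ncl'' = ?c + rk (Suc x)" unfolding ur C(1)[OF le] by (rule refl)
            fix y assume y: "y < Suc x" "cl s y = 0"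
            show "cl ?u y = ?c + rk (Suc y)"
              unfolding uc using C[OF le] y by (cases "y = x") simp_all
          qed
        qed
        have mv: "(mem ?t1)(1 * G + x := eval E ?t1 (Reg ''ncl'')) = (mem t)(1 * G + x := v)" using vw by simp
        have 2: "ST E (Put 1 (Reg ''x'') (Reg ''ncl'')) ?t1 1 0 (\<lambda>s''. ?I (Suc x) (set_reg E ''x'' (Suc x) s''))"
        proof (rule ST_Put[where i = x])
          show "?I (Suc x) (set_reg E ''x'' (Suc x) (?t1\<lparr>mem := (mem ?t1)(1 * G + x := eval E ?t1 (Reg ''ncl''))\<rparr>))"
            unfolding mv by (rule I1)
        qed (use r(1) xG t(3) in simp_all)
        show "ST E (Seq (Incr ''ncl'') (Put 1 (Reg ''x'') (Reg ''ncl''))) t 3 0 (\<lambda>s''. ?I (Suc x) (set_reg E ''x'' (Suc x) s''))"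
          by (rule ST_Seq[OF 1, where \<tau>b = 1 and \<sigma>b = 0]) (use 2 in simp_all)
      qed simp
    qed simp
  next
    show "?I 0 (set_reg E ''x'' 0 s)" using ncl by (simp add: rk_def)
  qed (use f sizes \<tau> in \<open>simp_all add: fixed_def\<close>)
qed

definition clustered :: "state \<Rightarrow> (nat \<Rightarrow> nat) \<Rightarrow> (nat \<Rightarrow> nat) \<Rightarrow> bool" where
  "clustered s \<nu> t \<longleftrightarrow> radius_ok s \<nu> t \<and> spread s \<nu> \<le> 16 * h * OPT * harm n \<and> (\<forall>x<n. cl s x \<noteq> 0)"

text \<open>Leftover points become clusters of radius 0, so they add nothing to
  \<open>spread\<close>. The two summands of \<open>Km\<close> pay for at most one label per step
  and one per leftover point.\<close>

lemma singles_clustered: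
  fixes s s' :: state
  assumes g: "inv_good S s" and sure: "inv_sure S s" and small: "card (Open s) \<le> 8 * k * h" and Km: "S + 8 * k * h \<le> Km"
    and s': "\<And>x. x < n \<Longrightarrow> cl s x \<noteq> 0 \<Longrightarrow> cl s' x = cl s x"
      "regs s ''ncl'' + card {z. z < n \<and> cl s z = 0} \<le> Km \<Longrightarrow> (\<forall>x<n. cl s x = 0 \<longrightarrow> cl s' x = regs s ''ncl'' + card {z. z < Suc x \<and> cl s z = 0})"
  shows "\<exists>\<nu> t. clustered s' \<nu> t"
proof -
  let ?c = "regs s ''ncl''"
  have c: "?c \<le> S" "\<And>x. x < n \<Longrightarrow> cl s x \<le> ?c" using sure unfolding inv_sure_def by simp_all
  have "?c + card {z. z < n \<and> cl s z = 0} \<le> Km" using c(1) small Km unfolding Open_def by linarith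
  then have new: "cl s' x = ?c + card {z. z < Suc x \<and> cl s z = 0}" if "x < n" "cl s x = 0" for x using s'(2) that by simp
  have gt: "?c < cl s' x" if "x < n" "cl s x = 0" for x
    unfolding new[OF that] using card_less_Suc[of x "\<lambda>z. cl s z = 0"] that by simp
  have inj: "x = y" if xy: "x < n" "cl s x = 0" "y < n" "cl s y = 0" "cl s' x = cl s' y" for x y
  proof (rule ccontr)
    assume "x \<noteq> y"
    have *: False if "a < b" "cl s b = 0" "card {z. z < Suc a \<and> cl s z = 0} = card {z. z < Suc b \<and> cl s z = 0}" for a b
    proof -
      have "card {z. z < Suc a \<and> cl s z = 0} \<le> card {z. z < b \<and> cl s z = 0}" using that(1) by (intro card_mono) auto
      then show False using card_less_Suc[of b "\<lambda>z. cl s z = 0"] that by simp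
    qed
    have "card {z. z < Suc x \<and> cl s z = 0} = card {z. z < Suc y \<and> cl s z = 0}"
      using xy(5) new[OF xy(1,2)] new[OF xy(3,4)] by simp
    then show False using *[of x y] *[of y x] xy \<open>x \<noteq> y\<close> by (cases "x < y") auto
  qed
  obtain \<nu> t where o: "radius_ok s \<nu> t" "spread s \<nu> \<le> 16 * h * OPT * (harm n - harm (card (Open s)))"
    using g unfolding inv_good_def by blast
  define \<nu>' where "\<nu>' = (\<lambda>q. if q \<le> ?c then \<nu> q else 0)"
  \<comment> \<open>A new label belongs to exactly one leftover point, by \<open>inj\<close>, and
    that point is its own centre.\<close>
  define t' where "t' = (\<lambda>q. if q \<le> ?c then t q else (THE x. x < n \<and> cl s x = 0 \<and> cl s' x = q))"
  have t'new: "t' (cl s' x) = x" if "x < n" "cl s x = 0" for x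
  proof -
    have "(THE y. y < n \<and> cl s y = 0 \<and> cl s' y = cl s' x) = x"
      by (rule the_equality) (use that inj in auto)
    then show ?thesis using gt[OF that] by (simp add: t'_def)
  qed
  have "radius_ok s' \<nu>' t'"
    unfolding radius_ok_def
  proof (intro allI impI)
    fix x assume x: "x < n" "cl s' x \<noteq> 0"
    show "t' (cl s' x) < n \<and> d (t' (cl s' x)) x \<le> \<nu>' (cl s' x)"
    proof (cases "cl s x = 0")
      case True
      then show ?thesis using t'new[OF x(1) True] x(1) self by simp
    next
      case False
      then have "cl s' x = cl s x" "cl s x \<le> ?c" using s'(1) x(1) c(2) by simp_all
      then show ?thesis using o(1) x(1) False unfolding radius_ok_def \<nu>'_def t'_def by simp
    qed
  qed
  moreover have nz: "cl s' x \<noteq> 0" if "x < n" for x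
    using s'(1)[OF that] gt[OF that] by (cases "cl s x = 0") simp_all
  moreover have "spread s' \<nu>' \<le> 16 * h * OPT * harm n"
  proof -
    have "spread s' \<nu>' = (\<Sum>x | x < n. real (\<nu>' (cl s' x)))" unfolding spread_def by (rule sum.cong) (use nz in auto)
    also have "\<dots> = (\<Sum>x | x < n \<and> cl s x \<noteq> 0. real (\<nu>' (cl s' x)))"
    proof (rule sum.mono_neutral_right)
      show "\<forall>x\<in>{x. x < n} - {x. x < n \<and> cl s x \<noteq> 0}. real (\<nu>' (cl s' x)) = 0"
      proof
        fix x assume "x \<in> {x. x < n} - {x. x < n \<and> cl s x \<noteq> 0}"
        then have "x < n" "cl s x = 0" by auto
        then show "real (\<nu>' (cl s' x)) = 0" using gt[of x] by (simp add: \<nu>'_def)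
      qed
    qed auto
    also have "\<dots> = spread s \<nu>" unfolding spread_def
    proof (rule sum.cong[OF refl])
      fix x assume "x \<in> {x. x < n \<and> cl s x \<noteq> 0}"
      then have "x < n" "cl s x \<noteq> 0" by auto
      then show "real (\<nu>' (cl s' x)) = real (\<nu> (cl s x))" using s'(1) c(2) by (simp add: \<nu>'_def)
    qed
    also have "\<dots> \<le> 16 * h * OPT * (harm n - harm (card (Open s)))" by (rule o(2))
    also have "\<dots> \<le> 16 * h * OPT * harm n" by (intro mult_left_mono) (simp_all add: harm_nonneg)
    finally show ?thesis .
  qed
  ultimately show ?thesis unfolding clustered_def by blast
qed

definition est :: "state \<Rightarrow> nat set \<Rightarrow> real" where
  "est s C = (\<Sum>i<regs s ''out''. real (mem s (3 * i + 1)) / real (mem s (3 * i + 2)) * real (near C (mem s (3 * i))))"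

definition centres :: "nat set set" where
  "centres = {C. C \<subseteq> {..<n} \<and> C \<noteq> {} \<and> card C \<le> k}"

definition \<delta>3 :: "nat \<Rightarrow> real \<Rightarrow> real" where
  "\<delta>3 M \<eta> = real ((n + 1) ^ k) * (2 * exp (- 2 * M * \<eta>\<^sup>2))"

lemma \<delta>3_nonneg: "0 \<le> \<delta>3 M \<eta>" by (simp add: \<delta>3_def)

definition upto :: "state \<Rightarrow> nat \<Rightarrow> nat set" where
  "upto s q = {x. x < n \<and> cl s x \<noteq> 0 \<and> cl s x \<le> q}"

definition fin_sure :: "state \<Rightarrow> nat \<Rightarrow> nat \<Rightarrow> state \<Rightarrow> bool" where
  "fin_sure s0 M q s \<longleftrightarrow> regs s ''out'' \<le> q * M \<and> (\<forall>x<n. cl s x = cl s0 x) \<and> (\<forall>i<regs s ''out''. mem s (3 * i) < n)"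

definition fin_good :: "state \<Rightarrow> (nat \<Rightarrow> nat) \<Rightarrow> real \<Rightarrow> nat \<Rightarrow> state \<Rightarrow> bool" where
  "fin_good s0 \<nu> \<eta> q s \<longleftrightarrow> (\<forall>C\<in>centres. \<bar>est s C - (\<Sum>x\<in>upto s0 q. real (near C x))\<bar> \<le> \<eta> * (2 * (\<Sum>x\<in>upto s0 q. real (\<nu> (cl s0 x)))))"

text \<open>Costs add over disjoint clusters, and so do the errors: this cluster contributes
  \<open>2 * \<eta>\<close> times its radius for each of its points. The claim is conditional on
  \<open>radius_ok\<close>, because samples are drawn even after a failed clustering.\<close>

lemma HT_Final_body:
  fixes s0 s :: state and M q :: nat and \<eta> :: real
  defines "P \<equiv> {x. x < n \<and> cl s0 x = Suc q}"
  assumes r: "fixed s" "regs s ''m'' = M" "regs s ''q'' = q" and M: "0 < M" "M \<le> G" and q: "3 * (Suc q * M) \<le> G" "Suc q \<le> G"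
    and \<eta>: "0 < \<eta>" and inv: "fin_sure s0 M q s"
  shows "HT E (Seq (Filter 2 ''pl'' Skip (Eql (Ar 1 (Reg ''x'')) (Add (Reg ''q'') (Const 1))))
       (If (Less (Const 0) (Reg ''pl'')) (Seq (Sample 3 2 ''pl'' ''m'') Emit) Skip)) s (n * 9 + M * 16 + 20) 0 (\<delta>3 M \<eta>)
     (fin_sure s0 M (Suc q)) (\<lambda>s'. (radius_ok s0 \<nu> t \<longrightarrow> fin_good s0 \<nu> \<eta> q s) \<longrightarrow> radius_ok s0 \<nu> t \<longrightarrow> fin_good s0 \<nu> \<eta> (Suc q) s')"
proof -
  let ?F = "Filter 2 ''pl'' Skip (Eql (Ar 1 (Reg ''x'')) (Add (Reg ''q'') (Const 1)))"
  let ?Q = "\<lambda>s'. (radius_ok s0 \<nu> t \<longrightarrow> fin_good s0 \<nu> \<eta> q s) \<longrightarrow> radius_ok s0 \<nu> t \<longrightarrow> fin_good s0 \<nu> \<eta> (Suc q) s'"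
  have rG: "regs s ''G'' = G" "regs s ''n'' = n" using r(1) by (simp_all add: fixed_def)
  have i: "regs s ''out'' \<le> q * M" "\<And>x. x < n \<Longrightarrow> cl s x = cl s0 x" "\<And>i. i < regs s ''out'' \<Longrightarrow> mem s (3 * i) < n"
    using inv unfolding fin_sure_def by simp_all
  have fP: "finite P" and Pn: "P \<subseteq> {..<n}" by (auto simp: P_def)
  have cP: "card P \<le> G" using card_mono[OF finite_lessThan Pn] sizes by simp
  have Sq: "to_word E (Suc q) = Suc q" "to_word E 1 = 1" using q(2) by (simp_all add: to_word_small)
  have fl: "ST E ?F s (n * (1 + 8) + 5) 0 (\<lambda>s'. regs s' ''pl'' = card {x. x < n \<and> cl s0 x = Suc q} \<and>
        bij_betw (\<lambda>i. mem s' (2 * G + i)) {..<card {x. x < n \<and> cl s0 x = Suc q}} {x. x < n \<and> cl s0 x = Suc q} \<and> mem_frame G 2 s s')"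
  proof (rule ST_Filter[where \<tau> = 1 and P = "\<lambda>x. cl s0 x = Suc q"])
    fix s' :: state and x
    assume s': "x < n" "regs s' ''x'' = x" "\<forall>y. y \<notin> {''pl'', ''x''} \<union> mods Skip \<longrightarrow> regs s' y = regs s y" "mem_frame G 2 s s'"
    have g: "regs s' ''G'' = G" "regs s' ''q'' = q" using s'(3) rG r(3) by simp_all
    have xG: "x < G" using s'(1) sizes by simp
    have "eval E s' (Ar 1 (Reg ''x'')) = cl s0 x"
      using eval_Ar[OF g(1), of 1 "Reg ''x''" x] s'(1,2) xG mem_frameD[OF s'(4) xG, of 1] i(2)[OF s'(1)] by simp
    then have "(eval E s' (Eql (Ar 1 (Reg ''x'')) (Add (Reg ''q'') (Const 1))) \<noteq> 0) = (cl s0 x = Suc q)" using g(2) Sq by simp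
    then show "ST E Skip s' 1 0 (\<lambda>s''. (eval E s'' (Eql (Ar 1 (Reg ''x'')) (Add (Reg ''q'') (Const 1))) \<noteq> 0) = (cl s0 x = Suc q))"
      by (intro HT_Skip) simp_all
  qed (use rG sizes in simp_all)
  have up: "upto s0 (Suc q) = upto s0 q \<union> P" "upto s0 q \<inter> P = {}" "finite (upto s0 q)"
    by (auto simp: upto_def P_def)
  have sumU: "(\<Sum>x\<in>upto s0 (Suc q). f x) = (\<Sum>x\<in>upto s0 q. f x) + (\<Sum>x\<in>P. f x)" for f :: "nat \<Rightarrow> real"
    unfolding up(1) using up(2,3) fP by (intro sum.union_disjoint)
  show ?thesis
  proof (rule HT_Seq[OF fl[folded P_def], where \<tau>b = "M * 16 + 10" and \<sigma>b = 0 and \<delta>b = "\<delta>3 M \<eta>"])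
    fix s1 :: state
    assume s1: "regs s1 ''pl'' = card P \<and> bij_betw (\<lambda>i. mem s1 (2 * G + i)) {..<card P} P \<and> mem_frame G 2 s s1"
      "\<forall>x. x \<notin> mods ?F \<longrightarrow> regs s1 x = regs s x"
    have r1: "regs s1 ''G'' = G" "regs s1 ''m'' = M" "regs s1 ''out'' = regs s ''out''" using s1(2) rG r by simp_all
    have "3 * (regs s ''out'' + M) \<le> 3 * (Suc q * M)" using i(1) by simp
    then have outG: "3 * (regs s ''out'' + M) \<le> G" using q(1) by (rule order_trans)
    have low1: "mem s1 a = mem s a" if "a < 3 * regs s ''out''" for a
    proof -
      have "a < G" using that outG by (simp add: algebra_simps)
      then show ?thesis using s1(1) mem_frameD[of G 2 s s1 a 0] by simp
    qed
    have cl1: "cl s1 x = cl s0 x" if "x < n" for x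
      using s1(1) mem_frameD[of G 2 s s1 x 1] that sizes i(2)[OF that] by simp
    have est_eq: "est s' C = (\<Sum>i<regs s ''out''. real (mem s' (3 * i + 1)) / real (mem s' (3 * i + 2)) * real (near C (mem s' (3 * i))))"
      if "regs s' ''out'' = regs s ''out''" for s' C using that by (simp add: est_def)
    have est_low: "(\<Sum>i<regs s ''out''. real (mem s' (3 * i + 1)) / real (mem s' (3 * i + 2)) * real (near C (mem s' (3 * i)))) = est s C"
      if "\<And>a. a < 3 * regs s ''out'' \<Longrightarrow> mem s' a = mem s a" for s' C
      unfolding est_def by (rule sum.cong) (use that in auto)
    show "HT E (If (Less (Const 0) (Reg ''pl'')) (Seq (Sample 3 2 ''pl'' ''m'') Emit) Skip) s1 (M * 16 + 10) 0 (\<delta>3 M \<eta>)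
       (fin_sure s0 M (Suc q)) (\<lambda>s'. True \<longrightarrow> ?Q s')"
    proof (rule HT_If[where \<tau>a = "M * 16 + 9"])
      assume "eval E s1 (Less (Const 0) (Reg ''pl'')) = 0"
      then have "card P = 0" using s1(1) by simp
      then have Pe: "P = {}" using fP by simp
      have "regs s1 ''out'' \<le> Suc q * M" using i(1) r1(3) by (simp add: trans_le_add2)
      moreover have "mem s1 (3 * j) < n" if "j < regs s1 ''out''" for j
        using i(3)[of j] low1[of "3 * j"] that r1(3) by simp
      ultimately have a: "fin_sure s0 M (Suc q) s1" using cl1 unfolding fin_sure_def by simp
      have e: "est s1 C = est s C" for C using est_eq[OF r1(3)] est_low[OF low1] by simp
      have u: "upto s0 (Suc q) = upto s0 q" using up(1) Pe by simp
      have "?Q s1" unfolding fin_good_def e u by simp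
      then show "HT E Skip s1 (M * 16 + 9) 0 (\<delta>3 M \<eta>) (fin_sure s0 M (Suc q)) (\<lambda>s'. True \<longrightarrow> ?Q s')"
        using a \<delta>3_nonneg by (intro HT_Skip impI) simp_all
    next
      assume "eval E s1 (Less (Const 0) (Reg ''pl'')) \<noteq> 0"
      then have P0: "0 < card P" using s1(1) by simp
      then have Pne: "P \<noteq> {}" by (simp add: card_gt_0_iff)
      let ?dev = "\<lambda>\<omega> C. \<bar>card P / M * (\<Sum>i<M. real (near C (\<omega> i))) - (\<Sum>x\<in>P. real (near C x))\<bar>"
      \<comment> \<open>The event covers all centre sets simultaneously, as the coreset property
        demands; without \<open>radius_ok\<close> it holds trivially.\<close>
      define Ev where "Ev = (\<lambda>\<omega> :: nat \<Rightarrow> nat. radius_ok s0 \<nu> t \<longrightarrow> (\<forall>C\<in>centres. ?dev \<omega> C \<le> \<eta> * (2 * card P * \<nu> (Suc q))))"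
      have Ev: "measure_pmf.prob (Pi_pmf {..<M} 0 (\<lambda>_. pmf_of_set P)) {\<omega>. \<not> Ev \<omega>} \<le> \<delta>3 M \<eta>"
      proof (cases "radius_ok s0 \<nu> t")
        case True
        obtain x0 where x0: "x0 \<in> P" using Pne by blast
        have rad: "t (Suc q) < n \<and> d (t (Suc q)) x \<le> \<nu> (Suc q)" if "x \<in> P" for x
        proof -
          have "x < n" "cl s0 x = Suc q" using that by (simp_all add: P_def)
          then show ?thesis using True unfolding radius_ok_def by (metis nat.distinct(2))
        qed
        have ee: "real_of_int (- 2 * int M) = - 2 * real M" by simp
        have t0: "t (Suc q) < n" by (rule rad[OF x0, THEN conjunct1])
        have r0: "\<And>x. x \<in> P \<Longrightarrow> d (t (Suc q)) x \<le> \<nu> (Suc q)" by (rule rad[THEN conjunct2])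
        have "measure_pmf.prob (Pi_pmf {..<M} 0 (\<lambda>_. pmf_of_set P)) {\<omega>. \<exists>C. C \<subseteq> {..<n} \<and> C \<noteq> {} \<and> card C \<le> k \<and>
            \<eta> * (2 * card P * \<nu> (Suc q)) < ?dev \<omega> C} \<le> \<delta>3 M \<eta>"
          unfolding \<delta>3_def using prob_cluster_sample[OF Pn Pne t0 r0 M(1) \<eta>, of k] unfolding ee .
        moreover have "{\<omega>. \<not> Ev \<omega>} = {\<omega>. \<exists>C. C \<subseteq> {..<n} \<and> C \<noteq> {} \<and> card C \<le> k \<and> \<eta> * (2 * card P * \<nu> (Suc q)) < ?dev \<omega> C}"
          unfolding Ev_def centres_def using True by (simp add: not_le)
        ultimately show ?thesis by simp
      next
        case False
        have "Ev \<omega>" for \<omega> unfolding Ev_def by (rule impI) (rule notE[OF False])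
        then show ?thesis using \<delta>3_nonneg by simp
      qed
      have smp: "HT E (Sample 3 2 ''pl'' ''m'') s1 (M * 6 + 3) 0 (\<delta>3 M \<eta>) (\<lambda>s'. (\<forall>i<M. mem s' (3 * G + i) \<in> P) \<and> mem_frame G 3 s1 s')
          (\<lambda>s'. Ev (\<lambda>i. if i < M then mem s' (3 * G + i) else 0))"
        by (rule HT_Sample[OF r1(1) _ _ _ conjunct1[OF s1(1)] P0 cP _ r1(2) M(2) _ conjunct1[OF conjunct2[OF s1(1)]] Ev order_refl]) simp_all
      show "HT E (Seq (Sample 3 2 ''pl'' ''m'') Emit) s1 (M * 16 + 9) 0 (\<delta>3 M \<eta>) (fin_sure s0 M (Suc q)) (\<lambda>s'. True \<longrightarrow> ?Q s')"
      proof (rule HT_Seq[OF smp, where \<tau>b = "M * 10 + 3" and \<sigma>b = 0 and \<delta>b = 0])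
        fix s2 :: state
        assume s2: "(\<forall>i<M. mem s2 (3 * G + i) \<in> P) \<and> mem_frame G 3 s1 s2" "\<forall>x. x \<notin> mods (Sample 3 2 ''pl'' ''m'') \<longrightarrow> regs s2 x = regs s1 x"
        let ?out = "regs s ''out''" and ?\<omega> = "\<lambda>i. if i < M then mem s2 (3 * G + i) else 0"
        have r2: "regs s2 ''G'' = G" "regs s2 ''m'' = M" "regs s2 ''out'' = ?out" "regs s2 ''pl'' = card P" using s2(2) r1 s1(1) by simp_all
        have low2: "mem s2 a = mem s a" if "a < 3 * ?out" for a
        proof -
          have "a < G" using that outG by (simp add: algebra_simps)
          then show ?thesis using s2(1) mem_frameD[of G 3 s1 s2 a 0] low1[OF that] by simp
        qed
        have cl2: "cl s2 x = cl s0 x" if "x < n" for x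
          using s2(1) mem_frameD[of G 3 s1 s2 x 1] that sizes cl1[OF that] by simp
        show "HT E Emit s2 (M * 10 + 3) 0 0 (fin_sure s0 M (Suc q)) (\<lambda>s'. Ev ?\<omega> \<longrightarrow> True \<longrightarrow> ?Q s')"
        proof (rule HT_conseq[OF ST_Emit[OF r2(1,2) M(2) r2(3) outG r2(4) order_refl] order_refl order_refl order_refl])
          fix s' :: state
          assume s': "regs s' ''out'' = ?out + M \<and>
             (\<forall>i<M. mem s' (3 * (?out + i)) = mem s2 (3 * G + i) \<and> mem s' (3 * (?out + i) + 1) = card P \<and> mem s' (3 * (?out + i) + 2) = M) \<and>
             (\<forall>a. a < 3 * ?out \<or> 3 * (?out + M) \<le> a \<longrightarrow> mem s' a = mem s2 a)"
          have out': "regs s' ''out'' = ?out + M" using s' by simp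
          have new: "mem s' (3 * (?out + i)) = mem s2 (3 * G + i)" "mem s' (3 * (?out + i) + 1) = card P" "mem s' (3 * (?out + i) + 2) = M"
            if "i < M" for i using s' that by simp_all
          have low: "mem s' a = mem s a" if "a < 3 * ?out" for a using s' low2[OF that] that by simp
          have cl': "cl s' x = cl s0 x" if "x < n" for x
          proof -
            have "mem s' (1 * G + x) = mem s2 (1 * G + x)" using s' outG by simp
            then show ?thesis using cl2[OF that] by simp
          qed
          have pts: "mem s' (3 * j) < n" if "j < ?out + M" for j
          proof (cases "j < ?out")
            case True
            then show ?thesis using low[of "3 * j"] i(3)[of j] by simp
          next
            case False
            define i' where "i' = j - ?out"
            have i': "j = ?out + i'" "i' < M" using that False by (simp_all add: i'_def)
            have "mem s2 (3 * G + i') \<in> {..<n}" using s2(1) i'(2) by (intro subsetD[OF Pn]) simp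
            then show ?thesis unfolding i'(1) new(1)[OF i'(2)] by simp
          qed
          have sure: "fin_sure s0 M (Suc q) s'"
            unfolding fin_sure_def using out' i(1) cl' pts by simp
          have est': "est s' C = est s C + card P / M * (\<Sum>i<M. real (near C (?\<omega> i)))" for C
          proof -
            have "est s' C = (\<Sum>i<?out. real (mem s' (3 * i + 1)) / real (mem s' (3 * i + 2)) * real (near C (mem s' (3 * i)))) +
               (\<Sum>i<M. real (mem s' (3 * (?out + i) + 1)) / real (mem s' (3 * (?out + i) + 2)) * real (near C (mem s' (3 * (?out + i)))))"
              unfolding est_def out' by (rule sum_lessThan_add)
            also have "(\<Sum>i<?out. real (mem s' (3 * i + 1)) / real (mem s' (3 * i + 2)) * real (near C (mem s' (3 * i)))) = est s C"
              by (rule est_low[OF low])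
            also have "(\<Sum>i<M. real (mem s' (3 * (?out + i) + 1)) / real (mem s' (3 * (?out + i) + 2)) * real (near C (mem s' (3 * (?out + i))))) =
                (\<Sum>i<M. card P / M * real (near C (?\<omega> i)))" by (rule sum.cong) (use new in simp_all)
            also have "\<dots> = card P / M * (\<Sum>i<M. real (near C (?\<omega> i)))" by (simp only: sum_distrib_left)
            finally show ?thesis .
          qed
          have "fin_good s0 \<nu> \<eta> (Suc q) s'" if ev: "Ev ?\<omega>" and rad: "radius_ok s0 \<nu> t" and old: "fin_good s0 \<nu> \<eta> q s"
            unfolding fin_good_def
          proof
            fix C assume C: "C \<in> centres"
            have 1: "?dev ?\<omega> C \<le> \<eta> * (2 * card P * \<nu> (Suc q))" using ev rad C unfolding Ev_def by simp
            have 2: "\<bar>est s C - (\<Sum>x\<in>upto s0 q. real (near C x))\<bar> \<le> \<eta> * (2 * (\<Sum>x\<in>upto s0 q. real (\<nu> (cl s0 x))))"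
              using old C unfolding fin_good_def by blast
            have ab: "\<bar>a + b - (c + e)\<bar> \<le> \<bar>a - c\<bar> + \<bar>b - e\<bar>" for a b c e :: real by linarith
            have 3: "(\<Sum>x\<in>P. real (\<nu> (cl s0 x))) = card P * \<nu> (Suc q)" by (simp add: P_def)
            have "\<bar>est s' C - (\<Sum>x\<in>upto s0 (Suc q). real (near C x))\<bar> \<le>
                \<bar>est s C - (\<Sum>x\<in>upto s0 q. real (near C x))\<bar> + ?dev ?\<omega> C" unfolding est' sumU by (rule ab)
            also have "\<dots> \<le> \<eta> * (2 * (\<Sum>x\<in>upto s0 q. real (\<nu> (cl s0 x)))) + \<eta> * (2 * card P * \<nu> (Suc q))" using 1 2 by linarith
            also have "\<dots> = \<eta> * (2 * (\<Sum>x\<in>upto s0 (Suc q). real (\<nu> (cl s0 x))))" unfolding sumU 3 by (simp add: algebra_simps)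
            finally show "\<bar>est s' C - (\<Sum>x\<in>upto s0 (Suc q). real (near C x))\<bar> \<le> \<eta> * (2 * (\<Sum>x\<in>upto s0 (Suc q). real (\<nu> (cl s0 x))))" .
          qed
          then show "fin_sure s0 M (Suc q) s' \<and> (True \<longrightarrow> Ev ?\<omega> \<longrightarrow> True \<longrightarrow> ?Q s')" using sure by simp
        qed
      qed simp_all
    qed simp
  qed (use \<delta>3_nonneg in simp_all)
qed

text \<open>Summed over all clusters the errors give \<open>2 * \<eta>\<close> times
  \<open>spread\<close>, which the clustering bounds by a multiple of \<open>OPT\<close>; the error
  is thus relative to the optimum and not to each centre set.\<close>

lemma HT_Final:
  fixes s :: state and M Km :: nat and \<eta> :: real
  assumes r: "fixed s" "regs s ''m'' = M" "regs s ''ncl'' \<le> Km" "regs s ''out'' = 0" and M: "0 < M" "M \<le> G"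
    and Km: "3 * (Km * M) \<le> G" "Km \<le> G" and \<eta>: "0 < \<eta>" and cl: "\<And>x. x < n \<Longrightarrow> cl s x \<le> regs s ''ncl''"
    and \<tau>: "Km * (n * 9 + M * 16 + 23) + 3 \<le> \<tau>"
  shows "HT E Final s \<tau> \<sigma> (Km * \<delta>3 M \<eta>) (\<lambda>s'. regs s' ''out'' \<le> Km * M \<and> (\<forall>i<regs s' ''out''. mem s' (3 * i) < n))
    (\<lambda>s'. clustered s \<nu> t \<longrightarrow> (\<forall>C\<in>centres. \<bar>est s' C - (\<Sum>x<n. real (near C x))\<bar> \<le> \<eta> * (2 * (16 * h * OPT * harm n))))"
proof -
  let ?n = "regs s ''ncl''"
  let ?F = "Filter 2 ''pl'' Skip (Eql (Ar 1 (Reg ''x'')) (Add (Reg ''q'') (Const 1)))"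
  let ?b = "Seq ?F (If (Less (Const 0) (Reg ''pl'')) (Seq (Sample 3 2 ''pl'' ''m'') Emit) Skip)"
  let ?Gd = "\<lambda>q s'. radius_ok s \<nu> t \<longrightarrow> fin_good s \<nu> \<eta> q s'"
  have reg: "fin_sure s M q (set_reg E ''q'' v s') = fin_sure s M q s'" "fin_good s \<nu> \<eta> q (set_reg E ''q'' v s') = fin_good s \<nu> \<eta> q s'" for q v s'
    by (simp_all add: fin_sure_def fin_good_def est_def)
  have nG: "?n \<le> G" using r(3) Km(2) by simp
  show ?thesis
    unfolding Final_def
  proof (rule HT_For[where N = ?n and \<tau> = "n * 9 + M * 16 + 20" and \<sigma> = 0 and \<delta> = "\<delta>3 M \<eta>" and Inv = "fin_sure s M" and Gd = ?Gd])
    fix q and s1 :: state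
    assume s1: "q < ?n" "fin_sure s M q s1" "regs s1 ''q'' = q" "\<forall>x. x \<noteq> ''q'' \<longrightarrow> x \<notin> mods ?b \<longrightarrow> regs s1 x = regs s x"
    have f1: "fixed s1" "regs s1 ''m'' = M" using s1(4) r by (simp_all add: fixed_def)
    have "Suc q * M \<le> Km * M" using s1(1) r(3) by (intro mult_le_mono1) simp
    then have "3 * (Suc q * M) \<le> 3 * (Km * M)" by (rule mult_le_mono2)
    then have q3: "3 * (Suc q * M) \<le> G" using Km(1) by (rule order_trans)
    have qG: "Suc q \<le> G" using s1(1) nG by simp
    show "HT E ?b s1 (n * 9 + M * 16 + 20) 0 (\<delta>3 M \<eta>) (\<lambda>s''. fin_sure s M (Suc q) (set_reg E ''q'' (Suc q) s''))
       (\<lambda>s''. ?Gd q s1 \<longrightarrow> ?Gd (Suc q) (set_reg E ''q'' (Suc q) s''))"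
      unfolding reg by (rule HT_Final_body[OF f1 s1(3) M q3 qG \<eta> s1(2)])
  next
    fix s' :: state assume s': "fin_sure s M ?n s'"
    have "regs s' ''out'' \<le> ?n * M" using s' unfolding fin_sure_def by blast
    also have "\<dots> \<le> Km * M" using r(3) by simp
    finally have o: "regs s' ''out'' \<le> Km * M" .
    have "\<bar>est s' C - (\<Sum>x<n. real (near C x))\<bar> \<le> \<eta> * (2 * (16 * h * OPT * harm n))"
      if g: "?Gd 0 (set_reg E ''q'' 0 s) \<longrightarrow> ?Gd ?n s'" and c: "clustered s \<nu> t" and C: "C \<in> centres" for C
    proof -
      have rad: "radius_ok s \<nu> t" "spread s \<nu> \<le> 16 * h * OPT * harm n" "\<And>x. x < n \<Longrightarrow> cl s x \<noteq> 0"
        using c unfolding clustered_def by simp_all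
      have "upto s 0 = {}" by (auto simp: upto_def)
      then have "fin_good s \<nu> \<eta> 0 s" using r(4) by (simp add: fin_good_def est_def)
      then have "fin_good s \<nu> \<eta> ?n s'" using g rad(1) unfolding reg by simp
      moreover have u: "upto s ?n = {..<n}" unfolding upto_def using rad(3) cl by auto
      ultimately have "\<bar>est s' C - (\<Sum>x<n. real (near C x))\<bar> \<le> \<eta> * (2 * (\<Sum>x<n. real (\<nu> (cl s x))))"
        using C unfolding fin_good_def by simp
      also have "(\<Sum>x<n. real (\<nu> (cl s x))) = spread s \<nu>" unfolding spread_def by (rule sum.cong) (use rad(3) in auto)
      also have "\<eta> * (2 * spread s \<nu>) \<le> \<eta> * (2 * (16 * h * OPT * harm n))" using rad(2) \<eta> by (intro mult_left_mono) simp_all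
      finally show ?thesis .
    qed
    moreover have "\<forall>i<regs s' ''out''. mem s' (3 * i) < n" using s' unfolding fin_sure_def by blast
    ultimately show "(regs s' ''out'' \<le> Km * M \<and> (\<forall>i<regs s' ''out''. mem s' (3 * i) < n)) \<and>
      ((?Gd 0 (set_reg E ''q'' 0 s) \<longrightarrow> ?Gd ?n s') \<longrightarrow> clustered s \<nu> t \<longrightarrow> (\<forall>C\<in>centres. \<bar>est s' C - (\<Sum>x<n. real (near C x))\<bar> \<le> \<eta> * (2 * (16 * h * OPT * harm n))))"
      using o by (intro conjI impI ballI) simp_all
  next
    have "?n * (n * 9 + M * 16 + 23) \<le> Km * (n * 9 + M * 16 + 23)" using r(3) by (rule mult_le_mono1)
    then have "?n * (n * 9 + M * 16 + 23) + 3 \<le> \<tau>" using \<tau> by linarith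
    moreover have "n * 9 + M * 16 + 20 + 3 = n * 9 + M * 16 + 23" by simp
    ultimately show "?n * (n * 9 + M * 16 + 20 + 3) + 3 \<le> \<tau>" by (simp only:)
    show "?n * \<delta>3 M \<eta> \<le> Km * \<delta>3 M \<eta>" using r(3) \<delta>3_nonneg by (intro mult_right_mono) simp_all
    show "fin_sure s M 0 (set_reg E ''q'' 0 s)" unfolding reg using r(4) by (simp add: fin_sure_def)
  qed (use word_gt1 word_gt[OF nG] \<delta>3_nonneg in simp_all)
qed

text \<open>The assumption \<open>stop\<close> turns the geometric decay into fewer than one open
  point, so either disjunct of \<open>inv_good\<close> leaves at most \<open>8 * k * h\<close>
  points for \<open>Singles\<close>.\<close>

lemma HT_Main:
  fixes s :: state and M S :: nat and \<eta> :: real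
  assumes f: "fixed s" and z: "\<And>x. x < n \<Longrightarrow> cl s x = 0" "regs s ''ncl'' = 0" "regs s ''out'' = 0"
    and S: "regs s ''S'' = S" and T: "regs s ''T'' = 8 * k * h" and K: "regs s ''K'' = S + 8 * k * h"
    and M: "regs s ''m'' = M" "0 < M" "M \<le> G" and Km: "3 * ((S + 8 * k * h) * M) \<le> G" "S + 8 * k * h \<le> G" and \<eta>: "0 < \<eta>"
    and stop: "n * (1 - 1 / (2 * real N)) ^ S < 1"
    and \<tau>: "S * (n * 9 + t_main + 10) + n * 8 + (S + 8 * k * h) * (n * 9 + M * 16 + 23) + 20 \<le> \<tau>"
    and \<sigma>: "S * (h * (N * 2) + N * 2) \<le> \<sigma>"
  shows "HT E (Main mode) s \<tau> \<sigma> (S * (\<delta>1 + \<delta>2) + (S + 8 * k * h) * \<delta>3 M \<eta>)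
    (\<lambda>s'. regs s' ''out'' \<le> (S + 8 * k * h) * M \<and> (\<forall>i<regs s' ''out''. mem s' (3 * i) < n))
    (\<lambda>s'. good_pattern m h K \<longrightarrow> (\<forall>C\<in>centres. \<bar>est s' C - (\<Sum>x<n. real (near C x))\<bar> \<le> \<eta> * (2 * (16 * h * OPT * harm n))))"
proof -
  let ?Km = "S + 8 * k * h"
  let ?S = "\<lambda>s'. regs s' ''out'' \<le> ?Km * M \<and> (\<forall>i<regs s' ''out''. mem s' (3 * i) < n)"
  let ?Q = "\<lambda>s'. good_pattern m h K \<longrightarrow> (\<forall>C\<in>centres. \<bar>est s' C - (\<Sum>x<n. real (near C x))\<bar> \<le> \<eta> * (2 * (16 * h * OPT * harm n)))"
  have SG: "S \<le> G" using Km(2) by simp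
  have inv0: "inv_sure 0 s" unfolding inv_sure_def using f z by simp
  have "Open s = {..<n}" using z(1) by (auto simp: Open_def)
  moreover have "radius_ok s (\<lambda>_. 0) (\<lambda>_. 0)" "spread s (\<lambda>_. 0) = 0" using z(1) by (simp_all add: radius_ok_def spread_def)
  ultimately have good0: "inv_good 0 s" unfolding inv_good_def by (intro conjI exI[of _ "\<lambda>_. 0"]) simp_all
  have st: "HT E (Steps mode) s (S * (n * 9 + t_main + 10) + 3) (S * (h * (N * 2) + N * 2)) (S * (\<delta>1 + \<delta>2)) (inv_sure S)
      (\<lambda>s'. good_pattern m h K \<and> inv_good 0 s \<longrightarrow> inv_good S s')"
    by (rule HT_Steps[OF inv0 S SG T order_refl order_refl])
  show ?thesis
    unfolding Main_def
  proof (rule HT_Seq[OF st, where \<tau>b = "n * 8 + ?Km * (n * 9 + M * 16 + 23) + 10" and \<sigma>b = 0 and \<delta>b = "?Km * \<delta>3 M \<eta>"])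
    fix s1 :: state
    assume s1: "inv_sure S s1" "\<forall>x. x \<notin> mods (Steps mode) \<longrightarrow> regs s1 x = regs s x"
    have r1: "fixed s1" "regs s1 ''K'' = ?Km" "regs s1 ''m'' = M" "regs s1 ''out'' = 0" "regs s1 ''ncl'' \<le> ?Km" "\<And>x. x < n \<Longrightarrow> cl s1 x \<le> regs s1 ''ncl''"
      using s1 K M z(3) unfolding inv_sure_def by simp_all
    let ?H = "good_pattern m h K \<and> inv_good 0 s \<longrightarrow> inv_good S s1"
    show "HT E (Seq Singles Final) s1 (n * 8 + ?Km * (n * 9 + M * 16 + 23) + 10) 0 (?Km * \<delta>3 M \<eta>) ?S (\<lambda>s'. ?H \<longrightarrow> ?Q s')"
    proof (rule HT_Seq[OF ST_Singles[OF r1(1,2) Km(2) r1(5,6) order_refl], where \<tau>b = "?Km * (n * 9 + M * 16 + 23) + 3" and \<sigma>b = 0 and \<delta>b = "?Km * \<delta>3 M \<eta>"])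
      fix s2 :: state
      assume s2: "regs s2 ''ncl'' \<le> ?Km \<and> (\<forall>x<n. cl s2 x \<le> regs s2 ''ncl'') \<and> (\<forall>x<n. cl s1 x \<noteq> 0 \<longrightarrow> cl s2 x = cl s1 x) \<and>
         (regs s1 ''ncl'' + card {z. z < n \<and> cl s1 z = 0} \<le> ?Km \<longrightarrow> (\<forall>x<n. cl s1 x = 0 \<longrightarrow> cl s2 x = regs s1 ''ncl'' + card {z. z < Suc x \<and> cl s1 z = 0}))"
        "\<forall>x. x \<notin> mods Singles \<longrightarrow> regs s2 x = regs s1 x"
      have r2: "fixed s2" "regs s2 ''m'' = M" "regs s2 ''out'' = 0" "regs s2 ''ncl'' \<le> ?Km" "\<And>x. x < n \<Longrightarrow> cl s2 x \<le> regs s2 ''ncl''"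
        using s2 r1 by (simp_all add: fixed_def)
      have ex: "\<exists>\<nu> t. clustered s2 \<nu> t" if "inv_good S s1"
      proof (rule singles_clustered[OF that s1(1) _ order_refl])
        have "card (Open s1) \<le> 8 * k * h \<or> real (card (Open s1)) \<le> n * (1 - 1 / (2 * real N)) ^ S"
          using that unfolding inv_good_def by blast
        then show "card (Open s1) \<le> 8 * k * h" using stop by auto
      qed (use s2 in simp_all)
      then obtain \<nu> t where \<nu>: "inv_good S s1 \<Longrightarrow> clustered s2 \<nu> t" by blast
      show "HT E Final s2 (?Km * (n * 9 + M * 16 + 23) + 3) 0 (?Km * \<delta>3 M \<eta>) ?S (\<lambda>s'. True \<longrightarrow> ?H \<longrightarrow> ?Q s')"
      proof (rule HT_conseq[OF HT_Final[OF r2(1,2,4,3) M(2,3) Km \<eta> r2(5) order_refl, of 0 \<nu> t] order_refl order_refl order_refl])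
        fix s' :: state assume "?S s'"
        then show "?S s' \<and> ((clustered s2 \<nu> t \<longrightarrow> (\<forall>C\<in>centres. \<bar>est s' C - (\<Sum>x<n. real (near C x))\<bar> \<le> \<eta> * (2 * (16 * h * OPT * harm n)))) \<longrightarrow> True \<longrightarrow> ?H \<longrightarrow> ?Q s')"
          using \<nu> good0 by blast
      qed
    qed (use \<delta>3_nonneg in simp_all)
  qed (use \<delta>3_nonneg \<tau> \<sigma> in simp_all)
qed

end

section \<open>The parameters of the algorithm\<close>

lemma exp_le_half_power_nat: "real j \<le> x \<Longrightarrow> exp (- x) \<le> (1 / 2 :: real) ^ j"
proof -
  assume "real j \<le> x"
  then have "exp (- x) \<le> exp (- real j)" by simp
  also have "\<dots> \<le> (1 / 2) powr real j" by (rule exp_le_half_power) simp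
  finally show ?thesis by (simp add: powr_realpow)
qed

lemma one_minus_power_le_exp:
  fixes x :: real
  assumes "0 \<le> x" "x \<le> 1"
  shows "(1 - x) ^ j \<le> exp (- (real j * x))"
proof -
  have "(1 - x) ^ j \<le> exp (- x) ^ j"
    using assms exp_ge_add_one_self[of "- x"] by (intro power_mono) simp_all
  also have "\<dots> = exp (- (real j * x))" by (simp add: exp_of_nat_mult[symmetric])
  finally show ?thesis .
qed

lemma mult_le_half_power:
  fixes a b :: real
  assumes "0 \<le> b" "a \<le> 2 ^ i" "b \<le> (1 / 2) ^ j" "i + l \<le> j"
  shows "a * b \<le> (1 / 2) ^ l"
proof -
  have "a * b \<le> 2 ^ i * (1 / 2) ^ j" using assms by (intro mult_mono) simp_all
  also have "\<dots> \<le> 2 ^ i * (1 / 2) ^ (i + l)" using assms(4) by (intro mult_left_mono power_decreasing) simp_all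
  also have "\<dots> = (1 / 2) ^ l" by (simp add: power_add power_one_over)
  finally show ?thesis .
qed

lemma harm_le_ln: "0 < n \<Longrightarrow> harm n \<le> ln (real n) + 1"
  using euler_mascheroni_sequence_decreasing[of 1 n] by (simp add: harm_def)

locale params =
  fixes c n k q L :: nat
  assumes k: "1 \<le> k" and q: "2 \<le> q" and kqn: "k\<^sup>2 * q ^ 3 < n" and L: "0 < L" "n < 2 ^ L" "2 ^ (L - 1) \<le> n"
begin

text \<open>Choice of the parameters, with \<open>L\<close> the bit length of \<open>n\<close>. The
  role of \<open>m\<close> is played by \<open>D * L\<close>, and \<open>h\<close> is a hundred
  times that. \<open>N\<close> makes \<open>(1 - 1 / (8 * k)) ^ N\<close> at most
  \<open>exp (- 2 * L * h)\<close>, which beats \<open>(n + 1) ^ h\<close>. \<open>S\<close> makes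
  the decay over all steps at most \<open>exp (- L)\<close>, below \<open>1 / n\<close>.
  \<open>M\<close> is such that \<open>2 * M * \<eta>\<^sup>2 = 2 * k * h\<close>, which beats the
  number of centre sets.\<close>

definition D :: nat where "D = 100 * (c + 5)"
definition h :: nat where "h = 100 * D * L"
definition N :: nat where "N = 16 * (k * (L * h))"
definition S :: nat where "S = 2 * (N * L)"
definition T :: nat where "T = 8 * (k * h)"
definition Km :: nat where "Km = S + T"
definition M :: nat where "M = 4096 * (h * (h * h) * (L * L * (q * q * k)))"
definition G :: nat where "G = 4 * (Km * M) + n"

lemma pos: "0 < n" "0 < k" "0 < D" "0 < h" "0 < N" "0 < S" "0 < T" "0 < Km" "0 < M" "0 < G"
proof -
  show 1: "0 < n" "0 < k" "0 < D" using k kqn by (simp_all add: D_def)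
  show 2: "0 < h" using 1 L by (simp add: h_def)
  show 3: "0 < N" "0 < T" using 1 2 L by (simp_all add: N_def T_def)
  show 4: "0 < S" using 3 L by (simp add: S_def)
  show 5: "0 < Km" using 4 by (simp add: Km_def)
  show "0 < M" using 1 2 L q by (simp add: M_def)
  show "0 < G" using 1 by (simp add: G_def)
qed

lemma k2_less: "k\<^sup>2 < n" and k2q2_less: "k\<^sup>2 * q\<^sup>2 < n" and k_le: "k \<le> n"
proof -
  have "k\<^sup>2 * q\<^sup>2 \<le> k\<^sup>2 * q ^ 3" using q by (intro mult_le_mono2 power_increasing) simp_all
  then show 1: "k\<^sup>2 * q\<^sup>2 < n" using kqn by (rule le_less_trans)
  have "k\<^sup>2 * 1 \<le> k\<^sup>2 * q\<^sup>2" using q by (intro mult_le_mono2) simp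
  then show 2: "k\<^sup>2 < n" using 1 by linarith
  have "k * 1 \<le> k * k" using k by (intro mult_le_mono2)
  then show "k \<le> n" using 2 unfolding power2_eq_square by linarith
qed

lemma L_le: "L \<le> n"
proof -
  have "L - 1 < 2 ^ (L - 1)" by (rule less_exp)
  then show ?thesis using L(3) by linarith
qed

lemma chain: "L \<le> h" "h \<le> N" "N \<le> S" "S \<le> Km" "T \<le> Km" "3 * (Km * M) \<le> G" "Km \<le> G" "M \<le> G" "n \<le> G" "T \<le> S"
proof -
  have p: "0 < k * L" "0 < k" "0 < L" using pos L by simp_all
  show "L \<le> h" using pos by (simp add: h_def)
  have "1 * h \<le> (16 * (k * L)) * h" using p by (intro mult_le_mono1) simp
  then show "h \<le> N" by (simp add: N_def mult_ac)
  have "N * 1 \<le> N * (2 * L)" using p by (intro mult_le_mono2) simp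
  then show "N \<le> S" by (simp add: S_def mult_ac)
  show "S \<le> Km" "T \<le> Km" by (simp_all add: Km_def)
  show "3 * (Km * M) \<le> G" "n \<le> G" by (simp_all add: G_def)
  have "Km * 1 \<le> Km * M" "1 * M \<le> Km * M" using pos by (intro mult_le_mono1 mult_le_mono2; simp)+
  then show "Km \<le> G" "M \<le> G" unfolding G_def by linarith+
  have "8 * (k * h) * 1 \<le> 8 * (k * h) * (4 * (L * L))" using p by (intro mult_le_mono2) simp
  then show "T \<le> S" by (simp add: T_def S_def N_def mult_ac)
qed

lemma S_eq: "S = 32 * (k * (L\<^sup>2 * h))"
  by (simp add: S_def N_def power2_eq_square mult_ac)

lemma D_ge: "500 \<le> D" "c + 3 \<le> D" by (simp_all add: D_def)

lemma S_le: "real S \<le> 2 ^ ((c + 28) * L)"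
proof -
  have l3: "L ^ 3 \<le> (2 ^ L) ^ 3" using less_exp[of L] by (intro power_mono) simp_all
  have c5: "c + 5 \<le> 2 ^ (c + 5)" using less_exp[of "c + 5"] by simp
  have "320000 * (c + 5) \<le> 2 ^ 19 * 2 ^ (c + 5)" using c5 by (intro mult_le_mono) simp_all
  also have "\<dots> = (2::nat) ^ (c + 24)" by (simp add: power_add)
  also have "\<dots> \<le> 2 ^ ((c + 24) * L)" using L by (intro power_increasing) simp_all
  finally have d: "320000 * (c + 5) \<le> 2 ^ ((c + 24) * L)" .
  have "S = (320000 * (c + 5)) * (k * L ^ 3)"
    by (simp add: S_eq h_def D_def power2_eq_square power3_eq_cube algebra_simps)
  also have "\<dots> \<le> 2 ^ ((c + 24) * L) * (2 ^ L * (2 ^ L) ^ 3)"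
    using d l3 k_le L(2) by (intro mult_mono) simp_all
  also have "\<dots> = 2 ^ ((c + 28) * L)" by (simp add: power_add[symmetric] power_mult[symmetric] algebra_simps)
  finally have "S \<le> 2 ^ ((c + 28) * L)" .
  then have "real S \<le> real (2 ^ ((c + 28) * L))" by (simp only: of_nat_le_iff)
  then show ?thesis by simp
qed

lemma n_le: "real n \<le> 2 ^ L" "real (n + 1) \<le> 2 ^ L"
proof -
  have "n + 1 \<le> 2 ^ L" using L(2) by simp
  then have "real (n + 1) \<le> real (2 ^ L)" by (simp only: of_nat_le_iff)
  then show "real (n + 1) \<le> 2 ^ L" by simp
  then show "real n \<le> 2 ^ L" by linarith
qed

lemma h_eq: "h = 10000 * (c * L) + 50000 * L"
  by (simp add: h_def D_def algebra_simps)

lemma bad_pattern_le: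
  "real ((n + 1) ^ (D * L) * (n + 1) ^ h) * exp (- (real (D * L) * real h / 50)) \<le> (1 / 2) ^ ((c + 3) * L)" (is ?A)
  "real (n ^ 3) * exp (- (real (h - 1) / 1800)) \<le> (1 / 2) ^ ((c + 3) * L)" (is ?B)
proof -
  \<comment> \<open>Choosing both sets costs the exponent
    \<open>L * (D * L + h) = 101 * D * L\<^sup>2\<close>, and the target probability at most
    \<open>D * L\<^sup>2\<close> more; the available exponent
    \<open>2 * D\<^sup>2 * L\<^sup>2\<close> is larger since \<open>D\<close> is at least
    51.\<close>
  have DL: "102 * (D * (L * L)) \<le> 2 * D * (D * (L * L))" using D_ge by (intro mult_le_mono1) simp
  have "(c + 3) * L \<le> D * (L * L)" using D_ge L by (intro mult_mono) simp_all
  have e: "L * (D * L + h) + (c + 3) * L \<le> 2 * D * (D * (L * L))"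
  proof -
    have "L * (D * L + h) = 101 * (D * (L * L))" by (simp add: h_def algebra_simps)
    then show ?thesis using DL \<open>(c + 3) * L \<le> D * (L * L)\<close> by linarith
  qed
  show ?A
  proof (rule mult_le_half_power[OF _ _ _ e])
    have "real (n + 1) ^ (D * L + h) \<le> (2 ^ L) ^ (D * L + h)" using n_le by (intro power_mono) simp_all
    then show "real ((n + 1) ^ (D * L) * (n + 1) ^ h) \<le> 2 ^ (L * (D * L + h))"
      by (simp add: power_add power_mult)
    have "real (2 * D * (D * (L * L))) = real (D * L) * real h / 50" by (simp add: h_def)
    then show "exp (- (real (D * L) * real h / 50)) \<le> (1 / 2) ^ (2 * D * (D * (L * L)))"
      by (intro exp_le_half_power_nat) (simp only: order_refl)
  qed simp
  have e: "3 * L + (c + 3) * L \<le> 5 * (c * L) + 25 * L" by (simp add: algebra_simps)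
  show ?B
  proof (rule mult_le_half_power[OF _ _ _ e])
    have "real n ^ 3 \<le> (2 ^ L) ^ 3" using n_le by (intro power_mono) simp_all
    then show "real (n ^ 3) \<le> 2 ^ (3 * L)" by (simp add: power_mult[symmetric] mult.commute)
    have "1800 * (5 * (c * L) + 25 * L) \<le> h - 1" using h_eq L by simp
    then have "real (1800 * (5 * (c * L) + 25 * L)) \<le> real (h - 1)" by (simp only: of_nat_le_iff)
    then show "exp (- (real (h - 1) / 1800)) \<le> (1 / 2) ^ (5 * (c * L) + 25 * L)"
      by (intro exp_le_half_power_nat) simp
  qed simp
qed

text \<open>The four ways in which a step can fail, each summed over the \<open>S\<close> steps: no
  candidate centre, a large core with too few voters, a sparse ball with many samples, a wrong
  second vote.\<close>

lemma step_failure_le: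
  "real S * (3 / 4) ^ h \<le> (1 / 2) ^ ((c + 3) * L)" (is ?A)
  "real S * (real k * (real ((n + 1) ^ h) * (1 - 1 / (8 * real k)) ^ N)) \<le> (1 / 2) ^ ((c + 3) * L)" (is ?B)
  "real S * (real n * (1 / 2) ^ h) \<le> (1 / 2) ^ ((c + 3) * L)" (is ?C)
  "real S * (real n * exp (- (real h / 320))) \<le> (1 / 2) ^ ((c + 3) * L)" (is ?D)
proof -
  have cL: "(c + 28) * L = c * L + 28 * L" "(c + 3) * L = c * L + 3 * L" by (simp_all add: algebra_simps)
  have "(3 / 4 :: real) ^ h \<le> (3 / 4) ^ (3 * (33 * (D * L)))" by (intro power_decreasing) (simp_all add: h_def)
  also have "\<dots> = ((3 / 4) ^ 3) ^ (33 * (D * L))" by (simp only: power_mult)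
  also have "\<dots> \<le> (1 / 2) ^ (33 * (D * L))" by (intro power_mono) (simp_all add: power3_eq_cube)
  finally have a: "(3 / 4 :: real) ^ h \<le> (1 / 2) ^ (33 * (D * L))" .
  have e: "(c + 28) * L + (c + 3) * L \<le> 33 * (D * L)" unfolding cL by (simp add: D_def algebra_simps)
  show ?A by (rule mult_le_half_power[OF _ S_le a e]) simp
  have Sn: "real S * real n \<le> 2 ^ ((c + 29) * L)"
  proof -
    have "real S * real n \<le> 2 ^ ((c + 28) * L) * 2 ^ L" using S_le n_le by (intro mult_mono) simp_all
    then show ?thesis by (simp add: power_add[symmetric] algebra_simps)
  qed
  show ?B
  proof -
    have "(1 - 1 / (8 * real k)) ^ N \<le> exp (- (real N * (1 / (8 * real k))))"
      using k by (intro one_minus_power_le_exp) simp_all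
    also have "real N * (1 / (8 * real k)) = real (2 * (L * h))" using k by (simp add: N_def)
    also have "exp (- real (2 * (L * h))) \<le> (1 / 2) ^ (2 * (L * h))" by (rule exp_le_half_power_nat) simp
    finally have 1: "(1 - 1 / (8 * real k)) ^ N \<le> (1 / 2) ^ (2 * (L * h))" .
    have "real S * real k \<le> real S * real n" using k_le by (intro mult_left_mono) simp_all
    also note Sn
    finally have "real S * real k * real (n + 1) ^ h \<le> 2 ^ ((c + 29) * L) * (2 ^ L) ^ h"
      using n_le by (intro mult_mono power_mono) simp_all
    then have 2: "real S * real k * real ((n + 1) ^ h) \<le> 2 ^ ((c + 29) * L + L * h)"
      by (simp add: power_add power_mult)
    have "1 * h \<le> L * h" using L by (intro mult_le_mono1) simp
    moreover have "(c + 29) * L + (c + 3) * L \<le> h" unfolding h_eq by (simp add: algebra_simps)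
    ultimately have "(c + 29) * L + L * h + (c + 3) * L \<le> 2 * (L * h)" by linarith
    then have "real S * real k * real ((n + 1) ^ h) * (1 - 1 / (8 * real k)) ^ N \<le> (1 / 2) ^ ((c + 3) * L)"
      using k by (intro mult_le_half_power[OF _ 2 1]) simp_all
    then show ?thesis by (simp only: mult.assoc)
  qed
  have "(c + 29) * L + (c + 3) * L \<le> h" unfolding h_eq by (simp add: algebra_simps)
  then have "real S * real n * (1 / 2) ^ h \<le> (1 / 2) ^ ((c + 3) * L)"
    by (intro mult_le_half_power[OF _ Sn order_refl]) simp_all
  then show ?C by (simp only: mult.assoc)
  have e: "(c + 29) * L + (c + 3) * L \<le> 31 * (c * L) + 155 * L" by (simp add: algebra_simps)
  have "320 * (31 * (c * L) + 155 * L) \<le> h" unfolding h_eq by simp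
  then have "real (320 * (31 * (c * L) + 155 * L)) \<le> real h" by (simp only: of_nat_le_iff)
  then have "exp (- (real h / 320)) \<le> (1 / 2) ^ (31 * (c * L) + 155 * L)"
    by (intro exp_le_half_power_nat) simp
  then have "real S * real n * exp (- (real h / 320)) \<le> (1 / 2) ^ ((c + 3) * L)"
    by (intro mult_le_half_power[OF _ Sn _ e]) simp_all
  then show ?D by (simp only: mult.assoc)
qed

text \<open>Calibrated to the total error \<open>\<eta> * 2 * 16 * h * OPT * harm n\<close>: with
  \<open>harm n \<le> 2 * L\<close> this is at most \<open>64 * \<eta> * h * L * OPT\<close>, that
  is \<open>OPT / q\<close>.\<close>

definition \<eta> :: real where "\<eta> = 1 / (64 * real h * real L * real q)"

lemma eta_pos: "0 < \<eta>" using pos L q by (simp add: \<eta>_def)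

lemma M_eta: "2 * real M * \<eta>\<^sup>2 = 2 * (real k * real h)"
  using pos L q by (simp add: M_def \<eta>_def power2_eq_square field_simps)

lemma final_failure_le: "real Km * (real ((n + 1) ^ k) * (2 * exp (- 2 * real M * \<eta>\<^sup>2))) \<le> (1 / 2) ^ ((c + 3) * L)"
proof -
  have "Km \<le> 2 * S" using chain(10) by (simp add: Km_def)
  then have "real Km \<le> 2 * real S" by linarith
  also have "\<dots> \<le> 2 * 2 ^ ((c + 28) * L)" using S_le by simp
  finally have "real Km * (real (n + 1) ^ k * 2) \<le> 2 * 2 ^ ((c + 28) * L) * ((2 ^ L) ^ k * 2)"
    using n_le by (intro mult_mono power_mono) simp_all
  also have "\<dots> = 2 ^ ((c + 28) * L + L * k + 2)" by (simp add: power_add power_mult)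
  finally have 1: "real Km * (real ((n + 1) ^ k) * 2) \<le> 2 ^ ((c + 28) * L + L * k + 2)" by simp
  have "- 2 * real M * \<eta>\<^sup>2 = - (2 * (real k * real h))" using M_eta by simp
  moreover have "exp (- (2 * (real k * real h))) \<le> (1 / 2) ^ (2 * (k * h))" by (rule exp_le_half_power_nat) simp
  ultimately have 2: "exp (- 2 * real M * \<eta>\<^sup>2) \<le> (1 / 2) ^ (2 * (k * h))" by (simp only:)
  have "1 * h \<le> k * h" "k * L \<le> k * h" using k chain(1) by (intro mult_le_mono1 mult_le_mono2; simp)+
  moreover have "(c + 28) * L + 2 + (c + 3) * L \<le> h" unfolding h_eq using L by (simp add: algebra_simps)
  moreover have "L * k = k * L" by simp
  ultimately have "(c + 28) * L + L * k + 2 + (c + 3) * L \<le> 2 * (k * h)" by linarith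
  then have "real Km * (real ((n + 1) ^ k) * 2) * exp (- 2 * real M * \<eta>\<^sup>2) \<le> (1 / 2) ^ ((c + 3) * L)"
    by (intro mult_le_half_power[OF _ 1 2]) simp_all
  then show ?thesis by (simp only: mult.assoc)
qed

text \<open>Seven failure terms are collected, two from the pattern and five from the coins of the
  program; the surplus \<open>3 * L\<close> in the exponent yields the factor 8 that absorbs
  them.\<close>

lemma failure_le: "7 * (1 / 2) ^ ((c + 3) * L) \<le> 1 / real n ^ c"
proof -
  have "(8::real) = 2 ^ 3" by simp
  also have "\<dots> \<le> 2 ^ (3 * L)" using L by (intro power_increasing) simp_all
  finally have 8: "8 \<le> (2::real) ^ (3 * L)" .
  have "real n ^ c \<le> (2 ^ L) ^ c" using n_le by (intro power_mono) simp_all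
  then have "8 * real n ^ c \<le> 2 ^ (3 * L) * (2 ^ L) ^ c" using 8 by (intro mult_mono) simp_all
  also have "\<dots> = 2 ^ ((c + 3) * L)" by (simp add: power_add[symmetric] power_mult[symmetric] algebra_simps)
  finally have "7 * real n ^ c \<le> 2 ^ ((c + 3) * L)" using zero_le_power[of "real n" c] by linarith
  then show ?thesis using pos(1) by (simp add: power_one_over field_simps)
qed

lemma stop: "real n * (1 - 1 / (2 * real N)) ^ S < 1"
proof -
  have "(1 - 1 / (2 * real N)) ^ S \<le> exp (- (real S * (1 / (2 * real N))))"
    using pos(5) by (intro one_minus_power_le_exp) simp_all
  also have "real S * (1 / (2 * real N)) = real L" using pos(5) by (simp add: S_def)
  also have "exp (- real L) \<le> (1 / 2) ^ L" by (rule exp_le_half_power_nat) simp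
  finally have "real n * (1 - 1 / (2 * real N)) ^ S \<le> real n * (1 / 2) ^ L" by (intro mult_left_mono) simp_all
  also have "real n < real (2 ^ L)" using L(2) by (simp only: of_nat_less_iff)
  then have "real n * (1 / 2) ^ L < 1" by (simp add: power_one_over field_simps)
  finally show ?thesis .
qed

lemma grow: "real n < (11 / 10) ^ (h - 1)"
proof -
  have "real n < real (2 ^ L)" using L(2) by (simp only: of_nat_less_iff)
  also have "real (2 ^ L) \<le> ((11 / 10) ^ 8) ^ L" unfolding of_nat_power by (intro power_mono) (simp_all add: power_divide)
  also have "\<dots> = (11 / 10) ^ (8 * L)" by (simp only: power_mult)
  also have "\<dots> \<le> (11 / 10) ^ (h - 1)" using h_eq L by (intro power_increasing) simp_all
  finally show ?thesis .
qed

lemma eta_error: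
  assumes "0 \<le> OPT"
  shows "\<eta> * (2 * (16 * real h * OPT * harm n)) \<le> OPT / real q"
proof -
  have n2: "0 < n" by (rule pos)
  have "ln (real n) \<le> ln (2 ^ L)" using n_le n2 by (intro ln_mono) simp_all
  also have "\<dots> = real L * ln 2" by (simp add: ln_realpow)
  also have "\<dots> \<le> real L * 1" using ln_2_less_1 by (intro mult_left_mono) simp_all
  finally have "harm n \<le> 1 + real L" using harm_le_ln[OF n2] by simp
  then have hl: "harm n \<le> 2 * real L" using L by simp
  have "\<eta> * (2 * (16 * real h * OPT * harm n)) = OPT * harm n / (2 * real L * real q)"
    using pos L q by (simp add: \<eta>_def field_simps)
  also have "\<dots> \<le> OPT * (2 * real L) / (2 * real L * real q)"
    using hl assms by (intro divide_right_mono mult_left_mono) simp_all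
  also have "\<dots> = OPT / real q" using L by simp
  finally show ?thesis .
qed

lemma size_le: "Km * M \<le> 64 * 4096 * (k\<^sup>2 * q\<^sup>2 * (L ^ 4 * h ^ 4))"
proof -
  have "Km \<le> 2 * S" using chain(10) by (simp add: Km_def)
  then have "Km * M \<le> 2 * S * M" by (rule mult_le_mono1)
  also have "\<dots> = 64 * 4096 * (k\<^sup>2 * q\<^sup>2 * (L ^ 4 * h ^ 4))"
    by (simp add: S_eq M_def power2_eq_square power4_eq_xxxx algebra_simps)
  finally show ?thesis .
qed

lemma queries_le: "S * (h * (N * 2) + N * 2) \<le> 2048 * (k\<^sup>2 * (L ^ 3 * h ^ 3))"
proof -
  have "1 * (N * 2) \<le> h * (N * 2)" using pos(4) by (intro mult_le_mono1) simp
  then have "h * (N * 2) + N * 2 \<le> 4 * (h * N)" by simp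
  then have "S * (h * (N * 2) + N * 2) \<le> S * (4 * (h * N))" by (rule mult_le_mono2)
  also have "\<dots> = 2048 * (k\<^sup>2 * (L ^ 3 * h ^ 3))"
    by (simp add: S_eq N_def power2_eq_square power3_eq_cube algebra_simps)
  finally show ?thesis .
qed

definition t_step :: nat where
  "t_step = N * 6 + 3 + (h * (N * N * 5 + N * 26 + 12) + h * (n * (h * 8 + 13) + 15) + N * 22 + n * 13 + 50)
     + (n * (h * 8 + 12) + h * 6 + 12) + 3"

definition t_all :: nat where
  "t_all = S * (n * 9 + t_step + 10) + n * 8 + Km * (n * 9 + M * 16 + 23) + 20"

text \<open>The term \<open>h * N * N\<close>, the work on the sample, is \<open>k\<^sup>2\<close>
  up to powers of \<open>L\<close> and \<open>h\<close>. It is dominated by \<open>n\<close> because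
  \<open>k\<^sup>2 < n\<close> in this regime.\<close>

lemma t_step_le: "n * 9 + t_step + 10 \<le> 16000 * (n * (L\<^sup>2 * h ^ 3))"
proof -
  define Y where "Y = n * (L\<^sup>2 * h ^ 3)"
  have p: "1 \<le> n" "1 \<le> h" "1 \<le> L" "1 \<le> N" using pos L by simp_all
  have L1: "1 \<le> L\<^sup>2" using p by simp
  have hh: "h * h * 1 \<le> h * h * h" using p by (intro mult_le_mono2)
  have "h * (N * N) = 256 * (k\<^sup>2 * (L\<^sup>2 * h ^ 3))"
    by (simp add: N_def power2_eq_square power3_eq_cube algebra_simps)
  also have "\<dots> \<le> 256 * (n * (L\<^sup>2 * h ^ 3))" using k2_less by (intro mult_le_mono2 mult_le_mono1) simp
  finally have 1: "h * (N * N) \<le> 256 * Y" by (simp add: Y_def)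
  have "h * (N * 1) \<le> h * (N * N)" using p by (intro mult_le_mono2)
  then have 2: "h * N \<le> 256 * Y" using 1 unfolding mult_1_right by (rule order_trans)
  have "1 * N \<le> h * N" using p by (intro mult_le_mono1)
  then have 3: "N \<le> 256 * Y" using 2 unfolding mult_1 by (rule order_trans)
  have "n * (1 * (h * h)) \<le> n * (L\<^sup>2 * h ^ 3)"
    using hh L1 by (intro mult_le_mono order_refl) (simp_all add: power3_eq_cube)
  then have 4: "n * (h * h) \<le> Y" by (simp add: Y_def)
  have "n * (h * 1) \<le> n * (h * h)" using p by (intro mult_le_mono2)
  then have 5: "n * h \<le> Y" using 4 unfolding mult_1_right by (rule order_trans)
  have "n * 1 \<le> n * h" "1 * h \<le> n * h" using mult_le_mono2[OF p(2), of n] mult_le_mono1[OF p(1), of h] by simp_all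
  then have 6: "n \<le> Y" "h \<le> Y" using 5 by linarith+
  have 7: "1 \<le> Y" using p 6 by simp
  have "t_step = 28 * N + 5 * (h * (N * N)) + 26 * (h * N) + 33 * h + 8 * (n * (h * h)) + 21 * (n * h) + 25 * n + 68"
    by (simp add: t_step_def algebra_simps)
  then have "n * 9 + t_step + 10 \<le> 16000 * Y" using 1 2 3 4 5 6 7 by linarith
  then show ?thesis by (simp add: Y_def)
qed

text \<open>The number of steps is linear in \<open>k\<close> up to powers of \<open>L\<close> and
  \<open>h\<close>, and each takes time linear in \<open>n\<close>. Writing the output takes
  \<open>Km * M\<close>, of order \<open>k\<^sup>2 * q\<^sup>2\<close>, which is below
  \<open>n\<close> in this regime.\<close>

lemma time_le: "t_all + 10 * n + 40 \<le> 5000000 * (n * k * (L ^ 4 * h ^ 4))"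
proof -
  define X where "X = n * k * (L ^ 4 * h ^ 4)"
  have p: "1 \<le> n" "1 \<le> k" "1 \<le> L" "1 \<le> h" using pos L by simp_all
  have Lh: "L\<^sup>2 * h \<le> L ^ 4 * h ^ 4" "1 \<le> L ^ 4 * h ^ 4"
    using p by (intro mult_le_mono power_increasing self_le_power; simp) (use pos L in simp)
  have "S * (n * 9 + t_step + 10) \<le> S * (16000 * (n * (L\<^sup>2 * h ^ 3)))" by (rule mult_le_mono2[OF t_step_le])
  also have "\<dots> = 512000 * X" by (simp add: S_eq X_def power2_eq_square power3_eq_cube power4_eq_xxxx algebra_simps)
  finally have 1: "S * (n * 9 + t_step + 10) \<le> 512000 * X" .
  have "n * k * 1 \<le> X" unfolding X_def using Lh by (intro mult_le_mono2)
  moreover have "n * 1 \<le> n * k" using p by (intro mult_le_mono2)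
  ultimately have 2: "n \<le> X" "1 \<le> X" using p by linarith+
  have "n * 9 + 23 \<le> 32 * n" using p by simp
  moreover have "Km \<le> 2 * S" using chain(10) by (simp add: Km_def)
  ultimately have "Km * (n * 9 + 23) \<le> 2 * S * (32 * n)" by (intro mult_le_mono)
  also have "\<dots> = 2048 * (n * k * (L\<^sup>2 * h))" by (simp add: S_eq algebra_simps)
  also have "\<dots> \<le> 2048 * X" unfolding X_def using Lh by (intro mult_le_mono2)
  finally have 3: "Km * (n * 9 + 23) \<le> 2048 * X" .
  have "k\<^sup>2 * q\<^sup>2 * 1 \<le> n * k" using k2q2_less p by (intro mult_le_mono) simp_all
  then have "k\<^sup>2 * q\<^sup>2 * (L ^ 4 * h ^ 4) \<le> X" unfolding X_def by (intro mult_le_mono1) simp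
  then have 4: "Km * M \<le> 262144 * X" using size_le by simp
  have "Km * (n * 9 + M * 16 + 23) = Km * (n * 9 + 23) + 16 * (Km * M)" by (simp add: algebra_simps)
  then have "t_all + 10 * n + 40 \<le> 5000000 * X" unfolding t_all_def using 1 2 3 4 by linarith
  then show ?thesis by (simp add: X_def)
qed

lemma h4: "L ^ 4 * h ^ 4 = (100 * D) ^ 4 * L ^ 8"
proof -
  have "h ^ 4 = (100 * D) ^ 4 * L ^ 4" unfolding h_def by (simp only: power_mult_distrib)
  then show ?thesis by (simp add: power_add[symmetric])
qed

text \<open>\<open>L - 1\<close> is at most the logarithm, and the shift \<open>n + 1\<close> makes
  the logarithm at least 1, which pays for the missing unit.\<close>

lemma L_le_log: "real L \<le> 2 * log 2 (real n + 1)"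
proof -
  have "real (L - 1) = log 2 (2 ^ (L - 1))" by (simp add: log_nat_power)
  also have "(2::real) ^ (L - 1) \<le> real n + 1"
  proof -
    have "real (2 ^ (L - 1)) \<le> real n" using L(3) by (simp only: of_nat_le_iff)
    then show ?thesis unfolding of_nat_power of_nat_numeral by linarith
  qed
  then have "log 2 (2 ^ (L - 1)) \<le> log 2 (real n + 1)" by (intro log_mono) simp_all
  finally have 1: "real L - 1 \<le> log 2 (real n + 1)" using L(1) by simp
  have "log 2 2 \<le> log 2 (real n + 1)" using pos(1) by (intro log_mono) simp_all
  moreover have "log 2 2 = (1 :: real)" by simp
  ultimately show ?thesis using 1 by linarith
qed

lemma L8_le: "real (L ^ 8) \<le> 256 * log 2 (real n + 1) ^ 8"
proof -
  have "real L ^ 8 \<le> (2 * log 2 (real n + 1)) ^ 8" using L_le_log by (intro power_mono) simp_all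
  then show ?thesis by (simp add: power_mult_distrib)
qed

text \<open>Since \<open>L \<le> n\<close>, the size \<open>k\<^sup>2 * q\<^sup>2 * L ^ 8\<close> of
  the output region is a polynomial of degree 12 in \<open>n + k + q\<close>; the degree 14 leaves
  slack.\<close>

lemma G_le: "16 * G + 16 \<le> (1677721600000000 * D ^ 4 + 32) * (n + k + q) ^ 14"
proof -
  define Q where "Q = n + k + q"
  have Q: "n \<le> Q" "k \<le> Q" "q \<le> Q" "L \<le> Q" "1 \<le> Q" using L_le k by (simp_all add: Q_def)
  have "k\<^sup>2 * q\<^sup>2 * (L ^ 8) \<le> Q\<^sup>2 * Q\<^sup>2 * Q ^ 8" using Q by (intro mult_le_mono power_mono) simp_all
  also have "\<dots> = Q ^ 12" by (simp add: power_add[symmetric])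
  also have "\<dots> \<le> Q ^ 14" using Q by (intro power_increasing) simp_all
  finally have a: "k\<^sup>2 * q\<^sup>2 * (L ^ 8) \<le> Q ^ 14" .
  have b: "n \<le> Q ^ 14" "1 \<le> Q ^ 14" using Q self_le_power[of Q 14] by simp_all
  have gen: "64 * x \<le> A \<Longrightarrow> y \<le> B \<Longrightarrow> 1 \<le> B \<Longrightarrow> 16 * (4 * x + y) + 16 \<le> A + 32 * B" for x y A B :: nat by (simp add: add_mult_distrib2)
  have "64 * (Km * M) \<le> 64 * (64 * 4096 * (k\<^sup>2 * q\<^sup>2 * ((100 * D) ^ 4 * L ^ 8)))"
    using size_le unfolding h4 by (intro mult_le_mono2)
  also have "\<dots> = 1677721600000000 * D ^ 4 * (k\<^sup>2 * q\<^sup>2 * L ^ 8)" by (simp add: power_mult_distrib)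
  also have "\<dots> \<le> 1677721600000000 * D ^ 4 * Q ^ 14" using a by (rule mult_le_mono2)
  finally have "16 * G + 16 \<le> 1677721600000000 * D ^ 4 * Q ^ 14 + 32 * Q ^ 14" using b unfolding G_def by (intro gen)
  then show ?thesis by (simp add: Q_def algebra_simps)
qed

end

section \<open>Resource accounting\<close>

fun strong_ok :: "strong_mode \<Rightarrow> com \<Rightarrow> bool" where
  "strong_ok mode (Seq c c') \<longleftrightarrow> strong_ok mode c \<and> strong_ok mode c'"
| "strong_ok mode (If e c c') \<longleftrightarrow> strong_ok mode c \<and> strong_ok mode c'"
| "strong_ok mode (While e c) \<longleftrightarrow> strong_ok mode c"
| "strong_ok mode (StrongPoint e) \<longleftrightarrow> mode = Point_Queries"
| "strong_ok mode (StrongDist x e f) \<longleftrightarrow> mode = Distance_Queries"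
| "strong_ok mode _ \<longleftrightarrow> True"

definition other_count :: "strong_mode \<Rightarrow> state \<Rightarrow> nat" where
  "other_count mode s = (case mode of Point_Queries \<Rightarrow> dist_count s | Distance_Queries \<Rightarrow> point_count s)"

lemma step_strong_ok:
  assumes "(cs', s') \<in> set_pmf (step E (cs, s))" "\<forall>c\<in>set cs. strong_ok mode c"
  shows "(\<forall>c\<in>set cs'. strong_ok mode c) \<and> other_count mode s' = other_count mode s"
  using assms
  by (induction E "(cs, s)" rule: step.induct) (auto simp: other_count_def split: if_splits strong_mode.splits)

lemma run_strong_ok:
  assumes "(cs', s') \<in> set_pmf (run E t ([c], s))" "strong_ok mode c"
  shows "other_count mode s' = other_count mode s"
proof -
  let ?I = "\<lambda>(cs', s'). (\<forall>c\<in>set cs'. strong_ok mode c) \<and> other_count mode s' = other_count mode s"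
  have "?I (cs', s')"
  proof (rule run_invariant[where I = ?I, OF _ _ assms(1)])
    fix cf cf' assume *: "?I cf" "cf' \<in> set_pmf (step E cf)"
    obtain c1 s1 c2 s2 where cf: "cf = (c1, s1)" "cf' = (c2, s2)" by (cases cf, cases cf') simp
    show "?I cf'" using * step_strong_ok[of c2 s2 E c1 s1 mode] unfolding cf by simp
  qed (use assms(2) in simp)
  then show ?thesis by simp
qed

lemma step_weak_count:
  assumes "(cs', s') \<in> set_pmf (step E (cs, s))"
  shows "weak_count s' \<le> Suc (weak_count s)"
  using assms by (induction E "(cs, s)" rule: step.induct) (auto split: if_splits)

text \<open>A step makes at most one weak query, so the time bound doubles as the weak query
  bound.\<close>

lemma run_weak_count:
  "(cs', s') \<in> set_pmf (run E t (cs, s)) \<Longrightarrow> weak_count s' \<le> weak_count s + t"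
proof (induction t arbitrary: cs' s')
  case (Suc t)
  then obtain c1 s1 where 1: "(c1, s1) \<in> set_pmf (run E t (cs, s))" "(cs', s') \<in> set_pmf (step E (c1, s1))"
    by auto
  show ?case using Suc.IH[OF 1(1)] step_weak_count[OF 1(2)] by simp
qed simp

lemma strong_ok_macros [simp]:
  "strong_ok mode (For x e c) = strong_ok mode c" "strong_ok mode (Put j e f)" "strong_ok mode (Incr x)"
  "strong_ok mode (Dist mode r e f)" "strong_ok mode (Vote j l)" "strong_ok mode (Sample jd js l N)"
  by (simp_all add: For_def Put_def Incr_def Dist_def Vote_def Sample_def split: strong_mode.split)

lemma strong_ok_Filter [simp]: "strong_ok mode (Filter j l c e) = strong_ok mode c"
  by (simp add: Filter_def)

lemma strong_ok_Main: "strong_ok mode (Main mode)"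
  by (simp add: Main_def Steps_def StepMain_def Prep_def Choose_def Ballc_def Scan_def Absorb_def Mark_def Clear_def
      Scales_def Scale_def Collect_ball_def Best_def Rank_def Update_def Count_def Dists_def Singles_def Final_def Emit_def)

section \<open>From the program logic to executions\<close>

text \<open>For a fixed pattern the weak oracle is a deterministic function, and the triple concerns
  the coins of the program alone. Averaging over patterns adds only the probability of a bad
  one.\<close>

lemma execution_HT:
  fixes \<delta> \<delta>0 :: real
  assumes ht: "\<And>K. HT \<lparr>word_size = W, num_points = n, true_dist = d, weak_dist = weak_oracle d adv K\<rparr> P (init_state n k \<epsilon>)
      \<tau> \<sigma> \<delta> S (\<lambda>s. good K \<longrightarrow> R s)"
    and bad: "measure_pmf.prob (corruption n) {K. \<not> good K} \<le> \<delta>0"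
    and ok: "strong_ok mode P"
  shows "\<forall>(cs, s) \<in> set_pmf (execution P W n k \<epsilon> d adv \<tau>).
      cs = [] \<and> strong_count s \<le> \<sigma> \<and> other_count mode s = 0 \<and> weak_count s \<le> \<tau>"
    and "1 - (\<delta>0 + \<delta>) \<le> measure_pmf.prob (execution P W n k \<epsilon> d adv \<tau>) {(cs, s). S s \<and> R s}"
proof -
  define env where "env K = \<lparr>word_size = W, num_points = n, true_dist = d, weak_dist = weak_oracle d adv K\<rparr>" for K
  let ?s0 = "init_state n k \<epsilon>" and ?B = "{(cs :: com list, s). \<not> (S s \<and> R s)}"
  let ?run = "\<lambda>K. run (env K) \<tau> ([P], init_state n k \<epsilon>)"
  have init: "strong_count ?s0 = 0" "weak_count ?s0 = 0" "other_count mode ?s0 = 0"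
    by (simp_all add: init_state_def strong_count_def other_count_def split: strong_mode.split)
  have run: "(\<forall>(cs, s) \<in> set_pmf (?run K). cs = [] \<and> strong_count s \<le> \<sigma>) \<and>
      measure_pmf.prob (?run K) ?B \<le> of_bool (\<not> good K) + \<delta>" for K
  proof -
    from ht[of K] obtain \<mu> where \<mu>: "\<forall>(s', u) \<in> set_pmf \<mu>. u \<le> \<tau> \<and> strong_count s' \<le> strong_count ?s0 + \<sigma> \<and> S s'"
      "measure_pmf.prob \<mu> {(s', u). \<not> (good K \<longrightarrow> R s')} \<le> \<delta>"
      "\<forall>cs t. \<tau> \<le> t \<longrightarrow> run (env K) t (P # cs, ?s0) = bind_pmf \<mu> (\<lambda>(s', u). run (env K) (t - u) (cs, s'))"
      unfolding HT_def env_def by blast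
    have r: "?run K = map_pmf (\<lambda>(s', u). ([], s')) \<mu>"
      using \<mu>(3) by (simp add: run_final map_pmf_def case_prod_unfold)
    have "measure_pmf.prob (?run K) ?B \<le> of_bool (\<not> good K) + \<delta>"
    proof (cases "good K")
      case True
      have "measure_pmf.prob (?run K) ?B = measure_pmf.prob \<mu> ((\<lambda>(s', u). ([], s')) -` ?B)"
        unfolding r by simp
      also have "\<dots> \<le> measure_pmf.prob \<mu> {(s', u). \<not> (good K \<longrightarrow> R s')}"
        using True \<mu>(1) by (intro measure_pmf.finite_measure_mono_AE AE_pmfI) auto
      finally show ?thesis using \<mu>(2) True by simp
    next
      case False
      have "0 \<le> \<delta>" using \<mu>(2) measure_nonneg order_trans by blast
      moreover have "of_bool (\<not> good K) = (1 :: real)" using False by simp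
      ultimately show ?thesis using measure_pmf.prob_le_1[of "?run K" ?B] by linarith
    qed
    moreover have "\<forall>(cs, s) \<in> set_pmf (?run K). cs = [] \<and> strong_count s \<le> \<sigma>"
      unfolding r using \<mu>(1) init by auto
    ultimately show ?thesis by blast
  qed
  have ex: "execution P W n k \<epsilon> d adv \<tau> = bind_pmf (corruption n) ?run" by (simp add: execution_def env_def)
  show "\<forall>(cs, s) \<in> set_pmf (execution P W n k \<epsilon> d adv \<tau>).
      cs = [] \<and> strong_count s \<le> \<sigma> \<and> other_count mode s = 0 \<and> weak_count s \<le> \<tau>"
  proof (rule ballI, unfold split_paired_all, unfold prod.case)
    fix cs s assume "(cs, s) \<in> set_pmf (execution P W n k \<epsilon> d adv \<tau>)"
    then obtain K where K: "(cs, s) \<in> set_pmf (?run K)" unfolding ex by auto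
    show "cs = [] \<and> strong_count s \<le> \<sigma> \<and> other_count mode s = 0 \<and> weak_count s \<le> \<tau>"
      using run[of K] K run_strong_ok[OF K ok] run_weak_count[OF K] init by auto
  qed
  have int: "integrable (measure_pmf (corruption n)) f" if "\<And>K. \<bar>f K\<bar> \<le> B" for f :: "(nat set \<Rightarrow> bool) \<Rightarrow> real" and B
    using that by (intro measure_pmf.integrable_const_bound[where B = B]) auto
  have "measure_pmf.prob (bind_pmf (corruption n) ?run) ?B = measure_pmf.expectation (corruption n) (\<lambda>K. measure_pmf.prob (?run K) ?B)"
    by (rule prob_bind_pmf)
  also have "\<dots> \<le> measure_pmf.expectation (corruption n) (\<lambda>K. indicator {K. \<not> good K} K + \<delta>)"
  proof (rule integral_mono)
    show "integrable (corruption n) (\<lambda>K. measure_pmf.prob (?run K) ?B)" by (rule int[where B = 1]) simp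
    show "integrable (corruption n) (\<lambda>K. indicator {K. \<not> good K} K + \<delta>)"
      by (rule int[where B = "1 + \<bar>\<delta>\<bar>"]) (auto simp: indicator_def)
  qed (use run in \<open>simp add: indicator_def of_bool_def\<close>)
  also have "\<dots> = measure_pmf.prob (corruption n) {K. \<not> good K} + \<delta>"
    by (subst Bochner_Integration.integral_add) (auto intro!: int[where B = 1] simp: indicator_def)
  finally have "measure_pmf.prob (execution P W n k \<epsilon> d adv \<tau>) ?B \<le> \<delta>0 + \<delta>" using bad unfolding ex by linarith
  moreover have "measure_pmf.prob (execution P W n k \<epsilon> d adv \<tau>) {(cs, s). S s \<and> R s} = 1 - measure_pmf.prob (execution P W n k \<epsilon> d adv \<tau>) ?B"
  proof -
    have "{(cs :: com list, s). S s \<and> R s} = space (execution P W n k \<epsilon> d adv \<tau>) - ?B" by auto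
    then show ?thesis by (simp only:) (rule measure_pmf.prob_compl, simp)
  qed
  ultimately show "1 - (\<delta>0 + \<delta>) \<le> measure_pmf.prob (execution P W n k \<epsilon> d adv \<tau>) {(cs, s). S s \<and> R s}" by linarith
qed

section \<open>Coresets from lists of weighted points\<close>

lemma metric_points:
  assumes "Metric_space {..<n} (\<lambda>x y. real (d x y))"
  shows "points n d"
proof
  interpret Metric_space "{..<n}" "\<lambda>x y. real (d x y)" by (rule assms)
  fix x y z
  show "d x y = d y x" using commute[of x y] by simp
  assume "x < n" "y < n" "z < n"
  then have "real (d x z) \<le> real (d x y) + real (d y z)" using triangle[of x y z] by simp
  then show "d x z \<le> d x y + d y z" by linarith
next
  interpret Metric_space "{..<n}" "\<lambda>x y. real (d x y)" by (rule assms)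
  fix x assume x: "x < n"
  have "real (d x x) = 0" by (subst zero) (use x in simp_all)
  then show "d x x = 0" by (simp only: of_nat_eq_0_iff)
qed

context points
begin

lemma Min_real_near:
  assumes "finite C" "C \<noteq> {}"
  shows "Min ((\<lambda>c. real (d x c)) ` C) = real (near C x)"
proof -
  have "Min (real ` (d x ` C)) = real (Min (d x ` C))"
    using assms by (intro mono_Min_commute[symmetric]) (auto simp: mono_def)
  then show ?thesis by (simp add: near_def image_image)
qed

lemma cost_points:
  assumes "C \<subseteq> {..<n}" "C \<noteq> {}"
  shows "cost (\<lambda>x y. real (d x y)) C {..<n} (\<lambda>_. 1) = (\<Sum>x<n. real (near C x))"
  using assms finite_subset[OF assms(1)] by (simp add: cost_def Min_real_near)

text \<open>Weights of repeated points add up, so grouping the list entries by their point turns the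
  sum over the list into the cost of the weighted set.\<close>

lemma cost_output:
  assumes "C \<subseteq> {..<n}" "C \<noteq> {}"
  shows "cost (\<lambda>x y. real (d x y)) C (out_set s) (out_weight s) =
    (\<Sum>i<regs s ''out''. real (mem s (3 * i + 1)) / real (mem s (3 * i + 2)) * real (near C (mem s (3 * i))))"
proof -
  let ?w = "\<lambda>i. real (mem s (3 * i + 1)) / real (mem s (3 * i + 2))" and ?I = "{..<regs s ''out''}"
  have fC: "finite C" using assms(1) finite_subset by blast
  have "(\<Sum>i\<in>?I. ?w i * real (near C (mem s (3 * i)))) =
      (\<Sum>x\<in>(\<lambda>i. mem s (3 * i)) ` ?I. \<Sum>i\<in>{i \<in> ?I. mem s (3 * i) = x}. ?w i * real (near C (mem s (3 * i))))"
    by (rule sum.image_gen) simp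
  also have "\<dots> = (\<Sum>x\<in>out_set s. out_weight s x * real (near C x))"
    unfolding out_set_def
  proof (rule sum.cong)
    fix x
    have "(\<Sum>i\<in>{i \<in> ?I. mem s (3 * i) = x}. ?w i * real (near C (mem s (3 * i)))) = (\<Sum>i\<in>{i \<in> ?I. mem s (3 * i) = x}. ?w i * real (near C x))"
      by (rule sum.cong) simp_all
    then show "(\<Sum>i\<in>{i \<in> ?I. mem s (3 * i) = x}. ?w i * real (near C (mem s (3 * i)))) = out_weight s x * real (near C x)"
      by (simp add: out_weight_def sum_distrib_right)
  qed simp
  also have "\<dots> = cost (\<lambda>x y. real (d x y)) C (out_set s) (out_weight s)"
    using fC assms(2) by (simp add: cost_def Min_real_near)
  finally show ?thesis by simp
qed

lemma is_coreset_output: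
  assumes "\<And>i. i < regs s ''out'' \<Longrightarrow> mem s (3 * i) < n"
    and "\<And>C. C \<subseteq> {..<n} \<Longrightarrow> C \<noteq> {} \<Longrightarrow> card C \<le> k \<Longrightarrow>
      \<bar>(\<Sum>i<regs s ''out''. real (mem s (3 * i + 1)) / real (mem s (3 * i + 2)) * real (near C (mem s (3 * i)))) - (\<Sum>x<n. real (near C x))\<bar>
        \<le> \<epsilon> * (\<Sum>x<n. real (near C x))"
  shows "is_coreset {..<n} (\<lambda>x y. real (d x y)) k \<epsilon> (out_set s) (out_weight s)"
  unfolding is_coreset_def
proof (intro conjI allI impI ballI)
  show "out_set s \<subseteq> {..<n}" using assms(1) by (auto simp: out_set_def)
  show "0 \<le> out_weight s x" for x by (simp add: out_weight_def sum_nonneg)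
  fix C assume C: "C \<subseteq> {..<n} \<and> C \<noteq> {} \<and> card C \<le> k"
  show "\<bar>cost (\<lambda>x y. real (d x y)) C (out_set s) (out_weight s) - cost (\<lambda>x y. real (d x y)) C {..<n} (\<lambda>_. 1)\<bar>
      \<le> \<epsilon> * cost (\<lambda>x y. real (d x y)) C {..<n} (\<lambda>_. 1)"
    using C assms(2)[of C] by (simp add: cost_points cost_output)
qed

end

lemma card_out_set: "card (out_set s) \<le> regs s ''out''"
  unfolding out_set_def using card_image_le[of "{..<regs s ''out''}"] by simp

section \<open>The program\<close>

text \<open>Arithmetic without wrap-around. The last clause is a dummy value for constructors that
  \<open>positive\<close> excludes.\<close>

fun ideal :: "(string \<Rightarrow> nat) \<Rightarrow> exp \<Rightarrow> nat" where
  "ideal r (Const v) = v"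
| "ideal r (Reg x) = r x"
| "ideal r (Add e f) = ideal r e + ideal r f"
| "ideal r (Mul e f) = ideal r e * ideal r f"
| "ideal r _ = 0"

fun positive :: "(string \<Rightarrow> nat) \<Rightarrow> exp \<Rightarrow> bool" where
  "positive r (Const v) \<longleftrightarrow> 0 < v"
| "positive r (Reg x) \<longleftrightarrow> 0 < r x"
| "positive r (Add e f) \<longleftrightarrow> positive r e \<and> positive r f"
| "positive r (Mul e f) \<longleftrightarrow> positive r e \<and> positive r f"
| "positive r _ \<longleftrightarrow> False"

lemma ideal_pos: "positive r e \<Longrightarrow> 0 < ideal r e"
  by (induction e) simp_all

text \<open>In an expression with positive subterms no intermediate value exceeds the final one, so that
  only the latter has to fit into a word.\<close>

lemma eval_ideal:
  "positive (regs s) e \<Longrightarrow> ideal (regs s) e < 2 ^ word_size E \<Longrightarrow> eval E s e = ideal (regs s) e"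
proof (induction e)
  case (Add e f)
  then show ?case by (simp add: to_word_id)
next
  case (Mul e f)
  have p: "0 < ideal (regs s) e" "0 < ideal (regs s) f" using Mul.prems(1) by (simp_all add: ideal_pos)
  have "ideal (regs s) e * 1 \<le> ideal (regs s) e * ideal (regs s) f" "1 * ideal (regs s) f \<le> ideal (regs s) e * ideal (regs s) f"
    using p by (intro mult_le_mono1 mult_le_mono2; simp)+
  moreover have "ideal (regs s) e * ideal (regs s) f < 2 ^ word_size E" using Mul.prems(2) by simp
  ultimately have "ideal (regs s) e < 2 ^ word_size E" "ideal (regs s) f < 2 ^ word_size E" by linarith+
  then show ?case using Mul by (simp add: to_word_id)
qed (simp_all add: to_word_id)

lemma HT_Assign_Seq:
  fixes s :: state
  assumes "positive (regs s) e" "ideal (regs s) e = v" "v < 2 ^ word_size E"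
    and "HT E c (s\<lparr>regs := (regs s)(x := v)\<rparr>) \<tau> \<sigma> \<delta> S Q" "\<tau> + 2 \<le> \<tau>'" "0 \<le> \<delta>"
  shows "HT E (Seq (Assign x e) c) s \<tau>' \<sigma> \<delta> S Q"
proof -
  have ev: "eval E s e = v" using eval_ideal assms(1-3) by simp
  have up: "set_reg E x v s = s\<lparr>regs := (regs s)(x := v)\<rparr>" using assms(3) by (simp add: set_reg_def to_word_id)
  have 1: "ST E (Assign x e) s 1 0 (\<lambda>s'. s' = set_reg E x v s)" by (rule HT_Assign) (simp_all add: ev)
  show ?thesis
  proof (rule HT_Seq[OF 1, where \<tau>b = \<tau> and \<sigma>b = \<sigma> and \<delta>b = \<delta>])
    fix s' assume "s' = set_reg E x v s"
    then show "HT E c s' \<tau> \<sigma> \<delta> S (\<lambda>s''. True \<longrightarrow> Q s'')" using assms(4) up by simp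
  qed (use assms in simp_all)
qed

section \<open>The complete program and its three regimes\<close>

definition Log :: com where
  "Log = Seq (Assign ''p'' (Const 1)) (For ''i'' (Reg ''n'')
     (If (Less (Reg ''n'') (Reg ''p'')) Skip (Seq (Assign ''p'' (Mul (Const 2) (Reg ''p''))) (Incr ''L''))))"

definition All :: com where
  "All = For ''i'' (Reg ''n'') (Seq (Store (Mul (Const 3) (Reg ''i'')) (Reg ''i''))
     (Seq (Store (Add (Mul (Const 3) (Reg ''i'')) (Const 1)) (Const 1))
       (Seq (Store (Add (Mul (Const 3) (Reg ''i'')) (Const 2)) (Const 1)) (Incr ''out''))))"

definition Params :: "nat \<Rightarrow> com \<Rightarrow> com" where
  "Params c P =
     Seq (Assign ''h'' (Mul (Const (10000 * (c + 5))) (Reg ''L'')))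
    (Seq (Assign ''N'' (Mul (Const 16) (Mul (Reg ''k'') (Mul (Reg ''L'') (Reg ''h'')))))
    (Seq (Assign ''S'' (Mul (Const 2) (Mul (Reg ''N'') (Reg ''L''))))
    (Seq (Assign ''T'' (Mul (Const 8) (Mul (Reg ''k'') (Reg ''h''))))
    (Seq (Assign ''K'' (Add (Reg ''S'') (Reg ''T'')))
    (Seq (Assign ''m'' (Mul (Const 4096) (Mul (Mul (Reg ''h'') (Mul (Reg ''h'') (Reg ''h'')))
       (Mul (Mul (Reg ''L'') (Reg ''L'')) (Mul (Mul (Reg ''inv_eps'') (Reg ''inv_eps'')) (Reg ''k''))))))
    (Seq (Assign ''G'' (Add (Mul (Const 4) (Mul (Reg ''K'') (Reg ''m''))) (Reg ''n''))) P))))))"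

abbreviation size_exp :: exp where
  "size_exp \<equiv> Mul (Mul (Reg ''k'') (Reg ''k'')) (Mul (Mul (Reg ''inv_eps'') (Reg ''inv_eps'')) (Reg ''inv_eps''))"

text \<open>If the coreset may have as many points as the space, all points are output; for
  \<open>\<epsilon> \<ge> 1\<close> the empty set is a coreset.\<close>

definition Program :: "strong_mode \<Rightarrow> nat \<Rightarrow> com" where
  "Program mode c = If (Less (Const 1) (Reg ''inv_eps''))
     (If (Less size_exp (Reg ''n'')) (Seq Log (Params c (Main mode))) All) Skip"

lemma strong_ok_Program: "strong_ok mode (Program mode c)"
  using strong_ok_Main by (simp add: Program_def Params_def Log_def All_def)

lemma mods_Log: "mods Log = {''p'', ''i'', ''L''}" "\<not> stores Log"
  by (auto simp: Log_def)

context machine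
begin

text \<open>The power of two is doubled only while it is at most \<open>n\<close>, so it stays at
  most \<open>2 * n\<close> and never wraps. Since \<open>n < 2 ^ n\<close>, a loop of
  \<open>n\<close> rounds is long enough.\<close>

lemma ST_Log:
  fixes s :: state
  assumes n: "regs s ''n'' = n" "0 < n" "n \<le> G" and L0: "regs s ''L'' = 0" and \<tau>: "n * 7 + 5 \<le> \<tau>"
  shows "ST E Log s \<tau> \<sigma> (\<lambda>s'. 0 < regs s' ''L'' \<and> n < 2 ^ regs s' ''L'' \<and> 2 ^ (regs s' ''L'' - 1) \<le> n)"
  unfolding Log_def
proof (rule ST_Seq[where \<tau>a = 1 and \<sigma>a = 0 and \<tau>b = "n * 7 + 3" and \<sigma>b = 0])
  show "ST E (Assign ''p'' (Const 1)) s 1 0 (\<lambda>s'. s' = set_reg E ''p'' 1 s)"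
    by (rule HT_Assign) (simp_all add: to_word_small)
next
  fix s1 :: state assume s1: "s1 = set_reg E ''p'' 1 s"
  have r1: "regs s1 ''n'' = n" "regs s1 ''L'' = 0" "regs s1 ''p'' = 1" using n L0 by (simp_all add: s1 to_word_small)
  let ?c = "Seq (Assign ''p'' (Mul (Const 2) (Reg ''p''))) (Incr ''L'')"
  let ?b = "If (Less (Reg ''n'') (Reg ''p'')) Skip ?c"
  let ?I = "\<lambda>i s' :: state. regs s' ''p'' = 2 ^ regs s' ''L'' \<and> (0 < regs s' ''L'' \<longrightarrow> 2 ^ (regs s' ''L'' - 1) \<le> n) \<and>
      (regs s' ''p'' \<le> n \<longrightarrow> regs s' ''L'' = i)"
  show "ST E (For ''i'' (Reg ''n'') ?b) s1 (n * 7 + 3) 0 (\<lambda>s'. 0 < regs s' ''L'' \<and> n < 2 ^ regs s' ''L'' \<and> 2 ^ (regs s' ''L'' - 1) \<le> n)"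
  proof (rule ST_For[where N = n and \<tau> = 4 and \<sigma> = 0 and Inv = ?I])
    show "?I 0 (set_reg E ''i'' 0 s1)" using r1 by simp
  next
    fix i and t :: state
    assume t: "i < n" "?I i t" "regs t ''i'' = i" "\<forall>x. x \<noteq> ''i'' \<longrightarrow> x \<notin> mods ?b \<longrightarrow> regs t x = regs s1 x"
    have rn: "regs t ''n'' = n" using t(4) r1 by simp
    show "ST E ?b t 4 0 (\<lambda>s''. ?I (Suc i) (set_reg E ''i'' (Suc i) s''))"
    proof (rule HT_If[where \<tau>a = 3])
      assume "eval E t (Less (Reg ''n'') (Reg ''p'')) \<noteq> 0"
      then have lt: "n < regs t ''p''" using rn by (simp add: to_word_small)
      show "ST E Skip t 3 0 (\<lambda>s''. ?I (Suc i) (set_reg E ''i'' (Suc i) s''))"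
      proof (rule HT_Skip)
        show "?I (Suc i) (set_reg E ''i'' (Suc i) t)" using t(2) lt by simp
      qed simp_all
    next
      assume "eval E t (Less (Reg ''n'') (Reg ''p'')) = 0"
      then have le: "regs t ''p'' \<le> n" using rn by (simp add: to_word_small not_less split: if_splits)
      have Li: "regs t ''L'' = i" using t(2) le by (elim conjE) (rule mp)
      have pi: "regs t ''p'' = 2 ^ i" using conjunct1[OF t(2)] unfolding Li .
      let ?t1 = "set_reg E ''p'' (2 ^ Suc i) t"
      have w: "to_word E (2 ^ Suc i) = 2 ^ Suc i" "to_word E (Suc i) = Suc i"
        using le pi t(1) n(3) by (intro to_word_small; simp)+
      have 1: "ST E (Assign ''p'' (Mul (Const 2) (Reg ''p''))) t 1 0 (\<lambda>t'. t' = ?t1)"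
        by (rule HT_Assign) (use w pi in \<open>simp_all add: to_word_small\<close>)
      have 2: "ST E (Incr ''L'') ?t1 1 0 (\<lambda>s''. ?I (Suc i) (set_reg E ''i'' (Suc i) s''))"
      proof (rule ST_Incr)
        show "?I (Suc i) (set_reg E ''i'' (Suc i) (set_reg E ''L'' (Suc (regs ?t1 ''L'')) ?t1))"
          using w Li le pi by simp
      qed (use Li t(1) n(3) in simp_all)
      show "ST E ?c t 3 0 (\<lambda>s''. ?I (Suc i) (set_reg E ''i'' (Suc i) s''))"
        by (rule ST_Seq[OF 1, where \<tau>b = 1 and \<sigma>b = 0]) (use 2 in simp_all)
    qed simp
  next
    fix s' :: state assume I: "?I n s'"
    have lt: "n < 2 ^ regs s' ''L''"
    proof (rule ccontr)
      assume "\<not> n < 2 ^ regs s' ''L''"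
      then have le: "2 ^ regs s' ''L'' \<le> n" by simp
      then have "regs s' ''p'' \<le> n" using conjunct1[OF I] by (simp only:)
      then have "regs s' ''L'' = n" using I by (elim conjE) (rule mp)
      then show False using le less_exp[of n] by simp
    qed
    then have "regs s' ''L'' \<noteq> 0" using n(2) by (cases "regs s' ''L'' = 0") simp_all
    then show "0 < regs s' ''L'' \<and> n < 2 ^ regs s' ''L'' \<and> 2 ^ (regs s' ''L'' - 1) \<le> n" using I lt by simp
  qed (use r1 n in simp_all)
qed (use \<tau> in simp_all)

lemma ST_All:
  fixes s :: state
  assumes n: "regs s ''n'' = n" "n \<le> G" and out: "regs s ''out'' = 0" and \<tau>: "n * 10 + 3 \<le> \<tau>"
  shows "ST E All s \<tau> \<sigma> (\<lambda>s'. regs s' ''out'' = n \<and> (\<forall>i<n. mem s' (3 * i) = i \<and> mem s' (3 * i + 1) = 1 \<and> mem s' (3 * i + 2) = 1))"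
  unfolding All_def
proof -
  let ?S1 = "Store (Mul (Const 3) (Reg ''i'')) (Reg ''i'')"
  let ?S2 = "Store (Add (Mul (Const 3) (Reg ''i'')) (Const 1)) (Const 1)"
  let ?S3 = "Store (Add (Mul (Const 3) (Reg ''i'')) (Const 2)) (Const 1)"
  let ?b = "Seq ?S1 (Seq ?S2 (Seq ?S3 (Incr ''out'')))"
  let ?I = "\<lambda>i s' :: state. regs s' ''out'' = i \<and> (\<forall>j<i. mem s' (3 * j) = j \<and> mem s' (3 * j + 1) = 1 \<and> mem s' (3 * j + 2) = 1)"
  show "ST E (For ''i'' (Reg ''n'') ?b) s \<tau> \<sigma> (?I n)"
  proof (rule ST_For[where N = n and \<tau> = 7 and \<sigma> = 0 and Inv = ?I])
    fix i and t :: state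
    assume t: "i < n" "?I i t" "regs t ''i'' = i"
    have w: "to_word E (3 * i) = 3 * i" "to_word E (3 * i + 1) = 3 * i + 1" "to_word E (3 * i + 2) = 3 * i + 2" "to_word E (Suc i) = Suc i"
      using t(1) n(2) by (intro to_word_small; simp)+
    let ?t1 = "t\<lparr>mem := (mem t)(3 * i := i)\<rparr>"
    let ?t2 = "?t1\<lparr>mem := (mem ?t1)(3 * i + 1 := 1)\<rparr>"
    let ?t3 = "?t2\<lparr>mem := (mem ?t2)(3 * i + 2 := 1)\<rparr>"
    have 1: "ST E ?S1 t 1 0 (\<lambda>t'. t' = ?t1)" by (rule HT_Store) (use w t(3) in \<open>simp_all add: to_word_small\<close>)
    have 2: "ST E ?S2 ?t1 1 0 (\<lambda>t'. t' = ?t2)" by (rule HT_Store) (use w t(3) in \<open>simp_all add: to_word_small\<close>)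
    have 3: "ST E ?S3 ?t2 1 0 (\<lambda>t'. t' = ?t3)" by (rule HT_Store) (use w t(3) in \<open>simp_all add: to_word_small\<close>)
    have 4: "ST E (Incr ''out'') ?t3 1 0 (\<lambda>s''. ?I (Suc i) (set_reg E ''i'' (Suc i) s''))"
    proof (rule ST_Incr)
      let ?u = "set_reg E ''i'' (Suc i) (set_reg E ''out'' (Suc (regs ?t3 ''out'')) ?t3)"
      have m: "mem ?u = (mem t)(3 * i := i, 3 * i + 1 := 1, 3 * i + 2 := 1)" by simp
      show "?I (Suc i) ?u"
      proof (intro conjI allI impI)
        show "regs ?u ''out'' = Suc i" using t(2) w(4) by simp
        fix j assume j: "j < Suc i"
        have ne: "3 * j \<noteq> 3 * i + 1" "3 * j \<noteq> 3 * i + 2" "3 * j + 1 \<noteq> 3 * i + 2" "3 * j + 1 \<noteq> 3 * i" "3 * j + 2 \<noteq> 3 * i" "3 * j + 2 \<noteq> 3 * i + 1"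
          by presburger+
        show "mem ?u (3 * j) = j" "mem ?u (3 * j + 1) = 1" "mem ?u (3 * j + 2) = 1"
          unfolding m using ne t(2) j by (cases "j = i"; simp add: less_Suc_eq)+
      qed
    qed (use t n in simp_all)
    have 5: "ST E (Seq ?S3 (Incr ''out'')) ?t2 3 0 (\<lambda>s''. ?I (Suc i) (set_reg E ''i'' (Suc i) s''))"
      by (rule ST_Seq[OF 3, where \<tau>b = 1 and \<sigma>b = 0]) (simp only: 4, simp_all)
    have 6: "ST E (Seq ?S2 (Seq ?S3 (Incr ''out''))) ?t1 5 0 (\<lambda>s''. ?I (Suc i) (set_reg E ''i'' (Suc i) s''))"
      by (rule ST_Seq[OF 2, where \<tau>b = 3 and \<sigma>b = 0]) (simp only: 5, simp_all)
    show "ST E ?b t 7 0 (\<lambda>s''. ?I (Suc i) (set_reg E ''i'' (Suc i) s''))"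
      by (rule ST_Seq[OF 1, where \<tau>b = 5 and \<sigma>b = 0]) (simp only: 6, simp_all)
  qed (use n out \<tau> in simp_all)
qed

end

context params
begin

lemma HT_Params:
  fixes s :: state and S' :: "state \<Rightarrow> bool"
  assumes word: "16 * G + 16 \<le> 2 ^ word_size E"
    and r: "regs s ''n'' = n" "regs s ''k'' = k" "regs s ''inv_eps'' = q" "regs s ''L'' = L"
    and ht: "HT E P (s\<lparr>regs := (regs s)(''h'' := h, ''N'' := N, ''S'' := S, ''T'' := T, ''K'' := Km, ''m'' := M, ''G'' := G)\<rparr>) \<tau> \<sigma> \<delta> S' Q"
    and \<delta>: "0 \<le> \<delta>"
  shows "HT E (Params c P) s (\<tau> + 14) \<sigma> \<delta> S' Q"
proof -
  have w: "h < 2 ^ word_size E" "N < 2 ^ word_size E" "S < 2 ^ word_size E" "T < 2 ^ word_size E" "Km < 2 ^ word_size E" "M < 2 ^ word_size E" "G < 2 ^ word_size E"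
    using word chain by linarith+
  define s1 where "s1 = s\<lparr>regs := (regs s)(''h'' := h)\<rparr>"
  define s2 where "s2 = s1\<lparr>regs := (regs s1)(''N'' := N)\<rparr>"
  define s3 where "s3 = s2\<lparr>regs := (regs s2)(''S'' := S)\<rparr>"
  define s4 where "s4 = s3\<lparr>regs := (regs s3)(''T'' := T)\<rparr>"
  define s5 where "s5 = s4\<lparr>regs := (regs s4)(''K'' := Km)\<rparr>"
  define s6 where "s6 = s5\<lparr>regs := (regs s5)(''m'' := M)\<rparr>"
  note d1 = s1_def and d2 = s2_def s1_def and d3 = s3_def s2_def s1_def and d4 = s4_def s3_def s2_def s1_def
    and d5 = s5_def s4_def s3_def s2_def s1_def and d6 = s6_def s5_def s4_def s3_def s2_def s1_def
  have ht': "HT E P (s6\<lparr>regs := (regs s6)(''G'' := G)\<rparr>) \<tau> \<sigma> \<delta> S' Q" using ht by (simp add: d6)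
  let ?c7 = "Seq (Assign ''G'' (Add (Mul (Const 4) (Mul (Reg ''K'') (Reg ''m''))) (Reg ''n''))) P"
  have 7: "HT E ?c7 s6 (\<tau> + 2) \<sigma> \<delta> S' Q"
    by (rule HT_Assign_Seq[OF _ _ w(7) ht' _ \<delta>]) (use r pos L q in \<open>simp_all add: d6 G_def\<close>)
  let ?c6 = "Seq (Assign ''m'' (Mul (Const 4096) (Mul (Mul (Reg ''h'') (Mul (Reg ''h'') (Reg ''h'')))
       (Mul (Mul (Reg ''L'') (Reg ''L'')) (Mul (Mul (Reg ''inv_eps'') (Reg ''inv_eps'')) (Reg ''k'')))))) ?c7"
  have 6: "HT E ?c6 s5 (\<tau> + 4) \<sigma> \<delta> S' Q"
    by (rule HT_Assign_Seq[OF _ _ w(6) 7[unfolded s6_def] _ \<delta>]) (use r pos L q in \<open>simp_all add: d5 M_def\<close>)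
  let ?c5 = "Seq (Assign ''K'' (Add (Reg ''S'') (Reg ''T''))) ?c6"
  have 5: "HT E ?c5 s4 (\<tau> + 6) \<sigma> \<delta> S' Q"
    by (rule HT_Assign_Seq[OF _ _ w(5) 6[unfolded s5_def] _ \<delta>]) (use r pos L q in \<open>simp_all add: d4 Km_def\<close>)
  let ?c4 = "Seq (Assign ''T'' (Mul (Const 8) (Mul (Reg ''k'') (Reg ''h'')))) ?c5"
  have 4: "HT E ?c4 s3 (\<tau> + 8) \<sigma> \<delta> S' Q"
    by (rule HT_Assign_Seq[OF _ _ w(4) 5[unfolded s4_def] _ \<delta>]) (use r pos L q in \<open>simp_all add: d3 T_def\<close>)
  let ?c3 = "Seq (Assign ''S'' (Mul (Const 2) (Mul (Reg ''N'') (Reg ''L'')))) ?c4"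
  have 3: "HT E ?c3 s2 (\<tau> + 10) \<sigma> \<delta> S' Q"
    by (rule HT_Assign_Seq[OF _ _ w(3) 4[unfolded s3_def] _ \<delta>]) (use r pos L q in \<open>simp_all add: d2 S_def\<close>)
  let ?c2 = "Seq (Assign ''N'' (Mul (Const 16) (Mul (Reg ''k'') (Mul (Reg ''L'') (Reg ''h''))))) ?c3"
  have 2: "HT E ?c2 s1 (\<tau> + 12) \<sigma> \<delta> S' Q"
    by (rule HT_Assign_Seq[OF _ _ w(2) 3[unfolded s2_def] _ \<delta>]) (use r pos L q in \<open>simp_all add: d1 N_def\<close>)
  let ?c1 = "Seq (Assign ''h'' (Mul (Const (10000 * (c + 5))) (Reg ''L''))) ?c2"
  have 1: "HT E ?c1 s (\<tau> + 14) \<sigma> \<delta> S' Q"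
    by (rule HT_Assign_Seq[OF _ _ w(1) 2[unfolded s1_def] _ \<delta>]) (use r pos L q in \<open>simp_all add: h_def D_def\<close>)
  show ?thesis unfolding Params_def by (rule 1)
qed

end

section \<open>The three cases\<close>

lemma conclude:
  fixes mode :: strong_mode and \<delta> \<delta>0 A :: real
  assumes ht: "\<And>K. HT \<lparr>word_size = W, num_points = n, true_dist = d, weak_dist = weak_oracle d adv K\<rparr> P (init_state n k \<epsilon>)
      \<tau> \<sigma> \<delta> S (\<lambda>s. good K \<longrightarrow> R s)"
    and bad: "measure_pmf.prob (corruption n) {K. \<not> good K} \<le> \<delta>0" and ok: "strong_ok mode P"
    and fail: "\<delta>0 + \<delta> \<le> 1 / real n ^ c"
    and time: "real \<tau> \<le> soft_bound A e n (real n * real k)" and strong: "real \<sigma> \<le> soft_bound A e n B"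
    and post: "\<And>s. S s \<Longrightarrow> R s \<Longrightarrow> is_coreset {..<n} (\<lambda>x y. real (d x y)) k \<epsilon> (out_set s) (out_weight s) \<and>
       real (card (out_set s)) \<le> soft_bound A e n B"
  shows "\<exists>t. real t \<le> soft_bound A e n (real n * real k) \<and>
        (\<forall>(cs, s) \<in> set_pmf (execution P W n k \<epsilon> d adv t).
           cs = [] \<and> strong_queries_le mode s (soft_bound A e n B) \<and>
           real (weak_count s) \<le> soft_bound A e n (real n * real k)) \<and>
        measure_pmf.prob (execution P W n k \<epsilon> d adv t)
          {(cs, s). is_coreset {..<n} (\<lambda>x y. real (d x y)) k \<epsilon> (out_set s) (out_weight s) \<and>
                    real (card (out_set s)) \<le> soft_bound A e n B} \<ge> 1 - 1 / real n ^ c"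
proof (intro exI[of _ \<tau>] conjI)
  let ?ex = "execution P W n k \<epsilon> d adv \<tau>"
  note ex = execution_HT[OF ht bad ok]
  show "real \<tau> \<le> soft_bound A e n (real n * real k)" by (rule time)
  show "\<forall>(cs, s) \<in> set_pmf ?ex. cs = [] \<and> strong_queries_le mode s (soft_bound A e n B) \<and>
      real (weak_count s) \<le> soft_bound A e n (real n * real k)"
  proof (rule ballI, unfold split_paired_all, unfold prod.case)
    fix cs s assume "(cs, s) \<in> set_pmf ?ex"
    then have s: "cs = []" "strong_count s \<le> \<sigma>" "other_count mode s = 0" "weak_count s \<le> \<tau>" using ex(1) by auto
    have "real (strong_count s) \<le> soft_bound A e n B" using s(2) strong by linarith
    then have "strong_queries_le mode s (soft_bound A e n B)"
      using s(3) by (cases mode) (simp_all add: other_count_def strong_count_def)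
    moreover have "real (weak_count s) \<le> soft_bound A e n (real n * real k)" using s(4) time by linarith
    ultimately show "cs = [] \<and> strong_queries_le mode s (soft_bound A e n B) \<and> real (weak_count s) \<le> soft_bound A e n (real n * real k)"
      using s(1) by simp
  qed
  have "measure_pmf.prob ?ex {(cs, s). S s \<and> R s} \<le> measure_pmf.prob ?ex
      {(cs, s). is_coreset {..<n} (\<lambda>x y. real (d x y)) k \<epsilon> (out_set s) (out_weight s) \<and> real (card (out_set s)) \<le> soft_bound A e n B}"
    using post by (intro measure_pmf.finite_measure_mono) auto
  then show "1 - 1 / real n ^ c \<le> measure_pmf.prob ?ex
      {(cs, s). is_coreset {..<n} (\<lambda>x y. real (d x y)) k \<epsilon> (out_set s) (out_weight s) \<and> real (card (out_set s)) \<le> soft_bound A e n B}"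
    using ex(2) fail by linarith
qed

lemma init_regs:
  "regs (init_state n k \<epsilon>) ''n'' = n" "regs (init_state n k \<epsilon>) ''k'' = k" "regs (init_state n k \<epsilon>) ''inv_eps'' = nat \<lceil>1 / \<epsilon>\<rceil>"
  "regs (init_state n k \<epsilon>) ''L'' = 0" "regs (init_state n k \<epsilon>) ''out'' = 0" "regs (init_state n k \<epsilon>) ''ncl'' = 0"
  "mem (init_state n k \<epsilon>) a = 0"
  by (simp_all add: init_state_def)

lemma ST_Program_trivial:
  assumes "machine E n" "nat \<lceil>1 / \<epsilon>\<rceil> \<le> 1"
  shows "HT E (Program mode c) (init_state n k \<epsilon>) 2 0 0 (\<lambda>s. regs s ''out'' = 0) (\<lambda>_. True)"
proof -
  interpret machine E n by (rule assms)
  show ?thesis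
    unfolding Program_def
  proof (rule HT_If[where \<tau>a = 1])
    assume "eval E (init_state n k \<epsilon>) (Less (Const 1) (Reg ''inv_eps'')) \<noteq> 0"
    then show "HT E (If (Less size_exp (Reg ''n'')) (Seq Log (Params c (Main mode))) All) (init_state n k \<epsilon>) 1 0 0 (\<lambda>s. regs s ''out'' = 0) (\<lambda>_. True)"
      using assms(2) by (simp add: init_regs to_word_small)
  next
    show "HT E Skip (init_state n k \<epsilon>) 1 0 0 (\<lambda>s. regs s ''out'' = 0) (\<lambda>_. True)"
      by (rule HT_Skip) (simp_all add: init_regs)
  qed simp
qed

lemma eval_size_exp:
  assumes "regs s ''k'' = k" "regs s ''inv_eps'' = q" "0 < k" "0 < q" "k\<^sup>2 * q ^ 3 < 2 ^ word_size E"
  shows "eval E s size_exp = k\<^sup>2 * q ^ 3"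
proof -
  have "ideal (regs s) size_exp = k\<^sup>2 * q ^ 3" using assms(1,2) by (simp add: power2_eq_square power3_eq_cube)
  moreover have "positive (regs s) size_exp" using assms by simp
  ultimately show ?thesis using eval_ideal[of s size_exp E] assms(5) by (simp only:)
qed

lemma ST_Program_all:
  assumes m: "machine E n" and q: "q = nat \<lceil>1 / \<epsilon>\<rceil>" "2 \<le> q" and k: "1 \<le> k"
    and w: "k\<^sup>2 * q ^ 3 < 2 ^ word_size E" and le: "n \<le> k\<^sup>2 * q ^ 3"
  shows "HT E (Program mode c) (init_state n k \<epsilon>) (n * 10 + 5) 0 0
    (\<lambda>s'. regs s' ''out'' = n \<and> (\<forall>i<n. mem s' (3 * i) = i \<and> mem s' (3 * i + 1) = 1 \<and> mem s' (3 * i + 2) = 1)) (\<lambda>_. True)"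
    (is "HT E _ ?s _ _ _ ?S _")
proof -
  interpret machine E n by (rule m)
  have ev: "eval E ?s size_exp = k\<^sup>2 * q ^ 3" 
    by (rule eval_size_exp[OF init_regs(2) init_regs(3)[of n k \<epsilon>, folded q(1)] _ _ w]) (use k q(2) in simp_all)
  show ?thesis
    unfolding Program_def
  proof (rule HT_If[where \<tau>a = "n * 10 + 4"])
    show "HT E (If (Less size_exp (Reg ''n'')) (Seq Log (Params c (Main mode))) All) ?s (n * 10 + 4) 0 0 ?S (\<lambda>_. True)"
    proof (rule HT_If[where \<tau>a = "n * 10 + 3"])
      assume "eval E ?s (Less size_exp (Reg ''n'')) \<noteq> 0"
      moreover have "eval E ?s (Less size_exp (Reg ''n'')) = to_word E (of_bool (k\<^sup>2 * q ^ 3 < n))"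
        by (simp only: eval.simps(2,9) ev init_regs)
      ultimately have False using le by (simp only: not_less[symmetric] of_bool_eq to_word_0)
      then show "HT E (Seq Log (Params c (Main mode))) ?s (n * 10 + 3) 0 0 ?S (\<lambda>_. True)" ..
    next
      show "HT E All ?s (n * 10 + 3) 0 0 ?S (\<lambda>_. True)" by (rule ST_All) (simp_all add: init_regs)
    qed simp
  next
    assume "eval E ?s (Less (Const 1) (Reg ''inv_eps'')) = 0"
    moreover have "eval E ?s (Less (Const 1) (Reg ''inv_eps'')) = to_word E (of_bool (1 < q))"
      by (simp only: eval.simps(1,2,9) init_regs to_word_small(3) q(1))
    ultimately have False using q(2) by (simp add: to_word_small)
    then show "HT E Skip ?s (n * 10 + 4) 0 0 ?S (\<lambda>_. True)" ..
  qed simp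
qed

lemma optimal_centres:
  fixes f :: "nat set \<Rightarrow> nat"
  assumes "0 < n" "1 \<le> k"
  obtains Cs where "Cs \<subseteq> {..<n}" "Cs \<noteq> {}" "card Cs \<le> k"
    "\<And>C. C \<subseteq> {..<n} \<Longrightarrow> C \<noteq> {} \<Longrightarrow> card C \<le> k \<Longrightarrow> f Cs \<le> f C"
proof -
  let ?F = "{C. C \<subseteq> {..<n} \<and> C \<noteq> {} \<and> card C \<le> k}"
  have "finite ?F" by (rule finite_subset[of _ "Pow {..<n}"]) auto
  moreover have "{0} \<in> ?F" using assms by simp
  ultimately obtain Cs where "Cs \<in> ?F" "\<And>C. C \<in> ?F \<Longrightarrow> f Cs \<le> f C"
    using ex_min_if_finite[of "f ` ?F"] by (metis (no_types, lifting) arg_min_if_finite(1) arg_min_least empty_iff)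
  then show ?thesis using that by blast
qed

context params
begin

text \<open>Identifies the value computed by \<open>Log\<close> with the \<open>L\<close> of the
  locale.\<close>

lemma L_unique:
  assumes "0 < L'" "n < 2 ^ L'" "2 ^ (L' - 1) \<le> n"
  shows "L' = L"
proof (rule ccontr)
  assume "L' \<noteq> L"
  then consider "L \<le> L' - 1" | "L' \<le> L - 1" by linarith
  then show False
  proof cases
    case 1
    then have "(2::nat) ^ L \<le> 2 ^ (L' - 1)" by (intro power_increasing) simp_all
    then show False using assms L by linarith
  next
    case 2
    then have "(2::nat) ^ L' \<le> 2 ^ (L - 1)" by (intro power_increasing) simp_all
    then show False using assms L by linarith
  qed
qed

text \<open>Here \<open>Cs\<close> becomes an optimal solution, so an error of
  \<open>OPT / q\<close> is at most \<open>\<epsilon>\<close> times the cost of any admissible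
  centre set. The factor 5 collects the four failures of a step and the one of the final
  samples.\<close>

lemma HT_Program_main:
  fixes \<epsilon> :: real and K :: "nat set \<Rightarrow> bool" and W :: nat and d :: "nat \<Rightarrow> nat \<Rightarrow> nat"
    and adv :: "(nat set \<Rightarrow> bool) \<Rightarrow> nat set \<Rightarrow> nat"
  defines "E \<equiv> \<lparr>word_size = W, num_points = n, true_dist = d, weak_dist = weak_oracle d adv K\<rparr>"
  assumes pts: "points n d" and word: "16 * G + 16 \<le> 2 ^ W" and dist: "\<And>x y. x < n \<Longrightarrow> y < n \<Longrightarrow> 2 * h * d x y < 2 ^ W"
    and eps: "nat \<lceil>1 / \<epsilon>\<rceil> = q" "0 < \<epsilon>" "1 / \<epsilon> \<le> real q" and w: "k\<^sup>2 * q ^ 3 < 2 ^ W"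
  shows "HT E (Program mode c) (init_state n k \<epsilon>) (t_all + 10 * n + 40) (S * (h * (N * 2) + N * 2)) (5 * (1 / 2) ^ ((c + 3) * L))
     (\<lambda>s. regs s ''out'' \<le> Km * M \<and> (\<forall>i<regs s ''out''. mem s (3 * i) < n))
     (\<lambda>s. points.good_pattern n d (D * L) h K \<longrightarrow>
        (\<forall>C. C \<subseteq> {..<n} \<longrightarrow> C \<noteq> {} \<longrightarrow> card C \<le> k \<longrightarrow>
          \<bar>(\<Sum>i<regs s ''out''. real (mem s (3 * i + 1)) / real (mem s (3 * i + 2)) * real (points.near d C (mem s (3 * i)))) - (\<Sum>x<n. real (points.near d C x))\<bar>
          \<le> \<epsilon> * (\<Sum>x<n. real (points.near d C x))))"
    (is "HT E _ ?s ?\<tau> ?\<sigma> ?\<delta> ?S ?Q")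
proof -
  interpret P: points n d by (rule pts)
  obtain Cs where Cs: "Cs \<subseteq> {..<n}" "Cs \<noteq> {}" "card Cs \<le> k"
    "\<And>C. C \<subseteq> {..<n} \<Longrightarrow> C \<noteq> {} \<Longrightarrow> card C \<le> k \<Longrightarrow> (\<Sum>x<n. P.near Cs x) \<le> (\<Sum>x<n. P.near C x)"
    by (rule optimal_centres[OF pos(1) k, where f = "\<lambda>C. \<Sum>x<n. P.near C x"]) blast
  have ws: "word_size E = W" by (simp add: E_def)
  have hG: "h \<le> G" "N \<le> G" using chain by linarith+
  interpret R: coreset_run E G n d h N K "D * L" k Cs
  proof (intro coreset_run.intro clustering.intro machine.intro pts clustering_axioms.intro coreset_run_axioms.intro)
    show "16 * G + 16 \<le> 2 ^ word_size E" "0 < G" using word pos ws by simp_all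
    show "num_points E = n" "true_dist E = d" by (simp_all add: E_def)
    show "n \<le> G" "h \<le> G" "N \<le> G" "0 < h" "h \<le> N" using chain hG pos by simp_all
    show "2 * h * d x y < 2 ^ word_size E" if "x < n" "y < n" for x y using dist[OF that] ws by simp
    show "weak_dist E x y = d x y" if "\<not> K {x, y}" for x y using that by (simp add: E_def weak_oracle_def)
    show "0 < D * L" "100 * (D * L) \<le> h" using pos L by (simp_all add: h_def)
    show "Cs \<subseteq> {..<n}" "Cs \<noteq> {}" "card Cs \<le> k" using Cs by simp_all
    show "real n < (11 / 10) ^ (h - 1)" by (rule grow)
  qed
  have T: "8 * k * h = T" "S + 8 * k * h = Km" by (simp_all add: T_def Km_def)
  have tm: "R.t_main = t_step" by (simp add: R.t_main_def R.t_prep_def R.t_absorb_def t_step_def)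
  have \<delta>: "S * (R.\<delta>1 + R.\<delta>2) + Km * R.\<delta>3 M \<eta> \<le> ?\<delta>"
  proof -
    have "S * (R.\<delta>1 + R.\<delta>2) = real S * (3 / 4) ^ h + real S * (real k * (real ((n + 1) ^ h) * (1 - 1 / (8 * real k)) ^ N))
       + real S * (real n * (1 / 2) ^ h) + real S * (real n * exp (- (real h / 320)))"
      unfolding R.\<delta>1_def R.\<delta>2_def by (simp only: distrib_left)
    then show ?thesis using step_failure_le final_failure_le unfolding R.\<delta>3_def by linarith
  qed
  have \<delta>0: "0 \<le> ?\<delta>" by simp
  have main: "HT E (Params c (Main mode)) s1 (t_all + 14) ?\<sigma> ?\<delta> ?S ?Q"
    if s1: "regs s1 ''n'' = n" "regs s1 ''k'' = k" "regs s1 ''inv_eps'' = q" "regs s1 ''L'' = L" "regs s1 ''ncl'' = 0" "regs s1 ''out'' = 0"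
      "\<And>a. mem s1 a = 0" for s1 :: state
  proof (rule HT_Params[OF _ s1(1-4) _ \<delta>0])
    show "16 * G + 16 \<le> 2 ^ word_size E" using word ws by simp
    let ?s2 = "s1\<lparr>regs := (regs s1)(''h'' := h, ''N'' := N, ''S'' := S, ''T'' := T, ''K'' := Km, ''m'' := M, ''G'' := G)\<rparr>"
    have f: "R.fixed ?s2" using s1 by (simp add: R.fixed_def)
    have c: "3 * ((S + 8 * k * h) * M) \<le> G" "S + 8 * k * h \<le> G" unfolding T(2) using chain by simp_all
    have "HT E (Main mode) ?s2 t_all ?\<sigma> (S * (R.\<delta>1 + R.\<delta>2) + (S + 8 * k * h) * R.\<delta>3 M \<eta>)
      (\<lambda>s'. regs s' ''out'' \<le> (S + 8 * k * h) * M \<and> (\<forall>i<regs s' ''out''. mem s' (3 * i) < n))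
      (\<lambda>s'. P.good_pattern (D * L) h K \<longrightarrow> (\<forall>C\<in>R.centres. \<bar>R.est s' C - (\<Sum>x<n. real (P.near C x))\<bar> \<le> \<eta> * (2 * (16 * h * R.OPT * harm n))))"
    proof (rule R.HT_Main[OF f _ _ _ _ _ _ _ pos(9) chain(8) c eta_pos stop])
      show "S * (n * 9 + R.t_main + 10) + n * 8 + (S + 8 * k * h) * (n * 9 + M * 16 + 23) + 20 \<le> t_all"
        unfolding T(2) tm t_all_def by simp
    qed (use s1 T in simp_all)
    then show "HT E (Main mode) ?s2 t_all ?\<sigma> ?\<delta> ?S ?Q"
      unfolding T(2)
    proof (rule HT_conseq[OF _ order_refl order_refl \<delta>])
      fix s :: state
      assume S: "?S s"
      have im: "?Q s" if good: "P.good_pattern (D * L) h K \<longrightarrow> (\<forall>C\<in>R.centres. \<bar>R.est s C - (\<Sum>x<n. real (P.near C x))\<bar> \<le> \<eta> * (2 * (16 * h * R.OPT * harm n)))"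
      proof (intro impI allI)
        fix C assume g: "P.good_pattern (D * L) h K" and C: "C \<subseteq> {..<n}" "C \<noteq> {}" "card C \<le> k"
        have "\<bar>R.est s C - (\<Sum>x<n. real (P.near C x))\<bar> \<le> \<eta> * (2 * (16 * h * R.OPT * harm n))"
          using good g C unfolding R.centres_def by simp
        also have "\<dots> \<le> real R.OPT / real q" using eta_error[of "real R.OPT"] by simp
        also have "\<dots> = real R.OPT * (1 / real q)" by simp
        also have "1 / real q \<le> \<epsilon>" using eps(2,3) q by (simp add: field_simps)
        then have "real R.OPT * (1 / real q) \<le> real R.OPT * \<epsilon>" by (intro mult_left_mono) simp_all
        also have "real R.OPT \<le> real (\<Sum>x<n. P.near C x)" using Cs(4)[OF C] unfolding R.OPT_def by (simp only: of_nat_le_iff)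
        then have "real R.OPT * \<epsilon> \<le> (\<Sum>x<n. real (P.near C x)) * \<epsilon>" using eps(2) by (intro mult_right_mono) simp_all
        finally show "\<bar>(\<Sum>i<regs s ''out''. real (mem s (3 * i + 1)) / real (mem s (3 * i + 2)) * real (P.near C (mem s (3 * i)))) - (\<Sum>x<n. real (P.near C x))\<bar>
          \<le> \<epsilon> * (\<Sum>x<n. real (P.near C x))" unfolding R.est_def by (simp only: mult.commute)
      qed
      show "?S s \<and> ((P.good_pattern (D * L) h K \<longrightarrow> (\<forall>C\<in>R.centres. \<bar>R.est s C - (\<Sum>x<n. real (P.near C x))\<bar> \<le> \<eta> * (2 * (16 * h * R.OPT * harm n)))) \<longrightarrow> ?Q s)"
        by (rule conjI[OF S], rule impI, erule im)
    qed
  qed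
  have ev: "eval E ?s size_exp = k\<^sup>2 * q ^ 3" 
    by (rule eval_size_exp[OF init_regs(2) init_regs(3)[of n k \<epsilon>, unfolded eps(1)]]) (use k q w ws in simp_all)
  have lg: "ST E Log ?s (n * 7 + 5) 0 (\<lambda>s'. 0 < regs s' ''L'' \<and> n < 2 ^ regs s' ''L'' \<and> 2 ^ (regs s' ''L'' - 1) \<le> n)"
    by (rule R.ST_Log) (simp_all add: init_regs pos chain)
  show ?thesis
    unfolding Program_def
  proof (rule HT_If[where \<tau>a = "t_all + 10 * n + 39"])
    show "HT E (If (Less size_exp (Reg ''n'')) (Seq Log (Params c (Main mode))) All) ?s (t_all + 10 * n + 39) ?\<sigma> ?\<delta> ?S ?Q"
    proof (rule HT_If[where \<tau>a = "t_all + 10 * n + 38"])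
      show "HT E (Seq Log (Params c (Main mode))) ?s (t_all + 10 * n + 38) ?\<sigma> ?\<delta> ?S ?Q"
      proof (rule HT_Seq[OF lg, where \<tau>b = "t_all + 14" and \<sigma>b = ?\<sigma> and \<delta>b = ?\<delta>])
        fix s1 :: state
        assume s1: "0 < regs s1 ''L'' \<and> n < 2 ^ regs s1 ''L'' \<and> 2 ^ (regs s1 ''L'' - 1) \<le> n"
          "\<forall>x. x \<notin> mods Log \<longrightarrow> regs s1 x = regs ?s x" "\<not> stores Log \<longrightarrow> mem s1 = mem ?s"
        have "HT E (Params c (Main mode)) s1 (t_all + 14) ?\<sigma> ?\<delta> ?S ?Q"
        proof (rule main)
          show "regs s1 ''L'' = L" using s1(1) by (intro L_unique) simp_all
        qed (use s1(2,3) eps(1) in \<open>simp_all add: mods_Log init_regs\<close>)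
        then show "HT E (Params c (Main mode)) s1 (t_all + 14) ?\<sigma> ?\<delta> ?S (\<lambda>s''. True \<longrightarrow> ?Q s'')" by (simp only: simp_thms)
      qed simp_all
    next
      assume "eval E ?s (Less size_exp (Reg ''n'')) = 0"
      moreover have "eval E ?s (Less size_exp (Reg ''n'')) = to_word E (of_bool (k\<^sup>2 * q ^ 3 < n))"
        by (simp only: eval.simps(2,9) ev init_regs)
      ultimately have False using kqn R.to_word_small(3) by (simp only: of_bool_eq simp_thms)
      then show "HT E All ?s (t_all + 10 * n + 38) ?\<sigma> ?\<delta> ?S ?Q" ..
    qed simp
  next
    assume "eval E ?s (Less (Const 1) (Reg ''inv_eps'')) = 0"
    moreover have "eval E ?s (Less (Const 1) (Reg ''inv_eps'')) = to_word E (of_bool (1 < q))"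
      by (simp only: eval.simps(1,2,9) init_regs R.to_word_small(3) eps(1))
    ultimately have False using q by (simp add: R.to_word_small)
    then show "HT E Skip ?s (t_all + 10 * n + 39) ?\<sigma> ?\<delta> ?S ?Q" ..
  qed simp
qed

end

text \<open>The word-size hypothesis offers an exponent but no constant factor; as
  \<open>B < 2 ^ B \<le> X ^ B\<close>, the constant moves into the exponent.\<close>

lemma word_bound:
  fixes X B :: nat
  assumes "2 \<le> X"
  shows "B * X ^ 14 < X ^ (B + 20)"
proof -
  have "B < 2 ^ B" by (rule less_exp)
  also have "(2::nat) ^ B \<le> X ^ B" using assms by (intro power_mono) simp_all
  finally have "B * X ^ 14 < X ^ B * X ^ 14" using assms by (intro mult_strict_right_mono) simp_all
  also have "\<dots> = X ^ (B + 14)" by (simp add: power_add)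
  also have "\<dots> \<le> X ^ (B + 20)" using assms by (intro power_increasing) simp_all
  finally show ?thesis .
qed

lemma inv_eps_bounds:
  fixes \<epsilon> :: real
  assumes "0 < \<epsilon>" "q = nat \<lceil>1 / \<epsilon>\<rceil>"
  shows "1 / \<epsilon> \<le> real q" and "1 \<le> q" and "q \<le> 1 \<Longrightarrow> 1 \<le> \<epsilon>" and "2 \<le> q \<Longrightarrow> \<epsilon> \<le> 1" and "2 \<le> q \<Longrightarrow> real q \<le> 2 / \<epsilon>"
proof -
  have p: "0 < 1 / \<epsilon>" using assms by simp
  show 1: "1 / \<epsilon> \<le> real q" unfolding assms(2) by (rule real_nat_ceiling_ge)
  have "0 < real q" using p 1 by linarith
  then show "1 \<le> q" by simp
  show "1 \<le> \<epsilon>" if "q \<le> 1"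
  proof -
    have "1 / \<epsilon> \<le> 1" using 1 that by linarith
    then show ?thesis using assms(1) by (simp add: field_simps)
  qed
  have up: "real q < 1 / \<epsilon> + 1"
  proof -
    have "real q = real_of_int \<lceil>1 / \<epsilon>\<rceil>" using p unfolding assms(2) by (intro of_nat_nat) linarith
    then show ?thesis using ceiling_correct[of "1 / \<epsilon>"] by linarith
  qed
  have 2: "1 < 1 / \<epsilon>" if "2 \<le> q" using up that by linarith
  show "\<epsilon> \<le> 1" if "2 \<le> q" using 2[OF that] assms(1) by (simp add: field_simps)
  show "real q \<le> 2 / \<epsilon>" if "2 \<le> q"
  proof -
    have "2 / \<epsilon> = 1 / \<epsilon> + 1 / \<epsilon>" by simp
    then show ?thesis using up 2[OF that] by linarith
  qed
qed

lemma one_le_log: "1 \<le> n \<Longrightarrow> 1 \<le> log 2 (real n + 1)"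
proof -
  assume "1 \<le> n"
  then have "log 2 2 \<le> log 2 (real n + 1)" by (intro log_mono) simp_all
  then show ?thesis by simp
qed

lemma soft_bound_ge:
  fixes A x B :: real
  assumes "1 \<le> n" "x \<le> A * B" "0 \<le> A" "0 \<le> B"
  shows "x \<le> soft_bound A e n B"
proof -
  have "A * B * 1 \<le> A * B * log 2 (real n + 1) ^ e"
    using assms one_le_log by (intro mult_left_mono one_le_power) simp_all
  then show ?thesis using assms(2) by (simp add: soft_bound_def)
qed

lemma obtain_log:
  fixes n :: nat
  assumes "1 \<le> n"
  obtains L where "0 < L" "n < 2 ^ L" "2 ^ (L - 1) \<le> n"
proof -
  define L where "L = (LEAST l. n < 2 ^ l)"
  have 1: "n < 2 ^ L" unfolding L_def by (rule LeastI[of _ n]) (rule less_exp)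
  have 2: "0 < L" using 1 assms by (cases L) simp_all
  have "\<not> n < 2 ^ (L - 1)" unfolding L_def by (rule not_less_Least) (use 2 in \<open>simp add: L_def\<close>)
  then show ?thesis using that 1 2 by simp
qed

theorem theorem3p1:
  fixes mode :: strong_mode and a c :: nat
  shows "\<exists>(P :: com) (b :: nat) (A :: real) (e :: nat).
    \<forall>(n :: nat) (k :: nat) (\<epsilon> :: real) (d :: nat \<Rightarrow> nat \<Rightarrow> nat) (W :: nat)
      (adv :: (nat set \<Rightarrow> bool) \<Rightarrow> nat set \<Rightarrow> nat).
      1 \<le> n \<and> 1 \<le> k \<and> 0 < \<epsilon> \<and>
      Metric_space {..<n} (\<lambda>x y. real (d x y)) \<and>
      aspect_ratio {..<n} (\<lambda>x y. real (d x y)) \<le> real n ^ a \<and>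
      (\<forall>x<n. \<forall>y<n. (n + k + nat \<lceil>1 / \<epsilon>\<rceil> + d x y) ^ b \<le> 2 ^ W)
      \<longrightarrow>
      (\<exists>t :: nat.
        real t \<le> soft_bound A e n (real n * real k) \<and>
        (\<forall>(cs, s) \<in> set_pmf (execution P W n k \<epsilon> d adv t).
           cs = [] \<and>
           strong_queries_le mode s (soft_bound A e n ((real k)\<^sup>2 / \<epsilon> ^ 3)) \<and>
           real (weak_count s) \<le> soft_bound A e n (real n * real k)) \<and>
        measure_pmf.prob (execution P W n k \<epsilon> d adv t)
          {(cs, s). is_coreset {..<n} (\<lambda>x y. real (d x y)) k \<epsilon> (out_set s) (out_weight s) \<and>
                    real (card (out_set s)) \<le> soft_bound A e n ((real k)\<^sup>2 / \<epsilon> ^ 3)}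
          \<ge> 1 - 1 / real n ^ c)"
proof -
  define D where "D = 100 * (c + 5)"
  define B where "B = 1677721600000000 * D ^ 4 + 32"
  define F where "F = (100 * real D) ^ 4"
  \<comment> \<open>The product of 5000000, the constant of \<open>time_le\<close>, and 256 from
    \<open>L8_le\<close>; \<open>F\<close> comes from \<open>h ^ 4\<close>. The exponent 8 of the
    logarithm is that of \<open>L ^ 4 * h ^ 4\<close>.\<close>
  define A where "A = 1280000000 * F"
  have F1: "1 \<le> F" unfolding F_def D_def by (intro one_le_power) simp
  have A1: "1280000000 \<le> A" "0 \<le> A" using F1 by (simp_all add: A_def)
  show ?thesis
  proof (rule exI[of _ "Program mode c"], rule exI[of _ "B + 20"], rule exI[of _ A], rule exI[of _ 8], intro allI impI)
    fix n k :: nat and \<epsilon> :: real and d :: "nat \<Rightarrow> nat \<Rightarrow> nat" and W :: nat and adv :: "(nat set \<Rightarrow> bool) \<Rightarrow> nat set \<Rightarrow> nat"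
    assume H: "1 \<le> n \<and> 1 \<le> k \<and> 0 < \<epsilon> \<and> Metric_space {..<n} (\<lambda>x y. real (d x y)) \<and>
      aspect_ratio {..<n} (\<lambda>x y. real (d x y)) \<le> real n ^ a \<and> (\<forall>x<n. \<forall>y<n. (n + k + nat \<lceil>1 / \<epsilon>\<rceil> + d x y) ^ (B + 20) \<le> 2 ^ W)"
    define q where "q = nat \<lceil>1 / \<epsilon>\<rceil>"
    have n: "1 \<le> n" and k: "1 \<le> k" and e0: "0 < \<epsilon>" and pts: "points n d"
      and wd: "\<And>x y. x < n \<Longrightarrow> y < n \<Longrightarrow> (n + k + q + d x y) ^ (B + 20) \<le> 2 ^ W"
      using H metric_points unfolding q_def by blast+
    interpret points n d by (rule pts)
    note qe = inv_eps_bounds[OF e0 q_def]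
    have word: "v < 2 ^ W" if "x < n" "y < n" "v \<le> B * (n + k + q + d x y) ^ 14" for v x y
    proof -
      have "B * (n + k + q + d x y) ^ 14 < (n + k + q + d x y) ^ (B + 20)" using n k by (intro word_bound) simp
      then show ?thesis using wd[OF that(1,2)] that(3) by linarith
    qed
    \<comment> \<open>The word-size hypothesis is indexed by pairs of points; the point 0 paired
      with itself is always available for bounds that involve no distance.\<close>
    define X where "X = n + k + q + d 0 0"
    have X: "n \<le> X" "k \<le> X" "q \<le> X" "1 \<le> X" using n by (simp_all add: X_def)
    have B1: "32 \<le> B" by (simp add: B_def)
    have "X \<le> X ^ 14" using X by (intro self_le_power) simp_all
    then have "16 * n + 16 \<le> 32 * X ^ 14" using X by linarith
    also have "\<dots> \<le> B * X ^ 14" using B1 by (rule mult_le_mono1)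
    finally have nW: "16 * n + 16 \<le> 2 ^ W" using word[of 0 0 "16 * n + 16"] n unfolding X_def by simp
    have "k\<^sup>2 * q ^ 3 \<le> X\<^sup>2 * X ^ 3" using X by (intro mult_le_mono power_mono) simp_all
    also have "\<dots> = X ^ 5" by (simp add: power_add[symmetric])
    also have "\<dots> \<le> X ^ 14" using X by (intro power_increasing) simp_all
    also have "\<dots> \<le> B * X ^ 14" using B1 by simp
    finally have kqW: "k\<^sup>2 * q ^ 3 < 2 ^ W" using word[of 0 0 "k\<^sup>2 * q ^ 3"] n unfolding X_def by simp
    have mach: "machine \<lparr>word_size = W, num_points = n, true_dist = d, weak_dist = weak_oracle d adv K\<rparr> n" for K
      by unfold_locales (use nW n in simp_all)
    have nk: "1 \<le> real n * real k" "real n \<le> real n * real k"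
      using n k mult_mono[of 1 "real n" 1 "real k"] mult_left_mono[of 1 "real k" "real n"] by simp_all
    have Bk: "0 \<le> (real k)\<^sup>2 / \<epsilon> ^ 3" using e0 by simp
    have nk0: "0 \<le> real n * real k" by simp
    have z0: "0 \<le> soft_bound A 8 n ((real k)\<^sup>2 / \<epsilon> ^ 3)"
      by (rule soft_bound_ge[OF n mult_nonneg_nonneg[OF A1(2) Bk] A1(2) Bk])
    have nonneg: "0 \<le> (\<Sum>x<n. real (near C x))" for C by (rule sum_nonneg) simp
    have triv: "measure_pmf.prob (corruption n) {K. \<not> True} \<le> 0" by simp
    have pn: "0 + 0 \<le> 1 / real n ^ c" by simp
    consider "q \<le> 1" | "2 \<le> q" "n \<le> k\<^sup>2 * q ^ 3" | "2 \<le> q" "k\<^sup>2 * q ^ 3 < n" by linarith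
    then show "\<exists>t. real t \<le> soft_bound A 8 n (real n * real k) \<and>
        (\<forall>(cs, s) \<in> set_pmf (execution (Program mode c) W n k \<epsilon> d adv t).
           cs = [] \<and> strong_queries_le mode s (soft_bound A 8 n ((real k)\<^sup>2 / \<epsilon> ^ 3)) \<and>
           real (weak_count s) \<le> soft_bound A 8 n (real n * real k)) \<and>
        measure_pmf.prob (execution (Program mode c) W n k \<epsilon> d adv t)
          {(cs, s). is_coreset {..<n} (\<lambda>x y. real (d x y)) k \<epsilon> (out_set s) (out_weight s) \<and>
                    real (card (out_set s)) \<le> soft_bound A 8 n ((real k)\<^sup>2 / \<epsilon> ^ 3)} \<ge> 1 - 1 / real n ^ c"
    proof cases
      case 1
      have e1: "1 \<le> \<epsilon>" by (rule qe(3)[OF 1])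
      show ?thesis
      proof (rule conclude[where good = "\<lambda>_. True" and R = "\<lambda>_. True" and S = "\<lambda>s. regs s ''out'' = 0" and \<tau> = 2 and \<sigma> = 0, OF _ triv strong_ok_Program pn])
        show "HT \<lparr>word_size = W, num_points = n, true_dist = d, weak_dist = weak_oracle d adv K\<rparr> (Program mode c) (init_state n k \<epsilon>)
           2 0 0 (\<lambda>s. regs s ''out'' = 0) (\<lambda>s. True \<longrightarrow> True)" for K
          using ST_Program_trivial[OF mach 1[unfolded q_def]] by (simp only: simp_thms)
        have "2 * 1 \<le> A * (real n * real k)" using A1 nk by (intro mult_mono) simp_all
        then have "real 2 \<le> A * (real n * real k)" by simp
        then show "real 2 \<le> soft_bound A 8 n (real n * real k)" by (rule soft_bound_ge[OF n _ A1(2) nk0])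
        show "real 0 \<le> soft_bound A 8 n ((real k)\<^sup>2 / \<epsilon> ^ 3)" using z0 by simp
        fix s :: state assume out: "regs s ''out'' = 0"
        have "1 * (\<Sum>x<n. real (near C x)) \<le> \<epsilon> * (\<Sum>x<n. real (near C x))" for C
          using e1 nonneg by (rule mult_right_mono)
        then have "is_coreset {..<n} (\<lambda>x y. real (d x y)) k \<epsilon> (out_set s) (out_weight s)"
          using out nonneg by (intro is_coreset_output) simp_all
        moreover have "real (card (out_set s)) \<le> soft_bound A 8 n ((real k)\<^sup>2 / \<epsilon> ^ 3)"
          using out z0 by (simp add: out_set_def)
        ultimately show "is_coreset {..<n} (\<lambda>x y. real (d x y)) k \<epsilon> (out_set s) (out_weight s) \<and> real (card (out_set s)) \<le> soft_bound A 8 n ((real k)\<^sup>2 / \<epsilon> ^ 3)" ..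
      qed
    next
      case 2
      \<comment> \<open>For \<open>q \<ge> 2\<close> rounding at most doubles
        \<open>1 / \<epsilon>\<close>, so the whole space has at most
        \<open>8 * k\<^sup>2 / \<epsilon> ^ 3\<close> points and may be output as it stands.\<close>
      have "real n \<le> real (k\<^sup>2 * q ^ 3)" using 2(2) by (simp only: of_nat_le_iff)
      also have "\<dots> = (real k)\<^sup>2 * real q ^ 3" by simp
      also have "\<dots> \<le> (real k)\<^sup>2 * (2 / \<epsilon>) ^ 3" using qe(5)[OF 2(1)] by (intro mult_left_mono power_mono) simp_all
      also have "\<dots> = 8 * ((real k)\<^sup>2 / \<epsilon> ^ 3)" by (simp add: power_divide)
      also have "\<dots> \<le> A * ((real k)\<^sup>2 / \<epsilon> ^ 3)" using A1 Bk by (intro mult_right_mono) simp_all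
      finally have size: "real n \<le> A * ((real k)\<^sup>2 / \<epsilon> ^ 3)" .
      let ?S = "\<lambda>s :: state. regs s ''out'' = n \<and> (\<forall>i<n. mem s (3 * i) = i \<and> mem s (3 * i + 1) = 1 \<and> mem s (3 * i + 2) = 1)"
      show ?thesis
      proof (rule conclude[where good = "\<lambda>_. True" and R = "\<lambda>_. True" and S = ?S and \<tau> = "n * 10 + 5" and \<sigma> = 0, OF _ triv strong_ok_Program pn])
        show "HT \<lparr>word_size = W, num_points = n, true_dist = d, weak_dist = weak_oracle d adv K\<rparr> (Program mode c) (init_state n k \<epsilon>)
           (n * 10 + 5) 0 0 ?S (\<lambda>s. True \<longrightarrow> True)" for K
          using ST_Program_all[OF mach q_def 2(1) k _ 2(2)] kqW by simp
        have "real (n * 10 + 5) \<le> 15 * (real n * real k)" using nk by simp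
        also have "\<dots> \<le> A * (real n * real k)" using A1 nk by (intro mult_right_mono) simp_all
        finally show "real (n * 10 + 5) \<le> soft_bound A 8 n (real n * real k)" by (rule soft_bound_ge[OF n _ A1(2) nk0])
        show "real 0 \<le> soft_bound A 8 n ((real k)\<^sup>2 / \<epsilon> ^ 3)" using z0 by simp
        fix s :: state assume s: "?S s"
        have out: "regs s ''out'' = n" using s by simp
        have "(\<Sum>i<n. real (mem s (3 * i + 1)) / real (mem s (3 * i + 2)) * real (near C (mem s (3 * i)))) = (\<Sum>x<n. real (near C x))" for C
          by (rule sum.cong) (use s in simp_all)
        then have "is_coreset {..<n} (\<lambda>x y. real (d x y)) k \<epsilon> (out_set s) (out_weight s)"
          using s e0 nonneg by (intro is_coreset_output) simp_all
        moreover have "real (card (out_set s)) \<le> A * ((real k)\<^sup>2 / \<epsilon> ^ 3)" using card_out_set[of s] size out by linarith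
        then have "real (card (out_set s)) \<le> soft_bound A 8 n ((real k)\<^sup>2 / \<epsilon> ^ 3)" by (rule soft_bound_ge[OF n _ A1(2) Bk])
        ultimately show "is_coreset {..<n} (\<lambda>x y. real (d x y)) k \<epsilon> (out_set s) (out_weight s) \<and> real (card (out_set s)) \<le> soft_bound A 8 n ((real k)\<^sup>2 / \<epsilon> ^ 3)" ..
      qed
    next
      case 3
      obtain L where L: "0 < L" "n < 2 ^ L" "2 ^ (L - 1) \<le> n" using obtain_log[OF n] .
      interpret p: params c n k q L by unfold_locales (use k 3 L in simp_all)
      let ?lam = "log 2 (real n + 1)"
      have D: "p.D = D" by (simp add: p.D_def D_def)
      have e1: "\<epsilon> \<le> 1" by (rule qe(4)[OF 3(1)])
      have LF: "real (L ^ 4 * p.h ^ 4) \<le> F * (256 * ?lam ^ 8)"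
      proof -
        have "real (L ^ 4 * p.h ^ 4) = F * real (L ^ 8)" unfolding p.h4 D F_def by simp
        also have "\<dots> \<le> F * (256 * ?lam ^ 8)" using p.L8_le F1 by (intro mult_left_mono) simp_all
        finally show ?thesis .
      qed
      have soft: "real v \<le> soft_bound A 8 n Y" if "real v \<le> 5000000 * Y * real (L ^ 4 * p.h ^ 4)" "0 \<le> Y" for v Y
      proof -
        have "5000000 * Y * real (L ^ 4 * p.h ^ 4) \<le> 5000000 * Y * (F * (256 * ?lam ^ 8))" using LF that(2) by (intro mult_left_mono) simp_all
        then show ?thesis using that(1) by (simp add: soft_bound_def A_def)
      qed
      have k2: "(real k)\<^sup>2 * 1 \<le> (real k)\<^sup>2 / \<epsilon> ^ 3" "(real k)\<^sup>2 * (4 / \<epsilon>\<^sup>2) \<le> 4 * ((real k)\<^sup>2 / \<epsilon> ^ 3)"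
      proof -
        have "\<epsilon> ^ 3 \<le> 1" "\<epsilon> ^ 3 \<le> \<epsilon>\<^sup>2" using e0 e1 by (simp_all add: power_le_one power_decreasing)
        then have "1 \<le> 1 / \<epsilon> ^ 3" "1 / \<epsilon>\<^sup>2 \<le> 1 / \<epsilon> ^ 3" using e0 by (simp_all add: frac_le)
        then have ab: "(real k)\<^sup>2 * 1 \<le> (real k)\<^sup>2 * (1 / \<epsilon> ^ 3)" "(real k)\<^sup>2 * (1 / \<epsilon>\<^sup>2) \<le> (real k)\<^sup>2 * (1 / \<epsilon> ^ 3)" by (intro mult_left_mono; simp)+
        have eq: "(real k)\<^sup>2 / \<epsilon> ^ 3 = (real k)\<^sup>2 * (1 / \<epsilon> ^ 3)" "(real k)\<^sup>2 * (4 / \<epsilon>\<^sup>2) = 4 * ((real k)\<^sup>2 * (1 / \<epsilon>\<^sup>2))" by simp_all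
        show "(real k)\<^sup>2 * 1 \<le> (real k)\<^sup>2 / \<epsilon> ^ 3" unfolding eq by (rule ab)
        show "(real k)\<^sup>2 * (4 / \<epsilon>\<^sup>2) \<le> 4 * ((real k)\<^sup>2 / \<epsilon> ^ 3)" unfolding eq by (rule mult_left_mono[OF ab(2)]) simp
      qed
      let ?S = "\<lambda>s. regs s ''out'' \<le> p.Km * p.M \<and> (\<forall>i<regs s ''out''. mem s (3 * i) < n)"
      let ?R = "\<lambda>s. \<forall>C. C \<subseteq> {..<n} \<longrightarrow> C \<noteq> {} \<longrightarrow> card C \<le> k \<longrightarrow>
          \<bar>(\<Sum>i<regs s ''out''. real (mem s (3 * i + 1)) / real (mem s (3 * i + 2)) * real (near C (mem s (3 * i)))) - (\<Sum>x<n. real (near C x))\<bar>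
          \<le> \<epsilon> * (\<Sum>x<n. real (near C x))"
      let ?p = "(1 / 2 :: real) ^ ((c + 3) * L)"
      have pG: "16 * p.G + 16 \<le> 2 ^ W"
      proof -
        have "(n + k + q) ^ 14 \<le> X ^ 14" by (intro power_mono) (simp_all add: X_def)
        then have "B * (n + k + q) ^ 14 \<le> B * X ^ 14" by (rule mult_le_mono2)
        then have "16 * p.G + 16 \<le> B * X ^ 14" using p.G_le unfolding D B_def by linarith
        then show ?thesis using word[of 0 0 "16 * p.G + 16"] n unfolding X_def by simp
      qed
      \<comment> \<open>Thresholds involve actual distances, so the word-size hypothesis is used for
        this very pair; \<open>h\<close> is \<open>100 * D * L\<close> with
        \<open>L \<le> n\<close>.\<close>
      have pd: "2 * p.h * d x y < 2 ^ W" if xy: "x < n" "y < n" for x y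
      proof (rule word[OF xy])
        let ?X = "n + k + q + d x y"
        have "L \<le> ?X" "d x y \<le> ?X" "1 \<le> ?X" using p.L_le n by simp_all
        have "L * d x y \<le> ?X * ?X" using \<open>L \<le> ?X\<close> \<open>d x y \<le> ?X\<close> by (rule mult_le_mono)
        also have "\<dots> = ?X\<^sup>2" by (simp only: power2_eq_square)
        also have "\<dots> \<le> ?X ^ 14" using \<open>1 \<le> ?X\<close> by (intro power_increasing) simp_all
        finally have Ld: "L * d x y \<le> ?X ^ 14" .
        have "D \<le> D ^ 4" by (rule self_le_power) (simp_all add: D_def)
        then have "200 * D \<le> B" unfolding B_def by linarith
        then have "200 * D * (L * d x y) \<le> B * ?X ^ 14" using Ld by (rule mult_le_mono)
        then show "2 * p.h * d x y \<le> B * ?X ^ 14" unfolding p.h_def D by (simp only: mult.assoc)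
      qed
      show ?thesis
      proof (rule conclude[where good = "good_pattern (p.D * L) p.h" and R = ?R and S = ?S and \<tau> = "p.t_all + 10 * n + 40"
            and \<sigma> = "p.S * (p.h * (p.N * 2) + p.N * 2)" and \<delta> = "5 * ?p" and ?\<delta>0.0 = "2 * ?p", OF _ _ strong_ok_Program])
        show "HT \<lparr>word_size = W, num_points = n, true_dist = d, weak_dist = weak_oracle d adv K\<rparr> (Program mode c) (init_state n k \<epsilon>)
           (p.t_all + 10 * n + 40) (p.S * (p.h * (p.N * 2) + p.N * 2)) (5 * ?p) ?S (\<lambda>s. good_pattern (p.D * L) p.h K \<longrightarrow> ?R s)" for K
          by (rule p.HT_Program_main[OF pts pG pd q_def[symmetric] e0 qe(1) kqW])
        have "measure_pmf.prob (corruption n) {K. \<not> good_pattern (p.D * L) p.h K} \<le>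
            real ((n + 1) ^ (p.D * L) * (n + 1) ^ p.h) * exp (- (real (p.D * L) * real p.h / 50)) + real (n ^ 3) * exp (- (real (p.h - 1) / 1800))"
          by (rule prob_bad_pattern) (use p.pos L in \<open>simp_all add: p.h_def\<close>)
        then show "measure_pmf.prob (corruption n) {K. \<not> good_pattern (p.D * L) p.h K} \<le> 2 * ?p" using p.bad_pattern_le by linarith
        show "2 * ?p + 5 * ?p \<le> 1 / real n ^ c" using p.failure_le by linarith
        have "real (p.t_all + 10 * n + 40) \<le> real (5000000 * (n * k * (L ^ 4 * p.h ^ 4)))" using p.time_le by (simp only: of_nat_le_iff)
        also have "\<dots> = 5000000 * (real n * real k) * real (L ^ 4 * p.h ^ 4)" by simp
        finally show "real (p.t_all + 10 * n + 40) \<le> soft_bound A 8 n (real n * real k)" by (rule soft) simp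
        have "L ^ 3 * p.h ^ 3 \<le> L ^ 4 * p.h ^ 4" using L p.pos by (intro mult_le_mono power_increasing) simp_all
        then have "k\<^sup>2 * (L ^ 3 * p.h ^ 3) \<le> k\<^sup>2 * (L ^ 4 * p.h ^ 4)" by (rule mult_le_mono2)
        then have "2048 * (k\<^sup>2 * (L ^ 3 * p.h ^ 3)) \<le> 5000000 * (k\<^sup>2 * (L ^ 4 * p.h ^ 4))" by (rule mult_le_mono[rotated]) simp
        then have "p.S * (p.h * (p.N * 2) + p.N * 2) \<le> 5000000 * (k\<^sup>2 * (L ^ 4 * p.h ^ 4))" by (rule order_trans[OF p.queries_le])
        then have "real (p.S * (p.h * (p.N * 2) + p.N * 2)) \<le> real (5000000 * (k\<^sup>2 * (L ^ 4 * p.h ^ 4)))" by (simp only: of_nat_le_iff)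
        also have "\<dots> = 5000000 * ((real k)\<^sup>2 * 1) * real (L ^ 4 * p.h ^ 4)" by simp
        also have "\<dots> \<le> 5000000 * ((real k)\<^sup>2 / \<epsilon> ^ 3) * real (L ^ 4 * p.h ^ 4)" by (intro mult_right_mono mult_left_mono k2) simp_all
        finally show "real (p.S * (p.h * (p.N * 2) + p.N * 2)) \<le> soft_bound A 8 n ((real k)\<^sup>2 / \<epsilon> ^ 3)" using Bk by (rule soft)
        fix s :: state assume S: "?S s" and R: "?R s"
        have "is_coreset {..<n} (\<lambda>x y. real (d x y)) k \<epsilon> (out_set s) (out_weight s)"
          using S R by (intro is_coreset_output) simp_all
        moreover have "real (card (out_set s)) \<le> soft_bound A 8 n ((real k)\<^sup>2 / \<epsilon> ^ 3)"
        proof (rule soft[OF _ Bk])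
          \<comment> \<open>The sampled coreset has size \<open>k\<^sup>2 * q\<^sup>2\<close> up to
            logarithms, and \<open>\<epsilon> \<le> 1\<close> converts
            \<open>1 / \<epsilon>\<^sup>2\<close> into \<open>1 / \<epsilon> ^ 3\<close>.\<close>
          have "(real k)\<^sup>2 * (real q)\<^sup>2 \<le> (real k)\<^sup>2 * (2 / \<epsilon>)\<^sup>2" using qe(5)[OF 3(1)] by (intro mult_left_mono power_mono) simp_all
          also have "\<dots> = (real k)\<^sup>2 * (4 / \<epsilon>\<^sup>2)" by (simp add: power_divide)
          also note k2(2)
          finally have kq: "(real k)\<^sup>2 * (real q)\<^sup>2 \<le> 4 * ((real k)\<^sup>2 / \<epsilon> ^ 3)" .
          have "card (out_set s) \<le> p.Km * p.M" using card_out_set[of s] S by linarith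
          then have "card (out_set s) \<le> 64 * 4096 * (k\<^sup>2 * q\<^sup>2 * (L ^ 4 * p.h ^ 4))" using p.size_le by linarith
          then have "real (card (out_set s)) \<le> real (64 * 4096 * (k\<^sup>2 * q\<^sup>2 * (L ^ 4 * p.h ^ 4)))" by (simp only: of_nat_le_iff)
          also have "\<dots> = 262144 * ((real k)\<^sup>2 * (real q)\<^sup>2) * real (L ^ 4 * p.h ^ 4)" by simp
          also have "\<dots> \<le> 262144 * (4 * ((real k)\<^sup>2 / \<epsilon> ^ 3)) * real (L ^ 4 * p.h ^ 4)"
            by (intro mult_right_mono mult_left_mono kq) simp_all
          also have "262144 * (4 * ((real k)\<^sup>2 / \<epsilon> ^ 3)) * real (L ^ 4 * p.h ^ 4) \<le> 5000000 * ((real k)\<^sup>2 / \<epsilon> ^ 3) * real (L ^ 4 * p.h ^ 4)"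
            using Bk by (intro mult_right_mono) simp_all
          finally show "real (card (out_set s)) \<le> 5000000 * ((real k)\<^sup>2 / \<epsilon> ^ 3) * real (L ^ 4 * p.h ^ 4)" .
        qed
        ultimately show "is_coreset {..<n} (\<lambda>x y. real (d x y)) k \<epsilon> (out_set s) (out_weight s) \<and> real (card (out_set s)) \<le> soft_bound A 8 n ((real k)\<^sup>2 / \<epsilon> ^ 3)" ..
      qed
    qed
  qed
qed

end
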